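(* Let $n\ge 2$ and let $\mathbf m=(m_{i,j})_{1\le i\le j\le n-1}$ be a regular collection, i.e. $m_{i,j}>0$ for all $i\le j$. Then the variety $R_n$ is embedded into the projective space $\mathbb{P}(M_{\mathbf m})$ as the closure of the $SL_n^a$-orbit, or of the $(N^-)^a$-orbit, through the highest weight line: $$R_n=\overline{SL_n^a\cdot[v_{\mathbf m}]}=\overline{(N^-)^a\cdot[v_{\mathbf m}]}\subset\mathbb{P}(M_{\mathbf m}).$$
   Context: Everything is over $\mathbb{C}$; $\mathfrak g=\mathfrak{sl}_n=\mathfrak n\oplus\mathfrak h\oplus\mathfrak n^-$ with Borel subalgebra $\mathfrak b=\mathfrak n\oplus\mathfrak h$ and Borel subgroup $B\subset SL_n$. The positive roots are $\alpha_{i,j}=\alpha_i+\dots+\alpha_j$, $1\le i\le j\le n-1$; $f_\beta\in\mathfrak n^-$ is a root vector of weight $-\beta$, $f_{i,j}=f_{\alpha_{i,j}}$. For roots, $\beta\ge\alpha$ means that $\beta-\alpha$ is a non-negative integer combination of simple roots. The degenerate Lie algebra is $\mathfrak g^a=\mathfrak b\oplus\mathfrak g/\mathfrak b$, where $\mathfrak g/\mathfrak b=(\mathfrak n^-)^a$ is an abelian ideal on which $\mathfrak b$ acts by the adjoint action. $(N^-)^a=\exp((\mathfrak n^-)^a)$ is the corresponding abelian unipotent group (a product of $\dim\mathfrak n^-$ copies of the additive group $\mathbb{G}_a$), and $SL_n^a=B\ltimes(N^-)^a$, with $B$ acting on $(N^-)^a$ through the adjoint action on $\mathfrak g/\mathfrak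 b$. $\circ$ denotes the induced adjoint action of $\mathfrak b$ on $S(\mathfrak n^-)\simeq S(\mathfrak g/\mathfrak b)=\mathbb{C}[f_\beta]_{\beta>0}$. For a positive root $\alpha=\alpha_{i,j}$, $M_\alpha=\mathbb{C}[f_\beta]_{\beta>0}/I_\alpha$, where $I_\alpha$ is the ideal generated by the subspace $U(\mathfrak b)\circ\langle f_\beta^2\ (\beta\ge\alpha),\ f_\beta\ (\beta\not\ge\alpha)\rangle$; $v_\alpha$ is the image of $1$. It is a $\mathfrak g^a$-module: $(\mathfrak n^-)^a$ acts by multiplication, $\mathfrak n$ by the action induced from $\circ$ (so $\mathfrak n v_\alpha=0$), and $\mathfrak h$ by the action induced from $\circ$ shifted so that $v_\alpha$ has weight the fundamental weight $\omega_i$. For $\mathbf m=(m_{i,j})$ set $v_{\mathbf m}=\bigotimes_{i\le j}v_{\alpha_{i,j}}^{\otimes m_{i,j}}$ and $M_{\mathbf m}=S(\mathfrak n^-)\cdot v_{\mathbf m}\subset\bigotimes_{i\le j}M_{\alpha_{i,j}}^{\otimes m_{i,j}}$. $[v]\in\mathbb{P}(V)$ denotes the line spanned by $v\in V$. Let $W$ be an $n$-dimensional space with basis $w_1,\dots,w_n$, and let $pr_k:W\to W$ be the projection with $pr_kw_k=0$, $pr_kw_l=w_l$ for $l\ne k$. The variety $R_n$ consists of collections $(V_{i,j})_{1\le i\le j\le n-1}$ of subspaces of $W$ with $\dim V_{i,j}=i$, $V_{i,j}\subset\mathrm{span}(w_1,\dots,w_i,w_{j+1},\dots,w_n)$, $V_{i,j}\subset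 V_{i+1,j}$ for $1\le i<j\le n-1$, and $pr_{j+1}V_{i,j}\subset V_{i,j+1}$ for $1\le i\le j<n-1$. *)

theory Defs
  imports
    "HOL-Library.Poly_Mapping"
    "HOL-Library.FuncSet"
    "HOL-Analysis.Abstract_Topology"
    "HOL-Algebra.Module"
    "Jordan_Normal_Form.Determinant"
    "Jordan_Normal_Form.Gauss_Jordan_Elimination"
begin

section \<open>Linear algebra over the complex numbers\<close>

text \<open>The type of finitely supported functions \<open>'x \<Rightarrow>\<^sub>0 complex\<close> is the complex vector space with
  basis \<open>'x\<close>; the basis vector belonging to \<open>x\<close> is \<open>single x 1\<close>. It serves for the space \<open>W\<close>, for
  the polynomial rings (basis: monomials) and for the free space in the construction of the
  tensor product.\<close>

definition cscale :: "complex \<Rightarrow> ('x \<Rightarrow>\<^sub>0 complex) \<Rightarrow> ('x \<Rightarrow>\<^sub>0 complex)"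
  where "cscale c v = Poly_Mapping.map ((*) c) v"

lemma lookup_cscale [simp]: "Poly_Mapping.lookup (cscale c v) x = c * Poly_Mapping.lookup v x"
  by (simp add: cscale_def Poly_Mapping.map.rep_eq when_def)

global_interpretation fsv: vector_space "cscale :: complex \<Rightarrow> ('x \<Rightarrow>\<^sub>0 complex) \<Rightarrow> _"
  by standard (rule poly_mapping_eqI, simp add: lookup_add algebra_simps)+

definition linear_extension :: "('x \<Rightarrow> 'y \<Rightarrow>\<^sub>0 complex) \<Rightarrow> ('x \<Rightarrow>\<^sub>0 complex) \<Rightarrow> ('y \<Rightarrow>\<^sub>0 complex)"
  where "linear_extension h t = (\<Sum>x\<in>Poly_Mapping.keys t. cscale (Poly_Mapping.lookup t x) (h x))"

text \<open>Vector spaces that are not whole types are \<open>module\<close> records; the fields \<open>mult\<close> and \<open>one\<close>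
  are irrelevant. Elements of a quotient \<open>V / K\<close> are the cosets \<open>v + K\<close>, and \<open>coset_map K h\<close> is
  the map on cosets induced by an endomorphism \<open>h\<close> that preserves \<open>K\<close>.\<close>

type_synonym 'v cspace = "(complex, 'v) module"

definition complex_ring :: "complex ring"
  where "complex_ring = \<lparr>carrier = UNIV, mult = (*), one = 1, zero = 0, add = (+)\<rparr>"

definition coset_map :: "'v::plus set \<Rightarrow> ('v \<Rightarrow> 'v) \<Rightarrow> 'v set \<Rightarrow> 'v set"
  where "coset_map K h A = {h a + k | a k. a \<in> A \<and> k \<in> K}"

definition quotient_space ::
  "('x \<Rightarrow>\<^sub>0 complex) set \<Rightarrow> ('x \<Rightarrow>\<^sub>0 complex) set \<Rightarrow> ('x \<Rightarrow>\<^sub>0 complex) set cspace" where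
  "quotient_space V K =
    \<lparr>carrier = (\<lambda>v. (+) v ` K) ` V, mult = undefined, one = undefined, zero = K,
     add = (\<lambda>A B. {a + b | a b. a \<in> A \<and> b \<in> B}), module.smult = (\<lambda>c. coset_map K (cscale c))\<rparr>"

text \<open>The tensor product of a finite family \<open>(M j)\<close>, \<open>j \<in> J\<close>: the free vector space on the set
  \<open>\<Pi>\<^sub>E j\<in>J. carrier (M j)\<close> modulo the relations expressing multilinearity.\<close>

definition tensor_relations ::
  "'j set \<Rightarrow> ('j \<Rightarrow> 'v cspace) \<Rightarrow> (('j \<Rightarrow> 'v) \<Rightarrow>\<^sub>0 complex) set" where
  "tensor_relations J M = fsv.span
    ({Poly_Mapping.single (f(j := u \<oplus>\<^bsub>M j\<^esub> v)) 1 - Poly_Mapping.single (f(j := u)) 1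
        - Poly_Mapping.single (f(j := v)) 1 | f j u v.
        f \<in> (\<Pi>\<^sub>E j\<in>J. carrier (M j)) \<and> j \<in> J \<and> u \<in> carrier (M j) \<and> v \<in> carrier (M j)}
     \<union> {Poly_Mapping.single (f(j := c \<odot>\<^bsub>M j\<^esub> u)) 1 - cscale c (Poly_Mapping.single (f(j := u)) 1) | f j c u.
        f \<in> (\<Pi>\<^sub>E j\<in>J. carrier (M j)) \<and> j \<in> J \<and> u \<in> carrier (M j)})"

definition tensor_space ::
  "'j set \<Rightarrow> ('j \<Rightarrow> 'v cspace) \<Rightarrow> (('j \<Rightarrow> 'v) \<Rightarrow>\<^sub>0 complex) set cspace" where
  "tensor_space J M = quotient_space
     {t. Poly_Mapping.keys t \<subseteq> (\<Pi>\<^sub>E j\<in>J. carrier (M j))} (tensor_relations J M)"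

definition pure_tensor ::
  "'j set \<Rightarrow> ('j \<Rightarrow> 'v cspace) \<Rightarrow> ('j \<Rightarrow> 'v) \<Rightarrow> (('j \<Rightarrow> 'v) \<Rightarrow>\<^sub>0 complex) set" where
  "pure_tensor J M f = (+) (Poly_Mapping.single (restrict f J) 1) ` tensor_relations J M"

text \<open>The Lie algebra action on a tensor product: an element acting on \<open>M j\<close> by \<open>a j\<close> acts by
  the sum over \<open>j\<close> of \<open>1 \<otimes> \<dots> \<otimes> a j \<otimes> \<dots> \<otimes> 1\<close>.\<close>

definition tensor_lie_action ::
  "'j set \<Rightarrow> ('j \<Rightarrow> 'v cspace) \<Rightarrow> ('j \<Rightarrow> 'v \<Rightarrow> 'v) \<Rightarrow>
   (('j \<Rightarrow> 'v) \<Rightarrow>\<^sub>0 complex) set \<Rightarrow> (('j \<Rightarrow> 'v) \<Rightarrow>\<^sub>0 complex) set" where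
  "tensor_lie_action J M a = coset_map (tensor_relations J M)
     (linear_extension (\<lambda>f. \<Sum>j\<in>J. Poly_Mapping.single (f(j := a j (f j))) 1))"


section \<open>Multiprojective varieties\<close>

text \<open>A (possibly reducible, reduced) variety is given by its points \<open>x\<close>, the set of systems of
  homogeneous coordinates of each point, and functions \<open>gens k\<close> of the coordinates that generate,
  in multidegree \<open>e\<^sub>k\<close>, the multihomogeneous coordinate ring.\<close>

record ('p, 'c, 'k) mproj =
  points :: "'p set"
  coords :: "'p \<Rightarrow> 'c set"
  gens :: "'k \<Rightarrow> ('c \<Rightarrow> complex) set"

inductive homogeneous :: "('k \<Rightarrow> ('c \<Rightarrow> complex) set) \<Rightarrow> ('k \<Rightarrow> nat) \<Rightarrow> ('c \<Rightarrow> complex) \<Rightarrow> bool"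
  for G where
  const: "homogeneous G (\<lambda>_. 0) (\<lambda>_. c)"
| gen: "g \<in> G k \<Longrightarrow> homogeneous G ((\<lambda>_. 0)(k := 1)) g"
| add: "homogeneous G d F \<Longrightarrow> homogeneous G d F' \<Longrightarrow> homogeneous G d (\<lambda>x. F x + F' x)"
| mult: "homogeneous G d F \<Longrightarrow> homogeneous G d' F' \<Longrightarrow>
    homogeneous G (\<lambda>k. d k + d' k) (\<lambda>x. F x * F' x)"

definition zariski :: "('p, 'c, 'k) mproj \<Rightarrow> 'p topology" where
  "zariski X = topology_generated_by
     {{x \<in> points X. \<exists>c\<in>coords X x. F c \<noteq> 0} | F. \<exists>d. homogeneous (gens X) d F}"

definition regular_on :: "('p, 'c, 'k) mproj \<Rightarrow> 'p set \<Rightarrow> ('p \<Rightarrow> complex) \<Rightarrow> bool" where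
  "regular_on X U \<phi> \<longleftrightarrow> openin (zariski X) U \<and>
     (\<forall>x\<in>U. \<exists>U' d F G. openin (zariski X) U' \<and> x \<in> U' \<and> U' \<subseteq> U \<and>
        homogeneous (gens X) d F \<and> homogeneous (gens X) d G \<and>
        (\<forall>y\<in>U'. \<forall>c\<in>coords X y. G c \<noteq> 0 \<and> \<phi> y = F c / G c))"

definition variety_iso ::
  "('p, 'c, 'k) mproj \<Rightarrow> ('q, 'd, 'l) mproj \<Rightarrow> ('p \<Rightarrow> 'q) \<Rightarrow> bool" where
  "variety_iso X Y \<Phi> \<longleftrightarrow> homeomorphic_map (zariski X) (zariski Y) \<Phi> \<and>
     (\<forall>U \<phi>. openin (zariski Y) U \<longrightarrow>
        (regular_on Y U \<phi> \<longleftrightarrow> regular_on X {x \<in> points X. \<Phi> x \<in> U} (\<phi> \<circ> \<Phi>)))"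

definition subvariety :: "('p, 'c, 'k) mproj \<Rightarrow> 'p set \<Rightarrow> ('p, 'c, 'k) mproj"
  where "subvariety X Z = X\<lparr>points := Z\<rparr>"

text \<open>\<open>\<Phi>\<close> is an isomorphism of \<open>X\<close> onto the closed subvariety \<open>Z\<close> of \<open>Y\<close>.\<close>

definition closed_embedding_onto ::
  "('p, 'c, 'k) mproj \<Rightarrow> ('q, 'd, 'l) mproj \<Rightarrow> 'q set \<Rightarrow> ('p \<Rightarrow> 'q) \<Rightarrow> bool" where
  "closed_embedding_onto X Y Z \<Phi> \<longleftrightarrow> closedin (zariski Y) Z \<and> variety_iso X (subvariety Y Z) \<Phi>"

definition linear_forms :: "'v cspace \<Rightarrow> ('v \<Rightarrow> complex) set" where
  "linear_forms M = {l. (\<forall>u\<in>carrier M. \<forall>v\<in>carrier M. l (u \<oplus>\<^bsub>M\<^esub> v) = l u + l v) \<and>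
     (\<forall>c. \<forall>u\<in>carrier M. l (c \<odot>\<^bsub>M\<^esub> u) = c * l u)}"

definition line_of :: "'v cspace \<Rightarrow> 'v \<Rightarrow> 'v set"
  where "line_of M v = (\<lambda>c. c \<odot>\<^bsub>M\<^esub> v) ` UNIV"

definition projective_space :: "'v cspace \<Rightarrow> ('v set, 'v, unit) mproj" where
  "projective_space M =
    \<lparr>points = line_of M ` (carrier M - {\<zero>\<^bsub>M\<^esub>}), coords = (\<lambda>L. L - {\<zero>\<^bsub>M\<^esub>}),
     gens = (\<lambda>_. linear_forms M)\<rparr>"


section \<open>The degenerate Lie algebra and its modules\<close>

text \<open>The positive root \<open>\<alpha>\<^bsub>i,j\<^esub>\<close> is the pair \<open>(i, j)\<close>.\<close>

definition pos_roots :: "nat \<Rightarrow> (nat \<times> nat) set"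
  where "pos_roots n = {(i, j). 1 \<le> i \<and> i \<le> j \<and> j \<le> n - 1}"

definition simple_coeff :: "nat \<times> nat \<Rightarrow> nat \<Rightarrow> nat"
  where "simple_coeff \<alpha> k = (if fst \<alpha> \<le> k \<and> k \<le> snd \<alpha> then 1 else 0)"

definition root_ge :: "nat \<times> nat \<Rightarrow> nat \<times> nat \<Rightarrow> bool"
  where "root_ge \<beta> \<alpha> \<longleftrightarrow> (\<forall>k. simple_coeff \<alpha> k \<le> simple_coeff \<beta> k)"

text \<open>Matrix indices start at 0, so \<open>f\<^bsub>i,j\<^esub> = E\<^bsub>j+1,i\<^esub>\<close> has its entry at position \<open>(j, i - 1)\<close>.\<close>

definition root_vector :: "nat \<Rightarrow> nat \<times> nat \<Rightarrow> complex mat"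
  where "root_vector n \<beta> = mat n n (\<lambda>(r, c). if r = snd \<beta> \<and> c = fst \<beta> - 1 then 1 else 0)"

definition borel_algebra :: "nat \<Rightarrow> complex mat set"
  where "borel_algebra n = {X \<in> carrier_mat n n. upper_triangular X \<and> (\<Sum>k<n. X $$ (k, k)) = 0}"

definition borel_group :: "nat \<Rightarrow> complex mat set"
  where "borel_group n = {b \<in> carrier_mat n n. upper_triangular b \<and> det b = 1}"

text \<open>\<open>\<complex>[f\<^sub>\<beta>]\<close>: monomials are finitely supported exponent functions on pairs; \<open>sym_alg n\<close> consists of
  the polynomials that involve only variables \<open>f\<^sub>\<beta>\<close> with \<open>\<beta>\<close> a positive root.\<close>

type_synonym spoly = "((nat \<times> nat) \<Rightarrow>\<^sub>0 nat) \<Rightarrow>\<^sub>0 complex"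

definition sym_alg :: "nat \<Rightarrow> spoly set" where
  "sym_alg n = {p. \<forall>\<mu>\<in>Poly_Mapping.keys p. Poly_Mapping.keys \<mu> \<subseteq> pos_roots n}"

definition fvar :: "nat \<times> nat \<Rightarrow> spoly"
  where "fvar \<beta> = Poly_Mapping.single (Poly_Mapping.single \<beta> 1) 1"

definition partial_deriv :: "nat \<times> nat \<Rightarrow> spoly \<Rightarrow> spoly" where
  "partial_deriv \<beta> = linear_extension (\<lambda>\<mu>.
     Poly_Mapping.single (\<mu> - Poly_Mapping.single \<beta> 1) (of_nat (Poly_Mapping.lookup \<mu> \<beta>)))"

definition substitute :: "(nat \<times> nat \<Rightarrow> spoly) \<Rightarrow> spoly \<Rightarrow> spoly" where
  "substitute \<sigma> = linear_extension (\<lambda>\<mu>.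
     \<Prod>\<beta>\<in>Poly_Mapping.keys \<mu>. \<sigma> \<beta> ^ Poly_Mapping.lookup \<mu> \<beta>)"

text \<open>The abelian ideal \<open>\<nn>\<^sup>-\<^sup>a = \<gg>/\<bb>\<close> is the space of linear forms in the \<open>f\<^sub>\<beta>\<close>;
  \<open>class_mod_b n A\<close> is the class of the matrix \<open>A\<close> in it.\<close>

definition nilrad :: "nat \<Rightarrow> spoly set"
  where "nilrad n = fsv.span (fvar ` pos_roots n)"

definition class_mod_b :: "nat \<Rightarrow> complex mat \<Rightarrow> spoly" where
  "class_mod_b n A = (\<Sum>\<beta>\<in>pos_roots n. cscale (A $$ (snd \<beta>, fst \<beta> - 1)) (fvar \<beta>))"

text \<open>The action \<open>\<circ>\<close> of \<open>\<bb>\<close> on \<open>S(\<gg>/\<bb>)\<close> (by derivations) and the corresponding action of \<open>B\<close>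
  (by automorphisms).\<close>

definition circ_action :: "nat \<Rightarrow> complex mat \<Rightarrow> spoly \<Rightarrow> spoly" where
  "circ_action n X p = (\<Sum>\<beta>\<in>pos_roots n.
     partial_deriv \<beta> p * class_mod_b n (X * root_vector n \<beta> - root_vector n \<beta> * X))"

definition Ad_action :: "nat \<Rightarrow> complex mat \<Rightarrow> spoly \<Rightarrow> spoly" where
  "Ad_action n b = substitute (\<lambda>\<beta>. class_mod_b n (b * root_vector n \<beta> * the (mat_inverse b)))"

definition ideal_gens :: "nat \<Rightarrow> nat \<times> nat \<Rightarrow> spoly set" where
  "ideal_gens n \<alpha> = (\<lambda>U. fsv.subspace U \<and> (\<forall>X\<in>borel_algebra n. \<forall>u\<in>U. circ_action n X u \<in> U)) hull
     ({fvar \<beta> ^ 2 | \<beta>. \<beta> \<in> pos_roots n \<and> root_ge \<beta> \<alpha>} \<union>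
      {fvar \<beta> | \<beta>. \<beta> \<in> pos_roots n \<and> \<not> root_ge \<beta> \<alpha>})"

definition root_ideal :: "nat \<Rightarrow> nat \<times> nat \<Rightarrow> spoly set" where
  "root_ideal n \<alpha> = fsv.span {p * g | p g. p \<in> sym_alg n \<and> g \<in> ideal_gens n \<alpha>}"

definition root_module :: "nat \<Rightarrow> nat \<times> nat \<Rightarrow> spoly set cspace"
  where "root_module n \<alpha> = quotient_space (sym_alg n) (root_ideal n \<alpha>)"

definition root_module_vec :: "nat \<Rightarrow> nat \<times> nat \<Rightarrow> spoly set"
  where "root_module_vec n \<alpha> = (+) 1 ` root_ideal n \<alpha>"

text \<open>The element \<open>exp x\<close> of \<open>(N\<^sup>-)\<^sup>a\<close>, and \<open>b \<in> B\<close>, acting on \<open>M\<^sub>\<alpha>\<close>. As \<open>x \<in> \<nn>\<^sup>-\<^sup>a\<close> acts nilpotently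
  on \<open>M\<^sub>\<alpha>\<close>, the exponential series is the sum of its finitely many nonzero terms. The factor
  \<open>\<Prod>k<i. b $$ (k, k)\<close> is the character \<open>\<omega>\<^sub>i\<close> of \<open>B\<close>, whence \<open>v\<^sub>\<alpha>\<close> gets weight \<open>\<omega>\<^sub>i\<close>.\<close>

definition exp_action :: "nat \<Rightarrow> nat \<times> nat \<Rightarrow> spoly \<Rightarrow> spoly set \<Rightarrow> spoly set" where
  "exp_action n \<alpha> x = coset_map (root_ideal n \<alpha>)
     (\<lambda>p. \<Sum>k | x ^ k * p \<notin> root_ideal n \<alpha>. cscale (1 / fact k) (x ^ k * p))"

definition borel_action :: "nat \<Rightarrow> nat \<times> nat \<Rightarrow> complex mat \<Rightarrow> spoly set \<Rightarrow> spoly set" where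
  "borel_action n \<alpha> b = coset_map (root_ideal n \<alpha>)
     (\<lambda>p. cscale (\<Prod>k<fst \<alpha>. b $$ (k, k)) (Ad_action n b p))"

text \<open>The pair \<open>(b, x)\<close> stands for the element \<open>b \<cdot> exp x\<close> of \<open>SL\<^sub>n\<^sup>a = B \<ltimes> (N\<^sup>-)\<^sup>a\<close>; note that
  \<open>exp x \<cdot> b' = b' \<cdot> exp (Ad (b'\<^sup>-\<^sup>1) x)\<close>.\<close>

definition SLa :: "nat \<Rightarrow> (complex mat \<times> spoly) monoid" where
  "SLa n = \<lparr>carrier = borel_group n \<times> nilrad n,
     mult = (\<lambda>(b, x) (b', x'). (b * b', Ad_action n (the (mat_inverse b')) x + x')),
     one = (1\<^sub>m n, 0)\<rparr>"

definition Na :: "nat \<Rightarrow> (complex mat \<times> spoly) set"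
  where "Na n = {1\<^sub>m n} \<times> nilrad n"

definition group_action :: "nat \<Rightarrow> nat \<times> nat \<Rightarrow> complex mat \<times> spoly \<Rightarrow> spoly set \<Rightarrow> spoly set"
  where "group_action n \<alpha> g v = borel_action n \<alpha> (fst g) (exp_action n \<alpha> (snd g) v)"

text \<open>The tensor factors are indexed by \<open>((i, j), k)\<close> with \<open>k < m i j\<close>; this factor is \<open>M\<^sub>\<alpha>\<close> for
  \<open>\<alpha> = (i, j)\<close>.\<close>

type_synonym tensor = "(((nat \<times> nat) \<times> nat \<Rightarrow> spoly set) \<Rightarrow>\<^sub>0 complex) set"

definition factors :: "nat \<Rightarrow> (nat \<Rightarrow> nat \<Rightarrow> nat) \<Rightarrow> ((nat \<times> nat) \<times> nat) set"
  where "factors n m = {((i, j), k). (i, j) \<in> pos_roots n \<and> k < m i j}"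

definition big_tensor :: "nat \<Rightarrow> (nat \<Rightarrow> nat \<Rightarrow> nat) \<Rightarrow> tensor cspace"
  where "big_tensor n m = tensor_space (factors n m) (root_module n \<circ> fst)"

text \<open>\<open>g \<cdot> v\<^sub>\<mm>\<close> for the diagonal action of \<open>SL\<^sub>n\<^sup>a\<close> on the tensor product.\<close>

definition translate :: "nat \<Rightarrow> (nat \<Rightarrow> nat \<Rightarrow> nat) \<Rightarrow> complex mat \<times> spoly \<Rightarrow> tensor" where
  "translate n m g = pure_tensor (factors n m) (root_module n \<circ> fst)
     (\<lambda>(\<alpha>, k). group_action n \<alpha> g (root_module_vec n \<alpha>))"

definition v_tensor :: "nat \<Rightarrow> (nat \<Rightarrow> nat \<Rightarrow> nat) \<Rightarrow> tensor" where
  "v_tensor n m = pure_tensor (factors n m) (root_module n \<circ> fst) (\<lambda>(\<alpha>, k). root_module_vec n \<alpha>)"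

definition f_action :: "nat \<Rightarrow> (nat \<Rightarrow> nat \<Rightarrow> nat) \<Rightarrow> nat \<times> nat \<Rightarrow> tensor \<Rightarrow> tensor" where
  "f_action n m \<beta> = tensor_lie_action (factors n m) (root_module n \<circ> fst)
     (\<lambda>(\<alpha>, k). coset_map (root_ideal n \<alpha>) (\<lambda>p. fvar \<beta> * p))"

text \<open>\<open>M\<^sub>\<mm>\<close>, the \<open>S(\<nn>\<^sup>-)\<close>-submodule generated by \<open>v\<^sub>\<mm>\<close>.\<close>

definition cyclic_module :: "nat \<Rightarrow> (nat \<Rightarrow> nat \<Rightarrow> nat) \<Rightarrow> tensor cspace" where
  "cyclic_module n m = (big_tensor n m)\<lparr>carrier :=
     (\<lambda>C. Module.submodule C complex_ring (big_tensor n m) \<and>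
          (\<forall>\<beta>\<in>pos_roots n. \<forall>u\<in>C. f_action n m \<beta> u \<in> C)) hull {v_tensor n m}\<rparr>"

definition PM :: "nat \<Rightarrow> (nat \<Rightarrow> nat \<Rightarrow> nat) \<Rightarrow> (tensor set, tensor, unit) mproj"
  where "PM n m = projective_space (cyclic_module n m)"

text \<open>The orbit of the line \<open>[v\<^sub>\<mm>]\<close> under a set of elements of \<open>SL\<^sub>n\<^sup>a\<close>.\<close>

definition orbit ::
  "nat \<Rightarrow> (nat \<Rightarrow> nat \<Rightarrow> nat) \<Rightarrow> (complex mat \<times> spoly) set \<Rightarrow> tensor set set"
  where "orbit n m G = (\<lambda>g. line_of (cyclic_module n m) (translate n m g)) ` G"


section \<open>The variety of collections of subspaces\<close>

type_synonym W = "nat \<Rightarrow>\<^sub>0 complex"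

definition wvec :: "nat \<Rightarrow> W"
  where "wvec k = Poly_Mapping.single k 1"

definition proj_kill :: "nat \<Rightarrow> W \<Rightarrow> W"
  where "proj_kill k = Poly_Mapping.update k 0"

definition R_points :: "nat \<Rightarrow> (nat \<times> nat \<Rightarrow> W set) set" where
  "R_points n = {V \<in> extensional (pos_roots n).
     (\<forall>(i, j)\<in>pos_roots n. fsv.subspace (V (i, j)) \<and> fsv.dim (V (i, j)) = i \<and>
        V (i, j) \<subseteq> fsv.span (wvec ` ({1..i} \<union> {j + 1..n}))) \<and>
     (\<forall>i j. 1 \<le> i \<and> i < j \<and> j \<le> n - 1 \<longrightarrow> V (i, j) \<subseteq> V (i + 1, j)) \<and>
     (\<forall>i j. 1 \<le> i \<and> i \<le> j \<and> j < n - 1 \<longrightarrow> proj_kill (j + 1) ` V (i, j) \<subseteq> V (i, j + 1))}"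

text \<open>\<open>R\<^sub>n\<close> as a closed subvariety of the product of the Grassmannians \<open>Gr(i, W)\<close>, \<open>(i, j)\<close> a
  positive root, each in its Pluecker embedding: a point is described by a choice of bases
  \<open>u (i, j) 0, \<dots>, u (i, j) (i - 1)\<close> of the \<open>V (i, j)\<close>, and the homogeneous coordinates are the
  \<open>i \<times> i\<close> minors of the matrices of coordinates of these bases.\<close>

definition basis_families :: "nat \<Rightarrow> (nat \<times> nat \<Rightarrow> W set) \<Rightarrow> (nat \<times> nat \<Rightarrow> nat \<Rightarrow> W) set" where
  "basis_families n V = {u. \<forall>(i, j)\<in>pos_roots n.
     inj_on (u (i, j)) {..<i} \<and> fsv.independent (u (i, j) ` {..<i}) \<and>
     fsv.span (u (i, j) ` {..<i}) = V (i, j)}"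

definition pluecker_minor :: "nat \<times> nat \<Rightarrow> (nat \<Rightarrow> nat) \<Rightarrow> (nat \<times> nat \<Rightarrow> nat \<Rightarrow> W) \<Rightarrow> complex" where
  "pluecker_minor \<alpha> t u =
     det (mat (fst \<alpha>) (fst \<alpha>) (\<lambda>(a, b). Poly_Mapping.lookup (u \<alpha> a) (t b)))"

definition R_variety ::
  "nat \<Rightarrow> (nat \<times> nat \<Rightarrow> W set, nat \<times> nat \<Rightarrow> nat \<Rightarrow> W, nat \<times> nat) mproj" where
  "R_variety n =
    \<lparr>points = R_points n, coords = basis_families n,
     gens = (\<lambda>\<alpha>. if \<alpha> \<in> pos_roots n then range (pluecker_minor \<alpha>) else {})\<rparr>"

end

theory Submission
  imports Defs
begin

text \<open>Write \<open>I(\<alpha>) = {1, \<dots>, i} \<union> {j + 1, \<dots>, n}\<close> for \<open>\<alpha> = \<alpha>\<^bsub>i,j\<^esub>\<close>, and \<open>W\<^sub>\<alpha>\<close> for the span of the \<open>w\<^sub>c\<close>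
  with \<open>c \<in> I(\<alpha>)\<close>. The theorem holds because \<open>M\<^sub>\<alpha>\<close> is the exterior power \<open>\<Lambda>\<^sup>i W\<^sub>\<alpha>\<close> with
  \<open>v\<^sub>\<alpha> = w\<^sub>1 \<and> \<dots> \<and> w\<^sub>i\<close>: the root vector \<open>f\<^bsub>a,b\<^esub>\<close> with \<open>a \<le> i\<close> and \<open>j \<le> b\<close> replaces \<open>w\<^sub>a\<close> by
  \<open>w\<^bsub>b+1\<^esub>\<close>, and the other root vectors act by zero. Then \<open>exp(x) v\<^sub>\<alpha>\<close> is the wedge of the rows
  \<open>w\<^sub>a + \<Sum>\<^sub>b x\<^bsub>a,b\<^esub> w\<^bsub>b+1\<^esub>\<close>, that is, the Pluecker vector of a graph over \<open>span (w\<^sub>1, \<dots>, w\<^sub>i)\<close>,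
  and the orbit of \<open>[v\<^sub>\<mm>]\<close> is the image, under the product of the Pluecker embeddings followed
  by the Segre embedding, of an open cell of \<open>R\<^sub>n\<close>.

  On the polynomial side, derivations by the Borel subalgebra turn the squares \<open>f\<^sub>\<beta>\<^sup>2\<close> into the
  permanents \<open>f\<^bsub>a,b\<^esub> f\<^bsub>a',b'\<^esub> + f\<^bsub>a,b'\<^esub> f\<^bsub>a',b\<^esub>\<close>, and together with the \<open>f\<^sub>\<beta>\<close>, \<open>\<beta> \<not>\<ge> \<alpha>\<close>, these
  span a stable space (\<open>explicit_gens_circ\<close>), which generates the root ideal (\<open>J_explicit\<close>). The
  exterior power enters through its coordinates only: \<open>pluecker_functional \<alpha> t p\<close> is the
  coordinate of \<open>p \<cdot> v\<^sub>\<alpha>\<close> at the columns \<open>t\<close>. These functionals kill the ideal (\<open>pl_J\<close>), they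
  separate the classes modulo the ideal (\<open>std_monomial_expansion\<close>), and each decomposable vector
  of \<open>\<Lambda>\<^sup>i W\<^sub>\<alpha>\<close> is the class of a polynomial (\<open>pl_pluecker_vector\<close>).

  The Borel subgroup multiplies \<open>v\<^sub>\<alpha>\<close> by a character and acts on \<open>S(\<nn>\<^sup>-)\<close> by algebra automorphisms
  that preserve the ideal, so it carries \<open>exp(x) v\<^sub>\<alpha>\<close> to a multiple of \<open>exp(x') v\<^sub>\<alpha>\<close> with \<open>x'\<close>
  independent of \<open>\<alpha>\<close> (\<open>group_action_highest_weight\<close>). Hence the orbits of both groups are the
  set of all lines \<open>line (exp_tensor c)\<close>.

  A tensor is determined by the products of Pluecker functionals, one for each factor
  (\<open>pforms_separate\<close>). Bases \<open>u\<close> of a point of \<open>R\<^sub>n\<close> give the tensor \<open>segre u\<close>, whose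
  coordinates are the products of minors of the \<open>u \<alpha>\<close>; its line is the image of the point under
  \<open>pluecker_map\<close>.

  Adapted bases of the flags \<open>V\<^bsub>1,j\<^esub> \<subset> V\<^bsub>2,j\<^esub> \<subset> \<dots>\<close> parametrise \<open>R\<^sub>n\<close> by an open part of an affine
  space, and restriction of a multihomogeneous function to a line in this space shows that the
  cell is dense (\<open>cell_dense\<close>); so the image of \<open>R\<^sub>n\<close> lies in the closure of the orbit.
  Conversely, in the chart where a given coordinate is nonzero, a point of the closure satisfies
  all homogeneous relations that hold on the orbit. They include relations saying that the
  quotients of coordinates are products of minors of reduced matrices, the same matrix for all
  factors with the same root, and that the row spaces of these matrices satisfy the incidence
  conditions of \<open>R\<^sub>n\<close>. So the point of \<open>R\<^sub>n\<close> can be read off (\<open>Z_pluecker_map\<close>). As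
  \<open>m\<^bsub>i,j\<^esub> > 0\<close>, each root has a factor, and the line determines all the \<open>V\<^bsub>i,j\<^esub>\<close>
  (\<open>inj_pluecker_map\<close>).

  It remains to compare functions. A linear form on the tensor product is a multihomogeneous
  function of the minors (\<open>form_segre_homogeneous\<close>). On a chart of the closure, conversely, a
  multihomogeneous function of the minors is a homogeneous function of the coordinates up to
  factors without zeros (\<open>chart_form\<close>). The first fact gives continuity of the map and the
  pullback of regular functions, the second one gives openness and the descent of regular
  functions.\<close>

section \<open>Minors and reduced bases\<close>

definition minor :: "nat \<Rightarrow> (nat \<Rightarrow> W) \<Rightarrow> (nat \<Rightarrow> nat) \<Rightarrow> complex" where
  "minor i u t = det (mat i i (\<lambda>(a, b). Poly_Mapping.lookup (u a) (t b)))"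

definition minor_cofactor :: "nat \<Rightarrow> (nat \<Rightarrow> W) \<Rightarrow> (nat \<Rightarrow> nat) \<Rightarrow> nat \<Rightarrow> nat \<Rightarrow> complex" where
  "minor_cofactor i u t = cofactor (mat i i (\<lambda>(a, b). Poly_Mapping.lookup (u a) (t b)))"

lemma pluecker_minor_eq: "pluecker_minor \<alpha> t u = minor (fst \<alpha>) (u \<alpha>) t"
  by (simp add: pluecker_minor_def minor_def)

lemma minor_cong:
  assumes "\<And>a b. a < i \<Longrightarrow> b < i \<Longrightarrow> Poly_Mapping.lookup (u a) (t b) = Poly_Mapping.lookup (u' a) (t' b)"
  shows "minor i u t = minor i u' t'"
proof -
  have "mat i i (\<lambda>(a, b). Poly_Mapping.lookup (u a) (t b)) = mat i i (\<lambda>(a, b). Poly_Mapping.lookup (u' a) (t' b))"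
    by (rule eq_matI) (auto simp: assms)
  then show ?thesis by (simp add: minor_def)
qed

lemma minor_expand_column:
  assumes "b < i"
  shows "minor i u (t(b := c)) = (\<Sum>r<i. Poly_Mapping.lookup (u r) c * minor_cofactor i u t r b)"
proof -
  let ?A = "\<lambda>t. mat i i (\<lambda>(a, b). Poly_Mapping.lookup (u a) (t b))"
  have "mat_delete (?A (t(b := c))) r b = mat_delete (?A t) r b" for r
    by (rule eq_matI) (auto simp: mat_delete_def)
  then have cof: "cofactor (?A (t(b := c))) r b = cofactor (?A t) r b" for r
    by (simp add: cofactor_def)
  have "minor i u (t(b := c)) = (\<Sum>r<i. ?A (t(b := c)) $$ (r, b) * cofactor (?A (t(b := c))) r b)"
    unfolding minor_def by (rule laplace_expansion_column) (use assms in auto)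
  also have "\<dots> = (\<Sum>r<i. Poly_Mapping.lookup (u r) c * minor_cofactor i u t r b)"
    unfolding cof minor_cofactor_def by (rule sum.cong) (use assms in auto)
  finally show ?thesis .
qed

lemma minor_expand_row:
  assumes "r < i"
  shows "minor i (u(r := v)) t = (\<Sum>s<i. Poly_Mapping.lookup v (t s) * minor_cofactor i u t r s)"
proof -
  let ?A = "\<lambda>u. mat i i (\<lambda>(a, b). Poly_Mapping.lookup (u a) (t b))"
  have "mat_delete (?A (u(r := v))) r s = mat_delete (?A u) r s" for s
    by (rule eq_matI) (auto simp: mat_delete_def)
  then have cof: "cofactor (?A (u(r := v))) r s = cofactor (?A u) r s" for s
    by (simp add: cofactor_def)
  have "minor i (u(r := v)) t = (\<Sum>s<i. ?A (u(r := v)) $$ (r, s) * cofactor (?A (u(r := v))) r s)"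
    unfolding minor_def by (rule laplace_expansion_row) (use assms in auto)
  also have "\<dots> = (\<Sum>s<i. Poly_Mapping.lookup v (t s) * minor_cofactor i u t r s)"
    unfolding cof minor_cofactor_def by (rule sum.cong) (use assms in auto)
  finally show ?thesis .
qed

lemma minor_row_add:
  assumes "r < i"
  shows "minor i (u(r := v + w)) t = minor i (u(r := v)) t + minor i (u(r := w)) t"
  by (simp add: minor_expand_row[OF assms] lookup_add algebra_simps sum.distrib)

lemma minor_row_cscale:
  assumes "r < i"
  shows "minor i (u(r := cscale c v)) t = c * minor i (u(r := v)) t"
  by (simp add: minor_expand_row[OF assms] algebra_simps sum_distrib_left)

lemma minor_row_zero: "r < i \<Longrightarrow> minor i (u(r := 0)) t = 0"
  by (simp add: minor_expand_row)

lemma minor_repeated_column: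
  assumes "a < i" "b < i" "a \<noteq> b" "t a = t b"
  shows "minor i u t = 0"
  unfolding minor_def
  by (rule det_identical_columns[of _ i a b]) (use assms in \<open>auto intro!: eq_vecI\<close>)

lemma minor_zero_column:
  assumes "b < i" "\<And>a. a < i \<Longrightarrow> Poly_Mapping.lookup (u a) (t b) = 0"
  shows "minor i u t = 0"
  using minor_expand_column[OF assms(1), of u t "t b"] assms(2) by simp

text \<open>Both sides are the sum of all entries of column \<open>a\<close> times the cofactors of the columns
  that equal \<open>b\<close>. Read from right to left, this turns the derivation \<open>w\<^sub>a \<mapsto> w\<^sub>b\<close> of an exterior
  power into an operation on column tuples.\<close>

lemma minor_column_derivation:
  "(\<Sum>s<i. if t s = b then minor i u (t(s := a)) else 0) =
   (\<Sum>r<i. minor i (u(r := cscale (Poly_Mapping.lookup (u r) a) (wvec b))) t)"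
proof -
  have "(\<Sum>s<i. if t s = b then minor i u (t(s := a)) else 0) =
    (\<Sum>s<i. \<Sum>r<i. if t s = b then Poly_Mapping.lookup (u r) a * minor_cofactor i u t r s else 0)"
    by (rule sum.cong) (auto simp: minor_expand_column)
  also have "\<dots> = (\<Sum>r<i. \<Sum>s<i. if t s = b then Poly_Mapping.lookup (u r) a * minor_cofactor i u t r s else 0)"
    by (rule sum.swap)
  also have "\<dots> = (\<Sum>r<i. minor i (u(r := cscale (Poly_Mapping.lookup (u r) a) (wvec b))) t)"
    by (rule sum.cong, simp)
      (auto simp: minor_expand_row wvec_def lookup_single when_def intro!: sum.cong)
  finally show ?thesis .
qed

definition lin_indep :: "nat \<Rightarrow> (nat \<Rightarrow> W) \<Rightarrow> bool" where
  "lin_indep i u \<longleftrightarrow> (\<forall>c. (\<Sum>a<i. cscale (c a) (u a)) = 0 \<longrightarrow> (\<forall>a<i. c a = 0))"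

lemma lookup_lincomb: "Poly_Mapping.lookup (\<Sum>a\<in>A. cscale (c a) (u a)) k = (\<Sum>a\<in>A. c a * Poly_Mapping.lookup (u a) k)"
  by (simp add: lookup_sum)

lemma lin_indep_iff: "lin_indep i u \<longleftrightarrow> inj_on u {..<i} \<and> fsv.independent (u ` {..<i})"
proof
  assume L: "lin_indep i u"
  have inj: "inj_on u {..<i}"
  proof (rule inj_onI, rule ccontr)
    fix a b assume ab: "a \<in> {..<i}" "b \<in> {..<i}" "u a = u b" "a \<noteq> b"
    define c where "c k = (if k = a then 1 else if k = b then - 1 else 0 :: complex)" for k
    have "(\<Sum>k<i. cscale (c k) (u k)) = (\<Sum>k\<in>{a, b}. cscale (c k) (u k))"
      by (rule sum.mono_neutral_right) (use ab in \<open>auto simp: c_def\<close>)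
    also have "\<dots> = 0" using ab by (simp add: c_def)
    finally have "c a = 0" using L ab unfolding lin_indep_def by blast
    then show False by (simp add: c_def)
  qed
  moreover have "fsv.independent (u ` {..<i})"
  proof
    assume "fsv.dependent (u ` {..<i})"
    then obtain d where d: "\<exists>v\<in>u ` {..<i}. d v \<noteq> 0" "(\<Sum>v\<in>u ` {..<i}. cscale (d v) v) = 0"
      using fsv.dependent_finite[of "u ` {..<i}"] by auto
    have "(\<Sum>a<i. cscale (d (u a)) (u a)) = 0"
      using d(2) by (simp add: sum.reindex[OF inj])
    then have "\<forall>a<i. d (u a) = 0" using L unfolding lin_indep_def by (elim allE[of _ "\<lambda>a. d (u a)"]) simp
    then show False using d(1) by auto
  qed
  ultimately show "inj_on u {..<i} \<and> fsv.independent (u ` {..<i})" by blast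
next
  assume H: "inj_on u {..<i} \<and> fsv.independent (u ` {..<i})"
  show "lin_indep i u" unfolding lin_indep_def
  proof (intro allI impI)
    fix c a assume c: "(\<Sum>a<i. cscale (c a) (u a)) = 0" and a: "a < i"
    define d where "d v = c (the_inv_into {..<i} u v)" for v
    have du: "d (u a) = c a" if "a < i" for a
      using that H by (simp add: d_def the_inv_into_f_f)
    have "(\<Sum>v\<in>u ` {..<i}. cscale (d v) v) = (\<Sum>a<i. cscale (d (u a)) (u a))"
      using H by (simp add: sum.reindex)
    also have "\<dots> = (\<Sum>a<i. cscale (c a) (u a))" by (rule sum.cong) (auto simp: du)
    finally have "(\<Sum>v\<in>u ` {..<i}. cscale (d v) v) = 0" using c by simp
    then have "\<forall>v\<in>u ` {..<i}. d v = 0"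
      using H fsv.dependent_finite[of "u ` {..<i}"] by blast
    then show "c a = 0" using a du by auto
  qed
qed

lemma span_family:
  fixes u :: "nat \<Rightarrow> 'x \<Rightarrow>\<^sub>0 complex"
  shows "fsv.span (u ` {..<i}) = {\<Sum>a<i. cscale (c a) (u a) | c. True}"
proof
  have S: "fsv.subspace {\<Sum>a<i. cscale (c a) (u a) | c. True}"
    unfolding fsv.subspace_def
  proof (intro conjI ballI allI)
    show "0 \<in> {\<Sum>a<i. cscale (c a) (u a) | c. True}" by (auto intro!: exI[of _ "\<lambda>_. 0"])
  next
    fix x y assume "x \<in> {\<Sum>a<i. cscale (c a) (u a) | c. True}" "y \<in> {\<Sum>a<i. cscale (c a) (u a) | c. True}"
    then obtain c d where "x = (\<Sum>a<i. cscale (c a) (u a))" "y = (\<Sum>a<i. cscale (d a) (u a))" by auto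
    then have "x + y = (\<Sum>a<i. cscale (c a + d a) (u a))"
      by (simp add: fsv.scale_left_distrib sum.distrib)
    then show "x + y \<in> {\<Sum>a<i. cscale (c a) (u a) | c. True}"
      by (intro CollectI exI[of _ "\<lambda>a. c a + d a"]) simp
  next
    fix k x assume "x \<in> {\<Sum>a<i. cscale (c a) (u a) | c. True}"
    then obtain c where "x = (\<Sum>a<i. cscale (c a) (u a))" by auto
    then have "cscale k x = (\<Sum>a<i. cscale (k * c a) (u a))"
      by (simp add: fsv.scale_sum_right)
    then show "cscale k x \<in> {\<Sum>a<i. cscale (c a) (u a) | c. True}"
      by (intro CollectI exI[of _ "\<lambda>a. k * c a"]) simp
  qed
  have "u ` {..<i} \<subseteq> {\<Sum>a<i. cscale (c a) (u a) | c. True}"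
  proof
    fix v assume "v \<in> u ` {..<i}"
    then obtain a where a: "a < i" "v = u a" by auto
    have "(\<Sum>k<i. cscale (if k = a then 1 else 0) (u k)) = (\<Sum>k\<in>{a}. cscale (if k = a then 1 else 0) (u k))"
      by (rule sum.mono_neutral_right) (use a in auto)
    then have "v = (\<Sum>k<i. cscale (if k = a then 1 else 0) (u k))" using a by simp
    then show "v \<in> {\<Sum>a<i. cscale (c a) (u a) | c. True}"
      by (intro CollectI exI[of _ "\<lambda>k. if k = a then 1 else 0"]) simp
  qed
  then show "fsv.span (u ` {..<i}) \<subseteq> {\<Sum>a<i. cscale (c a) (u a) | c. True}"
    using S by (rule fsv.span_minimal)
next
  show "{\<Sum>a<i. cscale (c a) (u a) | c. True} \<subseteq> fsv.span (u ` {..<i})"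
    by (clarify, intro fsv.span_sum fsv.span_scale fsv.span_base imageI)
qed

lemma subspace_supported: "fsv.subspace {v :: 'x \<Rightarrow>\<^sub>0 complex. Poly_Mapping.keys v \<subseteq> I}"
  unfolding fsv.subspace_def
  by (auto simp: in_keys_iff subset_iff lookup_add) (metis add.right_neutral)

lemma single_sum: "v = (\<Sum>k\<in>Poly_Mapping.keys v. cscale (Poly_Mapping.lookup v k) (Poly_Mapping.single k 1))"
  by (rule poly_mapping_eqI) (auto simp: lookup_sum lookup_single when_def in_keys_iff if_distrib cong: if_cong)

lemma span_singles: "fsv.span ((\<lambda>k. Poly_Mapping.single k 1) ` I) = {v :: 'x \<Rightarrow>\<^sub>0 complex. Poly_Mapping.keys v \<subseteq> I}"
proof
  show "fsv.span ((\<lambda>k. Poly_Mapping.single k 1) ` I) \<subseteq> {v :: 'x \<Rightarrow>\<^sub>0 complex. Poly_Mapping.keys v \<subseteq> I}"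
    by (rule fsv.span_minimal[OF _ subspace_supported]) auto
  show "{v :: 'x \<Rightarrow>\<^sub>0 complex. Poly_Mapping.keys v \<subseteq> I} \<subseteq> fsv.span ((\<lambda>k. Poly_Mapping.single k 1) ` I)"
  proof
    fix v :: "'x \<Rightarrow>\<^sub>0 complex" assume "v \<in> {v. Poly_Mapping.keys v \<subseteq> I}"
    then have "(\<Sum>k\<in>Poly_Mapping.keys v. cscale (Poly_Mapping.lookup v k) (Poly_Mapping.single k 1)) \<in> fsv.span ((\<lambda>k. Poly_Mapping.single k 1) ` I)"
      by (intro fsv.span_sum fsv.span_scale fsv.span_base) auto
    then show "v \<in> fsv.span ((\<lambda>k. Poly_Mapping.single k 1) ` I)"
      using single_sum[of v] by simp
  qed
qed

lemma span_wvec: "fsv.span (wvec ` I) = {v. Poly_Mapping.keys v \<subseteq> I}"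
  using span_singles[of I] by (simp add: wvec_def[abs_def])

lemma nonzero_minor_imp_lin_indep:
  assumes "minor i u t \<noteq> 0"
  shows "lin_indep i u"
  unfolding lin_indep_def
proof (intro allI impI)
  fix c a assume c: "(\<Sum>a<i. cscale (c a) (u a)) = 0" and a: "a < i"
  let ?u = "u(a := \<Sum>k<i. cscale (c k) (u k))"
  have "minor i ?u t = (\<Sum>k<i. c k * minor i (u(a := u k)) t)"
    by (simp add: minor_expand_row[OF a] lookup_lincomb sum_distrib_left sum_distrib_right mult.assoc)
      (rule sum.swap)
  also have "\<dots> = (\<Sum>k\<in>{a}. c k * minor i (u(a := u k)) t)"
  proof (rule sum.mono_neutral_right)
    have "minor i (u(a := u k)) t = 0" if "k < i" "k \<noteq> a" for k
      unfolding minor_def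
      by (rule det_identical_rows[of _ i a k]) (use that a in \<open>auto intro!: eq_vecI\<close>)
    then show "\<forall>k\<in>{..<i} - {a}. c k * minor i (u(a := u k)) t = 0" by auto
  qed (use a in auto)
  also have "\<dots> = c a * minor i u t" by simp
  finally show "c a = 0" using assms c minor_row_zero[OF a, of u t] by simp
qed

text \<open>Take a nonzero minor of the first \<open>i\<close> vectors. The cofactors along a further column are
  the coefficients of a nontrivial combination of all \<open>i + 1\<close> vectors, and each index at which
  this combination is nonzero is a suitable last column.\<close>

lemma lin_indep_imp_nonzero_minor:
  assumes "lin_indep i u" "\<And>a. a < i \<Longrightarrow> Poly_Mapping.keys (u a) \<subseteq> I"
  shows "\<exists>t. (\<forall>b<i. t b \<in> I) \<and> minor i u t \<noteq> 0"
  using assms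
proof (induction i)
  case 0
  then show ?case by (simp add: minor_def)
next
  case (Suc i)
  have "lin_indep i u" unfolding lin_indep_def
  proof (intro allI impI)
    fix c a assume c: "(\<Sum>a<i. cscale (c a) (u a)) = 0" and a: "a < i"
    have "(\<Sum>a<Suc i. cscale ((c(i := 0)) a) (u a)) = (\<Sum>a<i. cscale (c a) (u a))" by simp
    then have "(c(i := 0)) a = 0" using Suc.prems(1) c a unfolding lin_indep_def by (metis less_Suc_eq)
    then show "c a = 0" using a by simp
  qed
  then obtain t where t: "\<forall>b<i. t b \<in> I" "minor i u t \<noteq> 0" using Suc by auto
  let ?C = "\<lambda>r. minor_cofactor (Suc i) u t r i"
  have Ci: "?C i = minor i u t"
  proof -
    have "mat_delete (mat (Suc i) (Suc i) (\<lambda>(a, b). Poly_Mapping.lookup (u a) (t b))) i i =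
        mat i i (\<lambda>(a, b). Poly_Mapping.lookup (u a) (t b))"
      by (rule eq_matI) (auto simp: mat_delete_def)
    then show ?thesis by (simp add: minor_cofactor_def cofactor_def minor_def flip: mult_2)
  qed
  have "(\<Sum>r<Suc i. cscale (?C r) (u r)) \<noteq> 0"
    using Suc.prems(1) Ci t(2) unfolding lin_indep_def by (metis lessI)
  then obtain c where c: "Poly_Mapping.lookup (\<Sum>r<Suc i. cscale (?C r) (u r)) c \<noteq> 0"
    by (metis lookup_zero poly_mapping_eqI)
  then have nz: "(\<Sum>r<Suc i. ?C r * Poly_Mapping.lookup (u r) c) \<noteq> 0" by (simp only: lookup_lincomb) simp
  then obtain r where "r < Suc i" "Poly_Mapping.lookup (u r) c \<noteq> 0" by (metis (no_types, lifting) lessThan_iff mult_zero_right sum.neutral)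
  then have cI: "c \<in> I" using Suc.prems(2) by (meson in_keys_iff subsetD)
  have "minor (Suc i) u (t(i := c)) \<noteq> 0"
    using nz by (subst minor_expand_column) (auto simp: mult.commute)
  moreover have "\<forall>b<Suc i. (t(i := c)) b \<in> I" using t(1) cI by (auto simp: less_Suc_eq)
  ultimately show ?case by blast
qed

text \<open>The matrix of \<open>u'\<close> is the matrix of \<open>u\<close> multiplied from the left by a square matrix, whose
  determinant is the factor.\<close>

lemma minor_base_change:
  assumes "\<And>r. r < i \<Longrightarrow> u' r \<in> fsv.span (u ` {..<i})"
  shows "\<exists>g. \<forall>t. minor i u' t = g * minor i u t"
proof -
  have "\<forall>r. \<exists>c. r < i \<longrightarrow> u' r = (\<Sum>a<i. cscale (c a) (u a))"
    using assms unfolding span_family by blast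
  then obtain c where c: "\<And>r. r < i \<Longrightarrow> u' r = (\<Sum>a<i. cscale (c r a) (u a))" by metis
  have "minor i u' t = det (mat i i (\<lambda>(r, a). c r a)) * minor i u t" for t
  proof -
    have "mat i i (\<lambda>(a, b). Poly_Mapping.lookup (u' a) (t b)) =
        mat i i (\<lambda>(r, a). c r a) * mat i i (\<lambda>(a, b). Poly_Mapping.lookup (u a) (t b))"
      by (rule eq_matI) (auto simp: c lookup_lincomb scalar_prod_def lessThan_atLeast0)
    then show ?thesis by (simp add: minor_def det_mult[of _ i])
  qed
  then show ?thesis by blast
qed

text \<open>Cramer's rule for the basis of the span of \<open>u\<close> that is dual to the coordinates
  \<open>t 0, \<dots>, t (i - 1)\<close>; it is meant for \<open>minor i u t \<noteq> 0\<close>.\<close>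

definition reduced_basis :: "nat \<Rightarrow> (nat \<Rightarrow> W) \<Rightarrow> (nat \<Rightarrow> nat) \<Rightarrow> nat \<Rightarrow> W" where
  "reduced_basis i u t a = (\<Sum>r<i. cscale (minor_cofactor i u t r a / minor i u t) (u r))"

lemma lookup_reduced_basis:
  assumes "a < i"
  shows "Poly_Mapping.lookup (reduced_basis i u t a) c = minor i u (t(a := c)) / minor i u t"
  by (simp add: reduced_basis_def lookup_lincomb minor_expand_column[OF assms] sum_divide_distrib mult.commute)

lemma reduced_basis_pivot:
  assumes "minor i u t \<noteq> 0" "a < i" "b < i"
  shows "Poly_Mapping.lookup (reduced_basis i u t a) (t b) = (if a = b then 1 else 0)"
proof (cases "a = b")
  case False
  have "minor i u (t(a := t b)) = 0"
    by (rule minor_repeated_column[of a _ b]) (use assms False in auto)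
  then show ?thesis using False assms by (simp add: lookup_reduced_basis)
qed (use assms in \<open>simp add: lookup_reduced_basis\<close>)

lemma reduced_basis_in_span: "reduced_basis i u t a \<in> fsv.span (u ` {..<i})"
  unfolding reduced_basis_def by (intro fsv.span_sum fsv.span_scale fsv.span_base imageI)

lemma span_eq_zero_if_pivots_zero:
  assumes "minor i u t \<noteq> 0" "v \<in> fsv.span (u ` {..<i})" "\<And>b. b < i \<Longrightarrow> Poly_Mapping.lookup v (t b) = 0"
  shows "v = 0"
proof -
  obtain c where v: "v = (\<Sum>a<i. cscale (c a) (u a))" using assms(2) unfolding span_family by blast
  have "c a = 0" if a: "a < i" for a
  proof -
    have "minor i (u(a := v)) t = 0" using assms(3) by (simp add: minor_expand_row[OF a])
    moreover have "minor i (u(a := v)) t = (\<Sum>k<i. c k * minor i (u(a := u k)) t)"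
      by (simp add: v minor_expand_row[OF a] lookup_lincomb sum_distrib_left sum_distrib_right mult.assoc)
        (rule sum.swap)
    moreover have "\<dots> = (\<Sum>k\<in>{a}. c k * minor i (u(a := u k)) t)"
    proof (rule sum.mono_neutral_right)
      have "minor i (u(a := u k)) t = 0" if "k < i" "k \<noteq> a" for k
        unfolding minor_def
        by (rule det_identical_rows[of _ i a k]) (use that a in \<open>auto intro!: eq_vecI\<close>)
      then show "\<forall>k\<in>{..<i} - {a}. c k * minor i (u(a := u k)) t = 0" by auto
    qed (use a in auto)
    ultimately show ?thesis using assms(1) by simp
  qed
  then show ?thesis by (simp add: v)
qed

lemma reduced_basis_expand:
  assumes "minor i u t \<noteq> 0" "v \<in> fsv.span (u ` {..<i})"
  shows "v = (\<Sum>b<i. cscale (Poly_Mapping.lookup v (t b)) (reduced_basis i u t b))"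
proof -
  let ?s = "\<Sum>b<i. cscale (Poly_Mapping.lookup v (t b)) (reduced_basis i u t b)"
  have "v - ?s = 0"
  proof (rule span_eq_zero_if_pivots_zero[OF assms(1)])
    show "v - ?s \<in> fsv.span (u ` {..<i})"
      by (intro fsv.span_diff assms(2) fsv.span_sum fsv.span_scale reduced_basis_in_span)
    fix b assume b: "b < i"
    have "Poly_Mapping.lookup ?s (t b) = (\<Sum>a<i. Poly_Mapping.lookup v (t a) * (if a = b then 1 else 0))"
      unfolding lookup_lincomb by (rule sum.cong) (auto simp: reduced_basis_pivot[OF assms(1)] b)
    also have "\<dots> = Poly_Mapping.lookup v (t b)" using b by (simp add: if_distrib cong: if_cong)
    finally show "Poly_Mapping.lookup (v - ?s) (t b) = 0" by (simp add: lookup_minus)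
  qed
  then show ?thesis by simp
qed

lemma span_reduced_basis:
  assumes "minor i u t \<noteq> 0"
  shows "fsv.span (reduced_basis i u t ` {..<i}) = fsv.span (u ` {..<i})"
proof
  show "fsv.span (reduced_basis i u t ` {..<i}) \<subseteq> fsv.span (u ` {..<i})"
    by (rule fsv.span_minimal) (auto simp: reduced_basis_in_span fsv.subspace_span)
  show "fsv.span (u ` {..<i}) \<subseteq> fsv.span (reduced_basis i u t ` {..<i})"
  proof
    fix v assume "v \<in> fsv.span (u ` {..<i})"
    then have v: "v = (\<Sum>b<i. cscale (Poly_Mapping.lookup v (t b)) (reduced_basis i u t b))"
      by (rule reduced_basis_expand[OF assms])
    show "v \<in> fsv.span (reduced_basis i u t ` {..<i})"
      by (subst v) (intro fsv.span_sum fsv.span_scale fsv.span_base imageI)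
  qed
qed

lemma minor_pivot_reduced_basis:
  assumes "\<And>a b. a < i \<Longrightarrow> b < i \<Longrightarrow> Poly_Mapping.lookup (q a) (t b) = (if a = b then 1 else 0)"
  shows "minor i q t = 1"
proof -
  have "mat i i (\<lambda>(a, b). Poly_Mapping.lookup (q a) (t b)) = 1\<^sub>m i"
    by (rule eq_matI) (auto simp: assms)
  then show ?thesis by (simp add: minor_def)
qed

text \<open>By \<open>lookup_reduced_basis\<close> the entries of the reduced basis are quotients of minors
  themselves. So this expresses all minors by those that differ from \<open>t\<close> in one column, which is
  a form of the Pluecker relations.\<close>

lemma minor_reduced_basis:
  assumes "minor i u t \<noteq> 0"
  shows "minor i (reduced_basis i u t) s = minor i u s / minor i u t"
proof -
  obtain g where g: "\<And>s. minor i (reduced_basis i u t) s = g * minor i u s"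
    using minor_base_change[of i "reduced_basis i u t" u] reduced_basis_in_span by blast
  have "minor i (reduced_basis i u t) t = 1"
    by (rule minor_pivot_reduced_basis) (use reduced_basis_pivot[OF assms] in auto)
  then show ?thesis using g[of t] g[of s] assms by (simp add: field_simps)
qed

section \<open>Polynomials and the action of the Borel subalgebra\<close>

definition dual_ext :: "('x \<Rightarrow> complex) \<Rightarrow> ('x \<Rightarrow>\<^sub>0 complex) \<Rightarrow> complex" where
  "dual_ext h q = (\<Sum>k\<in>Poly_Mapping.keys q. Poly_Mapping.lookup q k * h k)"

lemma dual_ext_superset:
  assumes "finite K" "Poly_Mapping.keys q \<subseteq> K"
  shows "dual_ext h q = (\<Sum>k\<in>K. Poly_Mapping.lookup q k * h k)"
  unfolding dual_ext_def
proof (rule sum.mono_neutral_left[OF assms], rule ballI)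
  fix k assume "k \<in> K - Poly_Mapping.keys q"
  then have "Poly_Mapping.lookup q k = 0" by (simp add: in_keys_iff)
  then show "Poly_Mapping.lookup q k * h k = 0" by simp
qed

lemma dual_ext_add: "dual_ext h (p + q) = dual_ext h p + dual_ext h q"
proof -
  let ?K = "Poly_Mapping.keys p \<union> Poly_Mapping.keys q"
  have "dual_ext h (p + q) = (\<Sum>k\<in>?K. Poly_Mapping.lookup (p + q) k * h k)"
    by (rule dual_ext_superset) (use keys_add[of p q] in auto)
  moreover have "dual_ext h p = (\<Sum>k\<in>?K. Poly_Mapping.lookup p k * h k)"
    "dual_ext h q = (\<Sum>k\<in>?K. Poly_Mapping.lookup q k * h k)"
    by (rule dual_ext_superset; auto)+
  ultimately show ?thesis by (simp add: lookup_add algebra_simps sum.distrib)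
qed

lemma dual_ext_cscale: "dual_ext h (cscale c p) = c * dual_ext h p"
proof -
  have "dual_ext h (cscale c p) = (\<Sum>k\<in>Poly_Mapping.keys p. Poly_Mapping.lookup (cscale c p) k * h k)"
    by (rule dual_ext_superset) (simp_all add: in_keys_iff subset_iff)
  then show ?thesis by (simp add: dual_ext_def sum_distrib_left mult.assoc)
qed

lemma dual_ext_zero [simp]: "dual_ext h 0 = 0"
  by (simp add: dual_ext_def)

lemma dual_ext_single [simp]: "dual_ext h (Poly_Mapping.single k c) = c * h k"
  by (subst dual_ext_superset[of "{k}"]) auto

lemma dual_ext_diff: "dual_ext h (p - q) = dual_ext h p - dual_ext h q"
  using dual_ext_add[of h p "- q"] dual_ext_cscale[of h "- 1" q] by simp

lemma dual_ext_sum: "dual_ext h (\<Sum>a\<in>A. f a) = (\<Sum>a\<in>A. dual_ext h (f a))"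
  by (induction A rule: infinite_finite_induct) (auto simp: dual_ext_add)

lemma lookup_linear_extension:
  "Poly_Mapping.lookup (linear_extension h q) y = dual_ext (\<lambda>x. Poly_Mapping.lookup (h x) y) q"
  by (simp add: linear_extension_def dual_ext_def lookup_sum)

lemma linear_extension_add: "linear_extension h (p + q) = linear_extension h p + linear_extension h q"
  by (rule poly_mapping_eqI) (simp add: lookup_linear_extension dual_ext_add lookup_add)

lemma linear_extension_cscale: "linear_extension h (cscale c p) = cscale c (linear_extension h p)"
  by (rule poly_mapping_eqI) (simp add: lookup_linear_extension dual_ext_cscale)

lemma linear_extension_zero [simp]: "linear_extension h 0 = 0"
  by (rule poly_mapping_eqI) (simp add: lookup_linear_extension)

lemma linear_extension_single [simp]: "linear_extension h (Poly_Mapping.single k c) = cscale c (h k)"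
  by (rule poly_mapping_eqI) (simp add: lookup_linear_extension)

lemma linear_extension_diff: "linear_extension h (p - q) = linear_extension h p - linear_extension h q"
  by (rule poly_mapping_eqI) (simp add: lookup_linear_extension dual_ext_diff lookup_minus)

lemma linear_extension_sum: "linear_extension h (\<Sum>a\<in>A. f a) = (\<Sum>a\<in>A. linear_extension h (f a))"
  by (induction A rule: infinite_finite_induct) (auto simp: linear_extension_add)

lemma free_space_induct [consumes 1, case_names zero add scale base]:
  assumes "Poly_Mapping.keys (p :: 'x \<Rightarrow>\<^sub>0 complex) \<subseteq> I"
    and "P 0" "\<And>p q. P p \<Longrightarrow> P q \<Longrightarrow> P (p + q)" "\<And>c p. P p \<Longrightarrow> P (cscale c p)"
    and "\<And>k. k \<in> I \<Longrightarrow> P (Poly_Mapping.single k 1)"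
  shows "P p"
proof -
  have "P (\<Sum>k\<in>K. cscale (Poly_Mapping.lookup p k) (Poly_Mapping.single k 1))" if "K \<subseteq> I" for K
    using that
  proof (induction K rule: infinite_finite_induct)
    case (insert k K)
    then show ?case by (simp add: assms(3-5))
  qed (simp_all add: assms(2))
  from this[OF assms(1)] show ?thesis unfolding single_sum[of p, symmetric] .
qed

lemma cscale_eq_mult: "cscale c p = Poly_Mapping.single 0 c * (p :: 'a::monoid_add \<Rightarrow>\<^sub>0 complex)"
  by (simp add: cscale_def mult_map_scale_conv_mult)

lemma cscale_mult_left: "cscale c p * q = cscale c (p * (q :: spoly))"
  by (simp add: cscale_eq_mult mult.assoc)

lemma cscale_mult_right: "p * cscale c q = cscale c (p * (q :: spoly))"
  by (simp add: cscale_eq_mult mult.left_commute)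

lemma cscale_add_right: "cscale c (p + q) = cscale c p + cscale c q"
  by (simp add: fsv.scale_right_distrib)

lemma cscale_diff_right: "cscale c (p - q) = cscale c p - cscale c q"
  by (simp add: fsv.scale_right_diff_distrib)

subsection \<open>Polynomials\<close>

text \<open>The exponents of a monomial as a multiset of variables, so that \<open>fold_mset\<close> can run
  through a monomial.\<close>

definition mset_of :: "('x \<Rightarrow>\<^sub>0 nat) \<Rightarrow> 'x multiset" where
  "mset_of \<mu> = Abs_multiset (Poly_Mapping.lookup \<mu>)"

lemma count_mset_of: "count (mset_of \<mu>) = Poly_Mapping.lookup \<mu>"
  unfolding mset_of_def by (rule count_Abs_multiset) simp

lemma mset_of_zero [simp]: "mset_of 0 = {#}"
  by (rule multiset_eqI) (simp add: count_mset_of)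

lemma mset_of_add_single: "mset_of (Poly_Mapping.single \<beta> 1 + \<mu>) = add_mset \<beta> (mset_of \<mu>)"
  by (rule multiset_eqI) (simp add: count_mset_of lookup_add lookup_single when_def)

lemma one_in_sym_alg [simp]: "1 \<in> sym_alg n"
  by (simp add: sym_alg_def)

lemma subspace_sym_alg: "fsv.subspace (sym_alg n)"
proof -
  have "sym_alg n = {p. Poly_Mapping.keys p \<subseteq> {\<mu>. Poly_Mapping.keys \<mu> \<subseteq> pos_roots n}}"
    by (auto simp: sym_alg_def)
  then show ?thesis by (simp add: subspace_supported)
qed

lemma sym_alg_mult:
  assumes "p \<in> sym_alg n" "q \<in> sym_alg n"
  shows "p * q \<in> sym_alg n"
  unfolding sym_alg_def
proof (intro CollectI ballI)
  fix \<mu> assume "\<mu> \<in> Poly_Mapping.keys (p * q)"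
  then obtain k l where kl: "\<mu> = k + l" "k \<in> Poly_Mapping.keys p" "l \<in> Poly_Mapping.keys q"
    using keys_mult[of p q] by auto
  then show "Poly_Mapping.keys \<mu> \<subseteq> pos_roots n"
    using keys_add[of k l] assms unfolding sym_alg_def by blast
qed

lemma sym_alg_power: "p \<in> sym_alg n \<Longrightarrow> p ^ k \<in> sym_alg n"
  by (induction k) (auto intro: sym_alg_mult)

lemma sym_alg_prod: "(\<And>x. x \<in> A \<Longrightarrow> f x \<in> sym_alg n) \<Longrightarrow> (\<Prod>x\<in>A. f x) \<in> sym_alg n"
  by (induction A rule: infinite_finite_induct) (auto intro: sym_alg_mult)

lemma fvar_in_sym_alg: "\<beta> \<in> pos_roots n \<Longrightarrow> fvar \<beta> \<in> sym_alg n"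
  by (simp add: sym_alg_def fvar_def)

lemma fvar_mult_monomial: "fvar \<beta> * Poly_Mapping.single \<mu> c = Poly_Mapping.single (Poly_Mapping.single \<beta> 1 + \<mu>) c"
  by (simp add: fvar_def mult_single)

lemma sym_alg_induct [consumes 1, case_names one add scale mult]:
  assumes "p \<in> sym_alg n"
    and one: "P 1" and add: "\<And>p q. P p \<Longrightarrow> P q \<Longrightarrow> P (p + q)" and scale: "\<And>c p. P p \<Longrightarrow> P (cscale c p)"
    and mult: "\<And>\<beta> p. \<beta> \<in> pos_roots n \<Longrightarrow> p \<in> sym_alg n \<Longrightarrow> P p \<Longrightarrow> P (fvar \<beta> * p)"
  shows "P p"
proof -
  have mono: "P (Poly_Mapping.single \<mu> 1)" if "Poly_Mapping.keys \<mu> \<subseteq> pos_roots n" for \<mu>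
    using that
  proof (induction "size (mset_of \<mu>)" arbitrary: \<mu> rule: less_induct)
    case less
    show ?case
    proof (cases "\<mu> = 0")
      case True
      then show ?thesis using one by (simp flip: single_one)
    next
      case False
      then obtain \<beta> where \<beta>: "\<beta> \<in> Poly_Mapping.keys \<mu>" by (metis all_not_in_conv keys_eq_empty)
      then have \<beta>': "0 < Poly_Mapping.lookup \<mu> \<beta>" by (simp add: in_keys_iff)
      define \<nu> where "\<nu> = \<mu> - Poly_Mapping.single \<beta> 1"
      have \<mu>: "\<mu> = Poly_Mapping.single \<beta> 1 + \<nu>"
        by (rule poly_mapping_eqI) (use \<beta>' in \<open>auto simp: \<nu>_def lookup_add lookup_minus lookup_single when_def\<close>)
      have k: "Poly_Mapping.keys \<nu> \<subseteq> pos_roots n"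
        using less.prems by (simp add: \<nu>_def lookup_minus in_keys_iff subset_iff)
      have "P (Poly_Mapping.single \<nu> 1)"
        by (rule less.hyps[OF _ k]) (subst \<mu>, simp add: mset_of_add_single del: One_nat_def)
      then have "P (fvar \<beta> * Poly_Mapping.single \<nu> 1)"
        using k \<beta> less.prems by (intro mult) (auto simp: sym_alg_def)
      then show ?thesis using \<mu> by (simp add: fvar_mult_monomial)
    qed
  qed
  have z: "P 0" using scale[OF one, of 0] by simp
  have "Poly_Mapping.keys p \<subseteq> {\<mu>. Poly_Mapping.keys \<mu> \<subseteq> pos_roots n}"
    using assms(1) by (auto simp: sym_alg_def)
  then show ?thesis
    by (rule free_space_induct) (auto intro: z add scale mono)
qed

text \<open>The entry at row \<open>b\<close>, column \<open>a - 1\<close> of the generic strictly lower triangular matrix.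
  Extending the variables by zero makes the formulas for the action of the Borel subalgebra
  uniform.\<close>

definition gvar :: "nat \<Rightarrow> nat \<Rightarrow> nat \<Rightarrow> spoly" where
  "gvar n a b = (if (a, b) \<in> pos_roots n then fvar (a, b) else 0)"

lemma gvar_in_sym_alg: "gvar n a b \<in> sym_alg n"
  using fsv.subspace_0[OF subspace_sym_alg] by (auto simp: gvar_def fvar_in_sym_alg)

subsection \<open>The action of the Borel subalgebra\<close>

lemma partial_deriv_add: "partial_deriv \<beta> (p + q) = partial_deriv \<beta> p + partial_deriv \<beta> q"
  by (simp add: partial_deriv_def linear_extension_add)

lemma partial_deriv_cscale: "partial_deriv \<beta> (cscale c p) = cscale c (partial_deriv \<beta> p)"
  by (simp add: partial_deriv_def linear_extension_cscale)

lemma circ_action_add: "circ_action n X (p + q) = circ_action n X p + circ_action n X q"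
  by (simp add: circ_action_def partial_deriv_add distrib_right sum.distrib)

lemma circ_action_cscale: "circ_action n X (cscale c p) = cscale c (circ_action n X p)"
  by (simp add: circ_action_def partial_deriv_cscale cscale_mult_left fsv.scale_sum_right)

lemma circ_action_zero [simp]: "circ_action n X 0 = 0"
  by (simp add: circ_action_def partial_deriv_def)

lemma partial_deriv_fvar: "partial_deriv \<gamma> (fvar \<beta>) = (if \<gamma> = \<beta> then 1 else 0)"
  by (auto simp: partial_deriv_def fvar_def lookup_single when_def cscale_eq_mult)

lemma partial_deriv_fvar_mult:
  "partial_deriv \<gamma> (fvar \<beta> * fvar \<delta>) = partial_deriv \<gamma> (fvar \<beta>) * fvar \<delta> + fvar \<beta> * partial_deriv \<gamma> (fvar \<delta>)"
proof -
  have 1: "partial_deriv \<gamma> (fvar \<beta> * fvar \<delta>) =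
      Poly_Mapping.single (Poly_Mapping.single \<beta> 1 + Poly_Mapping.single \<delta> 1 - Poly_Mapping.single \<gamma> 1)
        (of_nat ((if \<beta> = \<gamma> then 1 else 0) + (if \<delta> = \<gamma> then 1 else 0)))"
    by (simp add: partial_deriv_def fvar_def mult_single lookup_add lookup_single when_def)
  show ?thesis
    unfolding 1 partial_deriv_fvar
    by (auto simp: fvar_def single_add[symmetric])
qed

lemma circ_action_fvar_mult:
  "circ_action n X (fvar \<beta> * fvar \<delta>) = circ_action n X (fvar \<beta>) * fvar \<delta> + fvar \<beta> * circ_action n X (fvar \<delta>)"
  unfolding circ_action_def partial_deriv_fvar_mult
  by (simp add: sum_distrib_left sum_distrib_right distrib_left distrib_right sum.distrib mult_ac)

lemma circ_action_gvar_mult: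
  "circ_action n X (gvar n a b * gvar n a' b') = circ_action n X (gvar n a b) * gvar n a' b' + gvar n a b * circ_action n X (gvar n a' b')"
  by (simp add: gvar_def circ_action_fvar_mult)

lemma finite_pos_roots [simp]: "finite (pos_roots n)"
  by (rule finite_subset[of _ "{..n} \<times> {..n}"]) (auto simp: pos_roots_def)

lemma sum_pos_roots_gvar:
  "(\<Sum>\<beta>\<in>pos_roots n. cscale (h (fst \<beta>) (snd \<beta>)) (fvar \<beta>)) =
   (\<Sum>a\<in>{1..n-1}. \<Sum>b\<in>{1..n-1}. cscale (h a b) (gvar n a b))"
proof -
  have "(\<Sum>\<beta>\<in>pos_roots n. cscale (h (fst \<beta>) (snd \<beta>)) (fvar \<beta>)) =
     (\<Sum>\<beta>\<in>{1..n-1} \<times> {1..n-1}. cscale (h (fst \<beta>) (snd \<beta>)) (gvar n (fst \<beta>) (snd \<beta>)))"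
    by (rule sum.mono_neutral_cong_left) (auto simp: pos_roots_def gvar_def)
  also have "\<dots> = (\<Sum>a\<in>{1..n-1}. \<Sum>b\<in>{1..n-1}. cscale (h a b) (gvar n a b))"
    by (simp add: sum.cartesian_product case_prod_beta)
  finally show ?thesis .
qed

lemma circ_action_fvar:
  assumes "\<beta> \<in> pos_roots n"
  shows "circ_action n X (fvar \<beta>) = class_mod_b n (X * root_vector n \<beta> - root_vector n \<beta> * X)"
proof -
  have "circ_action n X (fvar \<beta>) = (\<Sum>\<gamma>\<in>pos_roots n. if \<gamma> = \<beta> then class_mod_b n (X * root_vector n \<gamma> - root_vector n \<gamma> * X) else 0)"
    unfolding circ_action_def partial_deriv_fvar by (rule sum.cong) auto
  then show ?thesis using assms by simp
qed

lemma sum_if_eq [simp]: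
  fixes f :: "'a \<Rightarrow> 'b::comm_semiring_1"
  assumes "finite A"
  shows "(\<Sum>k\<in>A. f k * (if k = a then 1 else 0)) = (if a \<in> A then f a else 0)"
    "(\<Sum>k\<in>A. f k * (if a = k then 1 else 0)) = (if a \<in> A then f a else 0)"
proof -
  have "(\<Sum>k\<in>A. f k * (if k = a then 1 else 0)) = (\<Sum>k\<in>A. if k = a then f k else 0)"
    "(\<Sum>k\<in>A. f k * (if a = k then 1 else 0)) = (\<Sum>k\<in>A. if k = a then f k else 0)"
    by (rule sum.cong; auto)+
  then show "(\<Sum>k\<in>A. f k * (if k = a then 1 else 0)) = (if a \<in> A then f a else 0)"
    "(\<Sum>k\<in>A. f k * (if a = k then 1 else 0)) = (if a \<in> A then f a else 0)"
    using assms by simp_all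
qed

lemma mult_root_vector_entry:
  assumes "X \<in> carrier_mat n n" "(a, b) \<in> pos_roots n" "r < n" "c < n"
  shows "(X * root_vector n (a, b)) $$ (r, c) = (if c = a - 1 then X $$ (r, b) else 0)"
    "(root_vector n (a, b) * X) $$ (r, c) = (if r = b then X $$ (a - 1, c) else 0)"
proof -
  have b: "b < n" "a - 1 < n" using assms(2) by (auto simp: pos_roots_def)
  have "(X * root_vector n (a, b)) $$ (r, c) = (\<Sum>k\<in>{0..<n}. X $$ (r, k) * (if k = b \<and> c = a - 1 then 1 else 0))"
    using assms by (simp add: root_vector_def scalar_prod_def)
  also have "\<dots> = (\<Sum>k\<in>{0..<n}. if k = b then (if c = a - 1 then X $$ (r, k) else 0) else 0)"
    by (rule sum.cong) auto
  finally show "(X * root_vector n (a, b)) $$ (r, c) = (if c = a - 1 then X $$ (r, b) else 0)" using b by simp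
  have "(root_vector n (a, b) * X) $$ (r, c) = (\<Sum>k\<in>{0..<n}. (if r = b \<and> k = a - 1 then 1 else 0) * X $$ (k, c))"
    using assms by (simp add: root_vector_def scalar_prod_def)
  also have "\<dots> = (\<Sum>k\<in>{0..<n}. if k = a - 1 then (if r = b then X $$ (k, c) else 0) else 0)"
    by (rule sum.cong) auto
  finally show "(root_vector n (a, b) * X) $$ (r, c) = (if r = b then X $$ (a - 1, c) else 0)" using b by simp
qed

lemma root_vector_carrier [simp]: "root_vector n \<beta> \<in> carrier_mat n n"
  by (simp add: root_vector_def)

lemma gvar_zero: "b < a \<Longrightarrow> gvar n a b = 0"
  by (simp add: gvar_def pos_roots_def)

text \<open>The commutator of \<open>X\<close> with a matrix unit, read modulo the upper triangular matrices. For
  \<open>b < a\<close> the left side is zero, and triangularity of \<open>X\<close> kills each term on the right.\<close>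

lemma circ_action_gvar:
  assumes X: "X \<in> carrier_mat n n" "upper_triangular X" and ab: "a \<in> {1..n-1}" "b \<in> {1..n-1}"
  shows "circ_action n X (gvar n a b) =
    (\<Sum>r\<in>{1..n-1}. cscale (X $$ (r, b)) (gvar n a r)) - (\<Sum>c\<in>{1..n-1}. cscale (X $$ (a - 1, c - 1)) (gvar n c b))"
proof (cases "a \<le> b")
  case True
  then have pos: "(a, b) \<in> pos_roots n" using ab by (auto simp: pos_roots_def)
  let ?E = "root_vector n (a, b)"
  have "circ_action n X (gvar n a b) = class_mod_b n (X * ?E - ?E * X)"
    using pos by (simp add: gvar_def circ_action_fvar)
  also have "\<dots> = (\<Sum>\<beta>\<in>pos_roots n. cscale ((if fst \<beta> = a then X $$ (snd \<beta>, b) else 0) - (if snd \<beta> = b then X $$ (a - 1, fst \<beta> - 1) else 0)) (fvar \<beta>))"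
    unfolding class_mod_b_def
  proof (rule sum.cong[OF refl])
    fix \<beta> assume "\<beta> \<in> pos_roots n"
    then have \<beta>: "snd \<beta> < n" "fst \<beta> - 1 < n" "fst \<beta> \<ge> 1" by (auto simp: pos_roots_def)
    have e: "(fst \<beta> - 1 = a - 1) = (fst \<beta> = a)" using \<beta>(3) ab by auto
    have "(X * ?E - ?E * X) $$ (snd \<beta>, fst \<beta> - 1) = (X * ?E) $$ (snd \<beta>, fst \<beta> - 1) - (?E * X) $$ (snd \<beta>, fst \<beta> - 1)"
      using \<beta> X by (simp add: root_vector_def)
    then show "cscale ((X * ?E - ?E * X) $$ (snd \<beta>, fst \<beta> - 1)) (fvar \<beta>) =
       cscale ((if fst \<beta> = a then X $$ (snd \<beta>, b) else 0) - (if snd \<beta> = b then X $$ (a - 1, fst \<beta> - 1) else 0)) (fvar \<beta>)"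
      using \<beta> by (simp only: mult_root_vector_entry[OF X(1) pos] e)
  qed
  also have "\<dots> = (\<Sum>c\<in>{1..n-1}. \<Sum>r\<in>{1..n-1}. cscale ((if c = a then X $$ (r, b) else 0) - (if r = b then X $$ (a - 1, c - 1) else 0)) (gvar n c r))"
    by (rule sum_pos_roots_gvar)
  also have "\<dots> = (\<Sum>c\<in>{1..n-1}. \<Sum>r\<in>{1..n-1}. if c = a then cscale (X $$ (r, b)) (gvar n c r) else 0)
     - (\<Sum>c\<in>{1..n-1}. \<Sum>r\<in>{1..n-1}. if r = b then cscale (X $$ (a - 1, c - 1)) (gvar n c r) else 0)"
    unfolding sum_subtractf[symmetric]
    by (intro sum.cong refl) (auto simp: fsv.scale_left_diff_distrib)
  also have "(\<Sum>c\<in>{1..n-1}. \<Sum>r\<in>{1..n-1}. if r = b then cscale (X $$ (a - 1, c - 1)) (gvar n c r) else 0) =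
     (\<Sum>c\<in>{1..n-1}. cscale (X $$ (a - 1, c - 1)) (gvar n c b))"
    using ab by simp
  also have "(\<Sum>c\<in>{1..n-1}. \<Sum>r\<in>{1..n-1}. if c = a then cscale (X $$ (r, b)) (gvar n c r) else 0) =
     (\<Sum>c\<in>{1..n-1}. if c = a then (\<Sum>r\<in>{1..n-1}. cscale (X $$ (r, b)) (gvar n c r)) else 0)"
    by (intro sum.cong refl) auto
  also have "\<dots> = (\<Sum>r\<in>{1..n-1}. cscale (X $$ (r, b)) (gvar n a r))"
    using ab by simp
  finally show ?thesis .
next
  case False
  have "(\<Sum>r\<in>{1..n-1}. cscale (X $$ (r, b)) (gvar n a r)) = 0"
  proof (rule sum.neutral, intro ballI)
    fix r assume r: "r \<in> {1..n-1}"
    show "cscale (X $$ (r, b)) (gvar n a r) = 0"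
    proof (cases "b < r")
      case True
      then have "X $$ (r, b) = 0" using X r by (intro upper_triangularD) auto
      then show ?thesis by simp
    qed (use False in \<open>simp add: gvar_zero\<close>)
  qed
  moreover have "(\<Sum>c\<in>{1..n-1}. cscale (X $$ (a - 1, c - 1)) (gvar n c b)) = 0"
  proof (rule sum.neutral, intro ballI)
    fix c assume c: "c \<in> {1..n-1}"
    show "cscale (X $$ (a - 1, c - 1)) (gvar n c b) = 0"
    proof (cases "c < a")
      case True
      then have "X $$ (a - 1, c - 1) = 0" using X c ab by (intro upper_triangularD) auto
      then show ?thesis by simp
    qed (use False in \<open>simp add: gvar_zero\<close>)
  qed
  ultimately show ?thesis using False by (simp add: gvar_zero)
qed

section \<open>Generators of the root ideal\<close>

lemma root_ge_iff: "i \<le> j \<Longrightarrow> root_ge (a, b) (i, j) \<longleftrightarrow> a \<le> i \<and> j \<le> b"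
proof -
  assume ij: "i \<le> j"
  have "a \<le> i \<and> j \<le> b" if g: "root_ge (a, b) (i, j)"
  proof -
    have "simple_coeff (a, b) i \<noteq> 0" "simple_coeff (a, b) j \<noteq> 0"
      using g[unfolded root_ge_def, rule_format, of i] g[unfolded root_ge_def, rule_format, of j] ij
      by (auto simp: simple_coeff_def)
    then show ?thesis by (cases "a \<le> i"; cases "j \<le> b") (auto simp: simple_coeff_def)
  qed
  moreover have "root_ge (a, b) (i, j)" if "a \<le> i \<and> j \<le> b"
    unfolding root_ge_def
  proof
    fix k show "simple_coeff (i, j) k \<le> simple_coeff (a, b) k"
      using that by (cases "i \<le> k \<and> k \<le> j") (auto simp: simple_coeff_def)
  qed
  ultimately show ?thesis by blast
qed

text \<open>On \<open>w\<^sub>1 \<and> \<dots> \<and> w\<^sub>i\<close> the two products have opposite values, because they put the same two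
  vectors into the same two places in opposite order.\<close>

definition permanent :: "nat \<Rightarrow> nat \<Rightarrow> nat \<Rightarrow> nat \<Rightarrow> nat \<Rightarrow> spoly" where
  "permanent n a b a' b' = gvar n a b * gvar n a' b' + gvar n a b' * gvar n a' b"

lemma permanent_commute_rows: "permanent n a b a' b' = permanent n a' b a b'"
  by (simp add: permanent_def algebra_simps)

lemma permanent_commute_columns: "permanent n a b a' b' = permanent n a b' a' b"
  by (simp add: permanent_def algebra_simps)

lemma cscale_2: "cscale 2 p = p + p"
  by (rule poly_mapping_eqI) (simp add: lookup_add)

lemma permanent_same_row: "permanent n a b a b' = cscale 2 (gvar n a b * gvar n a b')"
  by (simp add: permanent_def cscale_2 mult.commute)
 
lemma permanent_same_column: "permanent n a b a' b = cscale 2 (gvar n a b * gvar n a' b)"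
  by (simp add: permanent_def cscale_2 mult.commute)

definition explicit_gens :: "nat \<Rightarrow> nat \<times> nat \<Rightarrow> spoly set" where
  "explicit_gens n \<alpha> =
     {permanent n a b a' b' | a b a' b'. {a, b, a', b'} \<subseteq> {1..n-1}} \<union>
     {gvar n a b | a b. {a, b} \<subseteq> {1..n-1} \<and> \<not> (a \<le> fst \<alpha> \<and> snd \<alpha> \<le> b)}"

lemma circ_action_permanent:
  assumes X: "X \<in> carrier_mat n n" "upper_triangular X" and I: "{a, b, a', b'} \<subseteq> {1..n-1}"
  shows "circ_action n X (permanent n a b a' b') =
     (\<Sum>r\<in>{1..n-1}. cscale (X $$ (r, b)) (permanent n a r a' b')) +
     (\<Sum>r\<in>{1..n-1}. cscale (X $$ (r, b')) (permanent n a b a' r)) -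
     (\<Sum>c\<in>{1..n-1}. cscale (X $$ (a - 1, c - 1)) (permanent n c b a' b')) -
     (\<Sum>c\<in>{1..n-1}. cscale (X $$ (a' - 1, c - 1)) (permanent n a b c b'))"
proof -
  define R where "R a b = (\<Sum>r\<in>{1..n-1}. cscale (X $$ (r, b)) (gvar n a r))" for a b
  define C where "C a b = (\<Sum>c\<in>{1..n-1}. cscale (X $$ (a - 1, c - 1)) (gvar n c b))" for a b
  have circ: "circ_action n X (gvar n a b) = R a b - C a b" if "{a, b} \<subseteq> {1..n-1}" for a b
    unfolding R_def C_def by (rule circ_action_gvar[OF X]) (use that in auto)
  have "circ_action n X (permanent n a b a' b') =
     (R a b - C a b) * gvar n a' b' + gvar n a b * (R a' b' - C a' b') +
     ((R a b' - C a b') * gvar n a' b + gvar n a b' * (R a' b - C a' b))"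
    using I by (simp add: permanent_def circ_action_add circ_action_gvar_mult circ)
  moreover have "(\<Sum>r\<in>{1..n-1}. cscale (X $$ (r, b)) (permanent n a r a' b')) = R a b * gvar n a' b' + gvar n a b' * R a' b"
    by (simp add: permanent_def cscale_add_right sum.distrib R_def sum_distrib_left sum_distrib_right cscale_mult_left cscale_mult_right)
  moreover have "(\<Sum>r\<in>{1..n-1}. cscale (X $$ (r, b')) (permanent n a b a' r)) = gvar n a b * R a' b' + R a b' * gvar n a' b"
    by (simp add: permanent_def cscale_add_right sum.distrib R_def sum_distrib_left sum_distrib_right cscale_mult_left cscale_mult_right)
  moreover have "(\<Sum>c\<in>{1..n-1}. cscale (X $$ (a - 1, c - 1)) (permanent n c b a' b')) = C a b * gvar n a' b' + C a b' * gvar n a' b"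
    by (simp add: permanent_def cscale_add_right sum.distrib C_def sum_distrib_left sum_distrib_right cscale_mult_left cscale_mult_right)
  moreover have "(\<Sum>c\<in>{1..n-1}. cscale (X $$ (a' - 1, c - 1)) (permanent n a b c b')) = gvar n a b * C a' b' + gvar n a b' * C a' b"
    by (simp add: permanent_def cscale_add_right sum.distrib C_def sum_distrib_left sum_distrib_right cscale_mult_left cscale_mult_right)
  ultimately show ?thesis by (simp add: algebra_simps)
qed

definition elem_mat :: "nat \<Rightarrow> nat \<Rightarrow> nat \<Rightarrow> complex mat" where
  "elem_mat n p q = mat n n (\<lambda>(r, c). if r = p \<and> c = q then 1 else 0)"

lemma elem_mat_borel: "p < q \<Longrightarrow> elem_mat n p q \<in> borel_algebra n"
  by (auto simp: borel_algebra_def elem_mat_def intro!: sum.neutral)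

lemma borel_algebraD: "X \<in> borel_algebra n \<Longrightarrow> X \<in> carrier_mat n n" "X \<in> borel_algebra n \<Longrightarrow> upper_triangular X"
  by (auto simp: borel_algebra_def)

lemma circ_action_elem_mat:
  assumes "p < q" "q < n" "a \<in> {1..n-1}" "b \<in> {1..n-1}" "1 \<le> p \<or> b \<noteq> q"
  shows "circ_action n (elem_mat n p q) (gvar n a b) =
    (if b = q then gvar n a p else 0) - (if a = Suc p then gvar n (Suc q) b else 0)"
proof -
  have "circ_action n (elem_mat n p q) (gvar n a b) =
    (\<Sum>r\<in>{1..n-1}. cscale (elem_mat n p q $$ (r, b)) (gvar n a r)) - (\<Sum>c\<in>{1..n-1}. cscale (elem_mat n p q $$ (a - 1, c - 1)) (gvar n c b))"
    using borel_algebraD[OF elem_mat_borel[OF assms(1)]] assms by (intro circ_action_gvar) auto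
  also have "(\<Sum>r\<in>{1..n-1}. cscale (elem_mat n p q $$ (r, b)) (gvar n a r)) = (\<Sum>r\<in>{1..n-1}. if r = p then (if b = q then gvar n a r else 0) else 0)"
    using assms by (intro sum.cong) (auto simp: elem_mat_def)
  also have "\<dots> = (if b = q then gvar n a p else 0)"
    using assms by auto
  also have "(\<Sum>c\<in>{1..n-1}. cscale (elem_mat n p q $$ (a - 1, c - 1)) (gvar n c b)) = (\<Sum>c\<in>{1..n-1}. if c = Suc q then (if a = Suc p then gvar n c b else 0) else 0)"
    using assms by (intro sum.cong) (auto simp: elem_mat_def)
  also have "\<dots> = (if a = Suc p then gvar n (Suc q) b else 0)"
    using assms by (auto simp: gvar_def pos_roots_def)
  finally show ?thesis .
qed

locale positive_root =
  fixes n i j :: nat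
  assumes ij: "1 \<le> i" "i \<le> j" "j \<le> n - 1"
begin

abbreviation "J \<equiv> root_ideal n (i, j)"
abbreviation "G \<equiv> ideal_gens n (i, j)"

lemma ge_iff: "root_ge (a, b) (i, j) \<longleftrightarrow> a \<le> i \<and> j \<le> b"
  using root_ge_iff ij by simp

lemma G_subspace: "fsv.subspace G"
  unfolding ideal_gens_def by (rule hull_induct) (auto simp: fsv.subspace_def hull_def)

lemma G_circ: "X \<in> borel_algebra n \<Longrightarrow> u \<in> G \<Longrightarrow> circ_action n X u \<in> G"
  unfolding ideal_gens_def hull_def by auto

lemma G_square: "\<beta> \<in> pos_roots n \<Longrightarrow> root_ge \<beta> (i, j) \<Longrightarrow> fvar \<beta> ^ 2 \<in> G"
  unfolding ideal_gens_def by (rule hull_inc) blast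

lemma G_var: "\<beta> \<in> pos_roots n \<Longrightarrow> \<not> root_ge \<beta> (i, j) \<Longrightarrow> fvar \<beta> \<in> G"
  unfolding ideal_gens_def by (rule hull_inc) blast

lemma G_scaleD: "cscale c u \<in> G \<Longrightarrow> c \<noteq> 0 \<Longrightarrow> u \<in> G"
  using fsv.subspace_scale[OF G_subspace, of "cscale c u" "1 / c"] by simp

text \<open>Permanents are bilinear in the rows and in the columns of the generic matrix, on which \<open>X\<close>
  acts by linear substitutions. As \<open>X\<close> is triangular, it lowers \<open>b\<close> and raises \<open>a\<close>, so a
  variable outside the quadrant \<open>a \<le> i\<close>, \<open>j \<le> b\<close> stays outside.\<close>

lemma explicit_gens_circ:
  assumes X: "X \<in> borel_algebra n" and u: "u \<in> fsv.span (explicit_gens n (i, j))"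
  shows "circ_action n X u \<in> fsv.span (explicit_gens n (i, j))"
proof -
  note X' = borel_algebraD[OF X]
  have P: "permanent n a b a' b' \<in> fsv.span (explicit_gens n (i, j))" if "{a, b, a', b'} \<subseteq> {1..n-1}" for a b a' b'
    using that unfolding explicit_gens_def fst_conv snd_conv by (intro fsv.span_base) blast
  have V: "gvar n a b \<in> fsv.span (explicit_gens n (i, j))" if "{a, b} \<subseteq> {1..n-1}" "\<not> (a \<le> i \<and> j \<le> b)" for a b
    using that unfolding explicit_gens_def fst_conv snd_conv by (intro fsv.span_base) blast
  have gen: "circ_action n X g \<in> fsv.span (explicit_gens n (i, j))" if g: "g \<in> explicit_gens n (i, j)" for g
  proof -
    consider (perm) a b a' b' where "{a, b, a', b'} \<subseteq> {1..n-1}" "g = permanent n a b a' b'"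
      | (var) a b where "{a, b} \<subseteq> {1..n-1}" "\<not> (a \<le> i \<and> j \<le> b)" "g = gvar n a b"
      using g unfolding explicit_gens_def fst_conv snd_conv by blast
    then show ?thesis
    proof cases
      case perm
      show ?thesis unfolding perm(2) circ_action_permanent[OF X' perm(1)]
        by (intro fsv.span_add fsv.span_diff fsv.span_sum fsv.span_scale P) (use perm(1) in auto)
    next
      case var
      have 1: "cscale (X $$ (r, b)) (gvar n a r) \<in> fsv.span (explicit_gens n (i, j))" if "r \<in> {1..n-1}" for r
      proof (cases "r \<le> b")
        case True
        then show ?thesis using var that by (intro fsv.span_scale V) auto
      next
        case False
        then have "X $$ (r, b) = 0" using X' that by (intro upper_triangularD) auto
        then show ?thesis by (simp add: fsv.span_zero)
      qed
      have 2: "cscale (X $$ (a - 1, c - 1)) (gvar n c b) \<in> fsv.span (explicit_gens n (i, j))" if "c \<in> {1..n-1}" for c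
      proof (cases "a \<le> c")
        case True
        then show ?thesis using var that by (intro fsv.span_scale V) auto
      next
        case False
        then have "X $$ (a - 1, c - 1) = 0" using X' that var(1) by (intro upper_triangularD) auto
        then show ?thesis by (simp add: fsv.span_zero)
      qed
      have ab: "a \<in> {1..n-1}" "b \<in> {1..n-1}" using var(1) by auto
      show ?thesis unfolding var(3) circ_action_gvar[OF X' ab]
        by (intro fsv.span_diff fsv.span_sum 1 2)
    qed
  qed
  show ?thesis using u
  proof (induction rule: fsv.span_induct_alt)
    case base
    then show ?case by (simp add: fsv.span_zero)
  next
    case (step c x y)
    then show ?case by (simp add: circ_action_add circ_action_cscale fsv.span_add fsv.span_scale gen)
  qed
qed

lemma G_subset: "G \<subseteq> fsv.span (explicit_gens n (i, j))"
  unfolding ideal_gens_def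
proof (rule hull_minimal)
  show "fsv.subspace (fsv.span (explicit_gens n (i, j))) \<and>
      (\<forall>X\<in>borel_algebra n. \<forall>u\<in>fsv.span (explicit_gens n (i, j)). circ_action n X u \<in> fsv.span (explicit_gens n (i, j)))"
    using explicit_gens_circ by (simp add: fsv.subspace_span)
  have 1: "fvar \<beta> ^ 2 \<in> fsv.span (explicit_gens n (i, j))" if "\<beta> \<in> pos_roots n" for \<beta>
  proof -
    obtain a b where \<beta>: "\<beta> = (a, b)" by (cases \<beta>)
    then have ab: "\<beta> = (a, b)" "{a, b} \<subseteq> {1..n-1}" using that by (auto simp: pos_roots_def)
    have "permanent n a b a b = cscale 2 (fvar \<beta> ^ 2)"
      using that ab by (simp add: permanent_same_row gvar_def power2_eq_square)
    moreover have "cscale (1/2) (permanent n a b a b) \<in> fsv.span (explicit_gens n (i, j))"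
      using ab by (intro fsv.span_scale fsv.span_base) (unfold explicit_gens_def, blast)
    ultimately show ?thesis by simp
  qed
  have 2: "fvar \<beta> \<in> fsv.span (explicit_gens n (i, j))" if "\<beta> \<in> pos_roots n" "\<not> root_ge \<beta> (i, j)" for \<beta>
  proof -
    obtain a b where \<beta>: "\<beta> = (a, b)" by (cases \<beta>)
    then have ab: "\<beta> = (a, b)" "{a, b} \<subseteq> {1..n-1}" using that by (auto simp: pos_roots_def)
    have "fvar \<beta> = gvar n a b" using that ab by (simp add: gvar_def)
    moreover have "\<not> (a \<le> i \<and> j \<le> b)" using that(2) ab(1) by (simp add: ge_iff)
    ultimately show ?thesis using ab(2) unfolding explicit_gens_def fst_conv snd_conv by (intro fsv.span_base) blast
  qed
  show "{fvar \<beta> ^ 2 |\<beta>. \<beta> \<in> pos_roots n \<and> root_ge \<beta> (i, j)} \<union> {fvar \<beta> |\<beta>. \<beta> \<in> pos_roots n \<and> \<not> root_ge \<beta> (i, j)}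
    \<subseteq> fsv.span (explicit_gens n (i, j))"
    using 1 2 by auto
qed

lemma J_subspace: "fsv.subspace J"
  unfolding root_ideal_def by (rule fsv.subspace_span)

lemmas J_add = fsv.subspace_add[OF J_subspace] and J_diff = fsv.subspace_diff[OF J_subspace]
  and J_scale = fsv.subspace_scale[OF J_subspace] and J_zero = fsv.subspace_0[OF J_subspace]
  and J_sum = fsv.subspace_sum[OF J_subspace]

lemma J_mult: "p \<in> sym_alg n \<Longrightarrow> q \<in> J \<Longrightarrow> p * q \<in> J"
proof -
  assume p: "p \<in> sym_alg n" and q: "q \<in> J"
  show "p * q \<in> J"
    using q unfolding root_ideal_def
  proof (induction rule: fsv.span_induct_alt)
    case base
    then show ?case by (simp add: fsv.span_zero)
  next
    case (step c x y)
    then obtain p' g where x: "x = p' * g" "p' \<in> sym_alg n" "g \<in> G" by auto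
    have "p * x \<in> fsv.span {p * g | p g. p \<in> sym_alg n \<and> g \<in> G}"
      using x sym_alg_mult[OF p x(2)] by (intro fsv.span_base) (auto simp: mult.assoc[symmetric])
    then show ?case using step by (simp add: distrib_left cscale_mult_right fsv.span_add fsv.span_scale)
  qed
qed

lemma J_mult': "p \<in> sym_alg n \<Longrightarrow> q \<in> J \<Longrightarrow> q * p \<in> J"
  using J_mult[of p q] by (simp add: mult.commute)

lemma G_subset_J: "G \<subseteq> J"
proof
  fix g assume "g \<in> G"
  then have "1 * g \<in> J" unfolding root_ideal_def by (intro fsv.span_base) (use one_in_sym_alg in blast)
  then show "g \<in> J" by simp
qed

lemma fvar_square_in_J:
  assumes "\<beta> \<in> pos_roots n"
  shows "fvar \<beta> * fvar \<beta> \<in> J"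
proof (cases "root_ge \<beta> (i, j)")
  case True
  then show ?thesis using G_square[OF assms] G_subset_J by (auto simp: power2_eq_square)
next
  case False
  then show ?thesis using G_var[OF assms] G_subset_J J_mult[OF fvar_in_sym_alg[OF assms]] by auto
qed

lemma gvar_in_J: "\<not> (a \<le> i \<and> j \<le> b) \<Longrightarrow> gvar n a b \<in> J"
  using G_subset_J G_var[of "(a, b)"] J_zero by (auto simp: gvar_def ge_iff)

text \<open>All these products arise from the square of one variable by moving one index at a time
  with an elementary matrix of the Borel subalgebra.\<close>

lemma products_in_G:
  assumes "1 \<le> a" "a \<le> i" "j \<le> b" "b \<le> n - 1"
  shows same_root_in_G: "gvar n a b * gvar n a b \<in> G"
    and same_row_in_G: "b < b' \<Longrightarrow> b' \<le> n - 1 \<Longrightarrow> gvar n a b * gvar n a b' \<in> G"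
    and same_column_in_G: "a < a' \<Longrightarrow> a' \<le> i \<Longrightarrow> gvar n a b * gvar n a' b \<in> G"
    and permanent_in_G: "a < a' \<Longrightarrow> a' \<le> i \<Longrightarrow> b < b' \<Longrightarrow> b' \<le> n - 1 \<Longrightarrow> permanent n a b a' b' \<in> G"
proof -
  have sq: "gvar n a b * gvar n a b \<in> G" if "j \<le> b" "b \<le> n - 1" for b
    using G_square[of "(a, b)"] that assms ij by (auto simp: gvar_def ge_iff pos_roots_def power2_eq_square)
  then show "gvar n a b * gvar n a b \<in> G" using assms by simp
  show row: "gvar n a b * gvar n a b' \<in> G" if b': "b < b'" "b' \<le> n - 1"
  proof -
    let ?X = "elem_mat n b b'"
    have "circ_action n ?X (gvar n a b') = gvar n a b"
      using assms b' ij by (subst circ_action_elem_mat) auto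
    then have "circ_action n ?X (gvar n a b' * gvar n a b') = cscale 2 (gvar n a b * gvar n a b')"
      by (simp add: circ_action_gvar_mult cscale_2 mult.commute)
    then show ?thesis
      using G_circ[OF elem_mat_borel[OF b'(1)] sq[of b']] assms b' G_scaleD[of 2] by simp
  qed
  have Y: "circ_action n (elem_mat n (a - 1) (a' - 1)) (gvar n a x) = - gvar n a' x"
    if "a < a'" "a' \<le> i" "j \<le> x" "x \<le> n - 1" for a' x
    using assms that ij by (subst circ_action_elem_mat) auto
  show "gvar n a b * gvar n a' b \<in> G" if a': "a < a'" "a' \<le> i"
  proof -
    have "circ_action n (elem_mat n (a - 1) (a' - 1)) (gvar n a b * gvar n a b) = cscale (- 2) (gvar n a b * gvar n a' b)"
      unfolding circ_action_gvar_mult Y[OF a' assms(3,4)] by (simp add: cscale_2 mult.commute)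
    moreover have "a - 1 < a' - 1" using a' assms by simp
    ultimately show ?thesis
      using G_circ[OF elem_mat_borel sq[of b], of "a - 1" "a' - 1"] assms G_scaleD[of "- 2" "gvar n a b * gvar n a' b"] by simp
  qed
  show "permanent n a b a' b' \<in> G" if a': "a < a'" "a' \<le> i" and b': "b < b'" "b' \<le> n - 1"
  proof -
    have "circ_action n (elem_mat n (a - 1) (a' - 1)) (gvar n a b * gvar n a b') = cscale (- 1) (permanent n a b a' b')"
      using assms b' unfolding circ_action_gvar_mult Y[OF a' assms(3,4)] by (subst Y[OF a']) (auto simp: permanent_def algebra_simps)
    moreover have "a - 1 < a' - 1" using a' assms by simp
    ultimately show ?thesis
      using G_circ[OF elem_mat_borel row[OF b'], of "a - 1" "a' - 1"] G_scaleD[of "- 1" "permanent n a b a' b'"] by simp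
  qed
qed

text \<open>After sorting the indices, either all four variables belong to roots \<open>\<ge> \<alpha>\<close>, or both
  products contain a variable of the ideal.\<close>

lemma permanent_in_J: "{a, b, a', b'} \<subseteq> {1..n-1} \<Longrightarrow> permanent n a b a' b' \<in> J"
proof -
  assume I: "{a, b, a', b'} \<subseteq> {1..n-1}"
  have *: "permanent n a b a' b' \<in> J" if I: "{a, b, a', b'} \<subseteq> {1..n-1}" and le: "a \<le> a'" "b \<le> b'" for a b a' b'
  proof (cases "a' \<le> i \<and> j \<le> b")
    case True
    then have h: "1 \<le> a" "a \<le> i" "j \<le> b" "b \<le> n - 1" "a' \<le> i" "b' \<le> n - 1" using I le by auto
    have "permanent n a b a' b' \<in> G"
    proof (cases "a = a'"; cases "b = b'")
      assume "a = a'" "b = b'"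
      then show ?thesis using same_root_in_G[OF h(1-4)] fsv.subspace_scale[OF G_subspace] by (simp add: permanent_same_row)
    next
      assume "a = a'" "b \<noteq> b'"
      then show ?thesis using same_row_in_G[OF h(1-4), of b'] le h fsv.subspace_scale[OF G_subspace] by (simp add: permanent_same_row)
    next
      assume "a \<noteq> a'" "b = b'"
      then show ?thesis using same_column_in_G[OF h(1-4), of a'] le h fsv.subspace_scale[OF G_subspace] by (simp add: permanent_same_column)
    next
      assume "a \<noteq> a'" "b \<noteq> b'"
      then show ?thesis using permanent_in_G[OF h(1-4), of a' b'] le h by simp
    qed
    then show ?thesis using G_subset_J by blast
  next
    case False
    then consider "gvar n a b \<in> J" "gvar n a b' \<in> J" | "gvar n a' b' \<in> J" "gvar n a' b \<in> J"
        | "gvar n a b \<in> J" "gvar n a' b \<in> J" | "gvar n a' b' \<in> J" "gvar n a b' \<in> J"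
      using gvar_in_J by blast
    then show ?thesis
      unfolding permanent_def
      by cases (auto intro!: J_add intro: J_mult J_mult' gvar_in_sym_alg)
  qed
  show ?thesis
  proof (cases "a \<le> a'"; cases "b \<le> b'")
    assume "a \<le> a'" "b \<le> b'"
    then show ?thesis using * I by blast
  next
    assume "a \<le> a'" "\<not> b \<le> b'"
    then show ?thesis using *[of a b' a' b] I by (subst permanent_commute_columns) auto
  next
    assume "\<not> a \<le> a'" "b \<le> b'"
    then show ?thesis using *[of a' b a b'] I by (subst permanent_commute_rows) auto
  next
    assume "\<not> a \<le> a'" "\<not> b \<le> b'"
    then show ?thesis using *[of a' b' a b] I by (subst permanent_commute_rows, subst permanent_commute_columns) auto
  qed
qed

lemma explicit_gens_subset_J: "explicit_gens n (i, j) \<subseteq> J"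
  using permanent_in_J gvar_in_J by (auto simp: explicit_gens_def)

lemma explicit_gens_sym_alg: "explicit_gens n (i, j) \<subseteq> sym_alg n"
  by (auto simp: explicit_gens_def permanent_def gvar_in_sym_alg sym_alg_mult
      intro!: fsv.subspace_add[OF subspace_sym_alg])

text \<open>The hull in the definition of the root ideal is traded for an explicit list of generators.
  This makes it possible to check that linear forms and automorphisms respect the ideal.\<close>

lemma J_explicit: "J = fsv.span {p * g | p g. p \<in> sym_alg n \<and> g \<in> explicit_gens n (i, j)}" (is "_ = fsv.span ?E")
proof
  have "p * g \<in> fsv.span ?E" if p: "p \<in> sym_alg n" and g: "g \<in> fsv.span (explicit_gens n (i, j))" for p g
    using g
  proof (induction rule: fsv.span_induct_alt)
    case base
    then show ?case by (simp add: fsv.span_zero)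
  next
    case (step c x y)
    have "p * x \<in> fsv.span ?E" using p step(1) by (intro fsv.span_base) auto
    then show ?case using step by (simp add: distrib_left cscale_mult_right fsv.span_add fsv.span_scale)
  qed
  then show "J \<subseteq> fsv.span ?E"
    unfolding root_ideal_def using G_subset by (intro fsv.span_minimal) (auto simp: fsv.subspace_span)
  show "fsv.span ?E \<subseteq> J"
    by (rule fsv.span_minimal[OF _ J_subspace]) (use explicit_gens_subset_J J_mult in auto)
qed

lemma J_subset: "J \<subseteq> sym_alg n"
  unfolding J_explicit
  by (rule fsv.span_minimal[OF _ subspace_sym_alg]) (use explicit_gens_sym_alg sym_alg_mult in auto)

end

section \<open>Pluecker functionals on polynomials\<close>

text \<open>The effect of \<open>f\<^sub>\<beta>\<close>, \<open>\<beta> = (a, b)\<close>, on the Pluecker coordinates \<open>\<omega>\<close> of a vector of the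
  exterior power, namely the transpose of \<open>w\<^sub>a \<mapsto> w\<^bsub>b+1\<^esub>\<close> on column tuples. The condition is
  \<open>\<beta> \<ge> \<alpha>\<close>.\<close>

definition lower :: "nat \<times> nat \<Rightarrow> nat \<times> nat \<Rightarrow> ((nat \<Rightarrow> nat) \<Rightarrow> complex) \<Rightarrow> (nat \<Rightarrow> nat) \<Rightarrow> complex" where
  "lower \<alpha> \<beta> \<omega> t = (if fst \<beta> \<le> fst \<alpha> \<and> snd \<alpha> \<le> snd \<beta>
     then \<Sum>s<fst \<alpha>. if t s = Suc (snd \<beta>) then \<omega> (t(s := fst \<beta>)) else 0 else 0)"

text \<open>The columns \<open>\<le> i\<close> that one operator inserts are never among the columns \<open>> j\<close> that the
  other one looks for. So the composition replaces columns at two different places, which is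
  symmetric in \<open>\<beta>\<close> and \<open>\<gamma>\<close>.\<close>

lemma lower_commute_aux:
  assumes \<alpha>: "fst \<alpha> \<le> snd \<alpha>"
    and ge: "fst \<beta> \<le> fst \<alpha>" "snd \<alpha> \<le> snd \<beta>" "fst \<gamma> \<le> fst \<alpha>" "snd \<alpha> \<le> snd \<gamma>"
  shows "lower \<alpha> \<beta> (lower \<alpha> \<gamma> \<omega>) t = (\<Sum>s<fst \<alpha>. \<Sum>s'<fst \<alpha>.
     if t s = Suc (snd \<beta>) \<and> t s' = Suc (snd \<gamma>) \<and> s \<noteq> s' then \<omega> (t(s := fst \<beta>, s' := fst \<gamma>)) else 0)"
proof -
  have "lower \<alpha> \<beta> (lower \<alpha> \<gamma> \<omega>) t = (\<Sum>s<fst \<alpha>. if t s = Suc (snd \<beta>) then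
     (\<Sum>s'<fst \<alpha>. if (t(s := fst \<beta>)) s' = Suc (snd \<gamma>) then \<omega> (t(s := fst \<beta>, s' := fst \<gamma>)) else 0) else 0)"
    using ge by (simp add: lower_def del: fun_upd_apply cong: if_cong)
  also have "\<dots> = (\<Sum>s<fst \<alpha>. \<Sum>s'<fst \<alpha>.
     if t s = Suc (snd \<beta>) \<and> t s' = Suc (snd \<gamma>) \<and> s \<noteq> s' then \<omega> (t(s := fst \<beta>, s' := fst \<gamma>)) else 0)"
  proof (rule sum.cong[OF refl])
    fix s
    have ne: "fst \<beta> \<noteq> Suc (snd \<gamma>)" using \<alpha> ge by linarith
    show "(if t s = Suc (snd \<beta>) then
     (\<Sum>s'<fst \<alpha>. if (t(s := fst \<beta>)) s' = Suc (snd \<gamma>) then \<omega> (t(s := fst \<beta>, s' := fst \<gamma>)) else 0) else 0) =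
     (\<Sum>s'<fst \<alpha>. if t s = Suc (snd \<beta>) \<and> t s' = Suc (snd \<gamma>) \<and> s \<noteq> s' then \<omega> (t(s := fst \<beta>, s' := fst \<gamma>)) else 0)"
    proof (cases "t s = Suc (snd \<beta>)")
      case True
      have "(\<Sum>s'<fst \<alpha>. if (t(s := fst \<beta>)) s' = Suc (snd \<gamma>) then \<omega> (t(s := fst \<beta>, s' := fst \<gamma>)) else 0) =
        (\<Sum>s'<fst \<alpha>. if t s = Suc (snd \<beta>) \<and> t s' = Suc (snd \<gamma>) \<and> s \<noteq> s' then \<omega> (t(s := fst \<beta>, s' := fst \<gamma>)) else 0)"
        by (rule sum.cong[OF refl]) (use True ne in \<open>simp add: fun_upd_def\<close>)
      then show ?thesis using True by simp
    qed simp
  qed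
  finally show ?thesis .
qed

lemma lower_zero: "lower \<alpha> \<beta> (\<lambda>_. 0) = (\<lambda>_. 0)"
  by (auto simp: lower_def fun_eq_iff intro!: sum.neutral)

lemma lower_trivial: "\<not> (fst \<beta> \<le> fst \<alpha> \<and> snd \<alpha> \<le> snd \<beta>) \<Longrightarrow> lower \<alpha> \<beta> \<omega> = (\<lambda>_. 0)"
  by (auto simp: lower_def fun_eq_iff)

lemma lower_commute:
  assumes "fst \<alpha> \<le> snd \<alpha>"
  shows "lower \<alpha> \<beta> (lower \<alpha> \<gamma> \<omega>) = lower \<alpha> \<gamma> (lower \<alpha> \<beta> \<omega>)"
proof (cases "(fst \<beta> \<le> fst \<alpha> \<and> snd \<alpha> \<le> snd \<beta>) \<and> (fst \<gamma> \<le> fst \<alpha> \<and> snd \<alpha> \<le> snd \<gamma>)")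
  case True
  show ?thesis
  proof
    fix t
    show "lower \<alpha> \<beta> (lower \<alpha> \<gamma> \<omega>) t = lower \<alpha> \<gamma> (lower \<alpha> \<beta> \<omega>) t"
      using True assms
      by (simp add: lower_commute_aux del: fun_upd_apply, subst sum.swap)
        (auto intro!: sum.cong simp: fun_upd_twist simp del: fun_upd_apply)
  qed
next
  case False
  then consider "\<not> (fst \<beta> \<le> fst \<alpha> \<and> snd \<alpha> \<le> snd \<beta>)" | "\<not> (fst \<gamma> \<le> fst \<alpha> \<and> snd \<alpha> \<le> snd \<gamma>)" by blast
  then show ?thesis
    by cases (simp_all add: lower_trivial lower_zero)
qed

text \<open>The Pluecker coordinate at the columns \<open>t\<close> of \<open>p \<cdot> (w\<^sub>1 \<and> \<dots> \<and> w\<^sub>i)\<close>: the operators of the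
  variables of a monomial commute and are applied to the coordinates of \<open>w\<^sub>1 \<and> \<dots> \<and> w\<^sub>i\<close>.\<close>

definition pluecker_functional :: "nat \<times> nat \<Rightarrow> (nat \<Rightarrow> nat) \<Rightarrow> spoly \<Rightarrow> complex" where
  "pluecker_functional \<alpha> t =
     dual_ext (\<lambda>\<mu>. fold_mset (lower \<alpha>) (minor (fst \<alpha>) (\<lambda>a. wvec (Suc a))) (mset_of \<mu>) t)"

lemma lookup_wvec: "Poly_Mapping.lookup (wvec a) b = (if a = b then 1 else 0)"
  by (simp add: wvec_def lookup_single when_def)

lemma lower_minor:
  assumes "a \<le> i" "j \<le> b"
  shows "lower (i, j) (a, b) (minor i u) t =
    (\<Sum>r<i. minor i (u(r := cscale (Poly_Mapping.lookup (u r) a) (wvec (Suc b)))) t)"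
  using assms by (simp add: lower_def minor_column_derivation del: fun_upd_apply)

lemma lower_minor_none:
  assumes "a \<le> i" "j \<le> b" "\<And>r. r < i \<Longrightarrow> Poly_Mapping.lookup (u r) a = 0"
  shows "lower (i, j) (a, b) (minor i u) t = 0"
  unfolding lower_minor[OF assms(1,2)] by (rule sum.neutral) (simp add: assms(3) minor_row_zero del: fun_upd_apply)

lemma lower_minor_unique:
  assumes "a \<le> i" "j \<le> b" "k < i" "\<And>r. r < i \<Longrightarrow> Poly_Mapping.lookup (u r) a = (if r = k then 1 else 0)"
  shows "lower (i, j) (a, b) (minor i u) t = minor i (u(k := wvec (Suc b))) t"
proof -
  have "lower (i, j) (a, b) (minor i u) t = (\<Sum>r<i. if r = k then minor i (u(r := wvec (Suc b))) t else 0)"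
    unfolding lower_minor[OF assms(1,2)]
    by (rule sum.cong[OF refl]) (simp add: assms(4) minor_row_zero del: fun_upd_apply)
  then show ?thesis using assms(3) by simp
qed

lemma minor_row_swap:
  assumes "r < i" "s < i" "r \<noteq> s"
  shows "minor i (u(r := v, s := w)) t = - minor i (u(r := w, s := v)) t"
proof -
  define M where "M x y = minor i (u(r := x, s := y)) t" for x y
  have same: "M x x = 0" for x
    unfolding M_def minor_def by (rule det_identical_rows[of _ i r s]) (use assms in \<open>auto intro!: eq_vecI\<close>)
  have add2: "M x (y + z) = M x y + M x z" for x y z
    unfolding M_def by (rule minor_row_add[OF assms(2)])
  have add1: "M (y + z) x = M y x + M z x" for x y z
    unfolding M_def fun_upd_twist[OF assms(3)] by (rule minor_row_add[OF assms(1)])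
  have "0 = M (v + w) (v + w)" by (simp add: same)
  also have "\<dots> = M v w + M w v" unfolding add1 add2 by (simp add: same)
  finally show ?thesis by (simp add: M_def eq_neg_iff_add_eq_0)
qed

lemma basis_minor_same: "inj_on x {..<i} \<Longrightarrow> minor i (\<lambda>r. wvec (x r)) x = 1"
  by (rule minor_pivot_reduced_basis) (auto simp: lookup_wvec inj_on_eq_iff)

lemma basis_minor_zero: "b < i \<Longrightarrow> t b \<notin> x ` {..<i} \<Longrightarrow> minor i (\<lambda>r. wvec (x r)) t = 0"
  by (rule minor_zero_column[of b]) (auto simp: lookup_wvec dest: sym)

context positive_root
begin

abbreviation "pl \<equiv> pluecker_functional (i, j)"

lemma pl_add: "pl t (p + q) = pl t p + pl t q"
  by (simp add: pluecker_functional_def dual_ext_add)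

lemma pl_cscale: "pl t (cscale c p) = c * pl t p"
  by (simp add: pluecker_functional_def dual_ext_cscale)

lemma pl_diff: "pl t (p - q) = pl t p - pl t q"
  by (simp add: pluecker_functional_def dual_ext_diff)

lemma pl_zero [simp]: "pl t 0 = 0"
  by (simp add: pluecker_functional_def)

lemma pl_sum: "pl t (\<Sum>a\<in>A. f a) = (\<Sum>a\<in>A. pl t (f a))"
  by (simp add: pluecker_functional_def dual_ext_sum)

lemma pl_one: "pl t 1 = minor i (\<lambda>a. wvec (Suc a)) t"
  by (simp add: pluecker_functional_def flip: single_one)

lemma pl_fvar: "pl t (fvar \<beta> * q) = lower (i, j) \<beta> (\<lambda>t. pl t q) t"
proof -
  interpret comp_fun_commute "lower (i, j)"
    by standard (use lower_commute[of "(i, j)"] ij in \<open>auto simp: fun_eq_iff\<close>)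
  have "Poly_Mapping.keys q \<subseteq> UNIV" by simp
  then show ?thesis
  proof (induction q arbitrary: t rule: free_space_induct)
    case (base k)
    have "pl t (fvar \<beta> * Poly_Mapping.single k 1) =
        fold_mset (lower (i, j)) (minor i (\<lambda>a. wvec (Suc a))) (add_mset \<beta> (mset_of k)) t"
      by (simp add: pluecker_functional_def fvar_mult_monomial flip: mset_of_add_single)
    also have "\<dots> = lower (i, j) \<beta> (\<lambda>t. pl t (Poly_Mapping.single k 1)) t"
      unfolding fold_mset_add_mset by (simp add: pluecker_functional_def)
    finally show ?case .
  next
    case (add p q)
    then show ?case
      by (simp add: distrib_left pl_add lower_def flip: sum.distrib) (auto intro!: sum.cong)
  next
    case (scale c p)
    then show ?case
      by (simp add: cscale_mult_right pl_cscale lower_def sum_distrib_left) (auto intro!: sum.cong)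
  qed (auto simp: lower_def intro!: sum.neutral)
qed

lemma pl_trivial: "\<not> (a \<le> i \<and> j \<le> b) \<Longrightarrow> pl t (gvar n a b * q) = 0"
  by (auto simp: gvar_def pl_fvar lower_trivial)

lemma pl_mult_zero:
  assumes "p \<in> sym_alg n" "\<And>t. pl t q = 0"
  shows "pl t (p * q) = 0"
  using assms(1)
proof (induction p arbitrary: t rule: sym_alg_induct)
  case (mult \<beta> p)
  then have "pl t (fvar \<beta> * (p * q)) = 0" by (simp add: pl_fvar lower_zero)
  then show ?case by (simp add: mult.assoc)
qed (auto simp: assms(2) distrib_right pl_add cscale_mult_left pl_cscale)

lemma pl_two_gvars:
  assumes "1 \<le> a" "a \<le> i" "1 \<le> a'" "a' \<le> i" "j \<le> b" "b \<le> n - 1" "j \<le> b'" "b' \<le> n - 1"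
  shows "pl t (gvar n a b * gvar n a' b') =
    (if a = a' then 0 else minor i ((\<lambda>r. wvec (Suc r))(a' - 1 := wvec (Suc b'), a - 1 := wvec (Suc b))) t)"
proof -
  let ?e = "\<lambda>r. wvec (Suc r)"
  let ?u = "?e(a' - 1 := wvec (Suc b'))"
  have pos: "(a, b) \<in> pos_roots n" "(a', b') \<in> pos_roots n" using assms ij by (auto simp: pos_roots_def)
  have "pl t (fvar (a', b') * 1) = minor i ?u t" for t
    unfolding pl_fvar pl_one
    by (rule lower_minor_unique) (use assms in \<open>auto simp: lookup_wvec\<close>)
  then have "pl t (gvar n a b * gvar n a' b') = lower (i, j) (a, b) (minor i ?u) t"
    using pos by (simp add: gvar_def pl_fvar)
  also have "\<dots> = (if a = a' then 0 else minor i (?u(a - 1 := wvec (Suc b))) t)"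
  proof (cases "a = a'")
    case True
    have "lower (i, j) (a, b) (minor i ?u) t = 0"
      by (rule lower_minor_none) (use assms ij True in \<open>auto simp: lookup_wvec\<close>)
    then show ?thesis using True by simp
  next
    case False
    have "lower (i, j) (a, b) (minor i ?u) t = minor i (?u(a - 1 := wvec (Suc b))) t"
      by (rule lower_minor_unique) (use assms ij False in \<open>auto simp: lookup_wvec\<close>)
    then show ?thesis using False by simp
  qed
  finally show ?thesis .
qed

text \<open>The two products replace the same two rows by the same two vectors in opposite order, and
  swapping rows changes the sign of a minor.\<close>

lemma pl_permanent:
  assumes I: "{a, b, a', b'} \<subseteq> {1..n-1}"
  shows "pl t (permanent n a b a' b') = 0"
proof (cases "a \<le> i \<and> a' \<le> i \<and> j \<le> b \<and> j \<le> b'")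
  case True
  have "pl t (permanent n a b a' b') = pl t (gvar n a b * gvar n a' b') + pl t (gvar n a b' * gvar n a' b)"
    by (simp add: permanent_def pl_add)
  also have "\<dots> = 0"
  proof (cases "a = a'")
    case False
    then have "a' - 1 \<noteq> a - 1" "a - 1 < i" "a' - 1 < i" using I True by auto
    then show ?thesis
      using I True False minor_row_swap[of "a' - 1" i "a - 1" "\<lambda>r. wvec (Suc r)" "wvec (Suc b')" "wvec (Suc b)" t]
      by (simp add: pl_two_gvars del: fun_upd_apply)
  qed (use I True in \<open>simp add: pl_two_gvars\<close>)
  finally show ?thesis .
next
  case False
  then have "pl t (gvar n a b * gvar n a' b') = 0 \<and> pl t (gvar n a b' * gvar n a' b) = 0"
    using pl_trivial[of a b t "gvar n a' b'"] pl_trivial[of a' b' t "gvar n a b"]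
      pl_trivial[of a b' t "gvar n a' b"] pl_trivial[of a' b t "gvar n a b'"]
    by (auto simp: mult.commute)
  then show ?thesis by (simp add: permanent_def pl_add)
qed

lemma pl_J:
  assumes "q \<in> J"
  shows "pl t q = 0"
proof -
  \<comment> \<open>The generators suffice, as the functionals of multiples of \<open>q\<close> are obtained from those of \<open>q\<close>
    by \<open>lower\<close>.\<close>
  have gen: "pl t g = 0" if "g \<in> explicit_gens n (i, j)" for g t
  proof -
    have "pl t (gvar n a b) = 0" if "\<not> (a \<le> i \<and> j \<le> b)" for a b
      using pl_trivial[OF that, of t 1] by simp
    then show ?thesis using that pl_permanent unfolding explicit_gens_def by auto
  qed
  show ?thesis using assms unfolding J_explicit
  proof (induction rule: fsv.span_induct_alt)
    case (step c x y)
    then show ?case using gen pl_mult_zero by (auto simp: pl_add pl_cscale)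
  qed simp
qed

lemma pl_cong: "p - q \<in> J \<Longrightarrow> pl t p = pl t q"
  using pl_J[of "p - q" t] by (simp add: pl_diff)

text \<open>The monomial \<open>\<Prod>\<^bsub>a\<in>A\<^esub> f\<^bsub>a,g a\<^esub>\<close> sends \<open>w\<^sub>1 \<and> \<dots> \<and> w\<^sub>i\<close> to the wedge of the basis vectors
  whose indices are listed here (\<open>pl_matching_monomial\<close>).\<close>

definition matching_tuple :: "nat set \<Rightarrow> (nat \<Rightarrow> nat) \<Rightarrow> nat \<Rightarrow> nat" where
  "matching_tuple A g r = (if Suc r \<in> A then Suc (g (Suc r)) else Suc r)"

definition matching_monomial :: "nat set \<Rightarrow> (nat \<Rightarrow> nat) \<Rightarrow> spoly" where
  "matching_monomial A g = (\<Prod>a\<in>A. fvar (a, g a))"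

lemma finite_rows: "A \<subseteq> {1..i} \<Longrightarrow> finite A"
  using finite_subset by blast

lemma matching_monomial_sym_alg:
  assumes "A \<subseteq> {1..i}" "g ` A \<subseteq> {j..n-1}"
  shows "matching_monomial A g \<in> sym_alg n"
  unfolding matching_monomial_def
proof (rule sym_alg_prod)
  fix a assume "a \<in> A"
  then have "1 \<le> a" "a \<le> i" "j \<le> g a" "g a \<le> n - 1" using assms by auto
  then show "fvar (a, g a) \<in> sym_alg n" using ij by (intro fvar_in_sym_alg) (auto simp: pos_roots_def)
qed

lemma pl_matching_monomial:
  assumes "A \<subseteq> {1..i}" "g ` A \<subseteq> {j..n-1}"
  shows "pl t (matching_monomial A g) = minor i (\<lambda>r. wvec (matching_tuple A g r)) t"
proof -
  have "finite A" using assms(1) by (rule finite_rows)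
  then show ?thesis using assms
  proof (induction A arbitrary: t rule: finite_induct)
    case empty
    then show ?case by (simp add: matching_monomial_def matching_tuple_def pl_one)
  next
    case (insert a A)
    have a: "1 \<le> a" "a \<le> i" "j \<le> g a" "g a \<le> n - 1" using insert.prems by auto
    have gA: "\<And>x. x \<in> A \<Longrightarrow> j \<le> g x" using insert.prems by auto
    have "pl t (matching_monomial (insert a A) g) = lower (i, j) (a, g a) (minor i (\<lambda>r. wvec (matching_tuple A g r))) t"
      using insert by (simp add: matching_monomial_def pl_fvar)
    also have "\<dots> = minor i ((\<lambda>r. wvec (matching_tuple A g r))(a - 1 := wvec (Suc (g a)))) t"
    proof (rule lower_minor_unique)
      fix r assume "r < i"
      show "Poly_Mapping.lookup (wvec (matching_tuple A g r)) a = (if r = a - 1 then 1 else 0)"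
        using a gA[of "Suc r"] insert(2) ij by (auto simp: lookup_wvec matching_tuple_def)
    qed (use a in auto)
    also have "\<dots> = minor i (\<lambda>r. wvec (matching_tuple (insert a A) g r)) t"
      by (rule minor_cong) (use a in \<open>auto simp: matching_tuple_def\<close>)
    finally show ?case .
  qed
qed

lemma matching_monomial_swap:
  assumes "A \<subseteq> {1..i}" "g ` A \<subseteq> {j..n-1}" "a \<in> A" "a' \<in> A" "a \<noteq> a'"
  shows "matching_monomial A g + matching_monomial A (g(a := g a', a' := g a)) \<in> J"
proof -
  have fin: "finite A" using assms(1) by (rule finite_rows)
  let ?rest = "\<Prod>x\<in>A - {a} - {a'}. fvar (x, g x)"
  have b: "{a, g a, a', g a'} \<subseteq> {1..n-1}" "j \<le> g a" "j \<le> g a'" "a \<le> i" "a' \<le> i"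
    using assms ij by (auto simp: image_subset_iff subset_iff)
  then have pos: "(a, g a) \<in> pos_roots n" "(a', g a') \<in> pos_roots n" "(a, g a') \<in> pos_roots n" "(a', g a) \<in> pos_roots n"
    using ij by (auto simp: pos_roots_def)
  have split: "matching_monomial A h = fvar (a, h a) * (fvar (a', h a') * (\<Prod>x\<in>A - {a} - {a'}. fvar (x, h x)))" for h
    unfolding matching_monomial_def using assms fin
    by (subst prod.remove[of A a]) (auto simp: prod.remove[of "A - {a}" a'])
  have "(\<Prod>x\<in>A - {a} - {a'}. fvar (x, (g(a := g a', a' := g a)) x)) = ?rest"
    by (rule prod.cong) auto
  then have "matching_monomial A g + matching_monomial A (g(a := g a', a' := g a)) = ?rest * permanent n a (g a) a' (g a')"
    using assms(5) pos unfolding split by (simp add: permanent_def gvar_def algebra_simps)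
  moreover have "?rest \<in> sym_alg n"
    using matching_monomial_sym_alg[of "A - {a} - {a'}" g] assms by (auto simp: matching_monomial_def)
  ultimately show ?thesis using J_mult permanent_in_J[OF b(1)] by simp
qed

text \<open>Modulo the ideal, permanents exchange two values of a bijection at the cost of a sign, and
  transpositions lead from \<open>g\<close> to \<open>g'\<close>.\<close>

lemma matching_monomial_sign:
  assumes "A \<subseteq> {1..i}" "B \<subseteq> {j..n-1}" "bij_betw g A B" "bij_betw g' A B"
  shows "matching_monomial A g - matching_monomial A g' \<in> J \<or> matching_monomial A g + matching_monomial A g' \<in> J"
  using assms
proof (induction "card A" arbitrary: A B g)
  case 0
  then have "A = {}" using finite_rows by auto
  then show ?case using J_zero by (simp add: matching_monomial_def)
next
  case (Suc k)
  have fin: "finite A" using Suc.prems(1) by (rule finite_rows)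
  obtain a where a: "a \<in> A" using Suc.hyps(2) by fastforce
  have main: "matching_monomial A h - matching_monomial A g' \<in> J \<or> matching_monomial A h + matching_monomial A g' \<in> J"
    if h: "bij_betw h A B" "h a = g' a" for h
  proof -
    have "bij_betw h (A - {a}) (B - {h a})" "bij_betw g' (A - {a}) (B - {h a})"
      using h Suc.prems(4) a by (auto simp: bij_betw_def inj_on_diff inj_on_image_set_diff[of _ A])
    then have "matching_monomial (A - {a}) h - matching_monomial (A - {a}) g' \<in> J \<or> matching_monomial (A - {a}) h + matching_monomial (A - {a}) g' \<in> J"
      using Suc.hyps(2) Suc.prems a fin by (intro Suc.hyps(1)[of "A - {a}" "B - {h a}"]) auto
    moreover have "fvar (a, g' a) \<in> sym_alg n"
    proof -
      have "g' a \<in> B" using Suc.prems(4) a by (auto simp: bij_betw_def)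
      then have "1 \<le> a" "a \<le> i" "j \<le> g' a" "g' a \<le> n - 1" using Suc.prems a by auto
      then show ?thesis using ij by (intro fvar_in_sym_alg) (auto simp: pos_roots_def)
    qed
    ultimately have "fvar (a, g' a) * (matching_monomial (A - {a}) h - matching_monomial (A - {a}) g') \<in> J \<or>
      fvar (a, g' a) * (matching_monomial (A - {a}) h + matching_monomial (A - {a}) g') \<in> J"
      using J_mult by blast
    moreover have "matching_monomial A f = fvar (a, f a) * matching_monomial (A - {a}) f" for f
      unfolding matching_monomial_def using fin a by (subst prod.remove[of A a]) auto
    ultimately show ?thesis using h(2) by (simp add: right_diff_distrib distrib_left)
  qed
  have "g' a \<in> g ` A" using Suc.prems a by (auto simp: bij_betw_def)
  then obtain a' where a': "a' \<in> A" "g a' = g' a" by auto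
  show ?case
  proof (cases "a' = a")
    case True
    then show ?thesis using main[of g] a' Suc.prems by simp
  next
    case False
    let ?h = "g(a := g a', a' := g a)"
    have bij: "bij_betw ?h A B"
    proof -
      have inj: "inj_on g A" "g ` A = B" using Suc.prems(3) by (auto simp: bij_betw_def)
      have "inj_on ?h A"
        using inj(1) a a'(1) False by (auto simp: inj_on_def)
      moreover have "?h ` A = g ` A"
      proof
        show "?h ` A \<subseteq> g ` A" using a a'(1) by auto
        show "g ` A \<subseteq> ?h ` A"
        proof
          fix y assume "y \<in> g ` A"
          then obtain x where x: "x \<in> A" "y = g x" by auto
          consider "x = a" | "x = a'" | "x \<noteq> a" "x \<noteq> a'" by blast
          then show "y \<in> ?h ` A"
          proof cases
            case 1
            then show ?thesis using x a'(1) by (intro image_eqI[of _ _ a']) auto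
          next
            case 2
            then show ?thesis using x a False by (intro image_eqI[of _ _ a]) auto
          next
            case 3
            then show ?thesis using x by (intro image_eqI[of _ _ x]) auto
          qed
        qed
      qed
      ultimately show ?thesis using inj(2) by (simp add: bij_betw_def)
    qed
    have sw: "matching_monomial A g + matching_monomial A ?h \<in> J"
      using Suc.prems a a'(1) False by (intro matching_monomial_swap) (auto simp: bij_betw_def)
    have "matching_monomial A ?h - matching_monomial A g' \<in> J \<or> matching_monomial A ?h + matching_monomial A g' \<in> J"
      by (rule main[OF bij]) (use a' False in auto)
    then show ?thesis
      using J_diff[OF sw, of "matching_monomial A ?h - matching_monomial A g'"]
        J_diff[OF sw, of "matching_monomial A ?h + matching_monomial A g'"]
      by (auto simp: algebra_simps)
  qed
qed

end

section \<open>A root module is an exterior power\<close>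

definition support_indices :: "nat \<Rightarrow> nat \<times> nat \<Rightarrow> nat set" where
  "support_indices n \<alpha> = {1..fst \<alpha>} \<union> {snd \<alpha> + 1..n}"

definition graph_row :: "nat \<Rightarrow> (nat \<times> nat \<Rightarrow> complex) \<Rightarrow> nat \<times> nat \<Rightarrow> nat \<Rightarrow> W" where
  "graph_row n c \<alpha> r = wvec (Suc r) + (\<Sum>b\<in>{snd \<alpha>..n-1}. cscale (c (Suc r, b)) (wvec (Suc b)))"

definition exp_product :: "nat \<Rightarrow> (nat \<times> nat \<Rightarrow> complex) \<Rightarrow> spoly" where
  "exp_product n c = (\<Prod>\<beta>\<in>pos_roots n. 1 + cscale (c \<beta>) (fvar \<beta>))"

definition nil_elem :: "nat \<Rightarrow> (nat \<times> nat \<Rightarrow> complex) \<Rightarrow> spoly" where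
  "nil_elem n c = (\<Sum>\<beta>\<in>pos_roots n. cscale (c \<beta>) (fvar \<beta>))"

context positive_root
begin

text \<open>The pair \<open>(A, B)\<close> stands for the subset \<open>({1, \<dots>, i} - A) \<union> (B + 1)\<close> of \<open>I(\<alpha>)\<close>, and so for
  a basis vector of \<open>\<Lambda>\<^sup>i W\<^sub>\<alpha>\<close>.\<close>

definition index_pairs :: "(nat set \<times> nat set) set" where
  "index_pairs = {(A, B). A \<subseteq> {1..i} \<and> B \<subseteq> {j..n-1} \<and> card A = card B}"

definition matching :: "nat set \<times> nat set \<Rightarrow> nat \<Rightarrow> nat" where
  "matching x = (SOME g. bij_betw g (fst x) (snd x))"

definition std_monomial :: "nat set \<times> nat set \<Rightarrow> spoly" where
  "std_monomial x = matching_monomial (fst x) (matching x)"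

definition std_tuple :: "nat set \<times> nat set \<Rightarrow> nat \<Rightarrow> nat" where
  "std_tuple x = matching_tuple (fst x) (matching x)"

lemma finite_index_pairs: "finite index_pairs"
  by (rule finite_subset[of _ "Pow {1..i} \<times> Pow {j..n-1}"]) (auto simp: index_pairs_def)

lemma index_pairsD:
  assumes "x \<in> index_pairs"
  shows "fst x \<subseteq> {1..i}" "snd x \<subseteq> {j..n-1}" "card (fst x) = card (snd x)"
    "bij_betw (matching x) (fst x) (snd x)" "matching x ` fst x \<subseteq> {j..n-1}"
proof -
  show 1: "fst x \<subseteq> {1..i}" "snd x \<subseteq> {j..n-1}" "card (fst x) = card (snd x)"
    using assms by (auto simp: index_pairs_def)
  then have "finite (fst x)" "finite (snd x)" using finite_subset by blast+
  then have "\<exists>g. bij_betw g (fst x) (snd x)" using 1 by (simp add: finite_same_card_bij)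
  then show "bij_betw (matching x) (fst x) (snd x)" unfolding matching_def by (rule someI_ex)
  then show "matching x ` fst x \<subseteq> {j..n-1}" using 1 by (simp add: bij_betw_def)
qed

lemma std_monomial_sym_alg: "x \<in> index_pairs \<Longrightarrow> std_monomial x \<in> sym_alg n"
  unfolding std_monomial_def using index_pairsD by (intro matching_monomial_sym_alg) auto

lemma std_tuple_range:
  assumes x: "x \<in> index_pairs"
  shows "std_tuple x ` {..<i} = ({1..i} - fst x) \<union> Suc ` snd x"
proof -
  have "std_tuple x ` {..<i} = (\<lambda>a. if a \<in> fst x then Suc (matching x a) else a) ` Suc ` {..<i}"
    unfolding image_image by (rule image_cong) (auto simp: std_tuple_def matching_tuple_def)
  also have "Suc ` {..<i} = {1..i}" by (simp add: image_Suc_lessThan)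
  also have "(\<lambda>a. if a \<in> fst x then Suc (matching x a) else a) ` {1..i} = ({1..i} - fst x) \<union> Suc ` matching x ` fst x"
    using index_pairsD(1)[OF x] by auto
  also have "matching x ` fst x = snd x" using index_pairsD(4)[OF x] by (simp add: bij_betw_def)
  finally show ?thesis .
qed

lemma std_tuple_inj:
  assumes x: "x \<in> index_pairs"
  shows "inj_on (std_tuple x) {..<i}"
proof (rule inj_onI)
  fix r s assume rs: "r \<in> {..<i}" "s \<in> {..<i}" "std_tuple x r = std_tuple x s"
  have inj: "inj_on (matching x) (fst x)" using index_pairsD(4)[OF x] by (simp add: bij_betw_def)
  have big: "\<And>a. a \<in> fst x \<Longrightarrow> i < Suc (matching x a)" using index_pairsD(5)[OF x] ij by fastforce
  show "r = s"
    using rs inj big[of "Suc r"] big[of "Suc s"]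
    by (auto simp: std_tuple_def matching_tuple_def inj_on_eq_iff split: if_splits)
qed

lemma pl_std_monomial:
  "x \<in> index_pairs \<Longrightarrow> pl t (std_monomial x) = minor i (\<lambda>r. wvec (std_tuple x r)) t"
  unfolding std_monomial_def std_tuple_def using index_pairsD by (intro pl_matching_monomial) auto

text \<open>Different pairs have different index sets (\<open>std_tuple_range\<close>), so some column of one tuple
  does not occur in the other one.\<close>

lemma pl_dual:
  assumes x: "x \<in> index_pairs" and y: "y \<in> index_pairs"
  shows "pl (std_tuple y) (std_monomial x) = (if x = y then 1 else 0)"
proof (cases "x = y")
  case True
  then show ?thesis using basis_minor_same[OF std_tuple_inj[OF y]] pl_std_monomial[OF y] by simp
next
  case False
  have "\<exists>b<i. std_tuple y b \<notin> std_tuple x ` {..<i}"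
  proof (rule ccontr)
    assume "\<not> ?thesis"
    then have sub: "std_tuple y ` {..<i} \<subseteq> std_tuple x ` {..<i}" by auto
    have "card (std_tuple y ` {..<i}) = card (std_tuple x ` {..<i})"
      by (simp add: card_image std_tuple_inj x y)
    then have eq: "std_tuple y ` {..<i} = std_tuple x ` {..<i}"
      using sub by (intro card_subset_eq) auto
    have big: "Suc ` snd z \<inter> {1..i} = {}" if "z \<in> index_pairs" for z
      using index_pairsD(2)[OF that] ij by auto
    have A: "{1..i} - fst z = std_tuple z ` {..<i} \<inter> {1..i}" if "z \<in> index_pairs" for z
      using big[OF that] std_tuple_range[OF that] by auto
    have B: "Suc ` snd z = std_tuple z ` {..<i} - {1..i}" if "z \<in> index_pairs" for z
      using big[OF that] std_tuple_range[OF that] by auto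
    have "{1..i} - fst y = {1..i} - fst x" using A[OF x] A[OF y] eq by simp
    then have "fst y = fst x" using index_pairsD(1)[OF x] index_pairsD(1)[OF y] by blast
    moreover have "Suc ` snd y = Suc ` snd x" using B[OF x] B[OF y] eq by simp
    then have "snd y = snd x" by (simp add: inj_image_eq_iff)
    ultimately show False using False by (simp add: prod_eq_iff)
  qed
  then show ?thesis using False basis_minor_zero by (auto simp: pl_std_monomial x)
qed

definition reducible :: "spoly \<Rightarrow> bool" where
  "reducible q \<longleftrightarrow> (\<exists>c. q - (\<Sum>x\<in>index_pairs. cscale (c x) (std_monomial x)) \<in> J)"

lemma reducible_J: "q \<in> J \<Longrightarrow> reducible q"
  unfolding reducible_def by (rule exI[of _ "\<lambda>_. 0"]) simp

lemma reducible_add: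
  assumes "reducible p" "reducible q"
  shows "reducible (p + q)"
proof -
  obtain c d where c: "p - (\<Sum>x\<in>index_pairs. cscale (c x) (std_monomial x)) \<in> J"
    and d: "q - (\<Sum>x\<in>index_pairs. cscale (d x) (std_monomial x)) \<in> J"
    using assms unfolding reducible_def by blast
  have "p + q - (\<Sum>x\<in>index_pairs. cscale (c x + d x) (std_monomial x)) \<in> J"
    using J_add[OF c d] by (simp add: fsv.scale_left_distrib sum.distrib algebra_simps)
  then show ?thesis unfolding reducible_def by (intro exI[of _ "\<lambda>x. c x + d x"])
qed

lemma reducible_scale:
  assumes "reducible p"
  shows "reducible (cscale k p)"
proof -
  obtain c where c: "p - (\<Sum>x\<in>index_pairs. cscale (c x) (std_monomial x)) \<in> J"
    using assms unfolding reducible_def by blast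
  have "cscale k p - (\<Sum>x\<in>index_pairs. cscale (k * c x) (std_monomial x)) \<in> J"
    using J_scale[OF c, of k] by (simp add: cscale_diff_right fsv.scale_sum_right)
  then show ?thesis unfolding reducible_def by (intro exI[of _ "\<lambda>x. k * c x"])
qed

lemma reducible_sum: "(\<And>x. x \<in> A \<Longrightarrow> reducible (f x)) \<Longrightarrow> reducible (\<Sum>x\<in>A. f x)"
  by (induction A rule: infinite_finite_induct) (auto intro: reducible_add reducible_J J_zero)

lemma reducible_cong: "p - q \<in> J \<Longrightarrow> reducible q \<Longrightarrow> reducible p"
  using reducible_add[of "p - q" q] reducible_J by simp

lemma reducible_std_monomial: "x \<in> index_pairs \<Longrightarrow> reducible (std_monomial x)"
proof -
  assume x: "x \<in> index_pairs"
  have "(\<Sum>y\<in>index_pairs. cscale (if y = x then 1 else 0) (std_monomial y)) = (\<Sum>y\<in>index_pairs. if y = x then std_monomial y else 0)"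
    by (rule sum.cong) auto
  also have "\<dots> = std_monomial x" using x finite_index_pairs by simp
  finally show ?thesis unfolding reducible_def
    by (intro exI[of _ "\<lambda>y. if y = x then 1 else 0"]) (simp add: J_zero)
qed

lemma reducible_matching_monomial:
  assumes "A \<subseteq> {1..i}" "B \<subseteq> {j..n-1}" "bij_betw g A B"
  shows "reducible (matching_monomial A g)"
proof -
  have x: "(A, B) \<in> index_pairs"
    using assms bij_betw_same_card[OF assms(3)] by (auto simp: index_pairs_def)
  have "matching_monomial A g - std_monomial (A, B) \<in> J \<or> matching_monomial A g + std_monomial (A, B) \<in> J"
    unfolding std_monomial_def fst_conv
    by (rule matching_monomial_sign[OF assms(1,2,3)]) (use index_pairsD(4)[OF x] in simp)
  then show ?thesis
  proof
    assume "matching_monomial A g - std_monomial (A, B) \<in> J"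
    then show ?thesis using reducible_cong reducible_std_monomial[OF x] by blast
  next
    assume "matching_monomial A g + std_monomial (A, B) \<in> J"
    then have "matching_monomial A g - cscale (- 1) (std_monomial (A, B)) \<in> J" by simp
    then show ?thesis using reducible_cong reducible_scale[OF reducible_std_monomial[OF x]] by blast
  qed
qed

text \<open>If the row or the column of \<open>\<beta>\<close> already occurs in the monomial, the product contains half
  a permanent with equal rows or columns. Otherwise the product is a matching monomial again.\<close>

lemma reducible_fvar_std_monomial:
  assumes \<beta>: "\<beta> \<in> pos_roots n" and x: "x \<in> index_pairs"
  shows "reducible (fvar \<beta> * std_monomial x)"
proof -
  obtain a b where ab: "\<beta> = (a, b)" by (cases \<beta>)
  let ?A = "fst x" and ?g = "matching x"
  note D = index_pairsD[OF x]
  have fin: "finite ?A" using D(1) by (rule finite_rows)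
  have mem: "reducible (fvar \<beta> * std_monomial x)" if "a' \<in> ?A" "fvar \<beta> * fvar (a', ?g a') \<in> J" for a'
  proof -
    have "std_monomial x = fvar (a', ?g a') * matching_monomial (?A - {a'}) ?g"
      unfolding std_monomial_def matching_monomial_def using that(1) fin by (simp add: prod.remove)
    moreover have "matching_monomial (?A - {a'}) ?g \<in> sym_alg n"
      using D(1,5) by (intro matching_monomial_sym_alg) auto
    ultimately have "fvar \<beta> * std_monomial x \<in> J" using that(2) J_mult' by (simp flip: mult.assoc)
    then show ?thesis by (rule reducible_J)
  qed
  have pos: "(a', ?g a') \<in> pos_roots n" "j \<le> ?g a'" "?g a' \<le> n - 1" "1 \<le> a'" "a' \<le> i" if "a' \<in> ?A" for a'
  proof -
    show "j \<le> ?g a'" "?g a' \<le> n - 1" "1 \<le> a'" "a' \<le> i" using that D(1,5) by auto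
    then show "(a', ?g a') \<in> pos_roots n" using ij by (auto simp: pos_roots_def)
  qed
  have same: "p \<in> J" if "cscale 2 p \<in> J" for p
    using J_scale[OF that, of "1/2"] by simp
  show ?thesis
  proof (cases "a \<le> i \<and> j \<le> b")
    case False
    then have "fvar \<beta> \<in> J" using gvar_in_J[of a b] \<beta> ab by (simp add: gvar_def)
    then show ?thesis using J_mult'[OF std_monomial_sym_alg[OF x]] reducible_J by blast
  next
    case True
    have ab': "1 \<le> a" "b \<le> n - 1" using \<beta> ab by (auto simp: pos_roots_def)
    consider "a \<in> ?A" | "b \<in> snd x" | "a \<notin> ?A" "b \<notin> snd x" by blast
    then show ?thesis
    proof cases
      case 1
      have "permanent n a b a (?g a) = cscale 2 (fvar \<beta> * fvar (a, ?g a))"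
        using \<beta> ab pos[OF 1] by (simp add: permanent_same_row gvar_def)
      moreover have "permanent n a b a (?g a) \<in> J"
        using pos[OF 1] True ab' ij by (intro permanent_in_J) auto
      ultimately show ?thesis using mem[OF 1] same by simp
    next
      case 2
      then have "b \<in> ?g ` ?A" using D(4) by (simp add: bij_betw_def)
      then obtain a' where a': "a' \<in> ?A" "?g a' = b" by auto
      have "permanent n a b a' b = cscale 2 (fvar \<beta> * fvar (a', ?g a'))"
        using \<beta> ab a'(2) pos[OF a'(1)] by (simp add: permanent_same_column gvar_def)
      moreover have "permanent n a b a' b \<in> J"
        using pos[OF a'(1)] True ab' ij by (intro permanent_in_J) auto
      ultimately show ?thesis using mem[OF a'(1)] same by simp
    next
      case 3
      have "bij_betw (?g(a := b)) (insert a ?A) (insert b (snd x))"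
      proof -
        have "bij_betw (?g(a := b)) ?A (snd x)"
          using D(4) 3 by (subst bij_betw_cong[of _ _ ?g]) auto
        then have "bij_betw (?g(a := b)) (?A \<union> {a}) (snd x \<union> {b})"
          by (rule bij_betw_combine) (use 3 in \<open>auto simp: bij_betw_def\<close>)
        then show ?thesis by simp
      qed
      then have "reducible (matching_monomial (insert a ?A) (?g(a := b)))"
        by (rule reducible_matching_monomial[rotated 2]) (use D True ab' in auto)
      moreover have "matching_monomial (insert a ?A) (?g(a := b)) = fvar \<beta> * std_monomial x"
      proof -
        have "(\<Prod>y\<in>?A. fvar (y, (?g(a := b)) y)) = (\<Prod>y\<in>?A. fvar (y, ?g y))"
          by (rule prod.cong) (use 3 in auto)
        then show ?thesis using 3 fin ab by (simp add: matching_monomial_def std_monomial_def)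
      qed
      ultimately show ?thesis by simp
    qed
  qed
qed

lemma sym_alg_reducible: "q \<in> sym_alg n \<Longrightarrow> reducible q"
proof (induction q rule: sym_alg_induct)
  case one
  have "reducible (matching_monomial {} (\<lambda>_. 0))"
    by (rule reducible_matching_monomial[of "{}" "{}"]) (auto simp: bij_betw_def)
  then show ?case by (simp add: matching_monomial_def)
next
  case (mult \<beta> p)
  then obtain c where c: "p - (\<Sum>x\<in>index_pairs. cscale (c x) (std_monomial x)) \<in> J" unfolding reducible_def by blast
  have "reducible (\<Sum>x\<in>index_pairs. cscale (c x) (fvar \<beta> * std_monomial x))"
    using mult by (intro reducible_sum reducible_scale reducible_fvar_std_monomial)
  moreover have "fvar \<beta> * p - (\<Sum>x\<in>index_pairs. cscale (c x) (fvar \<beta> * std_monomial x)) \<in> J"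
    using J_mult[OF fvar_in_sym_alg[OF mult(1)] c]
    by (simp add: right_diff_distrib sum_distrib_left cscale_mult_right)
  ultimately show ?case using reducible_cong by blast
qed (auto intro: reducible_add reducible_scale)

text \<open>The standard monomials span the quotient by the ideal, and the dual functionals read off
  the coefficients.\<close>

theorem std_monomial_expansion:
  assumes "q \<in> sym_alg n"
  shows "q - (\<Sum>x\<in>index_pairs. cscale (pl (std_tuple x) q) (std_monomial x)) \<in> J"
proof -
  obtain c where c: "q - (\<Sum>x\<in>index_pairs. cscale (c x) (std_monomial x)) \<in> J"
    using sym_alg_reducible[OF assms] unfolding reducible_def by blast
  have "pl (std_tuple y) q = c y" if y: "y \<in> index_pairs" for y
  proof -
    have "pl (std_tuple y) q = (\<Sum>x\<in>index_pairs. c x * pl (std_tuple y) (std_monomial x))"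
      using pl_cong[OF c, of "std_tuple y"] by (simp add: pl_sum pl_cscale)
    also have "\<dots> = (\<Sum>x\<in>index_pairs. if x = y then c x else 0)"
      by (rule sum.cong) (auto simp: pl_dual y)
    finally show ?thesis using y finite_index_pairs by simp
  qed
  then have "(\<Sum>x\<in>index_pairs. cscale (pl (std_tuple x) q) (std_monomial x)) = (\<Sum>x\<in>index_pairs. cscale (c x) (std_monomial x))"
    by (intro sum.cong) auto
  then show ?thesis using c by simp
qed

lemma in_J_iff: "q \<in> sym_alg n \<Longrightarrow> q \<in> J \<longleftrightarrow> (\<forall>t. pl t q = 0)"
  using std_monomial_expansion[of q] pl_J by auto

abbreviation "I \<equiv> support_indices n (i, j)"

definition realized :: "((nat \<Rightarrow> nat) \<Rightarrow> complex) \<Rightarrow> bool" where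
  "realized \<omega> \<longleftrightarrow> (\<exists>q\<in>sym_alg n. \<forall>t. pl t q = \<omega> t)"

text \<open>Induction on the number of indices \<open>> j\<close>. Such an index \<open>b + 1\<close> is produced by \<open>f\<^bsub>a,b\<^esub>\<close>
  from an index \<open>a \<le> i\<close> that does not occur in the other places.\<close>

lemma realized_basis_minor:
  assumes "\<And>r. r < i \<Longrightarrow> x r \<in> I"
  shows "realized (minor i (\<lambda>r. wvec (x r)))"
proof (cases "inj_on x {..<i}")
  case False
  then obtain r s where rs: "r < i" "s < i" "r \<noteq> s" "x r = x s" by (auto simp: inj_on_def)
  have "minor i (\<lambda>r. wvec (x r)) t = 0" for t
    unfolding minor_def by (rule det_identical_rows[of _ i r s]) (use rs in \<open>auto intro!: eq_vecI\<close>)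
  then show ?thesis unfolding realized_def
    by (intro bexI[of _ 0]) (auto simp: fsv.subspace_0[OF subspace_sym_alg])
next
  case True
  then show ?thesis using assms
  proof (induction "card {r. r < i \<and> j < x r}" arbitrary: x rule: less_induct)
    case less
    show ?case
    proof (cases "\<exists>r<i. j < x r")
      case False
      have "wvec (x r) \<in> fsv.span ((\<lambda>a. wvec (Suc a)) ` {..<i})" if "r < i" for r
      proof -
        have "x r \<in> {1..i}" using less.prems(2)[OF that] False that by (auto simp: support_indices_def)
        then have "wvec (x r) = wvec (Suc (x r - 1))" "x r - 1 < i" by auto
        then show ?thesis by (intro fsv.span_base) (auto intro!: image_eqI[of _ _ "x r - 1"])
      qed
      then obtain g where g: "\<And>t. minor i (\<lambda>r. wvec (x r)) t = g * minor i (\<lambda>a. wvec (Suc a)) t"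
        using minor_base_change[of i "\<lambda>r. wvec (x r)" "\<lambda>a. wvec (Suc a)"] by blast
      show ?thesis unfolding realized_def
        by (intro bexI[of _ "cscale g 1"]) (auto simp: g pl_cscale pl_one intro!: fsv.subspace_scale[OF subspace_sym_alg])
    next
      case True
      then obtain k where k: "k < i" "j < x k" by blast
      have "\<exists>a\<in>{1..i}. a \<notin> x ` ({..<i} - {k})"
      proof (rule ccontr)
        assume "\<not> ?thesis"
        then have "{1..i} \<subseteq> x ` ({..<i} - {k})" by blast
        then have "card {1..i} \<le> card (x ` ({..<i} - {k}))" by (intro card_mono) auto
        also have "\<dots> \<le> card ({..<i} - {k})" by (rule card_image_le) simp
        finally show False using k by simp
      qed
      then obtain a where a: "1 \<le> a" "a \<le> i" "a \<notin> x ` ({..<i} - {k})" by auto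
      let ?y = "x(k := a)"
      have inj: "inj_on ?y {..<i}"
        using less.prems(1) a(3) by (auto simp: inj_on_def image_iff)
      have I: "?y r \<in> I" if "r < i" for r
        using that a less.prems(2) by (auto simp: support_indices_def)
      have "{r. r < i \<and> j < ?y r} \<subset> {r. r < i \<and> j < x r}"
        using k a ij by (intro psubsetI) auto
      then have "card {r. r < i \<and> j < ?y r} < card {r. r < i \<and> j < x r}"
        by (intro psubset_card_mono) auto
      from less.hyps[OF this inj I] obtain q where q: "q \<in> sym_alg n" "\<And>t. pl t q = minor i (\<lambda>r. wvec (?y r)) t"
        unfolding realized_def by blast
      define b where "b = x k - 1"
      have b: "x k = Suc b" "j \<le> b" "b \<le> n - 1"
        using k less.prems(2)[OF k(1)] ij by (auto simp: b_def support_indices_def)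
      have pos: "(a, b) \<in> pos_roots n" using a b ij by (auto simp: pos_roots_def)
      have "pl t (fvar (a, b) * q) = minor i (\<lambda>r. wvec (x r)) t" for t
      proof -
        have "pl t (fvar (a, b) * q) = lower (i, j) (a, b) (minor i (\<lambda>r. wvec (?y r))) t"
          by (simp add: pl_fvar q(2) del: fun_upd_apply)
        also have "\<dots> = minor i ((\<lambda>r. wvec (?y r))(k := wvec (Suc b))) t"
        proof (rule lower_minor_unique)
          fix r assume r: "r < i"
          show "Poly_Mapping.lookup (wvec (?y r)) a = (if r = k then 1 else 0)"
            using r a(3) by (auto simp: lookup_wvec image_iff)
        qed (use a b k in auto)
        also have "\<dots> = minor i (\<lambda>r. wvec (x r)) t"
          by (rule minor_cong) (use b in auto)
        finally show ?thesis .
      qed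
      then show ?thesis unfolding realized_def
        by (intro bexI[of _ "fvar (a, b) * q"]) (auto intro: sym_alg_mult fvar_in_sym_alg pos q(1))
    qed
  qed
qed

lemma realized_lincomb:
  assumes "realized \<omega>" "realized \<omega>'"
  shows "realized (\<lambda>t. c * \<omega> t + \<omega>' t)"
proof -
  obtain q q' where "q \<in> sym_alg n" "\<And>t. pl t q = \<omega> t" "q' \<in> sym_alg n" "\<And>t. pl t q' = \<omega>' t"
    using assms unfolding realized_def by blast
  then show ?thesis unfolding realized_def
    by (intro bexI[of _ "cscale c q + q'"])
      (auto simp: pl_add pl_cscale intro!: fsv.subspace_add[OF subspace_sym_alg] fsv.subspace_scale[OF subspace_sym_alg])
qed

text \<open>Minors are multilinear in the rows, which reduces the claim to rows that are basis
  vectors. In the induction the first \<open>k\<close> rows are still arbitrary.\<close>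

lemma realized_minor:
  assumes "\<And>r. r < i \<Longrightarrow> Poly_Mapping.keys (u r) \<subseteq> I"
  shows "realized (minor i u)"
proof -
  have "realized (minor i u)" if "k \<le> i" "\<And>r. r < k \<Longrightarrow> Poly_Mapping.keys (u r) \<subseteq> I"
    "\<And>r. k \<le> r \<Longrightarrow> r < i \<Longrightarrow> \<exists>x\<in>I. u r = wvec x" for k
    using that
  proof (induction k arbitrary: u)
    case 0
    then have "\<forall>r. \<exists>x. r < i \<longrightarrow> x \<in> I \<and> u r = wvec x" by blast
    then obtain x where x: "\<And>r. r < i \<Longrightarrow> x r \<in> I \<and> u r = wvec (x r)" by metis
    have "minor i u = minor i (\<lambda>r. wvec (x r))"
      by (rule ext, rule minor_cong) (simp add: x)
    then show ?case using realized_basis_minor[of x] x by simp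
  next
    case (Suc k)
    have "u k \<in> fsv.span (wvec ` I)" using Suc.prems(2)[of k] by (simp add: span_wvec)
    then have "realized (minor i (u(k := u k)))"
    proof (induction rule: fsv.span_induct_alt)
      case base
      have "minor i (u(k := 0)) = (\<lambda>_. 0)" using Suc.prems(1) by (auto simp: fun_eq_iff minor_row_zero simp del: fun_upd_apply)
      then show ?case unfolding realized_def
        by (intro bexI[of _ 0]) (auto simp: fsv.subspace_0[OF subspace_sym_alg])
    next
      case (step c v y)
      have "realized (minor i (u(k := v)))"
        using step(1) Suc.prems by (intro Suc.IH) (auto simp: less_Suc_eq)
      then have "realized (\<lambda>t. c * minor i (u(k := v)) t + minor i (u(k := y)) t)"
        using step(2) by (rule realized_lincomb)
      moreover have "minor i (u(k := cscale c v + y)) = (\<lambda>t. c * minor i (u(k := v)) t + minor i (u(k := y)) t)"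
        using Suc.prems(1) by (auto simp: fun_eq_iff minor_row_add minor_row_cscale simp del: fun_upd_apply)
      ultimately show ?case by (simp del: fun_upd_apply)
    qed
    then show ?case by simp
  qed
  from this[of i] show ?thesis using assms by auto
qed

text \<open>A polynomial that represents \<open>u\<^sub>0 \<and> \<dots> \<and> u\<^bsub>i-1\<^esub>\<close>.\<close>

definition pluecker_vector :: "(nat \<Rightarrow> W) \<Rightarrow> spoly" where
  "pluecker_vector u = (\<Sum>x\<in>index_pairs. cscale (minor i u (std_tuple x)) (std_monomial x))"

lemma pluecker_vector_sym_alg: "pluecker_vector u \<in> sym_alg n"
  unfolding pluecker_vector_def
  by (intro fsv.subspace_sum[OF subspace_sym_alg] fsv.subspace_scale[OF subspace_sym_alg] std_monomial_sym_alg)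

theorem pl_pluecker_vector:
  assumes "\<And>r. r < i \<Longrightarrow> Poly_Mapping.keys (u r) \<subseteq> I"
  shows "pl t (pluecker_vector u) = minor i u t"
proof -
  have "realized (minor i u)" by (rule realized_minor) (rule assms)
  then obtain q where q: "q \<in> sym_alg n" "\<And>t. pl t q = minor i u t"
    unfolding realized_def by blast
  have "q - pluecker_vector u \<in> J" using std_monomial_expansion[OF q(1)] by (simp add: q(2) pluecker_vector_def)
  then show ?thesis using pl_cong[of q "pluecker_vector u" t] q(2) by simp
qed

lemma lookup_sum_wvec:
  "finite B \<Longrightarrow> Poly_Mapping.lookup (\<Sum>b\<in>B. cscale (c b) (wvec (Suc b))) k = (if k \<noteq> 0 \<and> k - 1 \<in> B then c (k - 1) else 0)"
proof -
  assume B: "finite B"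
  have "Poly_Mapping.lookup (\<Sum>b\<in>B. cscale (c b) (wvec (Suc b))) k = (\<Sum>b\<in>B. if b = k - 1 then (if k \<noteq> 0 then c b else 0) else 0)"
    unfolding lookup_lincomb by (rule sum.cong) (auto simp: lookup_wvec)
  then show ?thesis using B by simp
qed

text \<open>The factor of the root \<open>(a, b)\<close> adds a multiple of \<open>w\<^bsub>b+1\<^esub>\<close> to row \<open>a - 1\<close>. It does not
  see the other rows, because the indices added so far are greater than \<open>j\<close> and \<open>w\<^sub>a\<close> occurs in
  row \<open>a - 1\<close> only.\<close>

lemma pl_exp_product_aux:
  assumes "finite S" "S \<subseteq> pos_roots n"
  shows "pl t (\<Prod>\<beta>\<in>S. 1 + cscale (c \<beta>) (fvar \<beta>)) =
    minor i (\<lambda>r. wvec (Suc r) + (\<Sum>b\<in>{b\<in>{j..n-1}. (Suc r, b) \<in> S}. cscale (c (Suc r, b)) (wvec (Suc b)))) t"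
  using assms
proof (induction S arbitrary: t rule: finite_induct)
  case empty
  then show ?case by (simp add: pl_one)
next
  case (insert \<beta> S)
  obtain a b where ab: "\<beta> = (a, b)" by (cases \<beta>)
  have pos: "1 \<le> a" "a \<le> b" "b \<le> n - 1" using insert.prems ab by (auto simp: pos_roots_def)
  define row where "row S r = wvec (Suc r) + (\<Sum>b\<in>{b\<in>{j..n-1}. (Suc r, b) \<in> S}. cscale (c (Suc r, b)) (wvec (Suc b)))" for S r
  let ?P = "\<Prod>\<beta>\<in>S. 1 + cscale (c \<beta>) (fvar \<beta>)"
  have IH: "pl t ?P = minor i (row S) t" for t using insert by (simp add: row_def[abs_def])
  have "pl t (\<Prod>\<beta>\<in>insert \<beta> S. 1 + cscale (c \<beta>) (fvar \<beta>)) = pl t ?P + c \<beta> * pl t (fvar \<beta> * ?P)"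
    using insert(1,2) by (simp add: distrib_right pl_add cscale_mult_left pl_cscale)
  also have "\<dots> = minor i (row S) t + c \<beta> * lower (i, j) \<beta> (minor i (row S)) t"
    by (simp add: pl_fvar IH)
  also have "\<dots> = minor i (row (insert \<beta> S)) t"
  proof (cases "a \<le> i \<and> j \<le> b")
    case False
    have "row (insert \<beta> S) r = row S r" if "r < i" for r
      unfolding row_def using False that ab by (intro arg_cong2[of _ _ _ _ "(+)"] refl sum.cong) auto
    then have "minor i (row (insert \<beta> S)) t = minor i (row S) t" by (intro minor_cong) simp
    then show ?thesis using False ab by (simp add: lower_trivial)
  next
    case True
    have "lower (i, j) (a, b) (minor i (row S)) t = minor i ((row S)(a - 1 := wvec (Suc b))) t"
    proof (rule lower_minor_unique)
      fix r assume "r < i"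
      show "Poly_Mapping.lookup (row S r) a = (if r = a - 1 then 1 else 0)"
        using pos True ij by (auto simp: row_def lookup_add lookup_wvec lookup_sum_wvec)
    qed (use pos True in auto)
    moreover have "minor i ((row S)(a - 1 := row S (a - 1))) t + c \<beta> * minor i ((row S)(a - 1 := wvec (Suc b))) t
      = minor i ((row S)(a - 1 := row S (a - 1) + cscale (c \<beta>) (wvec (Suc b)))) t"
    proof -
      have "a - 1 < i" using pos True by linarith
      then show ?thesis by (simp only: minor_row_add minor_row_cscale)
    qed
    moreover have "minor i ((row S)(a - 1 := row S (a - 1) + cscale (c \<beta>) (wvec (Suc b)))) t = minor i (row (insert \<beta> S)) t"
    proof (rule minor_cong)
      fix r d
      have "row (insert \<beta> S) (a - 1) = row S (a - 1) + cscale (c \<beta>) (wvec (Suc b))"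
      proof -
        have "{b'\<in>{j..n-1}. (Suc (a - 1), b') \<in> insert \<beta> S} = insert b {b'\<in>{j..n-1}. (Suc (a - 1), b') \<in> S}"
          using pos True ab by auto
        then show ?thesis using insert(2) ab pos by (simp add: row_def algebra_simps)
      qed
      moreover have "row (insert \<beta> S) r = row S r" if "r \<noteq> a - 1"
        unfolding row_def using that ab pos by (intro arg_cong2[of _ _ _ _ "(+)"] refl sum.cong) auto
      ultimately show "Poly_Mapping.lookup (((row S)(a - 1 := row S (a - 1) + cscale (c \<beta>) (wvec (Suc b)))) r) (t d) =
        Poly_Mapping.lookup (row (insert \<beta> S) r) (t d)" by auto
    qed
    ultimately show ?thesis using ab by simp
  qed
  finally show ?case by (simp add: row_def[abs_def])
qed

theorem pl_exp_product: "pl t (exp_product n c) = minor i (graph_row n c (i, j)) t"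
proof -
  have "pl t (exp_product n c) =
    minor i (\<lambda>r. wvec (Suc r) + (\<Sum>b\<in>{b\<in>{j..n-1}. (Suc r, b) \<in> pos_roots n}. cscale (c (Suc r, b)) (wvec (Suc b)))) t"
    unfolding exp_product_def by (rule pl_exp_product_aux) auto
  also have "\<dots> = minor i (graph_row n c (i, j)) t"
  proof (rule minor_cong)
    fix r b assume "r < i"
    then have "{b\<in>{j..n-1}. (Suc r, b) \<in> pos_roots n} = {j..n-1}" using ij by (auto simp: pos_roots_def)
    then show "Poly_Mapping.lookup (wvec (Suc r) + (\<Sum>b\<in>{b\<in>{j..n-1}. (Suc r, b) \<in> pos_roots n}. cscale (c (Suc r, b)) (wvec (Suc b)))) (t b)
      = Poly_Mapping.lookup (graph_row n c (i, j) r) (t b)" by (simp add: graph_row_def)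
  qed
  finally show ?thesis .
qed

lemma exp_product_sym_alg: "exp_product n c \<in> sym_alg n"
  unfolding exp_product_def
  by (intro sym_alg_prod fsv.subspace_add[OF subspace_sym_alg] fsv.subspace_scale[OF subspace_sym_alg]
      one_in_sym_alg fvar_in_sym_alg)

subsection \<open>The exponential\<close>

abbreviation exp_term :: "spoly \<Rightarrow> nat \<Rightarrow> spoly" where
  "exp_term x k \<equiv> cscale (1 / fact k) (x ^ k)"

lemma power_add_square_zero:
  assumes x: "x \<in> sym_alg n" and y: "y \<in> sym_alg n" and yy: "y * y \<in> J"
  shows "(x + y) ^ Suc k - (x ^ Suc k + cscale (of_nat (Suc k)) (x ^ k * y)) \<in> J"
proof (induction k)
  case 0
  then show ?case using J_zero by simp
next
  case (Suc k)
  have "(x + y) * ((x + y) ^ Suc k - (x ^ Suc k + cscale (of_nat (Suc k)) (x ^ k * y))) + cscale (of_nat (Suc k)) (x ^ k * (y * y)) \<in> J"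
    by (intro J_add J_scale J_mult yy Suc.IH fsv.subspace_add[OF subspace_sym_alg] x y sym_alg_power)
  moreover have "cscale (of_nat (Suc (Suc k))) (x ^ Suc k * y) = x ^ Suc k * y + cscale (of_nat (Suc k)) (x ^ Suc k * y)"
  proof -
    have "of_nat (Suc (Suc k)) = 1 + (of_nat (Suc k) :: complex)" by simp
    then show ?thesis by (simp only: fsv.scale_left_distrib fsv.scale_one)
  qed
  ultimately show ?case
    by (simp add: algebra_simps cscale_add_right cscale_mult_left cscale_mult_right)
qed

lemma exp_term_add:
  assumes "x \<in> sym_alg n" "y \<in> sym_alg n" "y * y \<in> J"
  shows "exp_term (x + y) (Suc k) - (exp_term x (Suc k) + exp_term x k * y) \<in> J"
proof -
  have "cscale (1 / fact (Suc k)) ((x + y) ^ Suc k - (x ^ Suc k + cscale (of_nat (Suc k)) (x ^ k * y))) \<in> J"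
    by (rule J_scale[OF power_add_square_zero[OF assms]])
  moreover have "1 / fact (Suc k) * of_nat (Suc k) = (1 / fact k :: complex)"
    by (simp add: field_simps del: of_nat_Suc)
  ultimately show ?thesis
    by (simp add: cscale_diff_right cscale_add_right cscale_mult_left del: power_Suc fact_Suc of_nat_Suc)
qed

text \<open>As the squares of the variables lie in the ideal, each variable contributes the factor
  \<open>1 + c f\<close> to the exponential and raises the degree from which on the terms of the series
  vanish by one.\<close>

lemma exp_sum_product:
  fixes c :: "nat \<times> nat \<Rightarrow> complex"
  assumes "finite S" "S \<subseteq> pos_roots n"
  defines "x \<equiv> \<lambda>S. \<Sum>\<beta>\<in>S. cscale (c \<beta>) (fvar \<beta>)"
  shows "(\<forall>k>card S. exp_term (x S) k \<in> J) \<and>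
    (\<Sum>k\<le>card S. exp_term (x S) k) - (\<Prod>\<beta>\<in>S. 1 + cscale (c \<beta>) (fvar \<beta>)) \<in> J"
  using assms(1,2)
proof (induction S rule: finite_induct)
  case empty
  have "exp_term 0 k \<in> J" if "k > 0" for k using that J_zero by (simp add: zero_power)
  then show ?case using J_zero by (simp add: x_def)
next
  case (insert \<beta> S)
  let ?y = "cscale (c \<beta>) (fvar \<beta>)"
  have \<beta>: "\<beta> \<in> pos_roots n" using insert by auto
  have y: "?y \<in> sym_alg n" using \<beta> by (intro fsv.subspace_scale[OF subspace_sym_alg] fvar_in_sym_alg)
  have xS: "x S \<in> sym_alg n" unfolding x_def using insert
    by (intro fsv.subspace_sum[OF subspace_sym_alg] fsv.subspace_scale[OF subspace_sym_alg] fvar_in_sym_alg) auto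
  have yy: "?y * ?y \<in> J" using J_scale[OF J_scale[OF fvar_square_in_J[OF \<beta>]]] by (simp add: cscale_mult_left cscale_mult_right)
  have xi: "x (insert \<beta> S) = x S + ?y" using insert(1,2) by (simp add: x_def add.commute)
  note step = exp_term_add[OF xS y yy]
  have hi: "\<And>k. k > card S \<Longrightarrow> exp_term (x S) k \<in> J" using insert by auto
  have IH: "(\<Sum>k\<le>card S. exp_term (x S) k) - (\<Prod>\<beta>\<in>S. 1 + cscale (c \<beta>) (fvar \<beta>)) \<in> J" (is "?E - ?P \<in> J")
    using insert by auto
  have c: "card (insert \<beta> S) = Suc (card S)" using insert by simp
  have "exp_term (x (insert \<beta> S)) k \<in> J" if k: "k > card (insert \<beta> S)" for k
  proof -
    obtain l where l: "k = Suc l" "l > card S" using k c by (cases k) auto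
    have "exp_term (x S) (Suc l) + exp_term (x S) l * ?y \<in> J"
      using l by (intro J_add hi J_mult' y) auto
    then show ?thesis using J_add[OF step[of l]] unfolding l(1) xi by fastforce
  qed
  moreover have "(\<Sum>k\<le>Suc (card S). exp_term (x S + ?y) k) - (1 + ?y) * ?P \<in> J"
  proof -
    have "(\<Sum>k\<le>card S. exp_term (x S + ?y) (Suc k) - (exp_term (x S) (Suc k) + exp_term (x S) k * ?y)) \<in> J"
      by (rule J_sum) (rule step)
    then have 1: "(\<Sum>k\<le>card S. exp_term (x S + ?y) (Suc k)) - ((\<Sum>k\<le>card S. exp_term (x S) (Suc k)) + ?E * ?y) \<in> J"
      by (simp only: sum_subtractf sum.distrib sum_distrib_right)
    have 2: "(\<Sum>k\<le>Suc (card S). exp_term z k) = 1 + (\<Sum>k\<le>card S. exp_term z (Suc k))" for z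
      by (subst sum.atMost_Suc_shift) simp
    have 3: "(\<Sum>k\<le>Suc (card S). exp_term (x S) k) = ?E + exp_term (x S) (Suc (card S))" by simp
    have inJ: "(?E - ?P) + (?E - ?P) * ?y + exp_term (x S) (Suc (card S)) +
       ((\<Sum>k\<le>card S. exp_term (x S + ?y) (Suc k)) - ((\<Sum>k\<le>card S. exp_term (x S) (Suc k)) + ?E * ?y)) \<in> J"
      by (intro J_add IH J_mult' y hi 1) simp
    have alg: "(E - P) + (E - P) * y + e + (A - (B + E * y)) = (1 + A) - (1 + y) * P"
      if "1 + B = E + e" for A B E P e y :: spoly
    proof -
      have "e = 1 + B - E" using that by (simp add: algebra_simps)
      then show ?thesis by (simp add: algebra_simps)
    qed
    show ?thesis
      using inJ unfolding 2[of "x S + ?y"] alg[OF trans[OF 2[of "x S", symmetric] 3]] .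
  qed
  ultimately show ?case using insert(1,2) c xi by simp
qed

end

section \<open>Cosets and the group action on the highest weight vector\<close>

definition cls :: "('x \<Rightarrow>\<^sub>0 complex) set \<Rightarrow> ('x \<Rightarrow>\<^sub>0 complex) \<Rightarrow> ('x \<Rightarrow>\<^sub>0 complex) set" where
  "cls K v = (+) v ` K"

lemma mem_cls: "x \<in> cls K v \<longleftrightarrow> x - v \<in> K"
  by (auto simp: cls_def image_iff intro!: bexI[of _ "x - v"])

lemma cls_eq_iff:
  assumes "fsv.subspace K"
  shows "cls K v = cls K w \<longleftrightarrow> v - w \<in> K"
proof
  assume "cls K v = cls K w"
  moreover have "v \<in> cls K v" using fsv.subspace_0[OF assms] by (simp add: mem_cls)
  ultimately show "v - w \<in> K" by (simp add: mem_cls)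
next
  assume vw: "v - w \<in> K"
  have "x - v \<in> K \<longleftrightarrow> x - w \<in> K" for x
    using fsv.subspace_add[OF assms _ vw, of "x - v"] fsv.subspace_diff[OF assms _ vw, of "x - w"] by auto
  then show "cls K v = cls K w" by (simp add: set_eq_iff mem_cls)
qed

lemma cls_zero [simp]: "cls K 0 = K"
  by (simp add: set_eq_iff mem_cls)

lemma coset_map_cls:
  assumes "fsv.subspace K" "\<And>k. k \<in> K \<Longrightarrow> h (v + k) - h v \<in> K"
  shows "coset_map K h (cls K v) = cls K (h v)"
proof
  show "coset_map K h (cls K v) \<subseteq> cls K (h v)"
  proof
    fix x assume "x \<in> coset_map K h (cls K v)"
    then obtain k k' where x: "x = h (v + k) + k'" "k \<in> K" "k' \<in> K" unfolding coset_map_def cls_def by auto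
    have "h (v + k) - h v + k' \<in> K" using fsv.subspace_add[OF assms(1) assms(2)[OF x(2)] x(3)] .
    moreover have "x - h v = h (v + k) - h v + k'" by (simp add: x(1))
    ultimately show "x \<in> cls K (h v)" unfolding mem_cls by (simp only:)
  qed
  show "cls K (h v) \<subseteq> coset_map K h (cls K v)"
  proof
    fix x assume "x \<in> cls K (h v)"
    then obtain k where "x = h v + k" "k \<in> K" by (auto simp: cls_def)
    moreover have "v \<in> cls K v" using fsv.subspace_0[OF assms(1)] by (simp add: mem_cls)
    ultimately show "x \<in> coset_map K h (cls K v)" unfolding coset_map_def by blast
  qed
qed

lemma quotient_space_add:
  assumes "fsv.subspace K"
  shows "cls K v \<oplus>\<^bsub>quotient_space V K\<^esub> cls K w = cls K (v + w)"
proof -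
  have "{a + b | a b. a \<in> cls K v \<and> b \<in> cls K w} = cls K (v + w)"
  proof
    show "{a + b | a b. a \<in> cls K v \<and> b \<in> cls K w} \<subseteq> cls K (v + w)"
    proof clarify
      fix a b assume "a \<in> cls K v" "b \<in> cls K w"
      then have "(a - v) + (b - w) \<in> K" unfolding mem_cls by (rule fsv.subspace_add[OF assms])
      then show "a + b \<in> cls K (v + w)" by (simp add: mem_cls algebra_simps)
    qed
    show "cls K (v + w) \<subseteq> {a + b | a b. a \<in> cls K v \<and> b \<in> cls K w}"
    proof
      fix x assume x: "x \<in> cls K (v + w)"
      have "x = v + (x - v)" "v \<in> cls K v" "x - v \<in> cls K w"
        using x fsv.subspace_0[OF assms] by (auto simp: mem_cls algebra_simps)
      then show "x \<in> {a + b | a b. a \<in> cls K v \<and> b \<in> cls K w}" by blast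
    qed
  qed
  then show ?thesis by (simp add: quotient_space_def)
qed

lemma quotient_space_smult:
  assumes "fsv.subspace K"
  shows "c \<odot>\<^bsub>quotient_space V K\<^esub> cls K v = cls K (cscale c v)"
proof -
  have "coset_map K (cscale c) (cls K v) = cls K (cscale c v)"
    by (rule coset_map_cls[OF assms]) (simp add: cscale_add_right fsv.subspace_scale[OF assms])
  then show ?thesis by (simp add: quotient_space_def)
qed

lemma quotient_space_carrier: "carrier (quotient_space V K) = cls K ` V"
  by (simp add: quotient_space_def cls_def[abs_def])

lemma quotient_space_zero: "\<zero>\<^bsub>quotient_space V K\<^esub> = K"
  by (simp add: quotient_space_def)

subsection \<open>The adjoint action of the Borel subgroup\<close>

lemma monomial_value_superset:
  assumes "finite K" "Poly_Mapping.keys \<mu> \<subseteq> K"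
  shows "(\<Prod>\<beta>\<in>Poly_Mapping.keys \<mu>. \<sigma> \<beta> ^ Poly_Mapping.lookup \<mu> \<beta>) = (\<Prod>\<beta>\<in>K. (\<sigma> \<beta> :: spoly) ^ Poly_Mapping.lookup \<mu> \<beta>)"
proof (rule prod.mono_neutral_left[OF assms], rule ballI)
  fix \<beta> assume "\<beta> \<in> K - Poly_Mapping.keys \<mu>"
  then have "Poly_Mapping.lookup \<mu> \<beta> = 0" by (simp add: in_keys_iff)
  then show "\<sigma> \<beta> ^ Poly_Mapping.lookup \<mu> \<beta> = 1" by simp
qed

lemma substitute_add: "substitute \<sigma> (p + q) = substitute \<sigma> p + substitute \<sigma> q"
  by (simp add: substitute_def linear_extension_add)

lemma substitute_cscale: "substitute \<sigma> (cscale c p) = cscale c (substitute \<sigma> p)"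
  by (simp add: substitute_def linear_extension_cscale)

lemma substitute_diff: "substitute \<sigma> (p - q) = substitute \<sigma> p - substitute \<sigma> q"
  by (simp add: substitute_def linear_extension_diff)

lemma substitute_sum: "substitute \<sigma> (\<Sum>a\<in>A. f a) = (\<Sum>a\<in>A. substitute \<sigma> (f a))"
  by (simp add: substitute_def linear_extension_sum)

lemma substitute_zero [simp]: "substitute \<sigma> 0 = 0"
  by (simp add: substitute_def)

lemma substitute_single:
  "substitute \<sigma> (Poly_Mapping.single \<mu> 1) = (\<Prod>\<beta>\<in>Poly_Mapping.keys \<mu>. \<sigma> \<beta> ^ Poly_Mapping.lookup \<mu> \<beta>)"
  by (simp add: substitute_def)

lemma substitute_one [simp]: "substitute \<sigma> 1 = 1"
  using substitute_single[of \<sigma> 0] by simp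

lemma substitute_fvar [simp]: "substitute \<sigma> (fvar \<beta>) = \<sigma> \<beta>"
  by (simp add: fvar_def substitute_single)

lemma substitute_mult: "substitute \<sigma> (p * q) = substitute \<sigma> p * substitute \<sigma> q"
proof -
  have mono: "substitute \<sigma> (Poly_Mapping.single \<mu> 1 * Poly_Mapping.single \<nu> 1) =
     substitute \<sigma> (Poly_Mapping.single \<mu> 1) * substitute \<sigma> (Poly_Mapping.single \<nu> 1)" for \<mu> \<nu>
  proof -
    let ?K = "Poly_Mapping.keys \<mu> \<union> Poly_Mapping.keys \<nu>"
    have "substitute \<sigma> (Poly_Mapping.single \<mu> 1 * Poly_Mapping.single \<nu> 1) = substitute \<sigma> (Poly_Mapping.single (\<mu> + \<nu>) 1)"
      by (simp add: mult_single)
    also have "\<dots> = (\<Prod>\<beta>\<in>?K. \<sigma> \<beta> ^ Poly_Mapping.lookup (\<mu> + \<nu>) \<beta>)"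
      unfolding substitute_single by (rule monomial_value_superset) (use keys_add[of \<mu> \<nu>] in auto)
    also have "\<dots> = (\<Prod>\<beta>\<in>?K. \<sigma> \<beta> ^ Poly_Mapping.lookup \<mu> \<beta>) * (\<Prod>\<beta>\<in>?K. \<sigma> \<beta> ^ Poly_Mapping.lookup \<nu> \<beta>)"
      by (simp add: lookup_add power_add prod.distrib)
    also have "\<dots> = substitute \<sigma> (Poly_Mapping.single \<mu> 1) * substitute \<sigma> (Poly_Mapping.single \<nu> 1)"
      unfolding substitute_single
      by (intro arg_cong2[of _ _ _ _ "(*)"]; rule monomial_value_superset[symmetric]) auto
    finally show ?thesis .
  qed
  have 1: "substitute \<sigma> (Poly_Mapping.single \<mu> 1 * q) = substitute \<sigma> (Poly_Mapping.single \<mu> 1) * substitute \<sigma> q" for \<mu>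
  proof -
    have "Poly_Mapping.keys q \<subseteq> UNIV" by simp
    then show ?thesis
      by (induction q rule: free_space_induct)
        (simp_all add: mono distrib_left substitute_add cscale_mult_right substitute_cscale)
  qed
  have "Poly_Mapping.keys p \<subseteq> UNIV" by simp
  then show ?thesis
    by (induction p rule: free_space_induct)
      (simp_all add: 1 distrib_right substitute_add cscale_mult_left substitute_cscale)
qed

lemma substitute_power: "substitute \<sigma> (p ^ k) = substitute \<sigma> p ^ k"
  by (induction k) (simp_all add: substitute_mult)

lemma class_mod_b_sym_alg: "class_mod_b n A \<in> sym_alg n"
  unfolding class_mod_b_def
  by (intro fsv.subspace_sum[OF subspace_sym_alg] fsv.subspace_scale[OF subspace_sym_alg] fvar_in_sym_alg)

lemma Ad_action_sym_alg: "p \<in> sym_alg n \<Longrightarrow> Ad_action n b p \<in> sym_alg n"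
  unfolding Ad_action_def
  by (induction p rule: sym_alg_induct)
    (auto simp: substitute_add substitute_cscale substitute_mult class_mod_b_sym_alg
      intro!: fsv.subspace_add[OF subspace_sym_alg] fsv.subspace_scale[OF subspace_sym_alg] sym_alg_mult)

lemma upper_triangular_inverse:
  fixes b c :: "complex mat"
  assumes b: "b \<in> carrier_mat n n" "upper_triangular b" "\<And>k. k < n \<Longrightarrow> b $$ (k, k) \<noteq> 0"
    and c: "c \<in> carrier_mat n n" "b * c = 1\<^sub>m n"
  shows "upper_triangular c"
proof -
  have "c $$ (r, k) = 0" if "k < r" "r < n" for r k
    using that
  proof (induction "n - r" arbitrary: r rule: less_induct)
    case less
    have "0 = (b * c) $$ (r, k)" using less.prems c by simp
    also have "\<dots> = (\<Sum>l\<in>{0..<n}. b $$ (r, l) * c $$ (l, k))"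
      using less.prems b(1) c(1) by (simp add: scalar_prod_def)
    also have "\<dots> = (\<Sum>l\<in>{0..<n}. if l = r then b $$ (r, r) * c $$ (r, k) else 0)"
    proof (rule sum.cong[OF refl])
      fix l assume "l \<in> {0..<n}"
      then consider "l < r" | "l = r" | "r < l" "l < n" by force
      then show "b $$ (r, l) * c $$ (l, k) = (if l = r then b $$ (r, r) * c $$ (r, k) else 0)"
      proof cases
        case 1
        then have "b $$ (r, l) = 0" using b less.prems by (intro upper_triangularD) auto
        then show ?thesis using 1 by simp
      next
        case 3
        then have "c $$ (l, k) = 0" using less.prems by (intro less.hyps) auto
        then show ?thesis using 3 by simp
      qed simp
    qed
    also have "\<dots> = b $$ (r, r) * c $$ (r, k)" using less.prems by simp
    finally show ?case using b(3) less.prems by simp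
  qed
  then show ?thesis using c(1) by (auto simp: upper_triangular_def)
qed

lemma borel_group_inverse:
  assumes b: "b \<in> borel_group n"
  obtains b' where "the (mat_inverse b) = b'" "b' \<in> carrier_mat n n" "upper_triangular b'" "b * b' = 1\<^sub>m n"
proof -
  have b': "b \<in> carrier_mat n n" "upper_triangular b" "det b = 1" using b by (auto simp: borel_group_def)
  have "b \<in> Units (ring_mat TYPE(complex) n ())"
    by (rule det_non_zero_imp_unit[OF b'(1)]) (simp add: b')
  then obtain c where c: "mat_inverse b = Some c"
    using mat_inverse(1)[OF b'(1), of "()"] by (cases "mat_inverse b") auto
  have bc: "b * c = 1\<^sub>m n" "c \<in> carrier_mat n n" using mat_inverse(2)[OF b'(1) c] by auto
  have "prod_list (diag_mat b) = 1" using det_upper_triangular[OF b'(2,1)] b'(3) by simp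
  then have "\<forall>x\<in>set (diag_mat b). x \<noteq> 0" by (metis prod_list_zero_iff zero_neq_one)
  then have "b $$ (k, k) \<noteq> 0" if "k < n" for k
    using that b'(1) by (auto simp: diag_mat_def)
  then have "upper_triangular c" using b' bc by (intro upper_triangular_inverse[of b n c]) auto
  then show ?thesis using that[of c] c bc by simp
qed

lemma Ad_action_gvar:
  assumes b: "b \<in> borel_group n" "the (mat_inverse b) = b'" "b' \<in> carrier_mat n n" "upper_triangular b'"
    and xy: "x \<in> {1..n-1}" "y \<in> {1..n-1}"
  shows "Ad_action n b (gvar n x y) =
    (\<Sum>c\<in>{1..n-1}. \<Sum>r\<in>{1..n-1}. cscale (b $$ (r, y) * b' $$ (x - 1, c - 1)) (gvar n c r))"
proof (cases "x \<le> y")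
  case True
  then have pos: "(x, y) \<in> pos_roots n" using xy by (auto simp: pos_roots_def)
  have bc: "b \<in> carrier_mat n n" using b by (simp add: borel_group_def)
  let ?E = "root_vector n (x, y)"
  have entry: "(b * ?E * b') $$ (r, c) = b $$ (r, y) * b' $$ (x - 1, c)" if "r < n" "c < n" for r c
  proof -
    have "(b * ?E * b') $$ (r, c) = (\<Sum>k\<in>{0..<n}. (b * ?E) $$ (r, k) * b' $$ (k, c))"
      using that bc b(3) by (simp add: scalar_prod_def root_vector_def)
    also have "\<dots> = (\<Sum>k\<in>{0..<n}. if k = x - 1 then b $$ (r, y) * b' $$ (k, c) else 0)"
      by (rule sum.cong) (use that mult_root_vector_entry(1)[OF bc pos that(1)] in auto)
    also have "\<dots> = b $$ (r, y) * b' $$ (x - 1, c)"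
    proof -
      have "x - 1 < n" using xy by auto
      then show ?thesis by simp
    qed
    finally show ?thesis .
  qed
  have "Ad_action n b (gvar n x y) = class_mod_b n (b * ?E * b')"
    using pos by (simp add: gvar_def Ad_action_def b(2))
  also have "\<dots> = (\<Sum>\<beta>\<in>pos_roots n. cscale (b $$ (snd \<beta>, y) * b' $$ (x - 1, fst \<beta> - 1)) (fvar \<beta>))"
    unfolding class_mod_b_def by (rule sum.cong) (auto simp: entry pos_roots_def)
  finally show ?thesis by (simp only: sum_pos_roots_gvar[of "\<lambda>c r. b $$ (r, y) * b' $$ (x - 1, c - 1)"])
next
  case False
  have bu: "b \<in> carrier_mat n n" "upper_triangular b" using b by (auto simp: borel_group_def)
  have "cscale (b $$ (r, y) * b' $$ (x - 1, c - 1)) (gvar n c r) = 0" if "c \<in> {1..n-1}" "r \<in> {1..n-1}" for c r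
  proof -
    consider "y < r" | "c < x" | "r < c" using False by linarith
    then show ?thesis
    proof cases
      case 1
      then have "b $$ (r, y) = 0" using bu that by (intro upper_triangularD) auto
      then show ?thesis by simp
    next
      case 2
      then have "b' $$ (x - 1, c - 1) = 0" using b that xy by (intro upper_triangularD) auto
      then show ?thesis by simp
    qed (simp add: gvar_zero)
  qed
  then have "(\<Sum>c\<in>{1..n-1}. \<Sum>r\<in>{1..n-1}. cscale (b $$ (r, y) * b' $$ (x - 1, c - 1)) (gvar n c r)) = 0"
    by (intro sum.neutral ballI) 
  then show ?thesis using False by (simp add: gvar_zero Ad_action_def)
qed

text \<open>The adjoint action multiplies the generic matrix by matrices from both sides, and the
  permanent is bilinear in the rows and in the columns. In the second product the summation
  indices have to be renamed before the sums match.\<close>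

lemma Ad_action_permanent:
  assumes b: "b \<in> borel_group n" "the (mat_inverse b) = b'" "b' \<in> carrier_mat n n" "upper_triangular b'"
    and I: "{x, y, x', y'} \<subseteq> {1..n-1}"
  shows "Ad_action n b (permanent n x y x' y') =
    (\<Sum>c\<in>{1..n-1}. \<Sum>r\<in>{1..n-1}. \<Sum>c'\<in>{1..n-1}. \<Sum>r'\<in>{1..n-1}.
       cscale (b $$ (r, y) * b' $$ (x - 1, c - 1) * (b $$ (r', y') * b' $$ (x' - 1, c' - 1))) (permanent n c r c' r'))"
proof -
  let ?N = "{1..n-1}"
  let ?b = "\<lambda>r y. b $$ (r, y)" and ?b' = "\<lambda>x c. b' $$ (x - 1, c - 1)"
  have Ad: "Ad_action n b (gvar n x y) = (\<Sum>c\<in>?N. \<Sum>r\<in>?N. cscale (?b r y * ?b' x c) (gvar n c r))" if "{x, y} \<subseteq> ?N" for x y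
    by (rule Ad_action_gvar[OF b]) (use that in auto)
  have prod: "Ad_action n b (gvar n x y * gvar n x' y') = (\<Sum>c\<in>?N. \<Sum>r\<in>?N. \<Sum>c'\<in>?N. \<Sum>r'\<in>?N.
       cscale (?b r y * ?b' x c * (?b r' y' * ?b' x' c')) (gvar n c r * gvar n c' r'))" if "{x, y, x', y'} \<subseteq> ?N" for x y x' y'
  proof -
    have "Ad_action n b (gvar n x y * gvar n x' y') = Ad_action n b (gvar n x y) * Ad_action n b (gvar n x' y')"
      by (simp add: Ad_action_def substitute_mult)
    also have "\<dots> = (\<Sum>c\<in>?N. \<Sum>r\<in>?N. cscale (?b r y * ?b' x c) (gvar n c r)) *
        (\<Sum>c'\<in>?N. \<Sum>r'\<in>?N. cscale (?b r' y' * ?b' x' c') (gvar n c' r'))"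
      using that by (simp only: Ad insert_subset)
    finally show ?thesis
      by (simp only: sum_distrib_right, simp only: sum_distrib_left cscale_mult_left cscale_mult_right fsv.scale_scale,
        (simp only: mult_ac)?)
  qed
  have "Ad_action n b (permanent n x y x' y') = Ad_action n b (gvar n x y * gvar n x' y') + Ad_action n b (gvar n x y' * gvar n x' y)"
    by (simp add: permanent_def Ad_action_def substitute_add)
  moreover have "Ad_action n b (gvar n x y' * gvar n x' y) = (\<Sum>c\<in>?N. \<Sum>r\<in>?N. \<Sum>c'\<in>?N. \<Sum>r'\<in>?N.
       cscale (?b r y * ?b' x c * (?b r' y' * ?b' x' c')) (gvar n c r' * gvar n c' r))"
  proof -
    have "Ad_action n b (gvar n x y' * gvar n x' y) = (\<Sum>c\<in>?N. \<Sum>r'\<in>?N. \<Sum>c'\<in>?N. \<Sum>r\<in>?N.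
       cscale (?b r' y' * ?b' x c * (?b r y * ?b' x' c')) (gvar n c r' * gvar n c' r))"
      by (rule prod) (use I in auto)
    also have "\<dots> = (\<Sum>c\<in>?N. \<Sum>r'\<in>?N. \<Sum>r\<in>?N. \<Sum>c'\<in>?N.
       cscale (?b r' y' * ?b' x c * (?b r y * ?b' x' c')) (gvar n c r' * gvar n c' r))"
      by (intro sum.cong refl sum.swap)
    also have "\<dots> = (\<Sum>c\<in>?N. \<Sum>r\<in>?N. \<Sum>r'\<in>?N. \<Sum>c'\<in>?N.
       cscale (?b r' y' * ?b' x c * (?b r y * ?b' x' c')) (gvar n c r' * gvar n c' r))"
      by (intro sum.cong refl sum.swap)
    also have "\<dots> = (\<Sum>c\<in>?N. \<Sum>r\<in>?N. \<Sum>c'\<in>?N. \<Sum>r'\<in>?N.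
       cscale (?b r' y' * ?b' x c * (?b r y * ?b' x' c')) (gvar n c r' * gvar n c' r))"
      by (intro sum.cong refl sum.swap)
    finally show ?thesis by (simp add: mult_ac)
  qed
  ultimately show ?thesis
    unfolding prod[OF I] permanent_def by (simp add: cscale_add_right sum.distrib)
qed

context positive_root
begin

lemma Ad_action_J:
  assumes b: "b \<in> borel_group n" and q: "q \<in> J"
  shows "Ad_action n b q \<in> J"
proof -
  obtain b' where b': "the (mat_inverse b) = b'" "b' \<in> carrier_mat n n" "upper_triangular b'" "b * b' = 1\<^sub>m n"
    using borel_group_inverse[OF b] .
  have bu: "b \<in> carrier_mat n n" "upper_triangular b" using b by (auto simp: borel_group_def)
  have gen: "Ad_action n b g \<in> J" if g: "g \<in> explicit_gens n (i, j)" for g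
  proof -
    consider (perm) x y x' y' where "{x, y, x', y'} \<subseteq> {1..n-1}" "g = permanent n x y x' y'"
      | (var) x y where "{x, y} \<subseteq> {1..n-1}" "\<not> (x \<le> i \<and> j \<le> y)" "g = gvar n x y"
      using g unfolding explicit_gens_def fst_conv snd_conv by blast
    then show ?thesis
    proof cases
      case perm
      show ?thesis unfolding perm(2) Ad_action_permanent[OF b b'(1-3) perm(1)]
        by (intro J_sum J_scale permanent_in_J) auto
    next
      case var
      have xy: "x \<in> {1..n-1}" "y \<in> {1..n-1}" using var by auto
      have "cscale (b $$ (r, y) * b' $$ (x - 1, c - 1)) (gvar n c r) \<in> J" if "c \<in> {1..n-1}" "r \<in> {1..n-1}" for c r
      proof -
        consider "y < r" | "c < x" | "\<not> (c \<le> i \<and> j \<le> r)" using var(2) by linarith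
        then show ?thesis
        proof cases
          case 1
          then have "b $$ (r, y) = 0" using bu that by (intro upper_triangularD) auto
          then show ?thesis using J_zero by simp
        next
          case 2
          then have "b' $$ (x - 1, c - 1) = 0" using b' that xy by (intro upper_triangularD) auto
          then show ?thesis using J_zero by simp
        next
          case 3
          then show ?thesis by (intro J_scale gvar_in_J)
        qed
      qed
      then show ?thesis unfolding var(3) Ad_action_gvar[OF b b'(1-3) xy] by (intro J_sum)
    qed
  qed
  show ?thesis using q unfolding J_explicit
  proof (induction rule: fsv.span_induct_alt)
    case base
    then show ?case by (simp add: Ad_action_def fsv.span_zero)
  next
    case (step c x y)
    then obtain p g where x: "x = p * g" "p \<in> sym_alg n" "g \<in> explicit_gens n (i, j)" by auto
    have "Ad_action n b x = Ad_action n b p * Ad_action n b g" by (simp add: x Ad_action_def substitute_mult)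
    moreover have "Ad_action n b p * Ad_action n b g \<in> J"
      using x by (intro J_mult gen Ad_action_sym_alg)
    ultimately show ?case using step J_explicit
      by (simp add: Ad_action_def substitute_add substitute_cscale fsv.span_add fsv.span_scale)
  qed
qed

lemma exp_sum:
  shows exp_term_high: "k > card (pos_roots n) \<Longrightarrow> exp_term (nil_elem n c) k \<in> J"
    and exp_sum_eq: "(\<Sum>k\<le>card (pos_roots n). exp_term (nil_elem n c) k) - exp_product n c \<in> J"
  using exp_sum_product[of "pos_roots n" c] by (auto simp: nil_elem_def exp_product_def)

text \<open>The sum in \<open>exp_action\<close> depends on the argument, as it runs over the nonzero terms only.
  Modulo the ideal it can be replaced by a sum over a fixed range, for all arguments at once.\<close>

lemma exp_action_eq:
  "exp_action n (i, j) (nil_elem n c) (cls J 1) = cls J (exp_product n c)"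
proof -
  let ?x = "nil_elem n c" and ?N = "card (pos_roots n)"
  let ?h = "\<lambda>p. \<Sum>k | ?x ^ k * p \<notin> J. cscale (1 / fact k) (?x ^ k * p)"
  have h: "?h p - exp_product n c * p \<in> J" if p: "p \<in> sym_alg n" for p
  proof -
    have sub: "{k. ?x ^ k * p \<notin> J} \<subseteq> {..?N}"
    proof
      fix k assume k: "k \<in> {k. ?x ^ k * p \<notin> J}"
      show "k \<in> {..?N}"
      proof (rule ccontr)
        assume "k \<notin> {..?N}"
        then have "cscale (fact k) (exp_term ?x k) \<in> J" by (intro J_scale exp_term_high) simp
        then have "?x ^ k \<in> J" by simp
        then show False using k J_mult'[OF p] by blast
      qed
    qed
    have "(\<Sum>k\<le>?N. cscale (1 / fact k) (?x ^ k * p)) - ?h p = (\<Sum>k\<in>{..?N} - {k. ?x ^ k * p \<notin> J}. cscale (1 / fact k) (?x ^ k * p))"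
      using sub by (simp add: sum_diff finite_subset)
    also have "\<dots> \<in> J" by (intro J_sum J_scale) auto
    finally have 1: "(\<Sum>k\<le>?N. cscale (1 / fact k) (?x ^ k * p)) - ?h p \<in> J" .
    have "((\<Sum>k\<le>?N. exp_term ?x k) - exp_product n c) * p \<in> J"
      by (rule J_mult'[OF p exp_sum_eq])
    then have 2: "(\<Sum>k\<le>?N. cscale (1 / fact k) (?x ^ k * p)) - exp_product n c * p \<in> J"
      by (simp add: left_diff_distrib sum_distrib_right cscale_mult_left)
    show ?thesis using J_diff[OF 2 1] by simp
  qed
  have "coset_map J ?h (cls J 1) = cls J (?h 1)"
  proof (rule coset_map_cls[OF J_subspace])
    fix k assume k: "k \<in> J"
    then have ks: "k \<in> sym_alg n" using J_subset by blast
    have alg: "(X - e * (1 + k)) - (Y - e * 1) + e * k = X - Y" for X Y e :: spoly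
      by (simp add: algebra_simps)
    have 1: "?h (1 + k) - exp_product n c * (1 + k) \<in> J"
      by (rule h) (intro fsv.subspace_add[OF subspace_sym_alg] one_in_sym_alg ks)
    have 2: "?h 1 - exp_product n c * 1 \<in> J" by (rule h) simp
    have 3: "exp_product n c * k \<in> J" by (rule J_mult[OF exp_product_sym_alg k])
    show "?h (1 + k) - ?h 1 \<in> J"
      using J_add[OF J_diff[OF 1 2] 3] unfolding alg .
  qed
  also have "\<dots> = cls J (exp_product n c)"
    using h[OF one_in_sym_alg] by (simp add: cls_eq_iff[OF J_subspace])
  finally show ?thesis by (simp add: exp_action_def)
qed

text \<open>\<open>Ad b\<close> is an algebra automorphism that preserves the ideal, so it carries \<open>exp x\<close> to
  \<open>exp (Ad b x)\<close>. What remains of \<open>b\<close> is its character.\<close>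

theorem group_action_highest_weight:
  assumes b: "b \<in> borel_group n" and c': "Ad_action n b (nil_elem n c) = nil_elem n c'"
  shows "group_action n (i, j) (b, nil_elem n c) (root_module_vec n (i, j)) =
    cls J (cscale (\<Prod>k<i. b $$ (k, k)) (exp_product n c'))"
proof -
  let ?\<chi> = "\<Prod>k<i. b $$ (k, k)" and ?N = "card (pos_roots n)"
  have "group_action n (i, j) (b, nil_elem n c) (root_module_vec n (i, j)) =
     coset_map J (\<lambda>p. cscale ?\<chi> (Ad_action n b p)) (cls J (exp_product n c))"
    unfolding group_action_def fst_conv snd_conv root_module_vec_def cls_def[symmetric] exp_action_eq borel_action_def ..
  also have "\<dots> = cls J (cscale ?\<chi> (Ad_action n b (exp_product n c)))"
  proof (rule coset_map_cls[OF J_subspace])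
    fix k assume "k \<in> J"
    then have "cscale ?\<chi> (Ad_action n b k) \<in> J" by (intro J_scale Ad_action_J b)
    then show "cscale ?\<chi> (Ad_action n b (exp_product n c + k)) - cscale ?\<chi> (Ad_action n b (exp_product n c)) \<in> J"
      by (simp add: Ad_action_def substitute_add cscale_add_right)
  qed
  also have "\<dots> = cls J (cscale ?\<chi> (exp_product n c'))"
  proof -
    have "Ad_action n b ((\<Sum>k\<le>?N. exp_term (nil_elem n c) k) - exp_product n c) \<in> J"
      by (rule Ad_action_J[OF b exp_sum_eq])
    then have "(\<Sum>k\<le>?N. exp_term (nil_elem n c') k) - Ad_action n b (exp_product n c) \<in> J"
      by (simp add: Ad_action_def substitute_diff substitute_sum substitute_cscale substitute_power c'[unfolded Ad_action_def])
    from J_diff[OF exp_sum_eq[of c'] this] have "Ad_action n b (exp_product n c) - exp_product n c' \<in> J" by simp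
    then show ?thesis
      using J_scale[of _ ?\<chi>] by (simp add: cls_eq_iff[OF J_subspace] flip: cscale_diff_right)
  qed
  finally show ?thesis .
qed

end

lemma nilrad_eq: "nilrad n = range (nil_elem n)"
proof
  have "fsv.subspace (range (nil_elem n))"
    unfolding fsv.subspace_def
  proof (intro conjI ballI allI)
    show "0 \<in> range (nil_elem n)" by (rule image_eqI[of _ _ "\<lambda>_. 0"]) (simp_all add: nil_elem_def)
  next
    fix x y assume "x \<in> range (nil_elem n)" "y \<in> range (nil_elem n)"
    then obtain c d where "x = nil_elem n c" "y = nil_elem n d" by auto
    then have "x + y = nil_elem n (\<lambda>\<beta>. c \<beta> + d \<beta>)" by (simp add: nil_elem_def fsv.scale_left_distrib sum.distrib)
    then show "x + y \<in> range (nil_elem n)" by (metis rangeI)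
  next
    fix k x assume "x \<in> range (nil_elem n)"
    then obtain c where "x = nil_elem n c" by auto
    then have "cscale k x = nil_elem n (\<lambda>\<beta>. k * c \<beta>)" by (simp add: nil_elem_def fsv.scale_sum_right)
    then show "cscale k x \<in> range (nil_elem n)" by (metis rangeI)
  qed
  moreover have "fvar ` pos_roots n \<subseteq> range (nil_elem n)"
  proof clarify
    fix \<alpha> assume a: "\<alpha> \<in> pos_roots n"
    have "nil_elem n (\<lambda>\<beta>. if \<beta> = \<alpha> then 1 else 0) = (\<Sum>\<beta>\<in>pos_roots n. if \<beta> = \<alpha> then fvar \<beta> else 0)"
      unfolding nil_elem_def by (rule sum.cong) auto
    then have "fvar \<alpha> = nil_elem n (\<lambda>\<beta>. if \<beta> = \<alpha> then 1 else 0)" using a by simp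
    then show "fvar \<alpha> \<in> range (nil_elem n)" by (metis rangeI)
  qed
  ultimately show "nilrad n \<subseteq> range (nil_elem n)" unfolding nilrad_def by (intro fsv.span_minimal)
  show "range (nil_elem n) \<subseteq> nilrad n"
    unfolding nilrad_def nil_elem_def by (auto intro!: fsv.span_sum fsv.span_scale intro: fsv.span_base)
qed

lemma Ad_action_nil_elem: "\<exists>c'. Ad_action n b (nil_elem n c) = nil_elem n c'"
proof -
  have "Ad_action n b (nil_elem n c) \<in> nilrad n"
    unfolding Ad_action_def nil_elem_def substitute_sum substitute_cscale substitute_fvar class_mod_b_def nilrad_def
    by (intro fsv.span_sum fsv.span_scale fsv.span_base imageI)
  then show ?thesis by (auto simp: nilrad_eq)
qed

lemma one_in_borel_group: "1\<^sub>m n \<in> borel_group n"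
  by (simp add: borel_group_def)

lemma Ad_action_one: "Ad_action n (1\<^sub>m n) (nil_elem n c) = nil_elem n c"
proof -
  obtain b' where b': "the (mat_inverse (1\<^sub>m n :: complex mat)) = b'" "b' \<in> carrier_mat n n" "1\<^sub>m n * b' = 1\<^sub>m n"
    using borel_group_inverse[OF one_in_borel_group, of n] by metis
  then have inv: "the (mat_inverse (1\<^sub>m n)) = (1\<^sub>m n :: complex mat)" by simp
  have "Ad_action n (1\<^sub>m n) (fvar \<beta>) = fvar \<beta>" if \<beta>: "\<beta> \<in> pos_roots n" for \<beta>
  proof -
    have "class_mod_b n (1\<^sub>m n * root_vector n \<beta> * 1\<^sub>m n) = (\<Sum>\<gamma>\<in>pos_roots n. if \<gamma> = \<beta> then fvar \<gamma> else 0)"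
      unfolding class_mod_b_def
    proof (rule sum.cong[OF refl])
      fix \<gamma> assume \<gamma>: "\<gamma> \<in> pos_roots n"
      have 1: "1\<^sub>m n * root_vector n \<beta> * 1\<^sub>m n = root_vector n \<beta>"
        using left_mult_one_mat[OF root_vector_carrier, of n \<beta>] right_mult_one_mat[OF root_vector_carrier, of n \<beta>] by simp
      have "snd \<gamma> < n" "fst \<gamma> - 1 < n" "(snd \<gamma> = snd \<beta> \<and> fst \<gamma> - 1 = fst \<beta> - 1) = (\<gamma> = \<beta>)"
        using \<gamma> \<beta> by (auto simp: pos_roots_def)
      then have "root_vector n \<beta> $$ (snd \<gamma>, fst \<gamma> - 1) = (if \<gamma> = \<beta> then 1 else 0)"
        unfolding root_vector_def by simp
      then show "cscale ((1\<^sub>m n * root_vector n \<beta> * 1\<^sub>m n) $$ (snd \<gamma>, fst \<gamma> - 1)) (fvar \<gamma>) = (if \<gamma> = \<beta> then fvar \<gamma> else 0)"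
        unfolding 1 by simp
    qed
    then show ?thesis using \<beta> by (simp add: Ad_action_def inv)
  qed
  then show ?thesis
    unfolding nil_elem_def Ad_action_def substitute_sum substitute_cscale by (intro sum.cong) auto
qed

section \<open>Tensor products of quotient spaces\<close>

definition linear_form :: "(('x \<Rightarrow>\<^sub>0 complex) \<Rightarrow> complex) \<Rightarrow> bool" where
  "linear_form l \<longleftrightarrow> (\<forall>x y. l (x + y) = l x + l y) \<and> (\<forall>c x. l (cscale c x) = c * l x)"

lemma linear_formD:
  assumes "linear_form l"
  shows "l (x + y) = l x + l y" "l (cscale c x) = c * l x" "l 0 = 0" "l (x - y) = l x - l y"
proof -
  show add: "l (x + y) = l x + l y" and sc: "l (cscale c x) = c * l x" for x y c
    using assms by (auto simp: linear_form_def)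
  show "l 0 = 0" using sc[of 0 0] by simp
  have "l (x - y) + l y = l x" by (simp flip: add)
  then show "l (x - y) = l x - l y" by (simp add: algebra_simps)
qed

lemma linear_form_sum: "linear_form l \<Longrightarrow> l (\<Sum>a\<in>A. f a) = (\<Sum>a\<in>A. l (f a))"
  by (induction A rule: infinite_finite_induct) (auto simp: linear_formD)

lemma linear_form_dual_ext: "linear_form (dual_ext h)"
  by (simp add: linear_form_def dual_ext_add dual_ext_cscale)

lemma independent_form:
  fixes B :: "('x \<Rightarrow>\<^sub>0 complex) set"
  assumes "fsv.independent B"
  shows "\<exists>l. linear_form l \<and> (\<forall>x\<in>B. l x = f x)"
proof -
  interpret cc: vector_space "(*) :: complex \<Rightarrow> complex \<Rightarrow> complex"
    by standard (auto simp: algebra_simps)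
  interpret vector_space_pair "cscale :: complex \<Rightarrow> ('x \<Rightarrow>\<^sub>0 complex) \<Rightarrow> _" "(*) :: complex \<Rightarrow> complex \<Rightarrow> complex" ..
  obtain g where g: "Vector_Spaces.linear cscale (*) g" "\<forall>x\<in>B. g x = f x"
    using linear_independent_extend[OF assms, of f] by blast
  interpret g: Vector_Spaces.linear cscale "(*)" g by (rule g(1))
  show ?thesis using g(2) by (intro exI[of _ g]) (auto simp: linear_form_def g.add g.scale)
qed

lemma separating_form:
  fixes U :: "('x \<Rightarrow>\<^sub>0 complex) set"
  assumes "fsv.subspace U" "v \<notin> U"
  obtains l where "linear_form l" "\<And>u. u \<in> U \<Longrightarrow> l u = 0" "l v = 1"
proof -
  obtain B where B: "B \<subseteq> U" "fsv.independent B" "U \<subseteq> fsv.span B"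
    using fsv.maximal_independent_subset[of U] by blast
  have span: "fsv.span B \<subseteq> U" using B(1) assms(1) by (rule fsv.span_minimal)
  then have "fsv.independent (insert v B)"
    using B(2) assms(2) by (intro fsv.independent_insertI) auto
  then obtain l where l: "linear_form l" "\<forall>x\<in>insert v B. l x = (if x = v then 1 else 0)"
    using independent_form[of "insert v B" "\<lambda>x. if x = v then 1 else 0"] by blast
  have "l u = 0" if "u \<in> U" for u
  proof -
    have "u \<in> fsv.span B" using that B(3) by blast
    then show ?thesis
    proof (induction rule: fsv.span_induct_alt)
      case (step c x y)
      have "l x = 0" using step(1) l(2) B(1) assms(2) by auto
      then show ?case using step linear_formD[OF l(1)] by simp
    qed (simp add: linear_formD[OF l(1)])
  qed
  then show ?thesis using that[of l] l by simp
qed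

lemma extend_form:
  fixes U :: "('x \<Rightarrow>\<^sub>0 complex) set"
  assumes "fsv.subspace U" "\<And>x y. x \<in> U \<Longrightarrow> y \<in> U \<Longrightarrow> l (x + y) = l x + l y"
    "\<And>c x. x \<in> U \<Longrightarrow> l (cscale c x) = c * l x"
  obtains l' where "linear_form l'" "\<And>u. u \<in> U \<Longrightarrow> l' u = (l u :: complex)"
proof -
  obtain B where B: "B \<subseteq> U" "fsv.independent B" "U \<subseteq> fsv.span B"
    using fsv.maximal_independent_subset[of U] by blast
  obtain l' where l': "linear_form l'" "\<forall>x\<in>B. l' x = l x"
    using independent_form[OF B(2), of l] by blast
  have "u \<in> U \<and> l' u = l u" if "u \<in> U" for u
  proof -
    have "u \<in> fsv.span B" using that B(3) by blast
    then show ?thesis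
    proof (induction rule: fsv.span_induct_alt)
      case base
      have "l 0 = 0" using assms(3)[of 0 0] fsv.subspace_0[OF assms(1)] by simp
      then show ?case using fsv.subspace_0[OF assms(1)] linear_formD[OF l'(1)] by simp
    next
      case (step c x y)
      have x: "x \<in> U" "l' x = l x" using step(1) B(1) l'(2) by auto
      then have "cscale c x \<in> U" by (intro fsv.subspace_scale[OF assms(1)])
      then show ?case
        using step x fsv.subspace_add[OF assms(1)] by (simp add: linear_formD[OF l'(1)] assms(2,3))
    qed
  qed
  then show ?thesis using that[of l'] l'(1) by blast
qed

lemma quotient_space_submodule:
  assumes V: "fsv.subspace V" and K: "fsv.subspace K" "K \<subseteq> V"
  shows "submodule (carrier (quotient_space V K)) complex_ring (quotient_space V K)"
proof -
  let ?Q = "quotient_space V K"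
  have inv: "\<ominus>\<^bsub>?Q\<^esub> cls K v = cls K (- v)" if "v \<in> V" for v
    unfolding a_inv_def m_inv_def
  proof (rule the_equality)
    have "- v \<in> V" by (rule fsv.subspace_neg[OF V that])
    then show "cls K (- v) \<in> carrier (add_monoid ?Q) \<and> cls K v \<otimes>\<^bsub>add_monoid ?Q\<^esub> cls K (- v) = \<one>\<^bsub>add_monoid ?Q\<^esub> \<and>
        cls K (- v) \<otimes>\<^bsub>add_monoid ?Q\<^esub> cls K v = \<one>\<^bsub>add_monoid ?Q\<^esub>"
      by (simp add: quotient_space_carrier quotient_space_zero quotient_space_add[OF K(1)])
  next
    fix y assume y: "y \<in> carrier (add_monoid ?Q) \<and> cls K v \<otimes>\<^bsub>add_monoid ?Q\<^esub> y = \<one>\<^bsub>add_monoid ?Q\<^esub> \<and>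
        y \<otimes>\<^bsub>add_monoid ?Q\<^esub> cls K v = \<one>\<^bsub>add_monoid ?Q\<^esub>"
    then obtain w where w: "y = cls K w" "w \<in> V" by (auto simp: quotient_space_carrier)
    have "cls K (v + w) = cls K 0"
      using y unfolding w(1) by (simp add: quotient_space_zero quotient_space_add[OF K(1)])
    then have "v + w - 0 \<in> K" using cls_eq_iff[OF K(1)] by blast
    then have "w - - v \<in> K" by (simp add: add.commute)
    then show "y = cls K (- v)" unfolding w(1) using cls_eq_iff[OF K(1)] by blast
  qed
  show ?thesis
  proof
    show "carrier ?Q \<subseteq> carrier (add_monoid ?Q)" by simp
    show "x \<otimes>\<^bsub>add_monoid ?Q\<^esub> y \<in> carrier ?Q" if "x \<in> carrier ?Q" "y \<in> carrier ?Q" for x y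
      using that fsv.subspace_add[OF V] quotient_space_add[OF K(1)] unfolding quotient_space_carrier by auto
    show "\<one>\<^bsub>add_monoid ?Q\<^esub> \<in> carrier ?Q"
      using fsv.subspace_0[OF V] by (simp add: quotient_space_carrier quotient_space_zero image_iff) (metis cls_zero)
    show "inv\<^bsub>add_monoid ?Q\<^esub> x \<in> carrier ?Q" if x: "x \<in> carrier ?Q" for x
    proof -
      obtain v where v: "x = cls K v" "v \<in> V" using x by (auto simp: quotient_space_carrier)
      then show ?thesis using inv[OF v(2)] fsv.subspace_neg[OF V v(2)] by (simp add: quotient_space_carrier a_inv_def)
    qed
    show "a \<odot>\<^bsub>?Q\<^esub> x \<in> carrier ?Q" if "a \<in> carrier complex_ring" "x \<in> carrier ?Q" for a x
      using that fsv.subspace_scale[OF V] quotient_space_smult[OF K(1)] unfolding quotient_space_carrier by auto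
  qed
qed

text \<open>Tensors of classes are handled through families \<open>q\<close> of representatives: \<open>tens q\<close> is the
  basis vector of the free space that belongs to the tuple of classes, and \<open>T\<close> is the space of
  multilinearity relations.\<close>

locale quotient_family =
  fixes S :: "'j set" and V K :: "'j \<Rightarrow> ('x \<Rightarrow>\<^sub>0 complex) set"
  assumes finite_S: "finite S"
    and V_sub: "j \<in> S \<Longrightarrow> fsv.subspace (V j)"
    and K_sub: "j \<in> S \<Longrightarrow> fsv.subspace (K j)"
    and K_V: "j \<in> S \<Longrightarrow> K j \<subseteq> V j"
begin

abbreviation "Q \<equiv> \<lambda>j. quotient_space (V j) (K j)"
abbreviation "T \<equiv> tensor_relations S Q"

definition ambient :: "(('j \<Rightarrow> ('x \<Rightarrow>\<^sub>0 complex) set) \<Rightarrow>\<^sub>0 complex) set" where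
  "ambient = {t. Poly_Mapping.keys t \<subseteq> (\<Pi>\<^sub>E j\<in>S. carrier (Q j))}"

definition ptuple :: "('j \<Rightarrow> 'x \<Rightarrow>\<^sub>0 complex) \<Rightarrow> 'j \<Rightarrow> ('x \<Rightarrow>\<^sub>0 complex) set" where
  "ptuple q = (\<lambda>j\<in>S. cls (K j) (q j))"

definition tens :: "('j \<Rightarrow> 'x \<Rightarrow>\<^sub>0 complex) \<Rightarrow> ('j \<Rightarrow> ('x \<Rightarrow>\<^sub>0 complex) set) \<Rightarrow>\<^sub>0 complex" where
  "tens q = Poly_Mapping.single (ptuple q) 1"

definition in_V :: "('j \<Rightarrow> 'x \<Rightarrow>\<^sub>0 complex) \<Rightarrow> bool" where
  "in_V q \<longleftrightarrow> (\<forall>j\<in>S. q j \<in> V j)"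

lemma in_V_upd: "in_V q \<Longrightarrow> (j \<in> S \<Longrightarrow> p \<in> V j) \<Longrightarrow> in_V (q(j := p))"
  by (auto simp: in_V_def)

lemma ptuple_upd: "j \<in> S \<Longrightarrow> ptuple (q(j := p)) = (ptuple q)(j := cls (K j) p)"
  by (auto simp: ptuple_def fun_eq_iff)

lemma ptuple_cong: "(\<And>j. j \<in> S \<Longrightarrow> q j - q' j \<in> K j) \<Longrightarrow> ptuple q = ptuple q'"
  unfolding ptuple_def by (rule restrict_ext) (simp add: cls_eq_iff K_sub)

lemma tens_cong: "(\<And>j. j \<in> S \<Longrightarrow> q j - q' j \<in> K j) \<Longrightarrow> tens q = tens q'"
  using ptuple_cong[of q q'] by (simp add: tens_def)

lemma tens_cong_eq: "(\<And>j. j \<in> S \<Longrightarrow> q j = q' j) \<Longrightarrow> tens q = tens q'"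
  by (rule tens_cong) (simp add: fsv.subspace_0 K_sub)

lemma ptuple_PiE: "in_V q \<Longrightarrow> ptuple q \<in> (\<Pi>\<^sub>E j\<in>S. carrier (Q j))"
  by (auto simp: ptuple_def in_V_def quotient_space_carrier)

lemma PiE_ptuple:
  assumes "f \<in> (\<Pi>\<^sub>E j\<in>S. carrier (Q j))"
  obtains q where "in_V q" "f = ptuple q"
proof -
  have "\<forall>j. \<exists>v. j \<in> S \<longrightarrow> v \<in> V j \<and> f j = cls (K j) v"
    using assms by (force simp: PiE_iff quotient_space_carrier)
  then obtain q where q: "\<And>j. j \<in> S \<Longrightarrow> q j \<in> V j \<and> f j = cls (K j) (q j)" by metis
  have "f = ptuple q" using q assms by (auto simp: ptuple_def fun_eq_iff PiE_def extensional_def)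
  then show ?thesis using that q by (auto simp: in_V_def)
qed

lemma tens_ambient: "in_V q \<Longrightarrow> tens q \<in> ambient"
  by (simp add: ambient_def tens_def ptuple_PiE)

lemma subspace_ambient: "fsv.subspace ambient"
  unfolding ambient_def by (rule subspace_supported)

lemma ambient_induct [consumes 1, case_names zero add scale tens]:
  assumes "\<tau> \<in> ambient" "P 0" "\<And>p q. P p \<Longrightarrow> P q \<Longrightarrow> P (p + q)" "\<And>c p. P p \<Longrightarrow> P (cscale c p)"
    "\<And>q. in_V q \<Longrightarrow> P (tens q)"
  shows "P \<tau>"
proof -
  have "Poly_Mapping.keys \<tau> \<subseteq> (\<Pi>\<^sub>E j\<in>S. carrier (Q j))" using assms(1) by (simp add: ambient_def)
  then show ?thesis
  proof (rule free_space_induct)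
    fix k assume "k \<in> (\<Pi>\<^sub>E j\<in>S. carrier (Q j))"
    then obtain q where "in_V q" "k = ptuple q" by (rule PiE_ptuple)
    then show "P (Poly_Mapping.single k 1)" using assms(5)[of q] by (simp add: tens_def)
  qed (use assms in auto)
qed

lemma T_subspace: "fsv.subspace T"
  unfolding tensor_relations_def by (rule fsv.subspace_span)

lemma T_addI:
  assumes "in_V q" "j \<in> S" "p \<in> V j" "p' \<in> V j"
  shows "tens (q(j := p + p')) - tens (q(j := p)) - tens (q(j := p')) \<in> T"
proof -
  have "tens (q(j := p + p')) = Poly_Mapping.single ((ptuple q)(j := cls (K j) p \<oplus>\<^bsub>Q j\<^esub> cls (K j) p')) 1"
    using assms K_sub by (simp add: tens_def ptuple_upd quotient_space_add)
  moreover have "cls (K j) p \<in> carrier (Q j)" "cls (K j) p' \<in> carrier (Q j)"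
    using assms by (auto simp: quotient_space_carrier)
  ultimately show ?thesis
    unfolding tensor_relations_def using ptuple_PiE[OF assms(1)] assms(2)
    by (intro fsv.span_base UnI1) (auto simp: tens_def ptuple_upd)
qed

lemma T_scaleI:
  assumes "in_V q" "j \<in> S" "p \<in> V j"
  shows "tens (q(j := cscale c p)) - cscale c (tens (q(j := p))) \<in> T"
proof -
  have "tens (q(j := cscale c p)) = Poly_Mapping.single ((ptuple q)(j := c \<odot>\<^bsub>Q j\<^esub> cls (K j) p)) 1"
    using assms K_sub by (simp add: tens_def ptuple_upd quotient_space_smult)
  moreover have "cls (K j) p \<in> carrier (Q j)"
    using assms by (auto simp: quotient_space_carrier)
  ultimately show ?thesis
    unfolding tensor_relations_def using ptuple_PiE[OF assms(1)] assms(2)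
    by (intro fsv.span_base UnI2) (auto simp: tens_def ptuple_upd)
qed

lemma T_minimal:
  assumes U: "fsv.subspace U"
    and add: "\<And>q j p p'. in_V q \<Longrightarrow> j \<in> S \<Longrightarrow> p \<in> V j \<Longrightarrow> p' \<in> V j \<Longrightarrow>
      tens (q(j := p + p')) - tens (q(j := p)) - tens (q(j := p')) \<in> U"
    and scale: "\<And>q j c p. in_V q \<Longrightarrow> j \<in> S \<Longrightarrow> p \<in> V j \<Longrightarrow>
      tens (q(j := cscale c p)) - cscale c (tens (q(j := p))) \<in> U"
  shows "T \<subseteq> U"
  unfolding tensor_relations_def
proof (rule fsv.span_minimal[OF _ U], rule Un_least; clarify)
  fix f j u v assume f: "f \<in> (\<Pi>\<^sub>E j\<in>S. carrier (Q j))" and j: "j \<in> S" and "u \<in> carrier (Q j)" "v \<in> carrier (Q j)"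
  then obtain p p' where "u = cls (K j) p" "p \<in> V j" "v = cls (K j) p'" "p' \<in> V j"
    by (auto simp: quotient_space_carrier)
  moreover obtain q where "in_V q" "f = ptuple q" using f by (rule PiE_ptuple)
  ultimately show "Poly_Mapping.single (f(j := u \<oplus>\<^bsub>Q j\<^esub> v)) 1 - Poly_Mapping.single (f(j := u)) 1 - Poly_Mapping.single (f(j := v)) 1 \<in> U"
    using add[of q j p p'] j K_sub by (simp add: tens_def ptuple_upd quotient_space_add)
next
  fix f j c u assume f: "f \<in> (\<Pi>\<^sub>E j\<in>S. carrier (Q j))" and j: "j \<in> S" and "u \<in> carrier (Q j)"
  then obtain p where "u = cls (K j) p" "p \<in> V j"
    by (auto simp: quotient_space_carrier)
  moreover obtain q where "in_V q" "f = ptuple q" using f by (rule PiE_ptuple)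
  ultimately show "Poly_Mapping.single (f(j := c \<odot>\<^bsub>Q j\<^esub> u)) 1 - cscale c (Poly_Mapping.single (f(j := u)) 1) \<in> U"
    using scale[of q j p c] j K_sub by (simp add: tens_def ptuple_upd quotient_space_smult)
qed

lemma T_ambient: "T \<subseteq> ambient"
proof (rule T_minimal[OF subspace_ambient])
  fix q j p p' assume "in_V q" "j \<in> S" "p \<in> V j" "p' \<in> V j"
  then show "tens (q(j := p + p')) - tens (q(j := p)) - tens (q(j := p')) \<in> ambient"
    by (intro fsv.subspace_diff[OF subspace_ambient] tens_ambient in_V_upd fsv.subspace_add[OF V_sub])
next
  fix q j c p assume "in_V q" "j \<in> S" "p \<in> V j"
  then show "tens (q(j := cscale c p)) - cscale c (tens (q(j := p))) \<in> ambient"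
    by (intro fsv.subspace_diff[OF subspace_ambient] fsv.subspace_scale[OF subspace_ambient] tens_ambient in_V_upd fsv.subspace_scale[OF V_sub])
qed

lemma tens_zero_class:
  assumes "in_V q" "j \<in> S" "p \<in> K j"
  shows "tens (q(j := p)) \<in> T"
proof -
  have "tens (q(j := p)) = tens (q(j := cscale 0 0))"
    by (rule tens_cong) (use assms K_sub in \<open>auto simp: fsv.subspace_0\<close>)
  moreover have "tens (q(j := cscale 0 0)) - cscale 0 (tens (q(j := 0))) \<in> T"
    by (rule T_scaleI) (use assms V_sub fsv.subspace_0 in auto)
  ultimately show ?thesis by simp
qed

subsection \<open>Linear forms on the tensor product\<close>

lemma form_expand:
  assumes l: "linear_form l" "\<And>u. u \<in> T \<Longrightarrow> l u = 0"
    and q: "in_V q" "j \<in> S" and B: "finite B" "\<And>x. x \<in> B \<Longrightarrow> e x \<in> V j"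
    and v: "v - (\<Sum>x\<in>B. cscale (c x) (e x)) \<in> K j"
  shows "l (tens (q(j := v))) = (\<Sum>x\<in>B. c x * l (tens (q(j := e x))))"
proof -
  have add: "l (tens (q(j := p + p'))) = l (tens (q(j := p))) + l (tens (q(j := p')))" if "p \<in> V j" "p' \<in> V j" for p p'
    using l(2)[OF T_addI[OF q that]] by (simp add: linear_formD[OF l(1)] algebra_simps)
  have sc: "l (tens (q(j := cscale c p))) = c * l (tens (q(j := p)))" if "p \<in> V j" for c p
    using l(2)[OF T_scaleI[OF q that]] by (simp add: linear_formD[OF l(1)])
  have "l (tens (q(j := (\<Sum>x\<in>B. cscale (c x) (e x))))) = (\<Sum>x\<in>B. c x * l (tens (q(j := e x)))) \<and> (\<Sum>x\<in>B. cscale (c x) (e x)) \<in> V j"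
    using B
  proof (induction B rule: finite_induct)
    case empty
    have "l (tens (q(j := 0))) = 0" by (rule l(2)[OF tens_zero_class[OF q]]) (use K_sub q fsv.subspace_0 in auto)
    then show ?case using V_sub[OF q(2)] by (simp add: fsv.subspace_0 del: fun_upd_apply)
  next
    case (insert x B)
    have 1: "cscale (c x) (e x) \<in> V j" using insert V_sub[OF q(2)] by (intro fsv.subspace_scale) auto
    have 2: "(\<Sum>x\<in>B. cscale (c x) (e x)) \<in> V j" using insert by auto
    show ?case using insert 1 2 fsv.subspace_add[OF V_sub[OF q(2)] 1 2] by (simp add: add sc del: fun_upd_apply)
  qed
  moreover have "tens (q(j := v)) = tens (q(j := (\<Sum>x\<in>B. cscale (c x) (e x))))"
    by (rule tens_cong) (use v K_sub fsv.subspace_0 in auto)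
  ultimately show ?thesis by simp
qed

definition representative :: "('x \<Rightarrow>\<^sub>0 complex) set \<Rightarrow> 'x \<Rightarrow>\<^sub>0 complex" where
  "representative A = (SOME a. a \<in> A)"

lemma representative_cls: "j \<in> S \<Longrightarrow> representative (cls (K j) v) - v \<in> K j"
proof -
  assume j: "j \<in> S"
  have "v \<in> cls (K j) v" using fsv.subspace_0[OF K_sub[OF j]] by (simp add: mem_cls)
  then have "representative (cls (K j) v) \<in> cls (K j) v" unfolding representative_def by (rule someI)
  then show ?thesis by (simp add: mem_cls)
qed

text \<open>The tensor product of the linear forms \<open>\<phi> j\<close>, lifted to the free space.\<close>

definition product_form :: "('j \<Rightarrow> ('x \<Rightarrow>\<^sub>0 complex) \<Rightarrow> complex) \<Rightarrow> (('j \<Rightarrow> ('x \<Rightarrow>\<^sub>0 complex) set) \<Rightarrow>\<^sub>0 complex) \<Rightarrow> complex" where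
  "product_form \<phi> = dual_ext (\<lambda>f. \<Prod>j\<in>S. \<phi> j (representative (f j)))"

definition compatible :: "('j \<Rightarrow> ('x \<Rightarrow>\<^sub>0 complex) \<Rightarrow> complex) \<Rightarrow> bool" where
  "compatible \<phi> \<longleftrightarrow> (\<forall>j\<in>S. linear_form (\<phi> j) \<and> (\<forall>k\<in>K j. \<phi> j k = 0))"

lemma product_form_linear: "linear_form (product_form \<phi>)"
  unfolding product_form_def by (rule linear_form_dual_ext)

lemma product_form_tens:
  assumes "compatible \<phi>"
  shows "product_form \<phi> (tens q) = (\<Prod>j\<in>S. \<phi> j (q j))"
proof -
  have "\<phi> j (representative (ptuple q j)) = \<phi> j (q j)" if j: "j \<in> S" for j
  proof -
    have lin: "linear_form (\<phi> j)" "\<And>k. k \<in> K j \<Longrightarrow> \<phi> j k = 0" using assms j by (auto simp: compatible_def)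
    have "\<phi> j (representative (cls (K j) (q j)) - q j) = 0" by (rule lin(2)[OF representative_cls[OF j]])
    then show ?thesis using j by (simp add: ptuple_def linear_formD[OF lin(1)])
  qed
  then show ?thesis by (simp add: product_form_def tens_def cong: prod.cong)
qed

lemma product_form_T:
  assumes "compatible \<phi>" "u \<in> T"
  shows "product_form \<phi> u = 0"
proof -
  note l = linear_formD[OF product_form_linear[of \<phi>]]
  have lin: "linear_form (\<phi> j)" if "j \<in> S" for j using assms(1) that by (auto simp: compatible_def)
  have split: "product_form \<phi> (tens (q(j := p))) = \<phi> j p * (\<Prod>k\<in>S - {j}. \<phi> k (q k))" if j: "j \<in> S" for q j p
  proof -
    have "product_form \<phi> (tens (q(j := p))) = \<phi> j p * (\<Prod>k\<in>S - {j}. \<phi> k ((q(j := p)) k))"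
      by (subst product_form_tens[OF assms(1)], subst prod.remove[OF finite_S j]) simp
    also have "(\<Prod>k\<in>S - {j}. \<phi> k ((q(j := p)) k)) = (\<Prod>k\<in>S - {j}. \<phi> k (q k))" by (rule prod.cong) auto
    finally show ?thesis .
  qed
  have "fsv.subspace {u. product_form \<phi> u = 0}"
    unfolding fsv.subspace_def by (simp add: l)
  then have "T \<subseteq> {u. product_form \<phi> u = 0}"
    by (rule T_minimal) (simp_all add: l split linear_formD[OF lin] algebra_simps)
  then show ?thesis using assms(2) by blast
qed

text \<open>Take a linear form \<open>l\<close> that kills \<open>T\<close> but not \<open>\<tau>\<close>, and expand the factors of \<open>l \<tau>\<close> one
  after the other in the vectors \<open>e x\<close>. When all factors are expanded, the coefficients are
  values of product forms at \<open>\<tau>\<close>, so \<open>l \<tau> = 0\<close>.\<close>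

theorem product_forms_separate:
  fixes \<phi> :: "'j \<Rightarrow> 't \<Rightarrow> ('x \<Rightarrow>\<^sub>0 complex) \<Rightarrow> complex"
  assumes exp: "\<And>j. j \<in> S \<Longrightarrow> \<exists>(B :: 'b set) e t. finite B \<and> (\<forall>x\<in>B. e x \<in> V j) \<and>
      (\<forall>v\<in>V j. v - (\<Sum>x\<in>B. cscale (\<phi> j (t x) v) (e x)) \<in> K j)"
    and \<tau>: "\<tau> \<in> ambient" "\<And>t. product_form (\<lambda>j. \<phi> j (t j)) \<tau> = 0"
  shows "\<tau> \<in> T"
proof (rule ccontr)
  assume "\<tau> \<notin> T"
  then obtain l where l: "linear_form l" "\<And>u. u \<in> T \<Longrightarrow> l u = 0" "l \<tau> = 1"
    using separating_form[OF T_subspace] by blast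
  define F where "F = Poly_Mapping.keys \<tau>"
  define r where "r f j = representative (f j)" for f :: "'j \<Rightarrow> ('x \<Rightarrow>\<^sub>0 complex) set" and j
  have r: "in_V (r f) \<and> tens (r f) = Poly_Mapping.single f 1" if f: "f \<in> F" for f
  proof -
    have "f \<in> (\<Pi>\<^sub>E j\<in>S. carrier (Q j))" using f \<tau>(1) by (auto simp: F_def ambient_def)
    then obtain q where q: "in_V q" "f = ptuple q" by (rule PiE_ptuple)
    have diff: "r f j - q j \<in> K j" if "j \<in> S" for j
      using representative_cls[OF that] that by (simp add: r_def q(2) ptuple_def)
    then have "tens (r f) = tens q" by (rule tens_cong)
    moreover have "r f j \<in> V j" if "j \<in> S" for j
      using fsv.subspace_add[OF V_sub[OF that], of "r f j - q j" "q j"] diff[OF that] K_V[OF that] q(1) that by (auto simp: in_V_def)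
    ultimately show ?thesis by (simp add: in_V_def tens_def q(2))
  qed
  \<comment> \<open>The factors outside \<open>X\<close> are expanded already. The case \<open>X = {}\<close> is the assumption on \<open>\<tau>\<close>, and
    \<open>X = S\<close> says \<open>l \<tau> = 0\<close>.\<close>
  have main: "(\<Sum>f\<in>F. Poly_Mapping.lookup \<tau> f * (\<Prod>j\<in>S - X. \<phi> j (t j) (r f j)) *
      l (tens (\<lambda>j. if j \<in> X then r f j else g j))) = 0"
    if "finite X" "X \<subseteq> S" "in_V g" for X t g
    using that
  proof (induction X arbitrary: t g rule: finite_induct)
    case empty
    have "(\<Sum>f\<in>F. Poly_Mapping.lookup \<tau> f * (\<Prod>j\<in>S. \<phi> j (t j) (r f j))) = 0"
      using \<tau>(2)[of t] by (simp add: product_form_def dual_ext_def F_def r_def)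
    then show ?case by (simp flip: sum_distrib_right)
  next
    case (insert k X)
    have k: "k \<in> S" using insert by auto
    obtain B :: "'b set" and e tt where B: "finite B" "\<And>x. x \<in> B \<Longrightarrow> e x \<in> V k"
      "\<And>v. v \<in> V k \<Longrightarrow> v - (\<Sum>x\<in>B. cscale (\<phi> k (tt x) v) (e x)) \<in> K k"
      using exp[OF k] by blast
    have "(\<Sum>f\<in>F. Poly_Mapping.lookup \<tau> f * (\<Prod>j\<in>S - insert k X. \<phi> j (t j) (r f j)) *
      l (tens (\<lambda>j. if j \<in> insert k X then r f j else g j))) =
      (\<Sum>f\<in>F. \<Sum>x\<in>B. Poly_Mapping.lookup \<tau> f * (\<Prod>j\<in>S - X. \<phi> j ((t(k := tt x)) j) (r f j)) *
      l (tens (\<lambda>j. if j \<in> X then r f j else (g(k := e x)) j)))"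
    proof (rule sum.cong[OF refl])
      fix f assume f: "f \<in> F"
      let ?h = "\<lambda>j. if j \<in> X then r f j else g j"
      have h: "in_V ?h" using r[OF f] insert.prems(2) by (auto simp: in_V_def)
      have "(\<lambda>j. if j \<in> insert k X then r f j else g j) = ?h(k := r f k)" using insert(2) by auto
      then have "l (tens (\<lambda>j. if j \<in> insert k X then r f j else g j)) = (\<Sum>x\<in>B. \<phi> k (tt x) (r f k) * l (tens (?h(k := e x))))"
        using form_expand[OF l(1,2) h k B(1,2) B(3)[of "r f k"]] r[OF f] k by (simp add: in_V_def)
      moreover have "?h(k := e x) = (\<lambda>j. if j \<in> X then r f j else (g(k := e x)) j)" for x using insert(2) by auto
      moreover have "(\<Prod>j\<in>S - X. \<phi> j ((t(k := tt x)) j) (r f j)) = \<phi> k (tt x) (r f k) * (\<Prod>j\<in>S - insert k X. \<phi> j (t j) (r f j))" for x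
      proof -
        have "(\<Prod>j\<in>S - X. \<phi> j ((t(k := tt x)) j) (r f j)) = \<phi> k (tt x) (r f k) * (\<Prod>j\<in>S - X - {k}. \<phi> j ((t(k := tt x)) j) (r f j))"
          by (subst prod.remove[of _ k]) (use finite_S k insert(2) in auto)
        also have "(\<Prod>j\<in>S - X - {k}. \<phi> j ((t(k := tt x)) j) (r f j)) = (\<Prod>j\<in>S - insert k X. \<phi> j (t j) (r f j))"
          by (rule prod.cong) auto
        finally show ?thesis .
      qed
      ultimately show "Poly_Mapping.lookup \<tau> f * (\<Prod>j\<in>S - insert k X. \<phi> j (t j) (r f j)) *
          l (tens (\<lambda>j. if j \<in> insert k X then r f j else g j)) =
          (\<Sum>x\<in>B. Poly_Mapping.lookup \<tau> f * (\<Prod>j\<in>S - X. \<phi> j ((t(k := tt x)) j) (r f j)) *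
          l (tens (\<lambda>j. if j \<in> X then r f j else (g(k := e x)) j)))"
        by (simp only: sum_distrib_left) (simp only: mult_ac)
    qed
    also have "\<dots> = (\<Sum>x\<in>B. \<Sum>f\<in>F. Poly_Mapping.lookup \<tau> f * (\<Prod>j\<in>S - X. \<phi> j ((t(k := tt x)) j) (r f j)) *
      l (tens (\<lambda>j. if j \<in> X then r f j else (g(k := e x)) j)))"
      by (rule sum.swap)
    also have "\<dots> = 0"
    proof (rule sum.neutral, rule ballI)
      fix x assume "x \<in> B"
      then have "in_V (g(k := e x))" using insert.prems B(2) by (intro in_V_upd)
      then show "(\<Sum>f\<in>F. Poly_Mapping.lookup \<tau> f * (\<Prod>j\<in>S - X. \<phi> j ((t(k := tt x)) j) (r f j)) *
        l (tens (\<lambda>j. if j \<in> X then r f j else (g(k := e x)) j))) = 0"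
        using insert.prems by (intro insert.IH) (auto simp del: fun_upd_apply)
    qed
    finally show ?case .
  qed
  have "in_V (\<lambda>_. 0)" using V_sub by (auto simp: in_V_def fsv.subspace_0)
  from main[OF finite_S subset_refl this]
  have "0 = (\<Sum>f\<in>F. Poly_Mapping.lookup \<tau> f * l (tens (\<lambda>j. if j \<in> S then r f j else 0)))" by simp
  also have "\<dots> = (\<Sum>f\<in>F. Poly_Mapping.lookup \<tau> f * l (Poly_Mapping.single f 1))"
  proof (rule sum.cong[OF refl])
    fix f assume f: "f \<in> F"
    have "tens (\<lambda>j. if j \<in> S then r f j else 0) = tens (r f)" by (rule tens_cong_eq) simp
    then show "Poly_Mapping.lookup \<tau> f * l (tens (\<lambda>j. if j \<in> S then r f j else 0)) = Poly_Mapping.lookup \<tau> f * l (Poly_Mapping.single f 1)"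
      using r[OF f] by simp
  qed
  also have "\<dots> = l (\<Sum>f\<in>F. cscale (Poly_Mapping.lookup \<tau> f) (Poly_Mapping.single f 1))"
    by (simp add: linear_form_sum[OF l(1)] linear_formD[OF l(1)])
  also have "\<dots> = 1" using l(3) single_sum[of \<tau>] by (simp add: F_def)
  finally show False by simp
qed

end

locale lie_family = quotient_family +
  fixes A :: "'a \<Rightarrow> ('b \<Rightarrow>\<^sub>0 complex) \<Rightarrow> ('b \<Rightarrow>\<^sub>0 complex)"
  assumes A_add: "A j (p + q) = A j p + A j q" and A_scale: "A j (cscale c p) = cscale c (A j p)"
    and A_V: "j \<in> S \<Longrightarrow> v \<in> V j \<Longrightarrow> A j v \<in> V j" and A_K: "j \<in> S \<Longrightarrow> v \<in> K j \<Longrightarrow> A j v \<in> K j"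
begin

text \<open>The derivation of the tensor product induced by the \<open>A j\<close>, lifted to the free space.\<close>

definition D :: "(('a \<Rightarrow> ('b \<Rightarrow>\<^sub>0 complex) set) \<Rightarrow>\<^sub>0 complex) \<Rightarrow> (('a \<Rightarrow> ('b \<Rightarrow>\<^sub>0 complex) set) \<Rightarrow>\<^sub>0 complex)" where
  "D = linear_extension (\<lambda>f. \<Sum>j\<in>S. Poly_Mapping.single (f(j := coset_map (K j) (A j) (f j))) 1)"

lemma D_add: "D (x + y) = D x + D y" and D_cscale: "D (cscale c x) = cscale c (D x)"
  and D_diff: "D (x - y) = D x - D y" and D_zero: "D 0 = 0" and D_sum: "D (\<Sum>a\<in>B. f a) = (\<Sum>a\<in>B. D (f a))"
  by (simp_all add: D_def linear_extension_add linear_extension_cscale linear_extension_diff linear_extension_sum)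

lemma D_tens: "D (tens q) = (\<Sum>j\<in>S. tens (q(j := A j (q j))))"
proof -
  have "(ptuple q)(j := coset_map (K j) (A j) (ptuple q j)) = ptuple (q(j := A j (q j)))" if j: "j \<in> S" for j
  proof -
    have "coset_map (K j) (A j) (cls (K j) (q j)) = cls (K j) (A j (q j))"
      by (rule coset_map_cls) (use K_sub[OF j] A_K[OF j] in \<open>auto simp: A_add\<close>)
    then show ?thesis using j by (simp add: ptuple_upd) (simp add: ptuple_def)
  qed
  then show ?thesis by (simp add: D_def tens_def)
qed

lemma D_ambient: "\<tau> \<in> ambient \<Longrightarrow> D \<tau> \<in> ambient"
proof (induction \<tau> rule: ambient_induct)
  case (tens q)
  then show ?case unfolding D_tens
    by (intro fsv.subspace_sum[OF subspace_ambient] tens_ambient in_V_upd) (auto simp: in_V_def A_V)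
qed (auto simp: D_add D_cscale D_zero intro: fsv.subspace_add[OF subspace_ambient]
    fsv.subspace_scale[OF subspace_ambient] fsv.subspace_0[OF subspace_ambient])

lemma D_T: "u \<in> T \<Longrightarrow> D u \<in> T"
proof -
  assume u: "u \<in> T"
  have "fsv.subspace {u. D u \<in> T}"
    unfolding fsv.subspace_def using T_subspace
    by (auto simp: D_add D_cscale D_zero fsv.subspace_add fsv.subspace_scale fsv.subspace_0)
  then have "T \<subseteq> {u. D u \<in> T}"
  proof (rule T_minimal; unfold mem_Collect_eq)
    fix q j p p' assume q: "in_V q" "j \<in> S" "p \<in> V j" "p' \<in> V j"
    have "D (tens (q(j := p + p')) - tens (q(j := p)) - tens (q(j := p'))) =
      (\<Sum>k\<in>S. tens (q(j := p + p', k := A k ((q(j := p + p')) k))) - tens (q(j := p, k := A k ((q(j := p)) k)))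
         - tens (q(j := p', k := A k ((q(j := p')) k))))"
      by (simp only: D_diff D_tens sum_subtractf)
    also have "\<dots> \<in> T"
    proof (rule fsv.subspace_sum[OF T_subspace])
      fix k assume k: "k \<in> S"
      show "tens (q(j := p + p', k := A k ((q(j := p + p')) k))) - tens (q(j := p, k := A k ((q(j := p)) k)))
         - tens (q(j := p', k := A k ((q(j := p')) k))) \<in> T"
      proof (cases "k = j")
        case True
        then show ?thesis using T_addI[OF q(1,2) A_V[OF q(2,3)] A_V[OF q(2,4)]] by (simp add: A_add)
      next
        case False
        have "in_V (q(k := A k (q k)))" using q(1) k A_V by (intro in_V_upd) (auto simp: in_V_def)
        from T_addI[OF this q(2-4)] show ?thesis using False by (simp add: fun_upd_twist[of k j])
      qed
    qed
    finally show "D (tens (q(j := p + p')) - tens (q(j := p)) - tens (q(j := p'))) \<in> T" .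
  next
    fix q j c p assume q: "in_V q" "j \<in> S" "p \<in> V j"
    have "D (tens (q(j := cscale c p)) - cscale c (tens (q(j := p)))) =
      (\<Sum>k\<in>S. tens (q(j := cscale c p, k := A k ((q(j := cscale c p)) k))) - cscale c (tens (q(j := p, k := A k ((q(j := p)) k)))))"
      by (simp only: D_diff D_tens D_cscale sum_subtractf fsv.scale_sum_right)
    also have "\<dots> \<in> T"
    proof (rule fsv.subspace_sum[OF T_subspace])
      fix k assume k: "k \<in> S"
      show "tens (q(j := cscale c p, k := A k ((q(j := cscale c p)) k))) - cscale c (tens (q(j := p, k := A k ((q(j := p)) k)))) \<in> T"
      proof (cases "k = j")
        case True
        then show ?thesis using T_scaleI[OF q(1,2) A_V[OF q(2,3)]] by (simp add: A_scale)
      next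
        case False
        have "in_V (q(k := A k (q k)))" using q(1) k A_V by (intro in_V_upd) (auto simp: in_V_def)
        from T_scaleI[OF this q(2,3)] show ?thesis using False by (simp add: fun_upd_twist[of k j])
      qed
    qed
    finally show "D (tens (q(j := cscale c p)) - cscale c (tens (q(j := p)))) \<in> T" .
  qed
  then show "D u \<in> T" using u by blast
qed

lemma tensor_lie_action_cls:
  "tensor_lie_action S Q (\<lambda>j. coset_map (K j) (A j)) (cls T \<tau>) = cls T (D \<tau>)"
proof -
  have "coset_map T D (cls T \<tau>) = cls T (D \<tau>)"
    by (rule coset_map_cls[OF T_subspace]) (simp add: D_add D_T)
  then show ?thesis unfolding tensor_lie_action_def D_def .
qed

definition slots :: "('a \<Rightarrow> 'b \<Rightarrow>\<^sub>0 complex) \<Rightarrow> 'a set \<Rightarrow> ('a \<Rightarrow> ('b \<Rightarrow>\<^sub>0 complex) set) \<Rightarrow>\<^sub>0 complex" where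
  "slots q X = tens (\<lambda>j. if j \<in> X then A j (q j) else q j)"

lemma one_parameter_expansion:
  assumes q: "in_V q"
  shows "finite X \<Longrightarrow> X \<subseteq> S \<Longrightarrow> in_V h \<Longrightarrow> tens (\<lambda>j. if j \<in> X then q j + cscale c (A j (q j)) else h j) -
    (\<Sum>Y\<in>Pow X. cscale (c ^ card Y) (tens (\<lambda>j. if j \<in> Y then A j (q j) else if j \<in> X then q j else h j))) \<in> T"
proof (induction X arbitrary: h rule: finite_induct)
  case empty
  then show ?case by (simp add: fsv.subspace_0[OF T_subspace])
next
  case (insert x X)
  have x: "x \<in> S" "q x \<in> V x" "A x (q x) \<in> V x" using insert.prems q by (auto simp: in_V_def A_V)
  let ?L = "\<lambda>h. tens (\<lambda>j. if j \<in> X then q j + cscale c (A j (q j)) else h j)"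
  let ?R = "\<lambda>h. \<Sum>Y\<in>Pow X. cscale (c ^ card Y) (tens (\<lambda>j. if j \<in> Y then A j (q j) else if j \<in> X then q j else h j))"
  let ?G = "\<lambda>j. if j \<in> X then q j + cscale c (A j (q j)) else h j"
  have G: "in_V ?G"
    using q insert.prems by (auto simp: in_V_def A_V intro!: fsv.subspace_add fsv.subspace_scale V_sub)
  have upd: "(\<lambda>j. if j \<in> X then q j + cscale c (A j (q j)) else (h(x := p)) j) = ?G(x := p)" for p
    using insert(2) by auto
  have ins: "(\<lambda>j. if j \<in> insert x X then q j + cscale c (A j (q j)) else h j) = ?G(x := q x + cscale c (A x (q x)))"
    using insert(2) by auto
  have cA: "cscale c (A x (q x)) \<in> V x" using x by (intro fsv.subspace_scale[OF V_sub])
  have 1: "tens (?G(x := q x + cscale c (A x (q x)))) - tens (?G(x := q x)) - tens (?G(x := cscale c (A x (q x)))) \<in> T"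
    by (rule T_addI[OF G x(1,2) cA])
  have 2: "tens (?G(x := cscale c (A x (q x)))) - cscale c (tens (?G(x := A x (q x)))) \<in> T"
    by (rule T_scaleI[OF G x(1,3)])
  have 3: "?L (h(x := q x)) - ?R (h(x := q x)) \<in> T" "?L (h(x := A x (q x))) - ?R (h(x := A x (q x))) \<in> T"
    using insert.prems x by (intro insert.IH in_V_upd; auto)+
  have 4: "(\<Sum>Y\<in>Pow (insert x X). cscale (c ^ card Y) (tens (\<lambda>j. if j \<in> Y then A j (q j) else if j \<in> insert x X then q j else h j)))
     = ?R (h(x := q x)) + cscale c (?R (h(x := A x (q x))))"
  proof -
    let ?t = "\<lambda>Y. cscale (c ^ card Y) (tens (\<lambda>j. if j \<in> Y then A j (q j) else if j \<in> insert x X then q j else h j))"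
    have "(\<Sum>Y\<in>Pow (insert x X). ?t Y) = (\<Sum>Y\<in>Pow X. ?t Y) + (\<Sum>Y\<in>insert x ` Pow X. ?t Y)"
      unfolding Pow_insert by (rule sum.union_disjoint) (use insert(1,2) in auto)
    also have "(\<Sum>Y\<in>insert x ` Pow X. ?t Y) = (\<Sum>Y\<in>Pow X. ?t (insert x Y))"
      by (subst sum.reindex) (use insert(2) in \<open>auto simp: inj_on_def\<close>)
    also have "(\<Sum>Y\<in>Pow X. ?t Y) = ?R (h(x := q x))"
    proof (rule sum.cong[OF refl])
      fix Y assume "Y \<in> Pow X"
      then have "(\<lambda>j. if j \<in> Y then A j (q j) else if j \<in> insert x X then q j else h j) =
         (\<lambda>j. if j \<in> Y then A j (q j) else if j \<in> X then q j else (h(x := q x)) j)" using insert(2) by auto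
      then show "?t Y = cscale (c ^ card Y) (tens (\<lambda>j. if j \<in> Y then A j (q j) else if j \<in> X then q j else (h(x := q x)) j))" by simp
    qed
    also have "(\<Sum>Y\<in>Pow X. ?t (insert x Y)) = cscale c (?R (h(x := A x (q x))))"
      unfolding fsv.scale_sum_right
    proof (rule sum.cong[OF refl])
      fix Y assume Y: "Y \<in> Pow X"
      then have "(\<lambda>j. if j \<in> insert x Y then A j (q j) else if j \<in> insert x X then q j else h j) =
         (\<lambda>j. if j \<in> Y then A j (q j) else if j \<in> X then q j else (h(x := A x (q x))) j)" using insert(2) by auto
      moreover have "card (insert x Y) = Suc (card Y)" using Y insert(1,2) finite_subset by (intro card_insert_disjoint) auto
      ultimately show "?t (insert x Y) = cscale c (cscale (c ^ card Y) (tens (\<lambda>j. if j \<in> Y then A j (q j) else if j \<in> X then q j else (h(x := A x (q x))) j)))" by simp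
    qed
    finally show ?thesis .
  qed
  have alg: "(a - b - d) + (d - cscale c e) + ((b - r) + cscale c (e - s)) = a - (r + cscale c s)"
    for a b d e r s :: "('a \<Rightarrow> ('b \<Rightarrow>\<^sub>0 complex) set) \<Rightarrow>\<^sub>0 complex" by (simp add: cscale_diff_right algebra_simps)
  have "(tens (?G(x := q x + cscale c (A x (q x)))) - tens (?G(x := q x)) - tens (?G(x := cscale c (A x (q x))))) +
     (tens (?G(x := cscale c (A x (q x)))) - cscale c (tens (?G(x := A x (q x))))) +
     ((tens (?G(x := q x)) - ?R (h(x := q x))) + cscale c (tens (?G(x := A x (q x))) - ?R (h(x := A x (q x))))) \<in> T"
    using 3 unfolding upd
    by (intro fsv.subspace_add[OF T_subspace] fsv.subspace_scale[OF T_subspace] 1 2)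
  then show ?case unfolding ins 4 alg .
qed

lemma D_slots:
  assumes q: "in_V q" and nil: "\<And>j v. j \<in> S \<Longrightarrow> v \<in> V j \<Longrightarrow> A j (A j v) \<in> K j" and X: "X \<subseteq> S"
  shows "D (slots q X) - (\<Sum>j\<in>S - X. slots q (insert j X)) \<in> T"
proof -
  let ?q = "\<lambda>j. if j \<in> X then A j (q j) else q j"
  have q': "in_V ?q" using q by (auto simp: in_V_def A_V)
  have "D (slots q X) = (\<Sum>j\<in>S - X. tens (?q(j := A j (?q j)))) + (\<Sum>j\<in>X. tens (?q(j := A j (?q j))))"
    unfolding slots_def D_tens using X finite_S by (simp add: sum.subset_diff)
  also have "(\<Sum>j\<in>S - X. tens (?q(j := A j (?q j)))) = (\<Sum>j\<in>S - X. slots q (insert j X))"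
    unfolding slots_def by (intro sum.cong refl tens_cong_eq) auto
  finally have "D (slots q X) - (\<Sum>j\<in>S - X. slots q (insert j X)) = (\<Sum>j\<in>X. tens (?q(j := A j (?q j))))"
    by (simp del: fun_upd_apply)
  also have "\<dots> \<in> T"
    using X q by (intro fsv.subspace_sum[OF T_subspace] tens_zero_class[OF q']) (auto simp: in_V_def nil)
  finally show ?thesis .
qed

text \<open>A derivation that squares to zero in each factor acts on a pure tensor with divided
  powers: its \<open>k\<close>-th power is \<open>k!\<close> times the sum over all choices of \<open>k\<close> slots. So a stable
  subspace contains these sums, and hence the image of the pure tensor under the exponential,
  which has slots \<open>1 + c A j\<close>.\<close>

theorem one_parameter_closed:
  assumes U: "fsv.subspace U" "T \<subseteq> U" "\<And>u. u \<in> U \<Longrightarrow> D u \<in> U"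
    and nil: "\<And>j v. j \<in> S \<Longrightarrow> v \<in> V j \<Longrightarrow> A j (A j v) \<in> K j"
    and q: "in_V q" "tens q \<in> U"
  shows "tens (\<lambda>j. q j + cscale c (A j (q j))) \<in> U"
proof -
  define P where "P k = {X. X \<subseteq> S \<and> card X = k}" for k
  have finP: "finite (P k)" for k using finite_S by (auto simp: P_def intro: finite_subset[of _ "Pow S"])
  define \<gamma> where "\<gamma> k = (\<Sum>X\<in>P k. slots q X)" for k
  have fin: "finite X" if "X \<subseteq> S" for X using finite_subset[OF that finite_S] .
  \<comment> \<open>Each set of \<open>k + 1\<close> slots arises from \<open>k + 1\<close> sets of \<open>k\<close> slots.\<close>
  have \<gamma>: "D (\<gamma> k) - cscale (of_nat (Suc k)) (\<gamma> (Suc k)) \<in> T" for k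
  proof -
    have "(\<Sum>X\<in>P k. \<Sum>j\<in>S - X. slots q (insert j X)) = (\<Sum>(X, j)\<in>Sigma (P k) (\<lambda>X. S - X). slots q (insert j X))"
      using finite_S finP by (intro sum.Sigma) auto
    also have "\<dots> = (\<Sum>(Y, j)\<in>Sigma (P (Suc k)) (\<lambda>Y. Y). slots q Y)"
      by (rule sum.reindex_bij_witness[of _ "\<lambda>(Y, j). (Y - {j}, j)" "\<lambda>(X, j). (insert j X, j)"])
        (auto simp: P_def fin insert_absorb)
    also have "\<dots> = (\<Sum>Y\<in>P (Suc k). \<Sum>j\<in>Y. slots q Y)"
      using finP fin by (intro sum.Sigma[symmetric]) (auto simp: P_def)
    also have "\<dots> = (\<Sum>Y\<in>P (Suc k). cscale (of_nat (Suc k)) (slots q Y))"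
    proof (rule sum.cong[OF refl])
      fix Y assume "Y \<in> P (Suc k)"
      then have "card Y = Suc k" by (simp add: P_def)
      moreover have "(\<Sum>j\<in>Y. slots q Y) = cscale (of_nat (card Y)) (slots q Y)"
        by (rule poly_mapping_eqI) (simp add: lookup_sum)
      ultimately show "(\<Sum>j\<in>Y. slots q Y) = cscale (of_nat (Suc k)) (slots q Y)" by simp
    qed
    finally have eq: "(\<Sum>X\<in>P k. \<Sum>j\<in>S - X. slots q (insert j X)) = cscale (of_nat (Suc k)) (\<gamma> (Suc k))"
      by (simp add: \<gamma>_def fsv.scale_sum_right del: of_nat_Suc)
    have "(\<Sum>X\<in>P k. D (slots q X) - (\<Sum>j\<in>S - X. slots q (insert j X))) \<in> T"
      by (intro fsv.subspace_sum[OF T_subspace] D_slots q(1) nil) (auto simp: P_def)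
    then show ?thesis by (simp only: sum_subtractf eq) (simp add: \<gamma>_def D_sum)
  qed
  have in_U: "\<gamma> k \<in> U" for k
  proof (induction k)
    case 0
    have "P 0 = {{}}" using fin by (auto simp: P_def)
    then show ?case using q(2) by (simp add: \<gamma>_def slots_def)
  next
    case (Suc k)
    have "D (\<gamma> k) - (D (\<gamma> k) - cscale (of_nat (Suc k)) (\<gamma> (Suc k))) \<in> U"
      by (rule fsv.subspace_diff[OF U(1) U(3)[OF Suc] subsetD[OF U(2) \<gamma>[of k]]])
    then have "cscale (1 / of_nat (Suc k)) (cscale (of_nat (Suc k)) (\<gamma> (Suc k))) \<in> U"
      by (intro fsv.subspace_scale[OF U(1), of "cscale (of_nat (Suc k)) (\<gamma> (Suc k))"]) (simp del: of_nat_Suc)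
    then show ?case by (simp del: of_nat_Suc)
  qed
  have slot_U: "(\<Sum>Y\<in>Pow S. cscale (c ^ card Y) (slots q Y)) \<in> U"
  proof -
    have "(\<Sum>Y\<in>Pow S. cscale (c ^ card Y) (slots q Y)) = (\<Sum>k\<in>{..card S}. \<Sum>Y\<in>{Y\<in>Pow S. card Y = k}. cscale (c ^ card Y) (slots q Y))"
      using finite_S by (intro sum.group[symmetric]) (auto intro: card_mono)
    also have "\<dots> = (\<Sum>k\<in>{..card S}. cscale (c ^ k) (\<gamma> k))"
      unfolding \<gamma>_def fsv.scale_sum_right P_def by (intro sum.cong refl) auto
    also have "\<dots> \<in> U" by (intro fsv.subspace_sum[OF U(1)] fsv.subspace_scale[OF U(1)] in_U)
    finally show ?thesis .
  qed
  have "tens (\<lambda>j. if j \<in> S then q j + cscale c (A j (q j)) else q j) -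
    (\<Sum>Y\<in>Pow S. cscale (c ^ card Y) (tens (\<lambda>j. if j \<in> Y then A j (q j) else if j \<in> S then q j else q j))) \<in> T"
    by (rule one_parameter_expansion[OF q(1) finite_S subset_refl q(1)])
  then have "tens (\<lambda>j. if j \<in> S then q j + cscale c (A j (q j)) else q j) - (\<Sum>Y\<in>Pow S. cscale (c ^ card Y) (slots q Y)) \<in> U"
    using subsetD[OF U(2)] by (simp add: slots_def cong: if_cong)
  from fsv.subspace_add[OF U(1) this slot_U]
  have "tens (\<lambda>j. if j \<in> S then q j + cscale c (A j (q j)) else q j) \<in> U" by simp
  moreover have "tens (\<lambda>j. if j \<in> S then q j + cscale c (A j (q j)) else q j) = tens (\<lambda>j. q j + cscale c (A j (q j)))"
    by (rule tens_cong_eq) simp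
  ultimately show ?thesis by simp
qed

end

section \<open>The cyclic module in Pluecker coordinates\<close>

context quotient_family
begin

lemma tens_scale:
  assumes q: "in_V q"
  shows "finite X \<Longrightarrow> X \<subseteq> S \<Longrightarrow> tens (\<lambda>j. if j \<in> X then cscale (d j) (q j) else q j) - cscale (\<Prod>j\<in>X. d j) (tens q) \<in> T"
proof (induction X rule: finite_induct)
  case empty
  then show ?case by (simp add: fsv.subspace_0[OF T_subspace])
next
  case (insert x X)
  let ?h = "\<lambda>j. if j \<in> X then cscale (d j) (q j) else q j"
  have x: "x \<in> S" "q x \<in> V x" using insert.prems q by (auto simp: in_V_def)
  have h: "in_V ?h" using q by (auto simp: in_V_def intro!: fsv.subspace_scale V_sub)
  have 1: "tens (?h(x := cscale (d x) (q x))) - cscale (d x) (tens (?h(x := q x))) \<in> T"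
    by (rule T_scaleI[OF h x])
  have 2: "?h(x := q x) = ?h" "(\<lambda>j. if j \<in> insert x X then cscale (d j) (q j) else q j) = ?h(x := cscale (d x) (q x))"
    using insert(2) by auto
  have "tens ?h - cscale (\<Prod>j\<in>X. d j) (tens q) \<in> T" using insert by auto
  from fsv.subspace_add[OF T_subspace 1 fsv.subspace_scale[OF T_subspace this, of "d x"]]
  show ?case unfolding 2 using insert(1,2) by (simp add: cscale_diff_right del: fun_upd_apply)
qed

end

context positive_root
begin

lemma linear_form_pl: "linear_form (pl t)"
  by (simp add: linear_form_def pl_add pl_cscale)

lemma exp_product_pluecker_vector:
  "exp_product n c - pluecker_vector (graph_row n c (i, j)) \<in> J"
proof -
  have "Poly_Mapping.keys (graph_row n c (i, j) r) \<subseteq> I" if "r < i" for r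
  proof
    fix k assume "k \<in> Poly_Mapping.keys (graph_row n c (i, j) r)"
    then have "Poly_Mapping.lookup (graph_row n c (i, j) r) k \<noteq> 0" by (simp add: in_keys_iff)
    then show "k \<in> I"
      using that ij by (auto simp: graph_row_def lookup_add lookup_wvec lookup_sum_wvec support_indices_def split: if_splits)
  qed
  then have "pl t (exp_product n c - pluecker_vector (graph_row n c (i, j))) = 0" for t
    by (simp add: pl_diff pl_exp_product pl_pluecker_vector)
  moreover have "exp_product n c - pluecker_vector (graph_row n c (i, j)) \<in> sym_alg n"
    by (intro fsv.subspace_diff[OF subspace_sym_alg] exp_product_sym_alg pluecker_vector_sym_alg)
  ultimately show ?thesis using in_J_iff by blast
qed

end

lemma positive_rootI: "\<alpha> \<in> pos_roots n \<Longrightarrow> positive_root n (fst \<alpha>) (snd \<alpha>)"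
  by standard (auto simp: pos_roots_def)

lemma homogeneous_sum:
  assumes "finite A" "A \<noteq> {}" "\<And>a. a \<in> A \<Longrightarrow> homogeneous G d (F a)"
  shows "homogeneous G d (\<lambda>x. \<Sum>a\<in>A. F a x)"
  using assms
proof (induction A rule: finite_ne_induct)
  case (insert a A)
  then show ?case by (simp add: homogeneous.add)
qed simp

type_synonym free_tensor = "((nat \<times> nat) \<times> nat \<Rightarrow> spoly set) \<Rightarrow>\<^sub>0 complex"

locale collection =
  fixes n :: nat and m :: "nat \<Rightarrow> nat \<Rightarrow> nat"
  assumes n: "n \<ge> 2" and m: "\<forall>(i, j)\<in>pos_roots n. m i j > 0"
begin

abbreviation "S \<equiv> factors n m"
abbreviation "V \<equiv> \<lambda>_ :: (nat \<times> nat) \<times> nat. sym_alg n"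
abbreviation "K \<equiv> \<lambda>f :: (nat \<times> nat) \<times> nat. root_ideal n (fst f)"

lemma factor_root: "f \<in> S \<Longrightarrow> fst f \<in> pos_roots n"
  by (auto simp: factors_def)

lemma first_factor: "\<alpha> \<in> pos_roots n \<Longrightarrow> (\<alpha>, 0) \<in> S"
  using m by (auto simp: factors_def)

lemma finite_factors: "finite S"
proof -
  have "S = Sigma (pos_roots n) (\<lambda>\<alpha>. {..<m (fst \<alpha>) (snd \<alpha>)})" by (auto simp: factors_def)
  then show ?thesis by simp
qed

lemma factor_positive_root: "f \<in> S \<Longrightarrow> positive_root n (fst (fst f)) (snd (fst f))"
  by (rule positive_rootI[OF factor_root])

sublocale quotient_family S V K
proof
  fix f assume "f \<in> S"
  then interpret positive_root n "fst (fst f)" "snd (fst f)" by (rule factor_positive_root)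
  show "fsv.subspace (K f)" "K f \<subseteq> V f" using J_subspace J_subset by simp_all
qed (simp_all add: finite_factors subspace_sym_alg)

lemma root_module_family: "root_module n \<circ> fst = Q"
  by (simp add: fun_eq_iff root_module_def)

lemma big_tensor_eq: "big_tensor n m = quotient_space ambient T"
  unfolding big_tensor_def root_module_family tensor_space_def ambient_def ..

lemma pure_tensor_eq:
  assumes "\<And>f. f \<in> S \<Longrightarrow> h f = cls (K f) (q f)"
  shows "pure_tensor S (root_module n \<circ> fst) h = cls T (tens q)"
proof -
  have "restrict h S = ptuple q" unfolding ptuple_def by (rule restrict_ext) (rule assms)
  then show ?thesis by (simp add: pure_tensor_def root_module_family tens_def cls_def)
qed

abbreviation exp_tensor :: "(nat \<times> nat \<Rightarrow> complex) \<Rightarrow> free_tensor" where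
  "exp_tensor c \<equiv> tens (\<lambda>_. exp_product n c)"

lemma in_V_exp: "in_V (\<lambda>_. exp_product n c)"
  unfolding in_V_def exp_product_def
  by (intro ballI sym_alg_prod fsv.subspace_add[OF subspace_sym_alg] fsv.subspace_scale[OF subspace_sym_alg]
      one_in_sym_alg fvar_in_sym_alg)

lemma v_tensor_eq: "v_tensor n m = cls T (tens (\<lambda>_. 1))"
  unfolding v_tensor_def by (rule pure_tensor_eq) (auto simp: root_module_vec_def cls_def)

text \<open>The characters of the factors come together as one scalar.\<close>

lemma translate_eq:
  assumes "b \<in> borel_group n" "Ad_action n b (nil_elem n c) = nil_elem n c'"
  shows "\<exists>k. k \<noteq> 0 \<and> translate n m (b, nil_elem n c) = cls T (cscale k (exp_tensor c'))"
    and "b = 1\<^sub>m n \<Longrightarrow> translate n m (b, nil_elem n c) = cls T (exp_tensor c')"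
proof -
  define \<chi> where "\<chi> f = (\<Prod>k<fst (fst f). b $$ (k, k))" for f :: "(nat \<times> nat) \<times> nat"
  have 1: "translate n m (b, nil_elem n c) = cls T (tens (\<lambda>f. cscale (\<chi> f) (exp_product n c')))"
    unfolding translate_def
  proof (rule pure_tensor_eq)
    fix f assume f: "f \<in> S"
    then interpret positive_root n "fst (fst f)" "snd (fst f)" by (rule factor_positive_root)
    show "(\<lambda>(\<alpha>, k). group_action n \<alpha> (b, nil_elem n c) (root_module_vec n \<alpha>)) f = cls (K f) (cscale (\<chi> f) (exp_product n c'))"
      using group_action_highest_weight[OF assms] by (simp add: \<chi>_def case_prod_beta)
  qed
  have "tens (\<lambda>f. cscale (\<chi> f) (exp_product n c')) = tens (\<lambda>f. if f \<in> S then cscale (\<chi> f) (exp_product n c') else exp_product n c')"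
    by (rule tens_cong_eq) simp
  then have 2: "tens (\<lambda>f. cscale (\<chi> f) (exp_product n c')) - cscale (\<Prod>f\<in>S. \<chi> f) (exp_tensor c') \<in> T"
    using tens_scale[OF in_V_exp finite_factors subset_refl, of \<chi> c'] by simp
  have eq: "translate n m (b, nil_elem n c) = cls T (cscale (\<Prod>f\<in>S. \<chi> f) (exp_tensor c'))"
    unfolding 1 using 2 by (simp add: cls_eq_iff[OF T_subspace])
  have b: "b \<in> carrier_mat n n" "upper_triangular b" "det b = 1" using assms(1) by (auto simp: borel_group_def)
  have "prod_list (diag_mat b) = 1" using det_upper_triangular[OF b(2,1)] b(3) by simp
  then have nz: "\<forall>x\<in>set (diag_mat b). x \<noteq> 0" by (metis prod_list_zero_iff zero_neq_one)
  have diag: "b $$ (k, k) \<noteq> 0" if "k < n" for k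
    using nz that b(1) by (auto simp: diag_mat_def)
  have "\<chi> f \<noteq> 0" if f: "f \<in> S" for f
  proof -
    have "fst (fst f) < n" using factor_root[OF f] n by (auto simp: pos_roots_def)
    then show ?thesis using diag by (auto simp: \<chi>_def)
  qed
  then have "(\<Prod>f\<in>S. \<chi> f) \<noteq> 0" using finite_factors by simp
  then show "\<exists>k. k \<noteq> 0 \<and> translate n m (b, nil_elem n c) = cls T (cscale k (exp_tensor c'))" using eq by blast
  assume "b = 1\<^sub>m n"
  moreover have "fst (fst f) < n" if f: "f \<in> S" for f using factor_root[OF f] n by (auto simp: pos_roots_def)
  ultimately have "\<chi> f = 1" if f: "f \<in> S" for f using f by (fastforce simp: \<chi>_def intro: prod.neutral)
  then have "(\<Prod>f\<in>S. \<chi> f) = 1" by (intro prod.neutral) auto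
  then show "translate n m (b, nil_elem n c) = cls T (exp_tensor c')" using eq by simp
qed

subsection \<open>The cyclic module\<close>

abbreviation "C \<equiv> carrier (cyclic_module n m)"

text \<open>The preimage of \<open>M\<^sub>\<mm>\<close> in the free space.\<close>

definition cyclic_lift :: "free_tensor set" where
  "cyclic_lift = {\<tau> \<in> ambient. cls T \<tau> \<in> C}"

abbreviation stable :: "tensor set \<Rightarrow> bool" where
  "stable X \<equiv> submodule X complex_ring (big_tensor n m) \<and> (\<forall>\<beta>\<in>pos_roots n. \<forall>u\<in>X. f_action n m \<beta> u \<in> X)"

lemma C_hull: "C = stable hull {v_tensor n m}"
  by (simp add: cyclic_module_def)

lemma cyclic_module_ops:
  "x \<oplus>\<^bsub>cyclic_module n m\<^esub> y = x \<oplus>\<^bsub>big_tensor n m\<^esub> y" "c \<odot>\<^bsub>cyclic_module n m\<^esub> x = c \<odot>\<^bsub>big_tensor n m\<^esub> x"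
  "\<zero>\<^bsub>cyclic_module n m\<^esub> = T"
  by (simp_all add: cyclic_module_def) (simp add: big_tensor_eq quotient_space_zero)

lemma lie_family_fvar:
  assumes "\<beta> \<in> pos_roots n"
  shows "lie_family S V K (\<lambda>_. (*) (fvar \<beta>))"
proof
  fix f v assume f: "f \<in> S" and v: "v \<in> K f"
  interpret positive_root n "fst (fst f)" "snd (fst f)" by (rule factor_positive_root[OF f])
  show "fvar \<beta> * v \<in> K f" using J_mult[OF fvar_in_sym_alg[OF assms]] v by simp
qed (auto simp: distrib_left cscale_mult_right intro: sym_alg_mult fvar_in_sym_alg assms)

lemma f_action_cls:
  assumes "\<beta> \<in> pos_roots n"
  shows "f_action n m \<beta> (cls T \<tau>) = cls T (lie_family.D S K (\<lambda>_. (*) (fvar \<beta>)) \<tau>)"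
proof -
  interpret L: lie_family S V K "\<lambda>_. (*) (fvar \<beta>)" by (rule lie_family_fvar[OF assms])
  show ?thesis
    using L.tensor_lie_action_cls[of \<tau>]
    by (simp add: f_action_def root_module_family case_prod_unfold)
qed

lemma stable_carrier: "stable (carrier (big_tensor n m))"
proof (intro conjI ballI)
  show "submodule (carrier (big_tensor n m)) complex_ring (big_tensor n m)"
    unfolding big_tensor_eq by (rule quotient_space_submodule[OF subspace_ambient T_subspace T_ambient])
  fix \<beta> u assume \<beta>: "\<beta> \<in> pos_roots n" and "u \<in> carrier (big_tensor n m)"
  then obtain \<tau> where \<tau>: "u = cls T \<tau>" "\<tau> \<in> ambient" by (auto simp: big_tensor_eq quotient_space_carrier)
  interpret L: lie_family S V K "\<lambda>_. (*) (fvar \<beta>)" by (rule lie_family_fvar[OF \<beta>])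
  show "f_action n m \<beta> u \<in> carrier (big_tensor n m)"
    unfolding \<tau>(1) f_action_cls[OF \<beta>] big_tensor_eq quotient_space_carrier using L.D_ambient[OF \<tau>(2)] by blast
qed

lemma submodule_closed:
  assumes "submodule X complex_ring (big_tensor n m)"
  shows "T \<in> X" "cls T x \<in> X \<Longrightarrow> cls T y \<in> X \<Longrightarrow> cls T (x + y) \<in> X" "cls T x \<in> X \<Longrightarrow> cls T (cscale c x) \<in> X"
proof -
  interpret M: submodule X complex_ring "big_tensor n m" by (rule assms)
  show "T \<in> X" using M.one_closed by (simp add: big_tensor_eq quotient_space_zero)
  show "cls T (x + y) \<in> X" if "cls T x \<in> X" "cls T y \<in> X"
    using M.m_closed[OF that] by (simp add: big_tensor_eq quotient_space_add[OF T_subspace])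
  show "cls T (cscale c x) \<in> X" if "cls T x \<in> X"
    using M.smult_closed[of c, OF _ that] by (simp add: complex_ring_def big_tensor_eq quotient_space_smult[OF T_subspace])
qed

lemma C_subset: "C \<subseteq> cls T ` ambient"
proof -
  have "v_tensor n m \<in> carrier (big_tensor n m)"
    unfolding v_tensor_eq big_tensor_eq quotient_space_carrier
    by (intro imageI tens_ambient) (simp add: in_V_def)
  then have "C \<subseteq> carrier (big_tensor n m)" unfolding C_hull by (intro hull_minimal stable_carrier) simp
  then show ?thesis by (simp add: big_tensor_eq quotient_space_carrier)
qed

lemma C_closed:
  "T \<in> C" "cls T x \<in> C \<Longrightarrow> cls T y \<in> C \<Longrightarrow> cls T (x + y) \<in> C" "cls T x \<in> C \<Longrightarrow> cls T (cscale c x) \<in> C"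
  "\<beta> \<in> pos_roots n \<Longrightarrow> u \<in> C \<Longrightarrow> f_action n m \<beta> u \<in> C" "v_tensor n m \<in> C"
  unfolding C_hull hull_def using submodule_closed by auto

lemma cyclic_lift_subspace: "fsv.subspace cyclic_lift"
  unfolding fsv.subspace_def cyclic_lift_def
  using C_closed fsv.subspace_0[OF subspace_ambient] fsv.subspace_add[OF subspace_ambient] fsv.subspace_scale[OF subspace_ambient]
  by auto

lemma cls_T: "u \<in> T \<Longrightarrow> cls T u = T"
  using cls_eq_iff[OF T_subspace, of u 0] by simp

lemma T_cyclic_lift: "T \<subseteq> cyclic_lift"
  using T_ambient C_closed(1) by (auto simp: cyclic_lift_def cls_T)

lemma C_eq: "C = cls T ` cyclic_lift"
  using C_subset by (auto simp: cyclic_lift_def)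

text \<open>The exponential of a sum of commuting root vectors is reached by one one-parameter
  subgroup after the other.\<close>

lemma exp_tensor_cyclic: "exp_tensor c \<in> cyclic_lift"
proof -
  have "tens (\<lambda>_. \<Prod>\<beta>\<in>X. 1 + cscale (c \<beta>) (fvar \<beta>)) \<in> cyclic_lift" if "finite X" "X \<subseteq> pos_roots n" for X
    using that
  proof (induction X rule: finite_induct)
    case empty
    have "tens (\<lambda>_. 1) \<in> ambient" by (rule tens_ambient) (simp add: in_V_def)
    then show ?case using C_closed(5) by (simp add: cyclic_lift_def v_tensor_eq)
  next
    case (insert \<beta> X)
    let ?p = "\<Prod>\<beta>\<in>X. 1 + cscale (c \<beta>) (fvar \<beta>)"
    have \<beta>: "\<beta> \<in> pos_roots n" using insert by simp
    interpret L: lie_family S V K "\<lambda>_. (*) (fvar \<beta>)" by (rule lie_family_fvar[OF \<beta>])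
    have "tens (\<lambda>_. ?p + cscale (c \<beta>) (fvar \<beta> * ?p)) \<in> cyclic_lift"
    proof (rule L.one_parameter_closed[OF cyclic_lift_subspace T_cyclic_lift])
      show "L.D u \<in> cyclic_lift" if "u \<in> cyclic_lift" for u
        using that C_closed(4)[OF \<beta>, of "cls T u"] L.D_ambient by (simp add: cyclic_lift_def f_action_cls[OF \<beta>])
      show "fvar \<beta> * (fvar \<beta> * v) \<in> K f" if f: "f \<in> S" and v: "v \<in> sym_alg n" for f v
      proof -
        interpret positive_root n "fst (fst f)" "snd (fst f)" by (rule factor_positive_root[OF f])
        show ?thesis using J_mult'[OF v fvar_square_in_J[OF \<beta>]] by (simp add: mult.assoc)
      qed
      show "in_V (\<lambda>_. ?p)"
        unfolding in_V_def using insert.prems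
        by (intro ballI sym_alg_prod fsv.subspace_add[OF subspace_sym_alg] fsv.subspace_scale[OF subspace_sym_alg]
            one_in_sym_alg fvar_in_sym_alg) auto
      show "tens (\<lambda>_. ?p) \<in> cyclic_lift" using insert by auto
    qed
    moreover have "(\<Prod>\<beta>\<in>insert \<beta> X. 1 + cscale (c \<beta>) (fvar \<beta>)) = ?p + cscale (c \<beta>) (fvar \<beta> * ?p)"
      using insert(1,2) by (simp add: distrib_right cscale_mult_left)
    ultimately show ?case by simp
  qed
  from this[of "pos_roots n"] show ?thesis by (simp add: exp_product_def)
qed

subsection \<open>Pluecker coordinates on the tensor product\<close>

definition pform :: "((nat \<times> nat) \<times> nat \<Rightarrow> nat \<Rightarrow> nat) \<Rightarrow> free_tensor \<Rightarrow> complex" where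
  "pform t = product_form (\<lambda>f. pluecker_functional (fst f) (t f))"

text \<open>The tensor product of the Pluecker vectors of the bases \<open>u \<alpha>\<close>, one for each factor.\<close>

definition segre :: "(nat \<times> nat \<Rightarrow> nat \<Rightarrow> W) \<Rightarrow> free_tensor" where
  "segre u = tens (\<lambda>f. positive_root.pluecker_vector n (fst (fst f)) (snd (fst f)) (u (fst f)))"

definition supported :: "(nat \<times> nat \<Rightarrow> nat \<Rightarrow> W) \<Rightarrow> bool" where
  "supported u \<longleftrightarrow> (\<forall>\<alpha>\<in>pos_roots n. \<forall>r<fst \<alpha>. Poly_Mapping.keys (u \<alpha> r) \<subseteq> support_indices n \<alpha>)"

lemma pluecker_compatible: "compatible (\<lambda>f. pluecker_functional (fst f) (t f))"
  unfolding compatible_def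
proof (intro ballI conjI)
  fix f assume f: "f \<in> S"
  interpret positive_root n "fst (fst f)" "snd (fst f)" by (rule factor_positive_root[OF f])
  show "linear_form (pluecker_functional (fst f) (t f))" using linear_form_pl by simp
  show "pluecker_functional (fst f) (t f) k = 0" if "k \<in> K f" for k using pl_J[of k] that by simp
qed

lemma pform_linear: "linear_form (pform t)"
  unfolding pform_def by (rule product_form_linear)

lemma pform_T: "u \<in> T \<Longrightarrow> pform t u = 0"
  unfolding pform_def by (rule product_form_T[OF pluecker_compatible])

lemma pform_segre:
  assumes "supported u"
  shows "pform t (segre u) = (\<Prod>f\<in>S. minor (fst (fst f)) (u (fst f)) (t f))"
  unfolding pform_def segre_def product_form_tens[OF pluecker_compatible]
proof (rule prod.cong[OF refl])
  fix f assume f: "f \<in> S"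
  interpret positive_root n "fst (fst f)" "snd (fst f)" by (rule factor_positive_root[OF f])
  show "pluecker_functional (fst f) (t f) (pluecker_vector (u (fst f))) = minor (fst (fst f)) (u (fst f)) (t f)"
    using pl_pluecker_vector[of "u (fst f)" "t f"] assms factor_root[OF f] by (simp add: supported_def)
qed

lemma in_V_segre: "in_V (\<lambda>f. positive_root.pluecker_vector n (fst (fst f)) (snd (fst f)) (u (fst f)))"
  unfolding in_V_def using positive_root.pluecker_vector_sym_alg[OF factor_positive_root] by blast

lemma segre_ambient: "segre u \<in> ambient"
  unfolding segre_def by (rule tens_ambient[OF in_V_segre])

theorem pforms_separate:
  assumes "\<tau> \<in> ambient" "\<And>t. pform t \<tau> = 0"
  shows "\<tau> \<in> T"
proof (rule product_forms_separate[of "\<lambda>f. pluecker_functional (fst f)"])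
  fix f assume f: "f \<in> S"
  interpret positive_root n "fst (fst f)" "snd (fst f)" by (rule factor_positive_root[OF f])
  show "\<exists>(B :: (nat set \<times> nat set) set) e t. finite B \<and> (\<forall>x\<in>B. e x \<in> sym_alg n) \<and>
      (\<forall>v\<in>sym_alg n. v - (\<Sum>x\<in>B. cscale (pluecker_functional (fst f) (t x) v) (e x)) \<in> K f)"
    using finite_index_pairs std_monomial_sym_alg std_monomial_expansion
    by (intro exI[of _ index_pairs] exI[of _ std_monomial] exI[of _ std_tuple]) simp
qed (use assms in \<open>auto simp: pform_def\<close>)

text \<open>Both sides have the same Pluecker coordinates in each factor
  (\<open>exp_product_pluecker_vector\<close>).\<close>

lemma exp_tensor_segre: "exp_tensor c = segre (graph_row n c)"
  unfolding segre_def
proof (rule tens_cong)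
  fix f assume f: "f \<in> S"
  interpret positive_root n "fst (fst f)" "snd (fst f)" by (rule factor_positive_root[OF f])
  show "exp_product n c - pluecker_vector (graph_row n c (fst f)) \<in> K f"
    using exp_product_pluecker_vector[of c] by simp
qed

definition mdeg :: "nat \<times> nat \<Rightarrow> nat" where
  "mdeg \<alpha> = card {f \<in> S. fst f = \<alpha>}"

text \<open>Expanding the factors of \<open>segre u\<close> in standard monomials, one after the other, gives
  coefficients that are products of minors, one for each factor. In the induction the factors
  outside \<open>X\<close> hold fixed vectors \<open>g f\<close>.\<close>

lemma form_segre_homogeneous:
  assumes l: "linear_form l" "\<And>u. u \<in> T \<Longrightarrow> l u = 0"
  shows "homogeneous (gens (R_variety n)) mdeg (\<lambda>u. l (segre u))"
proof -
  let ?P = "\<lambda>u f. positive_root.pluecker_vector n (fst (fst f)) (snd (fst f)) (u (fst f))"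
  have "homogeneous (gens (R_variety n)) (\<lambda>\<alpha>. card {f \<in> X. fst f = \<alpha>})
      (\<lambda>u. l (tens (\<lambda>f. if f \<in> X then ?P u f else g f)))" if "finite X" "X \<subseteq> S" "in_V g" for X g
    using that
  proof (induction X arbitrary: g rule: finite_induct)
    case empty
    then show ?case by (simp add: homogeneous.const)
  next
    case (insert x X)
    have x: "x \<in> S" using insert by auto
    interpret positive_root n "fst (fst x)" "snd (fst x)" by (rule factor_positive_root[OF x])
    have eq: "l (tens (\<lambda>f. if f \<in> insert x X then ?P u f else g f)) =
      (\<Sum>y\<in>index_pairs. minor (fst (fst x)) (u (fst x)) (std_tuple y) *
         l (tens (\<lambda>f. if f \<in> X then ?P u f else (g(x := std_monomial y)) f)))" for u
    proof -
      let ?h = "\<lambda>f. if f \<in> X then ?P u f else g f"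
      have h: "in_V ?h" using in_V_segre[of u] insert.prems(2) by (auto simp: in_V_def)
      have "(\<lambda>f. if f \<in> insert x X then ?P u f else g f) = ?h(x := pluecker_vector (u (fst x)))" by auto
      then have "l (tens (\<lambda>f. if f \<in> insert x X then ?P u f else g f)) =
         (\<Sum>y\<in>index_pairs. minor (fst (fst x)) (u (fst x)) (std_tuple y) * l (tens (?h(x := std_monomial y))))"
        using form_expand[OF l h x finite_index_pairs, where e = std_monomial and v = "pluecker_vector (u (fst x))"
            and c = "\<lambda>y. minor (fst (fst x)) (u (fst x)) (std_tuple y)"] J_zero std_monomial_sym_alg
        by (simp add: pluecker_vector_def)
      moreover have "?h(x := std_monomial y) = (\<lambda>f. if f \<in> X then ?P u f else (g(x := std_monomial y)) f)" for y
        using insert(2) by auto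
      ultimately show ?thesis by simp
    qed
    have deg: "(\<lambda>\<alpha>. card {f \<in> insert x X. fst f = \<alpha>}) = (\<lambda>\<alpha>. ((\<lambda>_. 0)(fst x := 1)) \<alpha> + card {f \<in> X. fst f = \<alpha>})"
    proof
      fix \<alpha>
      have "{f \<in> insert x X. fst f = \<alpha>} = (if fst x = \<alpha> then insert x {f \<in> X. fst f = \<alpha>} else {f \<in> X. fst f = \<alpha>})" by auto
      then show "card {f \<in> insert x X. fst f = \<alpha>} = ((\<lambda>_. 0)(fst x := 1)) \<alpha> + card {f \<in> X. fst f = \<alpha>}"
        using insert(1,2) by auto
    qed
    have "({}, {}) \<in> index_pairs" by (simp add: index_pairs_def)
    then have ne: "index_pairs \<noteq> {}" by blast
    show ?case unfolding eq deg
    proof (rule homogeneous_sum[OF finite_index_pairs ne], rule homogeneous.mult)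
      fix y assume y: "y \<in> index_pairs"
      show "homogeneous (gens (R_variety n)) ((\<lambda>_. 0)(fst x := 1)) (\<lambda>u. minor (fst (fst x)) (u (fst x)) (std_tuple y))"
        by (rule homogeneous.gen) (use factor_root[OF x] in \<open>auto simp: R_variety_def pluecker_minor_eq[abs_def]\<close>)
      show "homogeneous (gens (R_variety n)) (\<lambda>\<alpha>. card {f \<in> X. fst f = \<alpha>})
         (\<lambda>u. l (tens (\<lambda>f. if f \<in> X then ?P u f else (g(x := std_monomial y)) f)))"
        using insert.prems std_monomial_sym_alg[OF y] by (intro insert.IH in_V_upd) auto
    qed
  qed
  moreover have "in_V (\<lambda>_. 0)" by (simp add: in_V_def fsv.subspace_0[OF subspace_sym_alg])
  ultimately have "homogeneous (gens (R_variety n)) (\<lambda>\<alpha>. card {f \<in> S. fst f = \<alpha>})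
      (\<lambda>u. l (tens (\<lambda>f. if f \<in> S then ?P u f else 0)))"
    using finite_factors by blast
  moreover have "tens (\<lambda>f. if f \<in> S then ?P u f else 0) = segre u" for u
    unfolding segre_def by (rule tens_cong_eq) simp
  ultimately show ?thesis by (simp add: mdeg_def[abs_def])
qed

lemma linear_form_lift:
  assumes "g \<in> linear_forms (cyclic_module n m)"
  obtains l where "linear_form l" "\<And>u. u \<in> T \<Longrightarrow> l u = 0" "\<And>\<tau>. \<tau> \<in> cyclic_lift \<Longrightarrow> l \<tau> = g (cls T \<tau>)"
proof -
  have g: "g (cls T (x + y)) = g (cls T x) + g (cls T y)" "g (cls T (cscale c x)) = c * g (cls T x)"
    if "x \<in> cyclic_lift" "y \<in> cyclic_lift" for x y c
  proof -
    have "cls T x \<in> C" "cls T y \<in> C" using that by (auto simp: cyclic_lift_def)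
    then have "g (cls T x \<oplus>\<^bsub>cyclic_module n m\<^esub> cls T y) = g (cls T x) + g (cls T y)"
      "g (c \<odot>\<^bsub>cyclic_module n m\<^esub> cls T x) = c * g (cls T x)"
      using assms unfolding linear_forms_def by blast+
    then show "g (cls T (x + y)) = g (cls T x) + g (cls T y)" "g (cls T (cscale c x)) = c * g (cls T x)"
      by (simp_all add: cyclic_module_ops big_tensor_eq quotient_space_add[OF T_subspace] quotient_space_smult[OF T_subspace])
  qed
  obtain l where l: "linear_form l" "\<And>\<tau>. \<tau> \<in> cyclic_lift \<Longrightarrow> l \<tau> = g (cls T \<tau>)"
    using extend_form[OF cyclic_lift_subspace, of "\<lambda>\<tau>. g (cls T \<tau>)"] g by blast
  have "l u = 0" if "u \<in> T" for u
  proof -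
    have "l u = g (cls T 0)" using l(2)[of u] that T_cyclic_lift by (auto simp: cls_T)
    also have "\<dots> = l 0" using l(2)[of 0] fsv.subspace_0[OF cyclic_lift_subspace] by simp
    finally show ?thesis using linear_formD[OF l(1)] by simp
  qed
  then show ?thesis using that l by blast
qed

lemma linear_form_descend:
  assumes "linear_form l" "\<And>u. u \<in> T \<Longrightarrow> l u = 0"
  obtains g where "g \<in> linear_forms (cyclic_module n m)" "\<And>\<tau>. g (cls T \<tau>) = l \<tau>"
proof -
  define g where "g A = l (SOME \<tau>. \<tau> \<in> A)" for A
  have g: "g (cls T \<tau>) = l \<tau>" for \<tau>
  proof -
    have "\<tau> \<in> cls T \<tau>" using fsv.subspace_0[OF T_subspace] by (simp add: mem_cls)
    then have "(SOME \<tau>'. \<tau>' \<in> cls T \<tau>) \<in> cls T \<tau>" by (rule someI)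
    then have "l ((SOME \<tau>'. \<tau>' \<in> cls T \<tau>) - \<tau>) = 0" by (intro assms(2)) (simp add: mem_cls)
    then show ?thesis by (simp add: g_def linear_formD[OF assms(1)])
  qed
  have "g \<in> linear_forms (cyclic_module n m)"
    unfolding linear_forms_def C_eq
    by (auto simp: cyclic_module_ops big_tensor_eq quotient_space_add[OF T_subspace] quotient_space_smult[OF T_subspace]
        g linear_formD[OF assms(1)])
  then show ?thesis using that g by blast
qed

end

section \<open>Points of R and density of the big cell\<close>

lemma lookup_graph_row:
  "Poly_Mapping.lookup (graph_row n c \<alpha> r) x =
     (if x = Suc r then 1 else 0) + (if snd \<alpha> < x \<and> x - 1 \<le> n - 1 then c (Suc r, x - 1) else 0)"
proof -
  have "Poly_Mapping.lookup (\<Sum>b\<in>{snd \<alpha>..n-1}. cscale (c (Suc r, b)) (wvec (Suc b))) x =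
     (\<Sum>b\<in>{snd \<alpha>..n-1}. if b = x - 1 then (if x \<noteq> 0 then c (Suc r, b) else 0) else 0)"
    unfolding lookup_lincomb by (rule sum.cong) (auto simp: lookup_wvec)
  also have "\<dots> = (if snd \<alpha> < x \<and> x - 1 \<le> n - 1 then c (Suc r, x - 1) else 0)"
    by (cases x) auto
  finally show ?thesis by (auto simp: graph_row_def lookup_add lookup_wvec)
qed

lemma basis_families_iff:
  "u \<in> basis_families n V \<longleftrightarrow> (\<forall>\<alpha>\<in>pos_roots n. lin_indep (fst \<alpha>) (u \<alpha>) \<and> fsv.span (u \<alpha> ` {..<fst \<alpha>}) = V \<alpha>)"
  by (auto simp: basis_families_def lin_indep_iff)

lemma proj_kill_eq: "proj_kill k v = v - cscale (Poly_Mapping.lookup v k) (wvec k)"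
  by (rule poly_mapping_eqI) (simp add: proj_kill_def lookup_update lookup_minus lookup_wvec)

lemma lookup_proj_kill: "Poly_Mapping.lookup (proj_kill k v) x = (if x = k then 0 else Poly_Mapping.lookup v x)"
  by (simp add: proj_kill_def lookup_update)

lemma R_pointsD:
  assumes V: "V \<in> R_points n"
  shows "V \<in> extensional (pos_roots n)"
    "\<And>\<alpha>. \<alpha> \<in> pos_roots n \<Longrightarrow> fsv.subspace (V \<alpha>)"
    "\<And>\<alpha>. \<alpha> \<in> pos_roots n \<Longrightarrow> fsv.dim (V \<alpha>) = fst \<alpha>"
    "\<And>\<alpha> v. \<alpha> \<in> pos_roots n \<Longrightarrow> v \<in> V \<alpha> \<Longrightarrow> Poly_Mapping.keys v \<subseteq> support_indices n \<alpha>"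
    "\<And>i j. (i, j) \<in> pos_roots n \<Longrightarrow> i < j \<Longrightarrow> V (i, j) \<subseteq> V (Suc i, j)"
    "\<And>i j v. (i, j) \<in> pos_roots n \<Longrightarrow> j < n - 1 \<Longrightarrow> v \<in> V (i, j) \<Longrightarrow> proj_kill (Suc j) v \<in> V (i, Suc j)"
proof -
  show "V \<in> extensional (pos_roots n)" using V by (simp add: R_points_def)
  have 1: "fsv.subspace (V \<alpha>) \<and> fsv.dim (V \<alpha>) = fst \<alpha> \<and> V \<alpha> \<subseteq> fsv.span (wvec ` ({1..fst \<alpha>} \<union> {snd \<alpha> + 1..n}))"
    if "\<alpha> \<in> pos_roots n" for \<alpha>
    using V that unfolding R_points_def by (cases \<alpha>) auto
  then show "\<And>\<alpha>. \<alpha> \<in> pos_roots n \<Longrightarrow> fsv.subspace (V \<alpha>)" "\<And>\<alpha>. \<alpha> \<in> pos_roots n \<Longrightarrow> fsv.dim (V \<alpha>) = fst \<alpha>" by blast+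
  show "\<And>\<alpha> v. \<alpha> \<in> pos_roots n \<Longrightarrow> v \<in> V \<alpha> \<Longrightarrow> Poly_Mapping.keys v \<subseteq> support_indices n \<alpha>"
    using 1 unfolding span_wvec support_indices_def by blast
  show "V (i, j) \<subseteq> V (Suc i, j)" if "(i, j) \<in> pos_roots n" "i < j" for i j
    using V that unfolding R_points_def pos_roots_def by auto
  show "proj_kill (Suc j) v \<in> V (i, Suc j)" if "(i, j) \<in> pos_roots n" "j < n - 1" "v \<in> V (i, j)" for i j v
    using V that unfolding R_points_def pos_roots_def by (auto simp: image_subset_iff)
qed

lemma R_pointsI:
  assumes "V \<in> extensional (pos_roots n)"
    "\<And>\<alpha>. \<alpha> \<in> pos_roots n \<Longrightarrow> lin_indep (fst \<alpha>) (u \<alpha>)"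
    "\<And>\<alpha>. \<alpha> \<in> pos_roots n \<Longrightarrow> fsv.span (u \<alpha> ` {..<fst \<alpha>}) = V \<alpha>"
    "\<And>\<alpha> r. \<alpha> \<in> pos_roots n \<Longrightarrow> r < fst \<alpha> \<Longrightarrow> Poly_Mapping.keys (u \<alpha> r) \<subseteq> support_indices n \<alpha>"
    "\<And>i j r. (i, j) \<in> pos_roots n \<Longrightarrow> i < j \<Longrightarrow> r < i \<Longrightarrow> u (i, j) r \<in> V (Suc i, j)"
    "\<And>i j r. (i, j) \<in> pos_roots n \<Longrightarrow> j < n - 1 \<Longrightarrow> r < i \<Longrightarrow> proj_kill (Suc j) (u (i, j) r) \<in> V (i, Suc j)"
  shows "V \<in> R_points n"
proof -
  have sub: "fsv.subspace (V \<alpha>)" if "\<alpha> \<in> pos_roots n" for \<alpha>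
    using assms(3)[OF that] fsv.subspace_span by metis
  have 1: "fsv.dim (V \<alpha>) = fst \<alpha>" if "\<alpha> \<in> pos_roots n" for \<alpha>
  proof -
    have "inj_on (u \<alpha>) {..<fst \<alpha>}" "fsv.independent (u \<alpha> ` {..<fst \<alpha>})" using assms(2)[OF that] by (auto simp: lin_indep_iff)
    then have "fsv.dim (fsv.span (u \<alpha> ` {..<fst \<alpha>})) = fst \<alpha>"
      by (simp add: fsv.dim_eq_card_independent card_image)
    then show ?thesis using assms(3)[OF that] by simp
  qed
  have 2: "V \<alpha> \<subseteq> fsv.span (wvec ` ({1..fst \<alpha>} \<union> {snd \<alpha> + 1..n}))" if "\<alpha> \<in> pos_roots n" for \<alpha>
    unfolding assms(3)[OF that, symmetric] span_wvec
    using assms(4)[OF that] by (intro fsv.span_minimal subspace_supported) (auto simp: support_indices_def)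
  have 3: "V (i, j) \<subseteq> V (i + 1, j)" if "1 \<le> i" "i < j" "j \<le> n - 1" for i j
  proof -
    have pos: "(i, j) \<in> pos_roots n" "(Suc i, j) \<in> pos_roots n" using that by (auto simp: pos_roots_def)
    have "fsv.span (u (i, j) ` {..<i}) \<subseteq> V (Suc i, j)"
    proof (rule fsv.span_minimal[OF _ sub[OF pos(2)]])
      show "u (i, j) ` {..<i} \<subseteq> V (Suc i, j)" using assms(5)[OF pos(1)] that(2) by blast
    qed
    then show ?thesis using assms(3)[OF pos(1)] by simp
  qed
  have 4: "proj_kill (j + 1) ` V (i, j) \<subseteq> V (i, j + 1)" if "1 \<le> i" "i \<le> j" "j < n - 1" for i j
  proof -
    have pos: "(i, j) \<in> pos_roots n" "(i, Suc j) \<in> pos_roots n" using that by (auto simp: pos_roots_def)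
    have "fsv.subspace {v. proj_kill (Suc j) v \<in> V (i, Suc j)}"
      unfolding fsv.subspace_def
    proof (intro conjI ballI allI; unfold mem_Collect_eq)
      show "proj_kill (Suc j) 0 \<in> V (i, Suc j)" using fsv.subspace_0[OF sub[OF pos(2)]] by (simp add: proj_kill_eq)
    next
      fix x y assume "proj_kill (Suc j) x \<in> V (i, Suc j)" "proj_kill (Suc j) y \<in> V (i, Suc j)"
      then have "proj_kill (Suc j) x + proj_kill (Suc j) y \<in> V (i, Suc j)" by (intro fsv.subspace_add[OF sub[OF pos(2)]]) auto
      moreover have "proj_kill (Suc j) (x + y) = proj_kill (Suc j) x + proj_kill (Suc j) y"
        by (rule poly_mapping_eqI) (simp add: lookup_proj_kill lookup_add)
      ultimately show "proj_kill (Suc j) (x + y) \<in> V (i, Suc j)" by simp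
    next
      fix c x assume "proj_kill (Suc j) x \<in> V (i, Suc j)"
      then have "cscale c (proj_kill (Suc j) x) \<in> V (i, Suc j)" by (intro fsv.subspace_scale[OF sub[OF pos(2)]]) auto
      moreover have "proj_kill (Suc j) (cscale c x) = cscale c (proj_kill (Suc j) x)"
        by (rule poly_mapping_eqI) (simp add: lookup_proj_kill)
      ultimately show "proj_kill (Suc j) (cscale c x) \<in> V (i, Suc j)" by simp
    qed
    then have "fsv.span (u (i, j) ` {..<i}) \<subseteq> {v. proj_kill (Suc j) v \<in> V (i, Suc j)}"
    proof (rule fsv.span_minimal[rotated])
      show "u (i, j) ` {..<i} \<subseteq> {v. proj_kill (Suc j) v \<in> V (i, Suc j)}" using assms(6)[OF pos(1)] that(3) by blast
    qed
    then show ?thesis unfolding assms(3)[OF pos(1), unfolded fst_conv] by auto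
  qed
  show ?thesis unfolding R_points_def
  proof (intro CollectI conjI ballI allI impI)
    fix \<alpha> assume a: "\<alpha> \<in> pos_roots n"
    show "case \<alpha> of (i, j) \<Rightarrow> fsv.subspace (V (i, j)) \<and> fsv.dim (V (i, j)) = i \<and>
        V (i, j) \<subseteq> fsv.span (wvec ` ({1..i} \<union> {j + 1..n}))"
      using sub[OF a] 1[OF a] 2[OF a] by (simp add: case_prod_beta)
  next
    show "V \<in> extensional (pos_roots n)" by (rule assms(1))
  next
    fix i j assume "1 \<le> i \<and> i < j \<and> j \<le> n - 1"
    then show "V (i, j) \<subseteq> V (i + 1, j)" using 3[of i j] by simp
  next
    fix i j assume "1 \<le> i \<and> i \<le> j \<and> j < n - 1"
    then show "proj_kill (j + 1) ` V (i, j) \<subseteq> V (i, j + 1)" using 4[of i j] by simp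
  qed
qed

subsection \<open>Adapted bases\<close>

lemma R_point_component_basis:
  assumes V: "V \<in> R_points n" and ij: "(i, j) \<in> pos_roots n"
  shows "\<exists>B. finite B \<and> card B = i \<and> fsv.independent B \<and> B \<subseteq> V (i, j) \<and> V (i, j) \<subseteq> fsv.span B"
proof -
  obtain B where B: "B \<subseteq> V (i, j)" "fsv.independent B" "V (i, j) \<subseteq> fsv.span B" "card B = fsv.dim (V (i, j))"
    using fsv.basis_exists[of "V (i, j)"] by blast
  have "card B = i" using B(4) R_pointsD(3)[OF V ij] by simp
  moreover have "1 \<le> i" using ij by (auto simp: pos_roots_def)
  ultimately have "card B = i" "finite B" using card_ge_0_finite[of B] by auto
  then show ?thesis using B by blast
qed

lemma lin_indep_Suc:
  assumes "lin_indep i u" "u i \<notin> fsv.span (u ` {..<i})"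
  shows "lin_indep (Suc i) u"
proof -
  have "u i \<notin> u ` {..<i}" using assms(2) fsv.span_base[of "u i" "u ` {..<i}"] by auto
  moreover have "inj_on u {..<i}" "fsv.independent (u ` {..<i})" using assms(1) by (auto simp: lin_indep_iff)
  moreover from this(2) have "fsv.independent (insert (u i) (u ` {..<i}))"
    by (rule fsv.independent_insertI[OF assms(2)])
  ultimately show ?thesis
    unfolding lin_indep_iff by (simp add: lessThan_Suc)
qed

lemma lin_indep_spans:
  assumes B: "finite B" "card B = i" "X \<subseteq> fsv.span B" and X: "fsv.subspace X"
    and u: "lin_indep i u" "\<And>r. r < i \<Longrightarrow> u r \<in> X"
  shows "fsv.span (u ` {..<i}) = X"
proof
  show "fsv.span (u ` {..<i}) \<subseteq> X" using u(2) X by (intro fsv.span_minimal) auto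
  show "X \<subseteq> fsv.span (u ` {..<i})"
  proof (rule ccontr)
    assume "\<not> ?thesis"
    then obtain v where v: "v \<in> X" "v \<notin> fsv.span (u ` {..<i})" by blast
    have ind: "inj_on u {..<i}" "fsv.independent (u ` {..<i})" using u(1) by (auto simp: lin_indep_iff)
    have "fsv.independent (insert v (u ` {..<i}))" using v(2) ind(2) by (rule fsv.independent_insertI)
    moreover have "insert v (u ` {..<i}) \<subseteq> fsv.span B" using v(1) u(2) B(3) by auto
    ultimately have "card (insert v (u ` {..<i})) \<le> card B" using fsv.independent_span_bound[OF B(1)] by blast
    moreover have "v \<notin> u ` {..<i}" using v(2) fsv.span_base[of v "u ` {..<i}"] by auto
    ultimately show False using B(2) ind(1) by (simp add: card_image)
  qed
qed

text \<open>Each column \<open>V\<^bsub>1,j\<^esub> \<subset> V\<^bsub>2,j\<^esub> \<subset> \<dots>\<close> is a flag; a vector is chosen in each step.\<close>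

lemma adapted_basis:
  assumes V: "V \<in> R_points n"
  obtains y where "\<And>i j. (i, j) \<in> pos_roots n \<Longrightarrow> lin_indep i (\<lambda>r. y (Suc r) j)"
    "\<And>i j. (i, j) \<in> pos_roots n \<Longrightarrow> fsv.span ((\<lambda>r. y (Suc r) j) ` {..<i}) = V (i, j)"
proof -
  define prev where "prev i j = (if i = 1 then {0} else V (i - 1, j))" for i j
  have prev_sub: "prev i j \<subseteq> V (i, j)" if "(i, j) \<in> pos_roots n" for i j
  proof (cases "i = 1")
    case True
    then show ?thesis using fsv.subspace_0[OF R_pointsD(2)[OF V that]] by (simp add: prev_def)
  next
    case False
    then obtain k where k: "i = Suc k" using \<open>(i, j) \<in> pos_roots n\<close> by (cases i) (auto simp: pos_roots_def)
    then have k: "i = Suc k" "(k, j) \<in> pos_roots n" "k < j" using False \<open>(i, j) \<in> pos_roots n\<close> by (auto simp: pos_roots_def)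
    then show ?thesis using R_pointsD(5)[OF V k(2,3)] False by (simp add: prev_def)
  qed
  define y where "y i j = (SOME v. v \<in> V (i, j) \<and> v \<notin> prev i j)" for i j
  have ex: "\<exists>v. v \<in> V (i, j) \<and> v \<notin> prev i j" if ij: "(i, j) \<in> pos_roots n" for i j
  proof (rule ccontr)
    assume neg: "\<not> ?thesis"
    have i1: "1 \<le> i" using ij by (auto simp: pos_roots_def)
    obtain B where B: "finite B" "card B = i" "fsv.independent B" "B \<subseteq> V (i, j)" "V (i, j) \<subseteq> fsv.span B"
      using R_point_component_basis[OF V ij] by blast
    obtain B' where B': "finite B'" "card B' < i" "prev i j \<subseteq> fsv.span B'"
    proof (cases "i = 1")
      case True
      then show ?thesis using that[of "{}"] by (simp add: prev_def)
    next
      case False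
      then have ij': "(i - 1, j) \<in> pos_roots n" "1 \<le> i - 1" using ij by (auto simp: pos_roots_def)
      obtain B where "finite B" "card B = i - 1" "V (i - 1, j) \<subseteq> fsv.span B"
        using R_point_component_basis[OF V ij'(1)] by blast
      then show ?thesis using that[of B] i1 False by (simp add: prev_def)
    qed
    have "B \<subseteq> fsv.span B'" using B(4) neg B'(3) by blast
    then have "card B \<le> card B'" using fsv.independent_span_bound[OF B'(1) B(3)] by blast
    then show False using B(2) B'(2) by simp
  qed
  have y: "y i j \<in> V (i, j) \<and> y i j \<notin> prev i j" if "(i, j) \<in> pos_roots n" for i j
    unfolding y_def by (rule someI_ex[OF ex[OF that]])
  have main: "lin_indep i (\<lambda>r. y (Suc r) j) \<and> fsv.span ((\<lambda>r. y (Suc r) j) ` {..<i}) = V (i, j)"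
    if "(i, j) \<in> pos_roots n" for i j
    using that
  proof (induction i)
    case 0
    then show ?case by (simp add: pos_roots_def)
  next
    case (Suc i)
    have IH: "lin_indep i (\<lambda>r. y (Suc r) j) \<and> fsv.span ((\<lambda>r. y (Suc r) j) ` {..<i}) = prev (Suc i) j"
    proof (cases "i = 0")
      case True
      then show ?thesis by (simp add: lin_indep_def prev_def)
    next
      case False
      then have "(i, j) \<in> pos_roots n" using Suc.prems by (auto simp: pos_roots_def)
      then show ?thesis using Suc.IH False by (simp add: prev_def)
    qed
    have yi: "y (Suc i) j \<in> V (Suc i, j)" "y (Suc i) j \<notin> prev (Suc i) j" using y[OF Suc.prems] by auto
    have li: "lin_indep (Suc i) (\<lambda>r. y (Suc r) j)"
      using IH yi(2) by (intro lin_indep_Suc) simp_all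
    obtain B where B: "finite B" "card B = Suc i" "V (Suc i, j) \<subseteq> fsv.span B"
      using R_point_component_basis[OF V Suc.prems] by blast
    have "y (Suc r) j \<in> V (Suc i, j)" if "r < Suc i" for r
    proof (cases "r = i")
      case False
      then have "y (Suc r) j \<in> fsv.span ((\<lambda>r. y (Suc r) j) ` {..<i})" using that by (intro fsv.span_base imageI) simp
      then have "y (Suc r) j \<in> prev (Suc i) j" using IH by simp
      then show ?thesis using prev_sub[OF Suc.prems] by (rule subsetD[rotated])
    qed (use yi in simp)
    then have "fsv.span ((\<lambda>r. y (Suc r) j) ` {..<Suc i}) = V (Suc i, j)"
      by (rule lin_indep_spans[OF B R_pointsD(2)[OF V Suc.prems] li])
    then show ?case using li by simp
  qed
  show ?thesis by (rule that[of y]) (simp_all add: main)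
qed

subsection \<open>The parametrisation of the variety\<close>

text \<open>Coordinates on \<open>R\<^sub>n\<close>: \<open>tower n c d k i\<close> is the \<open>i\<close>-th vector of an adapted basis of the
  column \<open>j = n - k\<close>. As \<open>pr\<^bsub>j+1\<^esub>\<close> maps \<open>V\<^bsub>i,j\<^esub>\<close> into \<open>V\<^bsub>i,j+1\<^esub>\<close>, it is a combination of
  \<open>w\<^bsub>j+1\<^esub>\<close> and of the first \<open>i\<close> vectors of column \<open>j + 1\<close>. The case \<open>k = 0\<close> is the column
  \<open>j = n\<close> with \<open>V\<^bsub>i,n\<^esub> = span (w\<^sub>1, \<dots>, w\<^sub>i)\<close>.\<close>

primrec tower :: "nat \<Rightarrow> (nat \<Rightarrow> nat \<Rightarrow> nat \<Rightarrow> complex) \<Rightarrow> (nat \<Rightarrow> nat \<Rightarrow> complex) \<Rightarrow> nat \<Rightarrow> nat \<Rightarrow> W" where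
  "tower n c d 0 = wvec"
| "tower n c d (Suc k) = (\<lambda>i. (\<Sum>a<i. cscale (c k i a) (tower n c d k (Suc a))) + cscale (d k i) (wvec (n - k)))"

definition tower_family :: "nat \<Rightarrow> (nat \<Rightarrow> nat \<Rightarrow> nat \<Rightarrow> complex) \<Rightarrow> (nat \<Rightarrow> nat \<Rightarrow> complex) \<Rightarrow> nat \<times> nat \<Rightarrow> nat \<Rightarrow> W" where
  "tower_family n c d \<alpha> r = tower n c d (n - snd \<alpha>) (Suc r)"

lemma tower_support:
  assumes "k \<le> n" "1 \<le> i"
  shows "Poly_Mapping.keys (tower n c d k i) \<subseteq> {1..i} \<union> {n - k + 1..n}"
  using assms
proof (induction k arbitrary: i)
  case 0
  then show ?case by (simp add: wvec_def)
next
  case (Suc k)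
  have "tower n c d (Suc k) i \<in> {v. Poly_Mapping.keys v \<subseteq> {1..i} \<union> {n - Suc k + 1..n}}"
    unfolding tower.simps
  proof (intro fsv.subspace_add[OF subspace_supported] fsv.subspace_sum[OF subspace_supported] fsv.subspace_scale[OF subspace_supported]; unfold mem_Collect_eq)
    fix a assume "a \<in> {..<i}"
    then have "{1..Suc a} \<union> {n - k + 1..n} \<subseteq> {1..i} \<union> {n - Suc k + 1..n}" by auto
    moreover have "Poly_Mapping.keys (tower n c d k (Suc a)) \<subseteq> {1..Suc a} \<union> {n - k + 1..n}" using Suc by simp
    ultimately show "Poly_Mapping.keys (tower n c d k (Suc a)) \<subseteq> {1..i} \<union> {n - Suc k + 1..n}" by blast
  next
    show "Poly_Mapping.keys (wvec (n - k)) \<subseteq> {1..i} \<union> {n - Suc k + 1..n}"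
      using Suc.prems by (auto simp: wvec_def)
  qed
  then show ?case by blast
qed

definition point_of :: "nat \<Rightarrow> (nat \<times> nat \<Rightarrow> nat \<Rightarrow> W) \<Rightarrow> nat \<times> nat \<Rightarrow> W set" where
  "point_of n u = (\<lambda>\<alpha>\<in>pos_roots n. fsv.span (u \<alpha> ` {..<fst \<alpha>}))"

lemma point_of_eq: "\<alpha> \<in> pos_roots n \<Longrightarrow> point_of n u \<alpha> = fsv.span (u \<alpha> ` {..<fst \<alpha>})"
  by (simp add: point_of_def)

lemma point_of_basis:
  "(\<And>\<alpha>. \<alpha> \<in> pos_roots n \<Longrightarrow> lin_indep (fst \<alpha>) (u \<alpha>)) \<Longrightarrow> u \<in> basis_families n (point_of n u)"
  by (simp add: basis_families_iff point_of_eq)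

lemma tower_point:
  assumes "\<And>\<alpha>. \<alpha> \<in> pos_roots n \<Longrightarrow> lin_indep (fst \<alpha>) (tower_family n c d \<alpha>)"
  shows "point_of n (tower_family n c d) \<in> R_points n"
proof (rule R_pointsI[of _ _ "tower_family n c d"])
  show "point_of n (tower_family n c d) \<in> extensional (pos_roots n)" by (simp add: point_of_def)
  fix \<alpha> r assume "\<alpha> \<in> pos_roots n" "r < fst \<alpha>"
  then have "n - snd \<alpha> \<le> n" "n - (n - snd \<alpha>) = snd \<alpha>" "Suc r \<le> fst \<alpha>" by (auto simp: pos_roots_def)
  then show "Poly_Mapping.keys (tower_family n c d \<alpha> r) \<subseteq> support_indices n \<alpha>"
    using tower_support[of "n - snd \<alpha>" n "Suc r" c d] by (fastforce simp: tower_family_def support_indices_def)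
next
  fix i j r assume ij: "(i, j) \<in> pos_roots n" "i < j" "r < i"
  then have "(Suc i, j) \<in> pos_roots n" by (auto simp: pos_roots_def)
  then show "tower_family n c d (i, j) r \<in> point_of n (tower_family n c d) (Suc i, j)"
    using ij unfolding tower_family_def by (simp add: point_of_eq) (auto intro!: fsv.span_base)
next
  fix i j r assume ij: "(i, j) \<in> pos_roots n" "j < n - 1" "r < i"
  have pos: "(i, Suc j) \<in> pos_roots n" using ij by (auto simp: pos_roots_def)
  define k where "k = n - Suc j"
  have k: "n - j = Suc k" "n - k = Suc j" "k \<le> n" using ij by (auto simp: k_def)
  let ?s = "\<Sum>a<Suc r. cscale (c k (Suc r) a) (tower n c d k (Suc a))"
  have "Poly_Mapping.lookup (tower n c d k (Suc a)) (Suc j) = 0" if "a < Suc r" for a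
  proof -
    have "Poly_Mapping.keys (tower n c d k (Suc a)) \<subseteq> {1..Suc a} \<union> {n - k + 1..n}"
      by (rule tower_support) (use k in auto)
    moreover have "Suc j \<notin> {1..Suc a} \<union> {n - k + 1..n}" using that ij k by (auto simp: pos_roots_def)
    ultimately show ?thesis by (meson in_keys_iff subsetD)
  qed
  then have s0: "Poly_Mapping.lookup ?s (Suc j) = 0" unfolding lookup_lincomb by simp
  have "proj_kill (Suc j) (tower_family n c d (i, j) r) = ?s"
  proof (rule poly_mapping_eqI)
    fix x
    have "tower_family n c d (i, j) r = ?s + cscale (d k (Suc r)) (wvec (Suc j))"
      unfolding tower_family_def snd_conv k by (simp only: tower.simps k)
    then show "Poly_Mapping.lookup (proj_kill (Suc j) (tower_family n c d (i, j) r)) x = Poly_Mapping.lookup ?s x"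
      using s0 by (simp add: lookup_proj_kill lookup_add lookup_wvec del: sum.lessThan_Suc)
  qed
  also have "?s \<in> fsv.span (tower_family n c d (i, Suc j) ` {..<i})"
    using ij(3) by (intro fsv.span_sum fsv.span_scale fsv.span_base) (auto simp: tower_family_def k_def)
  finally show "proj_kill (Suc j) (tower_family n c d (i, j) r) \<in> point_of n (tower_family n c d) (i, Suc j)"
    using pos by (simp add: point_of_eq)
qed (use assms in \<open>auto simp: point_of_eq\<close>)

lemma R_point_tower:
  assumes n: "n \<ge> 2" and V: "V \<in> R_points n"
  obtains c d where "tower_family n c d \<in> basis_families n V"
proof -
  obtain y where y: "\<And>i j. (i, j) \<in> pos_roots n \<Longrightarrow> lin_indep i (\<lambda>r. y (Suc r) j)"
    "\<And>i j. (i, j) \<in> pos_roots n \<Longrightarrow> fsv.span ((\<lambda>r. y (Suc r) j) ` {..<i}) = V (i, j)"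
    by (rule adapted_basis[OF V]) blast
  define Y where "Y k i = (if k = 0 then wvec i else y i (n - k))" for k i
  have "\<exists>c d. Y (Suc k) i = (\<Sum>a<i. cscale (c a) (Y k (Suc a))) + cscale d (wvec (n - k))"
    if ki: "(i, n - Suc k) \<in> pos_roots n" "Suc k \<le> n" for k i
  proof -
    define j where "j = n - Suc k"
    have j: "n - k = Suc j" "(i, j) \<in> pos_roots n" using ki by (auto simp: j_def)
    have "y i j \<in> fsv.span ((\<lambda>r. y (Suc r) j) ` {..<i})"
      using j(2) by (intro fsv.span_base) (auto simp: pos_roots_def intro!: image_eqI[of _ _ "i - 1"])
    then have yV: "y i j \<in> V (i, j)" using y(2)[OF j(2)] by simp
    have proj: "proj_kill (Suc j) (y i j) \<in> fsv.span ((\<lambda>a. Y k (Suc a)) ` {..<i})"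
    proof (cases "k = 0")
      case True
      have "proj_kill (Suc j) (y i j) \<in> {v. Poly_Mapping.keys v \<subseteq> {1..i}}"
        using R_pointsD(4)[OF V j(2) yV] True j
        by (auto simp: support_indices_def in_keys_iff lookup_proj_kill subset_iff split: if_splits)
      moreover have "(\<lambda>a. wvec (Suc a)) ` {..<i} = wvec ` {1..i}"
        unfolding image_Suc_lessThan[symmetric] image_image ..
      ultimately show ?thesis using True span_wvec[of "{1..i}"] by (simp add: Y_def)
    next
      case False
      then have "j < n - 1" "(i, Suc j) \<in> pos_roots n" using j by (auto simp: pos_roots_def)
      then show ?thesis using R_pointsD(6)[OF V j(2) _ yV] y(2)[of i "Suc j"] False j by (simp add: Y_def)
    qed
    then obtain c where c: "proj_kill (Suc j) (y i j) = (\<Sum>a<i. cscale (c a) (Y k (Suc a)))"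
      unfolding span_family by blast
    have "Y (Suc k) i = (\<Sum>a<i. cscale (c a) (Y k (Suc a))) + cscale (Poly_Mapping.lookup (y i j) (Suc j)) (wvec (n - k))"
      unfolding c[symmetric] proj_kill_eq j(1) by (simp add: Y_def j_def)
    then show ?thesis by blast
  qed
  then have "\<forall>k i. \<exists>c d. (i, n - Suc k) \<in> pos_roots n \<and> Suc k \<le> n \<longrightarrow>
      Y (Suc k) i = (\<Sum>a<i. cscale (c a) (Y k (Suc a))) + cscale d (wvec (n - k))"
    by blast
  then obtain c d where "\<forall>k i. (i, n - Suc k) \<in> pos_roots n \<and> Suc k \<le> n \<longrightarrow>
      Y (Suc k) i = (\<Sum>a<i. cscale (c k i a) (Y k (Suc a))) + cscale (d k i) (wvec (n - k))"
    unfolding choice_iff by blast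
  then have cd: "\<And>k i. (i, n - Suc k) \<in> pos_roots n \<Longrightarrow> Suc k \<le> n \<Longrightarrow>
      Y (Suc k) i = (\<Sum>a<i. cscale (c k i a) (Y k (Suc a))) + cscale (d k i) (wvec (n - k))"
    by blast
  have eq: "tower n c d k i = Y k i" if "k < n" "1 \<le> i" "i \<le> n - k" for k i
    using that
  proof (induction k arbitrary: i)
    case 0
    then show ?case by (simp add: Y_def)
  next
    case (Suc k)
    then have pos: "(i, n - Suc k) \<in> pos_roots n" by (auto simp: pos_roots_def)
    have "tower n c d k (Suc a) = Y k (Suc a)" if "a < i" for a using that Suc by (intro Suc.IH) auto
    then show ?case using cd[OF pos] Suc.prems by simp
  qed
  have "tower_family n c d \<in> basis_families n V"
    unfolding basis_families_iff
  proof
    fix \<alpha> assume a: "\<alpha> \<in> pos_roots n"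
    obtain i j where ij: "\<alpha> = (i, j)" by (cases \<alpha>)
    have "tower_family n c d \<alpha> r = y (Suc r) j" if "r < i" for r
    proof -
      have "n - j < n" "n - (n - j) = j" "n - j \<noteq> 0" "Suc r \<le> n - (n - j)"
        using a ij that n by (auto simp: pos_roots_def)
      then show ?thesis using ij eq[of "n - j" "Suc r"] by (simp add: tower_family_def Y_def)
    qed
    then have "lin_indep i (tower_family n c d \<alpha>) = lin_indep i (\<lambda>r. y (Suc r) j)"
      "tower_family n c d \<alpha> ` {..<i} = (\<lambda>r. y (Suc r) j) ` {..<i}"
      by (auto simp: lin_indep_def)
    then show "lin_indep (fst \<alpha>) (tower_family n c d \<alpha>) \<and> fsv.span (tower_family n c d \<alpha> ` {..<fst \<alpha>}) = V \<alpha>"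
      using y[of i j] a ij by simp
  qed
  then show ?thesis using that by blast
qed

lemma R_point_basis: "n \<ge> 2 \<Longrightarrow> V \<in> R_points n \<Longrightarrow> basis_families n V \<noteq> {}"
  using R_point_tower by blast

subsection \<open>Change of bases\<close>

lemma homogeneous_rescale:
  assumes "homogeneous (gens (R_variety n)) d F"
    and "\<And>\<alpha> t. \<alpha> \<in> pos_roots n \<Longrightarrow> minor (fst \<alpha>) (u' \<alpha>) t = g \<alpha> * minor (fst \<alpha>) (u \<alpha>) t"
  shows "F u' = (\<Prod>\<alpha>\<in>pos_roots n. g \<alpha> ^ d \<alpha>) * F u"
  using assms(1)
proof induction
  case (gen f \<alpha>)
  then have \<alpha>: "\<alpha> \<in> pos_roots n" and f: "f \<in> range (pluecker_minor \<alpha>)" by (auto simp: R_variety_def split: if_splits)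
  have "(\<Prod>\<beta>\<in>pos_roots n. g \<beta> ^ ((\<lambda>_. 0)(\<alpha> := 1)) \<beta>) = (\<Prod>\<beta>\<in>pos_roots n. if \<beta> = \<alpha> then g \<beta> else 1)"
    by (rule prod.cong) auto
  then show ?case using \<alpha> f assms(2)[OF \<alpha>] by (auto simp: pluecker_minor_eq simp del: fun_upd_apply)
next
  case (mult d F d' F')
  then show ?case by (simp add: power_add prod.distrib)
qed (auto simp: algebra_simps)

lemma basis_change:
  assumes u: "u \<in> basis_families n V" and u': "u' \<in> basis_families n V"
  obtains g where "\<And>\<alpha>. \<alpha> \<in> pos_roots n \<Longrightarrow> g \<alpha> \<noteq> 0"
    "\<And>\<alpha> t. \<alpha> \<in> pos_roots n \<Longrightarrow> minor (fst \<alpha>) (u' \<alpha>) t = g \<alpha> * minor (fst \<alpha>) (u \<alpha>) t"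
proof -
  have ex: "\<exists>g. g \<noteq> 0 \<and> (\<forall>t. minor (fst \<alpha>) (u' \<alpha>) t = g * minor (fst \<alpha>) (u \<alpha>) t)" if a: "\<alpha> \<in> pos_roots n" for \<alpha>
  proof -
    have "u' \<alpha> r \<in> fsv.span (u \<alpha> ` {..<fst \<alpha>})" if r: "r < fst \<alpha>" for r
    proof -
      have "u' \<alpha> r \<in> fsv.span (u' \<alpha> ` {..<fst \<alpha>})" using r by (intro fsv.span_base) auto
      then show ?thesis using u u' a by (simp add: basis_families_iff)
    qed
    then obtain g where g: "\<forall>t. minor (fst \<alpha>) (u' \<alpha>) t = g * minor (fst \<alpha>) (u \<alpha>) t"
      using minor_base_change[of "fst \<alpha>" "u' \<alpha>" "u \<alpha>"] by blast
    have "lin_indep (fst \<alpha>) (u' \<alpha>)" using u' a by (simp add: basis_families_iff)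
    then obtain t where "minor (fst \<alpha>) (u' \<alpha>) t \<noteq> 0"
      using lin_indep_imp_nonzero_minor[of "fst \<alpha>" "u' \<alpha>" UNIV] by auto
    then show ?thesis using g by (intro exI[of _ g]) auto
  qed
  define g where "g \<alpha> = (SOME g. g \<noteq> 0 \<and> (\<forall>t. minor (fst \<alpha>) (u' \<alpha>) t = g * minor (fst \<alpha>) (u \<alpha>) t))" for \<alpha>
  have "g \<alpha> \<noteq> 0 \<and> (\<forall>t. minor (fst \<alpha>) (u' \<alpha>) t = g \<alpha> * minor (fst \<alpha>) (u \<alpha>) t)" if "\<alpha> \<in> pos_roots n" for \<alpha>
    unfolding g_def by (rule someI_ex[OF ex[OF that]])
  then show ?thesis by (intro that[of g]) simp_all
qed

lemma homogeneous_basis_independent: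
  assumes "homogeneous (gens (R_variety n)) d F" "u \<in> basis_families n V" "u' \<in> basis_families n V"
  shows "F u' \<noteq> 0 \<longleftrightarrow> F u \<noteq> 0"
proof -
  obtain g where g: "\<And>\<alpha>. \<alpha> \<in> pos_roots n \<Longrightarrow> g \<alpha> \<noteq> 0"
    "\<And>\<alpha> t. \<alpha> \<in> pos_roots n \<Longrightarrow> minor (fst \<alpha>) (u' \<alpha>) t = g \<alpha> * minor (fst \<alpha>) (u \<alpha>) t"
    using basis_change[OF assms(2,3)] by blast
  have "(\<Prod>\<alpha>\<in>pos_roots n. g \<alpha> ^ d \<alpha>) \<noteq> 0" using g(1) by simp
  then show ?thesis using homogeneous_rescale[OF assms(1) g(2)] by simp
qed

subsection \<open>The open cell\<close>

lemma graph_row_minor: "\<alpha> \<in> pos_roots n \<Longrightarrow> minor (fst \<alpha>) (graph_row n c \<alpha>) Suc = 1"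
  by (rule minor_pivot_reduced_basis) (auto simp: lookup_graph_row pos_roots_def)

lemma graph_row_lin_indep: "\<alpha> \<in> pos_roots n \<Longrightarrow> lin_indep (fst \<alpha>) (graph_row n c \<alpha>)"
  using nonzero_minor_imp_lin_indep graph_row_minor by (metis zero_neq_one)

lemma graph_row_support:
  "\<alpha> \<in> pos_roots n \<Longrightarrow> r < fst \<alpha> \<Longrightarrow> Poly_Mapping.keys (graph_row n c \<alpha> r) \<subseteq> support_indices n \<alpha>"
proof
  fix k assume "\<alpha> \<in> pos_roots n" "r < fst \<alpha>" "k \<in> Poly_Mapping.keys (graph_row n c \<alpha> r)"
  then have "Poly_Mapping.lookup (graph_row n c \<alpha> r) k \<noteq> 0" "r < fst \<alpha>" "1 \<le> n"
    by (auto simp: pos_roots_def in_keys_iff)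
  then show "k \<in> support_indices n \<alpha>"
    by (auto simp: lookup_graph_row support_indices_def split: if_splits)
qed

lemma graph_row_point: "point_of n (graph_row n c) \<in> R_points n"
proof (rule R_pointsI[of _ _ "graph_row n c"])
  show "point_of n (graph_row n c) \<in> extensional (pos_roots n)" by (simp add: point_of_def)
next
  fix i j r assume ij: "(i, j) \<in> pos_roots n" "i < j" "r < i"
  then have pos: "(Suc i, j) \<in> pos_roots n" by (auto simp: pos_roots_def)
  have "graph_row n c (i, j) r = graph_row n c (Suc i, j) r" by (simp add: graph_row_def)
  then show "graph_row n c (i, j) r \<in> point_of n (graph_row n c) (Suc i, j)"
    using ij by (simp add: point_of_eq[OF pos] fsv.span_base)
next
  fix i j r assume ij: "(i, j) \<in> pos_roots n" "j < n - 1" "r < i"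
  then have pos: "(i, Suc j) \<in> pos_roots n" by (auto simp: pos_roots_def)
  have "proj_kill (Suc j) (graph_row n c (i, j) r) = graph_row n c (i, Suc j) r"
    by (rule poly_mapping_eqI) (use ij in \<open>auto simp: lookup_proj_kill lookup_graph_row pos_roots_def\<close>)
  then show "proj_kill (Suc j) (graph_row n c (i, j) r) \<in> point_of n (graph_row n c) (i, Suc j)"
    using ij by (simp add: point_of_eq[OF pos] fsv.span_base)
qed (use graph_row_lin_indep graph_row_support in \<open>auto simp: point_of_eq\<close>)

lemma graph_row_basis: "graph_row n c \<in> basis_families n (point_of n (graph_row n c))"
  by (rule point_of_basis) (rule graph_row_lin_indep)

text \<open>Reduce all bases with respect to the first \<open>i\<close> coordinates. The inclusions
  \<open>V\<^bsub>i,j\<^esub> \<subset> V\<^bsub>i+1,j\<^esub>\<close> show that row \<open>r\<close> does not depend on \<open>i > r\<close>, and the projections show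
  that the passage from \<open>j\<close> to \<open>j + 1\<close> changes the coordinate \<open>j + 1\<close> only. So all entries come
  from one matrix \<open>c\<close>.\<close>

lemma cell_point:
  assumes V: "V \<in> R_points n" and u: "u \<in> basis_families n V"
    and cell: "\<And>\<alpha>. \<alpha> \<in> pos_roots n \<Longrightarrow> minor (fst \<alpha>) (u \<alpha>) Suc \<noteq> 0"
  obtains c where "graph_row n c \<in> basis_families n V"
proof -
  define q where "q \<alpha> = reduced_basis (fst \<alpha>) (u \<alpha>) Suc" for \<alpha>
  have span: "fsv.span (u \<alpha> ` {..<fst \<alpha>}) = V \<alpha>" if "\<alpha> \<in> pos_roots n" for \<alpha>
    using u that by (simp add: basis_families_iff)
  have piv: "Poly_Mapping.lookup (q \<alpha> a) (Suc b) = (if a = b then 1 else 0)" if "\<alpha> \<in> pos_roots n" "a < fst \<alpha>" "b < fst \<alpha>" for \<alpha> a b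
    unfolding q_def using that cell by (intro reduced_basis_pivot)
  have qV: "q \<alpha> a \<in> V \<alpha>" if "\<alpha> \<in> pos_roots n" for \<alpha> a
    using reduced_basis_in_span[of "fst \<alpha>" "u \<alpha>" Suc a] span[OF that] by (simp add: q_def)
  have unique: "v = q \<alpha> r" if a: "\<alpha> \<in> pos_roots n" and v: "v \<in> V \<alpha>" and r: "r < fst \<alpha>"
    and b: "\<And>b. b < fst \<alpha> \<Longrightarrow> Poly_Mapping.lookup v (Suc b) = (if r = b then 1 else 0)" for \<alpha> v r
  proof -
    have "v = (\<Sum>b<fst \<alpha>. cscale (Poly_Mapping.lookup v (Suc b)) (q \<alpha> b))"
      unfolding q_def using cell[OF a] v span[OF a] by (intro reduced_basis_expand) auto
    also have "\<dots> = (\<Sum>b<fst \<alpha>. if b = r then q \<alpha> b else 0)" by (rule sum.cong) (auto simp: b)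
    finally show ?thesis using r by simp
  qed
  have S1: "q (i, j) r = q (Suc i, j) r" if ij: "(i, j) \<in> pos_roots n" "i < j" "r < i" for i j r
  proof (rule unique)
    show pos: "(Suc i, j) \<in> pos_roots n" using ij by (auto simp: pos_roots_def)
    show "q (i, j) r \<in> V (Suc i, j)" using R_pointsD(5)[OF V ij(1,2)] qV[OF ij(1)] by blast
    fix b assume "b < fst (Suc i, j)"
    show "Poly_Mapping.lookup (q (i, j) r) (Suc b) = (if r = b then 1 else 0)"
    proof (cases "b = i")
      case True
      have "Suc i \<notin> support_indices n (i, j)" using ij by (auto simp: support_indices_def)
      then have "Poly_Mapping.lookup (q (i, j) r) (Suc i) = 0"
        using R_pointsD(4)[OF V ij(1) qV[OF ij(1)]] by (meson in_keys_iff subsetD)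
      then show ?thesis using True ij by simp
    next
      case False
      then show ?thesis using piv[OF ij(1), of r b] ij \<open>b < _\<close> by simp
    qed
  qed (use ij in auto)
  have S2: "Poly_Mapping.lookup (q (i, j) r) x = Poly_Mapping.lookup (q (i, Suc j) r) x"
    if ij: "(i, j) \<in> pos_roots n" "j < n - 1" "r < i" "x \<noteq> Suc j" for i j r x
  proof -
    have "proj_kill (Suc j) (q (i, j) r) = q (i, Suc j) r"
    proof (rule unique)
      show "(i, Suc j) \<in> pos_roots n" using ij by (auto simp: pos_roots_def)
      show "proj_kill (Suc j) (q (i, j) r) \<in> V (i, Suc j)" using R_pointsD(6)[OF V ij(1,2)] qV[OF ij(1)] by blast
      fix b assume "b < fst (i, Suc j)"
      then show "Poly_Mapping.lookup (proj_kill (Suc j) (q (i, j) r)) (Suc b) = (if r = b then 1 else 0)"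
        using piv[OF ij(1), of r b] ij by (auto simp: lookup_proj_kill pos_roots_def)
    qed (use ij in auto)
    then show ?thesis using ij(4) lookup_proj_kill[of "Suc j" "q (i, j) r" x] by simp
  qed
  have T1: "q (i, j) r = q (Suc r, j) r" if "(i, j) \<in> pos_roots n" "r < i" for i j r
    using that
  proof (induction i)
    case (Suc i)
    show ?case
    proof (cases "i = r")
      case False
      then have "(i, j) \<in> pos_roots n" "i < j" "r < i" using Suc.prems by (auto simp: pos_roots_def)
      then show ?thesis using S1[of i j r] Suc.IH by simp
    qed simp
  qed simp
  have T2: "Poly_Mapping.lookup (q (i, j) r) (Suc b) = Poly_Mapping.lookup (q (i, b) r) (Suc b)"
    if "(i, j) \<in> pos_roots n" "r < i" "j \<le> b" "b \<le> n - 1" for i j r b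
    using that(3,1,2,4)
  proof (induction j rule: inc_induct)
    case (step j)
    then have "(i, j) \<in> pos_roots n" "(i, Suc j) \<in> pos_roots n" "j < n - 1" by (auto simp: pos_roots_def)
    then show ?case using S2[of i j r "Suc b"] step by simp
  qed simp
  define c where "c \<beta> = Poly_Mapping.lookup (q \<beta> (fst \<beta> - 1)) (Suc (snd \<beta>))" for \<beta>
  have eq: "graph_row n c (i, j) r = q (i, j) r" if ij: "(i, j) \<in> pos_roots n" "r < i" for i j r
  proof (rule poly_mapping_eqI)
    fix x
    have b: "1 \<le> i" "i \<le> j" "j \<le> n - 1" using ij by (auto simp: pos_roots_def)
    consider "x \<in> {1..i}" | "x \<in> {Suc j..n}" | "x \<notin> support_indices n (i, j)" by (auto simp: support_indices_def)
    then show "Poly_Mapping.lookup (graph_row n c (i, j) r) x = Poly_Mapping.lookup (q (i, j) r) x"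
    proof cases
      case 1
      then show ?thesis using piv[OF ij(1), of r "x - 1"] ij(2) b by (auto simp: lookup_graph_row)
    next
      case 2
      define y where "y = x - 1"
      have y: "x = Suc y" "j \<le> y" "y \<le> n - 1" using 2 by (auto simp: y_def)
      have pos: "(Suc r, j) \<in> pos_roots n" using ij b by (auto simp: pos_roots_def)
      have "Poly_Mapping.lookup (q (i, j) r) x = Poly_Mapping.lookup (q (Suc r, y) r) (Suc y)"
        using T1[OF ij] T2[OF pos _ y(2,3), of r] y(1) by simp
      then show ?thesis using 2 y ij(2) b by (auto simp: lookup_graph_row c_def)
    next
      case 3
      then have "Poly_Mapping.lookup (q (i, j) r) x = 0"
        using R_pointsD(4)[OF V ij(1) qV[OF ij(1)]] by (meson in_keys_iff subsetD)
      moreover have "Poly_Mapping.lookup (graph_row n c (i, j) r) x = 0"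
        using graph_row_support[OF ij(1), of r c] ij(2) 3 by (metis fst_conv in_keys_iff subsetD)
      ultimately show ?thesis by simp
    qed
  qed
  have "graph_row n c \<in> basis_families n V"
    unfolding basis_families_iff
  proof (intro ballI conjI)
    fix \<alpha> assume a: "\<alpha> \<in> pos_roots n"
    show "lin_indep (fst \<alpha>) (graph_row n c \<alpha>)" by (rule graph_row_lin_indep[OF a])
    have "graph_row n c \<alpha> ` {..<fst \<alpha>} = q \<alpha> ` {..<fst \<alpha>}"
      using eq[of "fst \<alpha>" "snd \<alpha>"] a by (intro image_cong) auto
    then show "fsv.span (graph_row n c \<alpha> ` {..<fst \<alpha>}) = V \<alpha>"
      using span_reduced_basis[OF cell[OF a]] span[OF a] by (simp add: q_def)
  qed
  then show ?thesis using that by blast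
qed

subsection \<open>Density of the cell\<close>

definition polyfun :: "(complex \<Rightarrow> complex) \<Rightarrow> bool" where
  "polyfun f \<longleftrightarrow> (\<exists>p. \<forall>t. f t = poly p t)"

lemma polyfun_const: "polyfun (\<lambda>_. c)"
  unfolding polyfun_def by (intro exI[of _ "[:c:]"]) simp

lemma polyfun_id: "polyfun (\<lambda>t. t)"
  unfolding polyfun_def by (intro exI[of _ "[:0, 1:]"]) simp

lemma polyfun_add: "polyfun f \<Longrightarrow> polyfun g \<Longrightarrow> polyfun (\<lambda>t. f t + g t)"
  unfolding polyfun_def by (metis poly_add)

lemma polyfun_mult: "polyfun f \<Longrightarrow> polyfun g \<Longrightarrow> polyfun (\<lambda>t. f t * g t)"
  unfolding polyfun_def by (metis poly_mult)

lemma polyfun_sum: "(\<And>a. a \<in> A \<Longrightarrow> polyfun (f a)) \<Longrightarrow> polyfun (\<lambda>t. \<Sum>a\<in>A. f a t)"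
  by (induction A rule: infinite_finite_induct) (auto intro: polyfun_const polyfun_add)

lemma polyfun_prod: "(\<And>a. a \<in> A \<Longrightarrow> polyfun (f a)) \<Longrightarrow> polyfun (\<lambda>t. \<Prod>a\<in>A. f a t)"
  by (induction A rule: infinite_finite_induct) (auto intro: polyfun_const polyfun_mult)

lemma polyfun_minor:
  assumes "\<And>a b. a < i \<Longrightarrow> b < i \<Longrightarrow> polyfun (\<lambda>t. Poly_Mapping.lookup (u t a) (s b))"
  shows "polyfun (\<lambda>t. minor i (u t) s)"
proof -
  have "minor i (u t) s = (\<Sum>p\<in>{p. p permutes {0..<i}}. signof p * (\<Prod>a\<in>{0..<i}. Poly_Mapping.lookup (u t a) (s (p a))))" for t
    unfolding minor_def
    by (subst det_def'[of _ i]) (auto intro!: sum.cong prod.cong simp: permutes_in_image)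
  moreover have "polyfun (\<lambda>t. Poly_Mapping.lookup (u t a) (s (p a)))" if "p permutes {0..<i}" "a \<in> {0..<i}" for p a
    using assms[of a "p a"] that permutes_in_image[OF that(1), of a] by simp
  ultimately show ?thesis
    by (simp only:) (intro polyfun_sum polyfun_mult polyfun_const polyfun_prod; simp)
qed

lemma polyfun_homogeneous:
  assumes "homogeneous (gens (R_variety n)) d F"
    and "\<And>\<alpha> a x. \<alpha> \<in> pos_roots n \<Longrightarrow> a < fst \<alpha> \<Longrightarrow> polyfun (\<lambda>t. Poly_Mapping.lookup (u t \<alpha> a) x)"
  shows "polyfun (\<lambda>t. F (u t))"
  using assms(1)
proof induction
  case (gen f \<alpha>)
  then have \<alpha>: "\<alpha> \<in> pos_roots n" and "f \<in> range (pluecker_minor \<alpha>)" by (auto simp: R_variety_def split: if_splits)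
  then obtain s where s: "f = pluecker_minor \<alpha> s" by blast
  show ?case unfolding s pluecker_minor_eq by (rule polyfun_minor) (rule assms(2)[OF \<alpha>])
qed (auto intro: polyfun_const polyfun_add polyfun_mult)

lemma polyfun_nonzero:
  assumes "finite A" "\<And>a. a \<in> A \<Longrightarrow> polyfun (f a)" "\<And>a. a \<in> A \<Longrightarrow> \<exists>t. f a t \<noteq> 0"
  obtains t where "\<And>a. a \<in> A \<Longrightarrow> f a t \<noteq> 0"
proof -
  have "\<forall>a. \<exists>p. a \<in> A \<longrightarrow> (\<forall>t. f a t = poly p t)" using assms(2) unfolding polyfun_def by blast
  then obtain p where p: "\<And>a t. a \<in> A \<Longrightarrow> f a t = poly (p a) t" by metis
  have "p a \<noteq> 0" if "a \<in> A" for a using assms(3)[OF that] p[OF that] by auto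
  then have "(\<Prod>a\<in>A. p a) \<noteq> 0" using assms(1) by simp
  then obtain t where "poly (\<Prod>a\<in>A. p a) t \<noteq> 0" using poly_all_0_iff_0 by blast
  then have "f a t \<noteq> 0" if "a \<in> A" for a using that p[OF that] assms(1) by (simp add: poly_prod)
  then show ?thesis using that by blast
qed

lemma polyfun_tower:
  assumes "\<And>k i a. polyfun (\<lambda>t. c t k i a)" "\<And>k i. polyfun (\<lambda>t. d t k i)"
  shows "polyfun (\<lambda>t. Poly_Mapping.lookup (tower n (c t) (d t) k i) x)"
proof (induction k arbitrary: i)
  case 0
  then show ?case by (simp add: polyfun_const)
next
  case (Suc k)
  show ?case unfolding tower.simps lookup_add lookup_lincomb lookup_cscale
    by (intro polyfun_add polyfun_sum polyfun_mult assms Suc polyfun_const)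
qed

lemma trivial_tower: "tower n (\<lambda>k i a. if Suc a = i then 1 else 0) (\<lambda>_ _. 0) k (Suc r) = wvec (Suc r)"
proof (induction k arbitrary: r)
  case (Suc k)
  have "(\<Sum>a<Suc r. cscale (if Suc a = Suc r then 1 else 0) (tower n (\<lambda>k i a. if Suc a = i then 1 else 0) (\<lambda>_ _. 0) k (Suc a))) =
     (\<Sum>a<Suc r. if a = r then wvec (Suc r) else 0)"
    by (rule sum.cong) (auto simp: Suc)
  then show ?case by simp
qed simp

text \<open>Join the parameters of \<open>V\<close> to those of the coordinate subspaces by a line. Along this
  line, \<open>F\<close> and the leading minors are polynomials that are not identically zero: \<open>F\<close> is nonzero
  at one end and the minors are nonzero at the other. So some point of the line lies in the cell
  and has \<open>F \<noteq> 0\<close>.\<close>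

theorem cell_dense:
  assumes n: "n \<ge> 2" and F: "homogeneous (gens (R_variety n)) d F"
    and V: "V \<in> R_points n" "u \<in> basis_families n V" "F u \<noteq> 0"
  obtains c where "F (graph_row n c) \<noteq> 0"
proof -
  obtain c d where cd: "tower_family n c d \<in> basis_families n V" using R_point_tower[OF n V(1)] .
  define U where "U t = tower_family n (\<lambda>k i a. (1 - t) * c k i a + t * (if Suc a = i then 1 else 0)) (\<lambda>k i. (1 - t) * d k i + t * 0)" for t
  have sub: "polyfun (\<lambda>t. 1 - t)"
    using polyfun_add[OF polyfun_const[of 1] polyfun_mult[OF polyfun_const[of "- 1"] polyfun_id]] by simp
  have poly: "polyfun (\<lambda>t. Poly_Mapping.lookup (U t \<alpha> a) x)" for \<alpha> a x
    unfolding U_def tower_family_def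
    by (rule polyfun_tower) (intro polyfun_add polyfun_mult polyfun_const polyfun_id sub)+
  have U0: "U 0 = tower_family n c d" by (simp add: U_def)
  have U1: "U 1 \<alpha> r = wvec (Suc r)" for \<alpha> r by (simp add: U_def tower_family_def trivial_tower)
  \<comment> \<open>\<open>None\<close> stands for the function \<open>F\<close> and \<open>Some \<alpha>\<close> for the leading minor of the root \<open>\<alpha>\<close>.\<close>
  define f where "f x t = (case x of None \<Rightarrow> F (U t) | Some \<alpha> \<Rightarrow> minor (fst \<alpha>) (U t \<alpha>) Suc)" for x t
  obtain t where t: "\<And>x. x \<in> insert None (Some ` pos_roots n) \<Longrightarrow> f x t \<noteq> 0"
  proof (rule polyfun_nonzero[of "insert None (Some ` pos_roots n)" f])
    fix x assume x: "x \<in> insert None (Some ` pos_roots n)"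
    show "polyfun (f x)"
      unfolding f_def using polyfun_homogeneous[OF F poly] by (cases x) (auto intro!: polyfun_minor poly)
    show "\<exists>t. f x t \<noteq> 0"
    proof (cases x)
      case None
      have "F (U 0) \<noteq> 0" unfolding U0 using homogeneous_basis_independent[OF F V(2) cd] V(3) by simp
      then show ?thesis using None by (auto simp: f_def)
    next
      case (Some \<alpha>)
      have "minor (fst \<alpha>) (U 1 \<alpha>) Suc = 1"
        by (rule minor_pivot_reduced_basis) (simp add: U1 lookup_wvec)
      then show ?thesis using Some by (intro exI[of _ 1]) (simp add: f_def)
    qed
  qed auto
  have cell: "minor (fst \<alpha>) (U t \<alpha>) Suc \<noteq> 0" if "\<alpha> \<in> pos_roots n" for \<alpha>
    using t[of "Some \<alpha>"] that by (auto simp: f_def)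
  have Ft: "F (U t) \<noteq> 0" using t[of None] by (simp add: f_def)
  have ind: "lin_indep (fst \<alpha>) (U t \<alpha>)" if "\<alpha> \<in> pos_roots n" for \<alpha>
    by (rule nonzero_minor_imp_lin_indep[OF cell[OF that]])
  have pt: "point_of n (U t) \<in> R_points n" using ind unfolding U_def by (rule tower_point)
  obtain c' where "graph_row n c' \<in> basis_families n (point_of n (U t))"
    using cell_point[OF pt point_of_basis[OF ind] cell] .
  then have "F (graph_row n c') \<noteq> 0"
    using homogeneous_basis_independent[OF F point_of_basis[OF ind]] Ft by blast
  then show ?thesis using that by blast
qed

section \<open>The map from R to the orbit closure\<close>

definition basic_open :: "('p, 'c, 'k) mproj \<Rightarrow> ('c \<Rightarrow> complex) \<Rightarrow> 'p set" where
  "basic_open X F = {x \<in> points X. \<exists>c\<in>coords X x. F c \<noteq> 0}"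

text \<open>The vanishing of homogeneous functions does not depend on the choice of coordinates of a
  point. Then the sets \<open>basic_open X F\<close> are closed under intersection and form a basis of the
  Zariski topology.\<close>

definition coherent :: "('p, 'c, 'k) mproj \<Rightarrow> bool" where
  "coherent X \<longleftrightarrow> (\<forall>x\<in>points X. coords X x \<noteq> {}) \<and>
     (\<forall>d F x c c'. homogeneous (gens X) d F \<longrightarrow> x \<in> points X \<longrightarrow> c \<in> coords X x \<longrightarrow> c' \<in> coords X x \<longrightarrow>
        (F c \<noteq> 0 \<longleftrightarrow> F c' \<noteq> 0))"

lemma coherentD:
  assumes "coherent X"
  shows "x \<in> points X \<Longrightarrow> coords X x \<noteq> {}"
    "homogeneous (gens X) d F \<Longrightarrow> x \<in> points X \<Longrightarrow> c \<in> coords X x \<Longrightarrow> c' \<in> coords X x \<Longrightarrow> F c \<noteq> 0 \<Longrightarrow> F c' \<noteq> 0"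
  using assms unfolding coherent_def by blast+

lemma zariski_eq: "zariski X = topology_generated_by {basic_open X F | F. \<exists>d. homogeneous (gens X) d F}"
  by (simp add: zariski_def basic_open_def)

lemma openin_basic_open: "homogeneous (gens X) d F \<Longrightarrow> openin (zariski X) (basic_open X F)"
  unfolding zariski_eq by (rule topology_generated_by_Basis) blast

lemma topspace_zariski:
  assumes "coherent X"
  shows "topspace (zariski X) = points X"
proof -
  have "basic_open X (\<lambda>_. 1) = points X" using coherentD(1)[OF assms] by (auto simp: basic_open_def)
  then have "points X \<in> {basic_open X F | F. \<exists>d. homogeneous (gens X) d F}"
    using homogeneous.const[of "gens X" 1] by blast
  then show ?thesis unfolding zariski_eq topology_generated_by_topspace by (auto simp: basic_open_def)
qed

lemma zariski_basis:
  assumes X: "coherent X" and U: "openin (zariski X) U" "x \<in> U"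
  obtains d F where "homogeneous (gens X) d F" "x \<in> basic_open X F" "basic_open X F \<subseteq> U"
proof -
  let ?B = "{basic_open X F | F. \<exists>d. homogeneous (gens X) d F}"
  have "generate_topology_on ?B U" using U(1) unfolding zariski_eq openin_topology_generated_by_iff .
  then have "\<forall>x\<in>U. \<exists>d F. homogeneous (gens X) d F \<and> x \<in> basic_open X F \<and> basic_open X F \<subseteq> U"
  proof (induction rule: generate_topology_on.induct)
    case (Int A B)
    show ?case
    proof
      fix x assume x: "x \<in> A \<inter> B"
      obtain d F where F: "homogeneous (gens X) d F" "x \<in> basic_open X F" "basic_open X F \<subseteq> A" using Int x by blast
      obtain d' F' where F': "homogeneous (gens X) d' F'" "x \<in> basic_open X F'" "basic_open X F' \<subseteq> B" using Int x by blast
      have "basic_open X (\<lambda>c. F c * F' c) \<subseteq> basic_open X F \<inter> basic_open X F'" by (auto simp: basic_open_def)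
      moreover obtain c where c: "x \<in> points X" "c \<in> coords X x" "F c \<noteq> 0" using F(2) by (auto simp: basic_open_def)
      moreover obtain c' where "c' \<in> coords X x" "F' c' \<noteq> 0" using F'(2) by (auto simp: basic_open_def)
      then have "F' c \<noteq> 0" using coherentD(2)[OF X F'(1)] c by blast
      then have "x \<in> basic_open X (\<lambda>c. F c * F' c)" using c by (auto simp: basic_open_def)
      ultimately show "\<exists>d F. homogeneous (gens X) d F \<and> x \<in> basic_open X F \<and> basic_open X F \<subseteq> A \<inter> B"
        using homogeneous.mult[OF F(1) F'(1)] F(3) F'(3) by blast
    qed
  next
    case (UN K)
    then show ?case by (meson Union_iff Union_upper subset_trans)
  qed blast+
  then show ?thesis using U(2) that by blast
qed

context collection
begin

abbreviation "R \<equiv> R_variety n"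
abbreviation "P \<equiv> PM n m"

definition line :: "free_tensor \<Rightarrow> tensor set" where
  "line \<tau> = line_of (cyclic_module n m) (cls T \<tau>)"

lemma line_eq: "line \<tau> = {cls T (cscale k \<tau>) | k. True}"
  by (auto simp: line_def line_of_def cyclic_module_ops big_tensor_eq quotient_space_smult[OF T_subspace])

lemma cls_T_iff: "cls T \<tau> = T \<longleftrightarrow> \<tau> \<in> T"
  using cls_eq_iff[OF T_subspace, of \<tau> 0] by simp

lemma T_scale_iff: "k \<noteq> 0 \<Longrightarrow> cscale k \<tau> \<in> T \<longleftrightarrow> \<tau> \<in> T"
  using fsv.subspace_scale[OF T_subspace, of "cscale k \<tau>" "1 / k"] fsv.subspace_scale[OF T_subspace, of \<tau> k] by auto

lemma line_cong:
  assumes "k \<noteq> 0" "\<tau>' - cscale k \<tau> \<in> T"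
  shows "line \<tau>' = line \<tau>"
proof -
  have "cls T (cscale l \<tau>') = cls T (cscale (l * k) \<tau>)" for l
    using fsv.subspace_scale[OF T_subspace assms(2), of l] by (simp add: cls_eq_iff[OF T_subspace] cscale_diff_right)
  moreover have "cls T (cscale l \<tau>) = cls T (cscale (l / k) \<tau>')" for l
    using calculation[of "l / k"] assms(1) by simp
  ultimately show ?thesis unfolding line_eq by blast
qed

lemma points_P: "points P = line ` (cyclic_lift - T)"
proof -
  have "C - {T} = cls T ` (cyclic_lift - T)"
  proof (intro subset_antisym subsetI)
    fix x assume "x \<in> C - {T}"
    then obtain \<tau> where \<tau>: "\<tau> \<in> cyclic_lift" "x = cls T \<tau>" "x \<noteq> T" unfolding C_eq by blast
    then have "\<tau> \<notin> T" using cls_T by blast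
    then show "x \<in> cls T ` (cyclic_lift - T)" using \<tau> by blast
  next
    fix x assume "x \<in> cls T ` (cyclic_lift - T)"
    then obtain \<tau> where \<tau>: "\<tau> \<in> cyclic_lift" "\<tau> \<notin> T" "x = cls T \<tau>" by blast
    then have "x \<noteq> T" using cls_T_iff by blast
    then show "x \<in> C - {T}" using \<tau> C_eq by blast
  qed
  then have "points P = line_of (cyclic_module n m) ` cls T ` (cyclic_lift - T)"
    by (simp add: PM_def projective_space_def cyclic_module_ops)
  then show ?thesis by (simp add: image_image line_def[abs_def])
qed

lemma coords_P: "coords P L = L - {T}"
  by (simp add: PM_def projective_space_def cyclic_module_ops)

lemma gens_P: "gens P = (\<lambda>_. linear_forms (cyclic_module n m))"
  by (simp add: PM_def projective_space_def)

lemma coords_line: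
  assumes "\<tau> \<notin> T"
  shows "coords P (line \<tau>) = {cls T (cscale k \<tau>) | k. k \<noteq> 0}"
proof -
  have "cls T (cscale k \<tau>) = T \<longleftrightarrow> k = 0" for k
    using T_scale_iff[of k \<tau>] assms fsv.subspace_0[OF T_subspace] by (cases "k = 0") (auto simp: cls_T_iff)
  then show ?thesis unfolding coords_P line_eq by auto
qed

lemma homogeneous_scale_P:
  assumes "homogeneous (gens P) d F" "\<tau> \<in> cyclic_lift"
  shows "F (cls T (cscale k \<tau>)) = k ^ d () * F (cls T \<tau>)"
  using assms(1)
proof induction
  case (gen g u)
  have "cls T \<tau> \<in> C" using assms(2) by (simp add: cyclic_lift_def)
  then have "g (k \<odot>\<^bsub>cyclic_module n m\<^esub> cls T \<tau>) = k * g (cls T \<tau>)"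
    using gen unfolding gens_P linear_forms_def by blast
  then show ?case by (simp add: cyclic_module_ops big_tensor_eq quotient_space_smult[OF T_subspace])
qed (auto simp: algebra_simps power_add)

lemma coherent_P: "Z \<subseteq> points P \<Longrightarrow> coherent (subvariety P Z)"
  unfolding coherent_def subvariety_def
proof (intro conjI ballI allI impI; simp)
  fix L assume "Z \<subseteq> points P" "L \<in> Z"
  then obtain \<tau> where \<tau>: "\<tau> \<in> cyclic_lift" "\<tau> \<notin> T" "L = line \<tau>" unfolding points_P by blast
  have "cls T (cscale 1 \<tau>) \<in> coords P L" unfolding \<tau>(3) coords_line[OF \<tau>(2)] by (intro CollectI exI[of _ 1]) simp
  then show "coords P L \<noteq> {}" by blast
next
  fix d F L c c' assume "Z \<subseteq> points P" and F: "homogeneous (gens P) d F" and L: "L \<in> Z" and c: "c \<in> coords P L" "c' \<in> coords P L"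
  then obtain \<tau> where \<tau>: "\<tau> \<in> cyclic_lift" "\<tau> \<notin> T" "L = line \<tau>" unfolding points_P by blast
  obtain k k' where k: "k \<noteq> 0" "k' \<noteq> 0" "c = cls T (cscale k \<tau>)" "c' = cls T (cscale k' \<tau>)"
    using c unfolding \<tau>(3) coords_line[OF \<tau>(2)] by blast
  show "(F c = 0) = (F c' = 0)"
    unfolding k(3,4) homogeneous_scale_P[OF F \<tau>(1)] using k(1,2) by simp
qed

lemma subvariety_all: "subvariety P (points P) = P"
  by (simp add: subvariety_def)

lemma coherent_R: "coherent R"
proof -
  have "coords R E \<noteq> {}" if "E \<in> points R" for E
    using R_point_basis[OF n] that by (simp add: R_variety_def)
  moreover have "F c \<noteq> 0 \<longleftrightarrow> F c' \<noteq> 0" if "homogeneous (gens R) d F" "c \<in> coords R E" "c' \<in> coords R E" for d F E c c'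
    using homogeneous_basis_independent[OF that(1), of c' E c] that(2,3) by (simp add: R_variety_def)
  ultimately show ?thesis unfolding coherent_def by blast
qed

lemma points_R: "points R = R_points n" and coords_R: "coords R E = basis_families n E"
  by (simp_all add: R_variety_def)

subsection \<open>Homogeneous functions in the Pluecker coordinates\<close>

text \<open>Homogeneous functions on the projective space of \<open>M\<^sub>\<mm>\<close>, as functions on the free space.\<close>

definition pm_hom :: "nat \<Rightarrow> (free_tensor \<Rightarrow> complex) \<Rightarrow> bool" where
  "pm_hom D h \<longleftrightarrow> (\<exists>F. homogeneous (gens P) (\<lambda>_. D) F \<and> (\<forall>\<tau>. F (cls T \<tau>) = h \<tau>))"

lemma pm_hom_pform: "pm_hom 1 (pform s)"
proof -
  obtain g where g: "g \<in> linear_forms (cyclic_module n m)" "\<And>\<tau>. g (cls T \<tau>) = pform s \<tau>"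
    using linear_form_descend[OF pform_linear pform_T] by blast
  have "homogeneous (gens P) ((\<lambda>_. 0)(() := 1)) g" by (rule homogeneous.gen) (simp add: gens_P g)
  moreover have "(\<lambda>_. 0)(() := 1) = (\<lambda>_. 1 :: nat)" by auto
  ultimately show ?thesis unfolding pm_hom_def using g(2) by auto
qed

lemma pm_hom_const: "pm_hom 0 (\<lambda>_. c)"
  unfolding pm_hom_def by (intro exI[of _ "\<lambda>_. c"]) (simp add: homogeneous.const)

lemma pm_hom_add: "pm_hom D h \<Longrightarrow> pm_hom D h' \<Longrightarrow> pm_hom D (\<lambda>\<tau>. h \<tau> + h' \<tau>)"
  unfolding pm_hom_def by (metis (no_types, lifting) homogeneous.add)

lemma pm_hom_mult:
  assumes "pm_hom D h" "pm_hom D' h'"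
  shows "pm_hom (D + D') (\<lambda>\<tau>. h \<tau> * h' \<tau>)"
proof -
  obtain F F' where F: "homogeneous (gens P) (\<lambda>_. D) F" "\<And>\<tau>. F (cls T \<tau>) = h \<tau>"
    and F': "homogeneous (gens P) (\<lambda>_. D') F'" "\<And>\<tau>. F' (cls T \<tau>) = h' \<tau>"
    using assms unfolding pm_hom_def by blast
  show ?thesis unfolding pm_hom_def
    using homogeneous.mult[OF F(1) F'(1)] F(2) F'(2) by (intro exI[of _ "\<lambda>x. F x * F' x"]) simp
qed

lemma pm_hom_scale: "pm_hom D h \<Longrightarrow> pm_hom D (\<lambda>\<tau>. c * h \<tau>)"
  using pm_hom_mult[OF pm_hom_const] by fastforce

lemma pm_hom_power: "pm_hom D h \<Longrightarrow> pm_hom (k * D) (\<lambda>\<tau>. h \<tau> ^ k)"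
proof (induction k)
  case (Suc k)
  then show ?case using pm_hom_mult[of D h "k * D" "\<lambda>\<tau>. h \<tau> ^ k"] by simp
qed (simp add: pm_hom_const)

lemma pm_hom_zero: "pm_hom D (\<lambda>_. 0)"
  using pm_hom_scale[OF pm_hom_power[OF pm_hom_pform, of D], of 0 "\<lambda>_ _. 0"] by simp

lemma pm_hom_sum: "(\<And>a. a \<in> A \<Longrightarrow> pm_hom D (h a)) \<Longrightarrow> pm_hom D (\<lambda>\<tau>. \<Sum>a\<in>A. h a \<tau>)"
  by (induction A rule: infinite_finite_induct) (auto intro: pm_hom_zero pm_hom_add)

lemma pm_hom_prod: "finite A \<Longrightarrow> (\<And>a. a \<in> A \<Longrightarrow> pm_hom 1 (h a)) \<Longrightarrow> pm_hom (card A) (\<lambda>\<tau>. \<Prod>a\<in>A. h a \<tau>)"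
proof (induction A rule: finite_induct)
  case (insert a A)
  then show ?case using pm_hom_mult[of 1 "h a" "card A" "\<lambda>\<tau>. \<Prod>a\<in>A. h a \<tau>"] by simp
qed (simp add: pm_hom_const)

lemma pm_hom_det:
  assumes "\<And>a b. pm_hom 1 (h a b)"
  shows "pm_hom i (\<lambda>\<tau>. det (mat i i (\<lambda>(a, b). h a b \<tau>)))"
proof -
  have "det (mat i i (\<lambda>(a, b). h a b \<tau>)) = (\<Sum>p\<in>{p. p permutes {0..<i}}. signof p * (\<Prod>a\<in>{0..<i}. h a (p a) \<tau>))" for \<tau>
    by (subst det_def'[of _ i]) (auto intro!: sum.cong prod.cong simp: permutes_in_image)
  moreover have "pm_hom i (\<lambda>\<tau>. \<Prod>a\<in>{0..<i}. h a (p a) \<tau>)" for p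
    using pm_hom_prod[of "{0..<i}" "\<lambda>a. h a (p a)"] assms by simp
  ultimately show ?thesis by (simp only:) (intro pm_hom_sum pm_hom_scale)
qed

lemma pullback:
  assumes "homogeneous (gens P) d F"
  obtains F' where "homogeneous (gens R) (\<lambda>\<alpha>. d () * mdeg \<alpha>) F'"
    "\<And>u. segre u \<in> cyclic_lift \<Longrightarrow> F' u = F (cls T (segre u))"
proof -
  have "\<exists>F'. homogeneous (gens R) (\<lambda>\<alpha>. d () * mdeg \<alpha>) F' \<and> (\<forall>u. segre u \<in> cyclic_lift \<longrightarrow> F' u = F (cls T (segre u)))"
    using assms
  proof induction
    case (const c)
    show ?case by (intro exI[of _ "\<lambda>_. c"]) (simp add: homogeneous.const)
  next
    case (gen g k)
    then have "g \<in> linear_forms (cyclic_module n m)" by (simp add: gens_P)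
    then obtain l where l: "linear_form l" "\<And>u. u \<in> T \<Longrightarrow> l u = 0" "\<And>\<tau>. \<tau> \<in> cyclic_lift \<Longrightarrow> l \<tau> = g (cls T \<tau>)"
      using linear_form_lift by blast
    show ?case using form_segre_homogeneous[OF l(1,2)] l(3) by (intro exI[of _ "\<lambda>u. l (segre u)"]) simp
  next
    case (add d F1 F2)
    then obtain F1' F2' where "homogeneous (gens R) (\<lambda>\<alpha>. d () * mdeg \<alpha>) F1'" "\<forall>u. segre u \<in> cyclic_lift \<longrightarrow> F1' u = F1 (cls T (segre u))"
      "homogeneous (gens R) (\<lambda>\<alpha>. d () * mdeg \<alpha>) F2'" "\<forall>u. segre u \<in> cyclic_lift \<longrightarrow> F2' u = F2 (cls T (segre u))" by blast
    then show ?case by (intro exI[of _ "\<lambda>u. F1' u + F2' u"]) (simp add: homogeneous.add)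
  next
    case (mult d1 F1 d2 F2)
    then obtain F1' F2' where *: "homogeneous (gens R) (\<lambda>\<alpha>. d1 () * mdeg \<alpha>) F1'" "\<forall>u. segre u \<in> cyclic_lift \<longrightarrow> F1' u = F1 (cls T (segre u))"
      "homogeneous (gens R) (\<lambda>\<alpha>. d2 () * mdeg \<alpha>) F2'" "\<forall>u. segre u \<in> cyclic_lift \<longrightarrow> F2' u = F2 (cls T (segre u))" by blast
    show ?case using homogeneous.mult[OF *(1,3)] *(2,4) by (intro exI[of _ "\<lambda>u. F1' u * F2' u"]) (simp add: distrib_right)
  qed
  then show ?thesis using that by blast
qed

subsection \<open>The embedding\<close>

lemma basis_supported:
  assumes "E \<in> R_points n" "u \<in> basis_families n E"
  shows "supported u"
  unfolding supported_def
proof (intro ballI allI impI)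
  fix \<alpha> r assume a: "\<alpha> \<in> pos_roots n" and r: "r < fst \<alpha>"
  have "u \<alpha> r \<in> fsv.span (u \<alpha> ` {..<fst \<alpha>})" using r by (intro fsv.span_base) auto
  then have "u \<alpha> r \<in> E \<alpha>" using assms(2) a by (simp add: basis_families_iff)
  then show "Poly_Mapping.keys (u \<alpha> r) \<subseteq> support_indices n \<alpha>" by (rule R_pointsD(4)[OF assms(1) a])
qed

text \<open>A linear form that vanishes on the lift of \<open>M\<^sub>\<mm>\<close> vanishes on the orbit, so its pullback to
  \<open>R\<^sub>n\<close> vanishes on the dense cell and hence everywhere.\<close>

lemma segre_cyclic_lift:
  assumes "E \<in> R_points n" "u \<in> basis_families n E"
  shows "segre u \<in> cyclic_lift"
proof (rule ccontr)
  assume "segre u \<notin> cyclic_lift"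
  then obtain l where l: "linear_form l" "\<And>x. x \<in> cyclic_lift \<Longrightarrow> l x = 0" "l (segre u) = 1"
    using separating_form[OF cyclic_lift_subspace] by blast
  have "homogeneous (gens R) mdeg (\<lambda>u. l (segre u))"
    using l(1) by (rule form_segre_homogeneous) (use l(2) T_cyclic_lift in blast)
  then obtain c where "l (segre (graph_row n c)) \<noteq> 0"
    using cell_dense[OF n _ assms, of mdeg "\<lambda>u. l (segre u)"] l(3) by auto
  then show False using l(2)[OF exp_tensor_cyclic[of c]] by (simp add: exp_tensor_segre)
qed

lemma basis_chart:
  assumes "u \<in> basis_families n E"
  obtains t where "\<And>f. f \<in> S \<Longrightarrow> minor (fst (fst f)) (u (fst f)) (t f) \<noteq> 0"
proof -
  have "\<exists>t. minor (fst \<alpha>) (u \<alpha>) t \<noteq> 0" if "\<alpha> \<in> pos_roots n" for \<alpha>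
    using lin_indep_imp_nonzero_minor[of "fst \<alpha>" "u \<alpha>" UNIV] assms that by (auto simp: basis_families_iff)
  then have ex: "\<exists>t. minor (fst (fst f)) (u (fst f)) t \<noteq> 0" if "f \<in> S" for f using factor_root[OF that] by blast
  define t where "t f = (SOME t. minor (fst (fst f)) (u (fst f)) t \<noteq> 0)" for f :: "(nat \<times> nat) \<times> nat"
  have "minor (fst (fst f)) (u (fst f)) (t f) \<noteq> 0" if "f \<in> S" for f
    unfolding t_def by (rule someI_ex[OF ex[OF that]])
  then show ?thesis by (rule that)
qed

lemma pform_segre_nonzero_iff:
  "supported u \<Longrightarrow> pform t (segre u) \<noteq> 0 \<longleftrightarrow> (\<forall>f\<in>S. minor (fst (fst f)) (u (fst f)) (t f) \<noteq> 0)"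
  using finite_factors by (auto simp: pform_segre)

lemma segre_not_T:
  assumes "E \<in> R_points n" "u \<in> basis_families n E"
  shows "segre u \<notin> T"
proof -
  obtain t where "\<And>f. f \<in> S \<Longrightarrow> minor (fst (fst f)) (u (fst f)) (t f) \<noteq> 0" by (rule basis_chart[OF assms(2)]) blast
  then have "pform t (segre u) \<noteq> 0" using pform_segre_nonzero_iff[OF basis_supported[OF assms]] by blast
  then show ?thesis using pform_T[of "segre u" t] by blast
qed

lemma segre_basis_change:
  assumes E: "E \<in> R_points n" and u: "u \<in> basis_families n E" "u' \<in> basis_families n E"
  shows "line (segre u') = line (segre u)"
proof -
  obtain g where g: "\<And>\<alpha>. \<alpha> \<in> pos_roots n \<Longrightarrow> g \<alpha> \<noteq> 0"
    "\<And>\<alpha> t. \<alpha> \<in> pos_roots n \<Longrightarrow> minor (fst \<alpha>) (u' \<alpha>) t = g \<alpha> * minor (fst \<alpha>) (u \<alpha>) t"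
    using basis_change[OF u] by blast
  let ?k = "\<Prod>f\<in>S. g (fst f)"
  have k: "?k \<noteq> 0" using g(1) factor_root finite_factors by simp
  have "pform t (segre u' - cscale ?k (segre u)) = 0" for t
  proof -
    have "pform t (segre u') = (\<Prod>f\<in>S. g (fst f) * minor (fst (fst f)) (u (fst f)) (t f))"
      unfolding pform_segre[OF basis_supported[OF E u(2)]]
      by (rule prod.cong[OF refl]) (rule g(2)[OF factor_root])
    then show ?thesis
      by (simp add: linear_formD[OF pform_linear] pform_segre[OF basis_supported[OF E u(1)]] prod.distrib)
  qed
  moreover have "segre u' - cscale ?k (segre u) \<in> ambient"
    by (intro fsv.subspace_diff[OF subspace_ambient] fsv.subspace_scale[OF subspace_ambient] segre_ambient)
  ultimately have "segre u' - cscale ?k (segre u) \<in> T" by (intro pforms_separate)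
  then show ?thesis by (rule line_cong[OF k])
qed

definition pluecker_map :: "(nat \<times> nat \<Rightarrow> W set) \<Rightarrow> tensor set" where
  "pluecker_map E = line (segre (SOME u. u \<in> basis_families n E))"

lemma pluecker_map_eq: "E \<in> R_points n \<Longrightarrow> u \<in> basis_families n E \<Longrightarrow> pluecker_map E = line (segre u)"
  unfolding pluecker_map_def by (rule segre_basis_change) (auto intro: someI[of "\<lambda>u. u \<in> basis_families n E"])

lemma pluecker_map_points: "E \<in> R_points n \<Longrightarrow> pluecker_map E \<in> points P"
proof -
  assume E: "E \<in> R_points n"
  obtain u where u: "u \<in> basis_families n E" using R_point_basis[OF n E] by blast
  show ?thesis unfolding pluecker_map_eq[OF E u] points_P using segre_cyclic_lift[OF E u] segre_not_T[OF E u] by blast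
qed

lemma coords_pluecker_map:
  assumes "E \<in> R_points n" "u \<in> basis_families n E"
  shows "coords P (pluecker_map E) = {cls T (cscale k (segre u)) | k. k \<noteq> 0}"
  unfolding pluecker_map_eq[OF assms] by (rule coords_line[OF segre_not_T[OF assms]])

lemma segre_coords:
  assumes "E \<in> R_points n" "u \<in> basis_families n E"
  shows "cls T (segre u) \<in> coords P (pluecker_map E)"
  unfolding coords_pluecker_map[OF assms] by (intro CollectI exI[of _ 1]) simp

lemma line_exp_tensor: "line (exp_tensor c) = pluecker_map (point_of n (graph_row n c))"
  using pluecker_map_eq[OF graph_row_point graph_row_basis] by (simp add: exp_tensor_segre)

subsection \<open>The orbits\<close>

lemma orbit_SLa: "orbit n m (carrier (SLa n)) = range (\<lambda>c. line (exp_tensor c))"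
  and orbit_Na: "orbit n m (Na n) = range (\<lambda>c. line (exp_tensor c))"
proof -
  have line1: "line_of (cyclic_module n m) (translate n m (1\<^sub>m n, nil_elem n c)) = line (exp_tensor c)" for c
    using translate_eq(2)[OF one_in_borel_group Ad_action_one[of n c]] by (simp add: line_def)
  have "line_of (cyclic_module n m) (translate n m g) \<in> range (\<lambda>c. line (exp_tensor c))" if g: "g \<in> carrier (SLa n)" for g
  proof -
    obtain b c where b: "g = (b, nil_elem n c)" "b \<in> borel_group n" using g by (auto simp: SLa_def nilrad_eq)
    obtain c' where c': "Ad_action n b (nil_elem n c) = nil_elem n c'" using Ad_action_nil_elem by blast
    obtain k where k: "k \<noteq> 0" "translate n m g = cls T (cscale k (exp_tensor c'))"
      using translate_eq(1)[OF b(2) c'] b(1) by blast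
    have "line (cscale k (exp_tensor c')) = line (exp_tensor c')"
      by (rule line_cong[OF k(1)]) (simp add: fsv.subspace_0[OF T_subspace])
    then show ?thesis using k(2) by (auto simp: line_def)
  qed
  moreover have "(1\<^sub>m n, nil_elem n c) \<in> carrier (SLa n)" for c
    by (simp add: SLa_def one_in_borel_group nilrad_eq)
  ultimately show "orbit n m (carrier (SLa n)) = range (\<lambda>c. line (exp_tensor c))"
    unfolding orbit_def using line1 by (auto simp: image_iff) metis
  show "orbit n m (Na n) = range (\<lambda>c. line (exp_tensor c))"
    unfolding orbit_def Na_def nilrad_eq using line1 by auto
qed

abbreviation "Orb \<equiv> range (\<lambda>c. line (exp_tensor c))"
abbreviation "Z \<equiv> zariski P closure_of Orb"

lemma coherent_P': "coherent P"
  using coherent_P[of "points P"] by (simp add: subvariety_all)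

lemma Orb_points: "Orb \<subseteq> points P"
  unfolding line_exp_tensor using pluecker_map_points[OF graph_row_point] by blast

lemma Z_points: "Z \<subseteq> points P"
  using closure_of_subset_topspace[of "zariski P" Orb] by (simp add: topspace_zariski[OF coherent_P'])

lemma pluecker_map_Z: "E \<in> R_points n \<Longrightarrow> pluecker_map E \<in> Z"
  unfolding in_closure_of
proof (intro conjI allI impI)
  assume E: "E \<in> R_points n"
  show "pluecker_map E \<in> topspace (zariski P)" using pluecker_map_points[OF E] by (simp add: topspace_zariski[OF coherent_P'])
  fix U assume U: "pluecker_map E \<in> U \<and> openin (zariski P) U"
  then obtain d F where F: "homogeneous (gens P) d F" "pluecker_map E \<in> basic_open P F" "basic_open P F \<subseteq> U"
    using zariski_basis[OF coherent_P'] by metis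
  obtain u where u: "u \<in> basis_families n E" using R_point_basis[OF n E] by blast
  obtain F' where F': "homogeneous (gens R) (\<lambda>\<alpha>. d () * mdeg \<alpha>) F'"
    "\<And>u. segre u \<in> cyclic_lift \<Longrightarrow> F' u = F (cls T (segre u))" using pullback[OF F(1)] by blast
  obtain x where "x \<in> coords P (pluecker_map E)" "F x \<noteq> 0" using F(2) by (auto simp: basic_open_def)
  then have "F (cls T (segre u)) \<noteq> 0"
    using coherentD(2)[OF coherent_P' F(1) pluecker_map_points[OF E]] segre_coords[OF E u] by blast
  then have "F' u \<noteq> 0" using F'(2)[OF segre_cyclic_lift[OF E u]] by simp
  then obtain c where "F' (graph_row n c) \<noteq> 0" using cell_dense[OF n F'(1) E u] by blast
  then have "F (cls T (segre (graph_row n c))) \<noteq> 0"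
    using F'(2)[OF segre_cyclic_lift[OF graph_row_point graph_row_basis]] by simp
  then have "pluecker_map (point_of n (graph_row n c)) \<in> basic_open P F"
    using pluecker_map_points[OF graph_row_point] segre_coords[OF graph_row_point graph_row_basis]
    by (auto simp: basic_open_def)
  then show "\<exists>y. y \<in> Orb \<and> y \<in> U" using F(3) line_exp_tensor by (intro exI[of _ "line (exp_tensor c)"]) auto
qed

text \<open>Otherwise the product of \<open>h\<close> and \<open>pform t\<close> is nonzero on an open neighbourhood of
  \<open>line \<tau>\<close>, which meets the orbit.\<close>

lemma chart_relation:
  assumes \<tau>: "\<tau> \<in> cyclic_lift" "\<tau> \<notin> T" "line \<tau> \<in> Z" "pform t \<tau> \<noteq> 0"
    and h: "pm_hom D h" "\<And>c. pform t (segre (graph_row n c)) \<noteq> 0 \<Longrightarrow> h (segre (graph_row n c)) = 0"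
  shows "h \<tau> = 0"
proof (rule ccontr)
  assume nz: "h \<tau> \<noteq> 0"
  obtain F where F: "homogeneous (gens P) (\<lambda>_. 1 + D) F" "\<And>\<tau>. F (cls T \<tau>) = pform t \<tau> * h \<tau>"
    using pm_hom_mult[OF pm_hom_pform h(1)] unfolding pm_hom_def by blast
  have "cls T \<tau> \<in> coords P (line \<tau>)" unfolding coords_line[OF \<tau>(2)] by (intro CollectI exI[of _ 1]) simp
  then have "line \<tau> \<in> basic_open P F"
    unfolding basic_open_def mem_Collect_eq
    using nz \<tau>(4) Z_points \<tau>(3) F(2) by (intro conjI bexI[of _ "cls T \<tau>"]) auto
  then obtain y where y: "y \<in> Orb" "y \<in> basic_open P F"
    using \<tau>(3) openin_basic_open[OF F(1)] unfolding in_closure_of by blast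
  then obtain c where c: "y = pluecker_map (point_of n (graph_row n c))" using line_exp_tensor by auto
  obtain x where x: "x \<in> coords P y" "F x \<noteq> 0" using y(2) by (auto simp: basic_open_def)
  have "F (cls T (segre (graph_row n c))) \<noteq> 0"
    using coherentD(2)[OF coherent_P' F(1) pluecker_map_points[OF graph_row_point] _ _ x(2)] x(1)
      segre_coords[OF graph_row_point graph_row_basis] unfolding c by blast
  then show False using F(2) h(2) by auto
qed

section \<open>Relations on the charts of the orbit closure\<close>

lemma pm_hom_diff: "pm_hom D h \<Longrightarrow> pm_hom D h' \<Longrightarrow> pm_hom D (\<lambda>\<tau>. h \<tau> - h' \<tau>)"
  using pm_hom_add[of D h "\<lambda>\<tau>. - 1 * h' \<tau>"] pm_hom_scale[of D h' "- 1"] by simp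

lemma pm_hom_pform_power: "pm_hom k (\<lambda>\<tau>. pform t \<tau> ^ k)"
  using pm_hom_power[OF pm_hom_pform, of k t] by simp

lemma pform_segre_exchange:
  assumes u: "supported u" and f: "f \<in> S"
  shows "pform (t(f := s)) (segre u) * minor (fst (fst f)) (u (fst f)) (t f) =
    minor (fst (fst f)) (u (fst f)) s * pform t (segre u)"
proof -
  let ?p = "\<lambda>t. \<Prod>f'\<in>S - {f}. minor (fst (fst f')) (u (fst f')) (t f')"
  have 1: "pform t' (segre u) = minor (fst (fst f)) (u (fst f)) (t' f) * ?p t'" for t'
    unfolding pform_segre[OF u] by (rule prod.remove[OF finite_factors f])
  have "?p (t(f := s)) = ?p t" by (rule prod.cong) auto
  then show ?thesis unfolding 1 by simp
qed

lemma pform_segre_upd: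
  assumes u: "supported u" and f: "f \<in> S" and t: "minor (fst (fst f)) (u (fst f)) (t f) \<noteq> 0"
  shows "pform (t(f := s)) (segre u) =
    pform t (segre u) * minor (fst (fst f)) (reduced_basis (fst (fst f)) (u (fst f)) (t f)) s"
  using pform_segre_exchange[OF u f, of t s] t
  by (simp add: minor_reduced_basis[OF t] eq_divide_eq mult.commute del: fun_upd_apply)

lemma pform_segre_reduced:
  assumes u: "supported u" and t: "\<And>f. f \<in> S \<Longrightarrow> minor (fst (fst f)) (u (fst f)) (t f) \<noteq> 0"
  shows "pform s (segre u) = pform t (segre u) *
    (\<Prod>f\<in>S. minor (fst (fst f)) (reduced_basis (fst (fst f)) (u (fst f)) (t f)) (s f))"
proof -
  have "pform s (segre u) = (\<Prod>f\<in>S. minor (fst (fst f)) (u (fst f)) (t f) *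
      minor (fst (fst f)) (reduced_basis (fst (fst f)) (u (fst f)) (t f)) (s f))"
    unfolding pform_segre[OF u] using t by (intro prod.cong) (auto simp: minor_reduced_basis)
  then show ?thesis by (simp add: prod.distrib pform_segre[OF u])
qed

definition chart_lift :: "((nat \<times> nat) \<times> nat \<Rightarrow> nat \<Rightarrow> nat) \<Rightarrow> free_tensor \<Rightarrow> bool" where
  "chart_lift t \<tau> \<longleftrightarrow> \<tau> \<in> cyclic_lift \<and> \<tau> \<notin> T \<and> line \<tau> \<in> Z \<and> pform t \<tau> \<noteq> 0"

text \<open>On the image of \<open>R\<^sub>n\<close> this is the minor at the columns \<open>s\<close> of the reduced basis, with
  pivots \<open>t f\<close>, of the factor \<open>f\<close>; see \<open>pform_segre_upd\<close>.\<close>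

definition chart_coord where
  "chart_coord t \<tau> f s = pform (t(f := s)) \<tau> / pform t \<tau>"

lemma chart_relation':
  assumes \<tau>: "chart_lift t \<tau>" and h: "pm_hom D h" "pm_hom D h'"
    and eq: "\<And>c. pform t (segre (graph_row n c)) \<noteq> 0 \<Longrightarrow> h (segre (graph_row n c)) = h' (segre (graph_row n c))"
  shows "h \<tau> = h' \<tau>"
  using chart_relation[of \<tau> t D "\<lambda>\<tau>. h \<tau> - h' \<tau>"] \<tau> pm_hom_diff[OF h] eq unfolding chart_lift_def by auto

lemma supported_graph_row: "supported (graph_row n c)"
  by (rule basis_supported[OF graph_row_point graph_row_basis])

lemma cell_minor_nonzero:
  assumes "pform t (segre (graph_row n c)) \<noteq> 0" "f \<in> S"
  shows "minor (fst (fst f)) (graph_row n c (fst f)) (t f) \<noteq> 0"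
  using assms pform_segre_nonzero_iff[OF supported_graph_row] by blast

lemma cell_pform_upd:
  assumes "pform t (segre (graph_row n c)) \<noteq> 0" "f \<in> S"
  shows "pform (t(f := s)) (segre (graph_row n c)) = pform t (segre (graph_row n c)) *
    minor (fst (fst f)) (reduced_basis (fst (fst f)) (graph_row n c (fst f)) (t f)) s"
  by (intro pform_segre_upd supported_graph_row assms(2) cell_minor_nonzero[OF assms])

lemma chart_pform:
  assumes \<tau>: "chart_lift t \<tau>"
  shows "pform s \<tau> = pform t \<tau> * (\<Prod>f\<in>S. chart_coord t \<tau> f (s f))"
proof -
  let ?N = "card S"
  have "pform s \<tau> * pform t \<tau> ^ ?N = pform t \<tau> * (\<Prod>f\<in>S. pform (t(f := s f)) \<tau>)"
  proof (rule chart_relation'[OF \<tau>, where D = "1 + ?N"])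
    show "pm_hom (1 + ?N) (\<lambda>\<tau>. pform s \<tau> * pform t \<tau> ^ ?N)"
      by (intro pm_hom_mult pm_hom_pform pm_hom_pform_power)
    show "pm_hom (1 + ?N) (\<lambda>\<tau>. pform t \<tau> * (\<Prod>f\<in>S. pform (t(f := s f)) \<tau>))"
      by (intro pm_hom_mult pm_hom_prod pm_hom_pform finite_factors)
    fix c assume p: "pform t (segre (graph_row n c)) \<noteq> 0"
    have "(\<Prod>f\<in>S. pform (t(f := s f)) (segre (graph_row n c))) = (\<Prod>f\<in>S. pform t (segre (graph_row n c)) *
        minor (fst (fst f)) (reduced_basis (fst (fst f)) (graph_row n c (fst f)) (t f)) (s f))"
      by (rule prod.cong[OF refl]) (rule cell_pform_upd[OF p])
    then show "pform s (segre (graph_row n c)) * pform t (segre (graph_row n c)) ^ ?N =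
       pform t (segre (graph_row n c)) * (\<Prod>f\<in>S. pform (t(f := s f)) (segre (graph_row n c)))"
      using pform_segre_reduced[OF supported_graph_row cell_minor_nonzero[OF p], of s] by (simp add: prod.distrib)
  qed
  moreover have "(\<Prod>f\<in>S. chart_coord t \<tau> f (s f)) = (\<Prod>f\<in>S. pform (t(f := s f)) \<tau>) / pform t \<tau> ^ ?N"
    by (simp add: chart_coord_def prod_dividef)
  moreover have nz: "pform t \<tau> ^ ?N \<noteq> 0" using \<tau> by (simp add: chart_lift_def)
  ultimately have "pform s \<tau> * pform t \<tau> ^ ?N = (pform t \<tau> * (\<Prod>f\<in>S. chart_coord t \<tau> f (s f))) * pform t \<tau> ^ ?N"
    by (simp only: mult.assoc) simp
  then show ?thesis using nz by (rule mult_right_cancel[THEN iffD1, rotated])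
qed

lemma chart_coord_base: "chart_lift t \<tau> \<Longrightarrow> chart_coord t \<tau> f (t f) = 1"
  by (simp add: chart_coord_def chart_lift_def)

text \<open>Factors with the same root carry the same subspace, so their minors are proportional.\<close>

lemma chart_coord_exchange:
  assumes \<tau>: "chart_lift t \<tau>" and f: "f \<in> S" "f' \<in> S" "fst f' = fst f"
  shows "chart_coord t \<tau> f s * chart_coord t \<tau> f' s' = chart_coord t \<tau> f s' * chart_coord t \<tau> f' s"
proof -
  have "pform (t(f := s)) \<tau> * pform (t(f' := s')) \<tau> = pform (t(f := s')) \<tau> * pform (t(f' := s)) \<tau>"
  proof (rule chart_relation'[OF \<tau>, where D = "1 + 1"])
    fix c assume p: "pform t (segre (graph_row n c)) \<noteq> 0"
    show "pform (t(f := s)) (segre (graph_row n c)) * pform (t(f' := s')) (segre (graph_row n c)) =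
       pform (t(f := s')) (segre (graph_row n c)) * pform (t(f' := s)) (segre (graph_row n c))"
      using cell_minor_nonzero[OF p f(1)] cell_minor_nonzero[OF p f(2)] f(3)
      by (simp add: cell_pform_upd[OF p f(1)] cell_pform_upd[OF p f(2)] minor_reduced_basis)
  qed (intro pm_hom_mult pm_hom_pform)+
  then show ?thesis by (simp add: chart_coord_def)
qed

text \<open>The minors of a reduced basis are the determinants formed from its entries, which are the
  chart coordinates of the tuples that differ from \<open>t f\<close> in one column.\<close>

lemma chart_coord_det:
  assumes \<tau>: "chart_lift t \<tau>" and f: "f \<in> S"
  shows "chart_coord t \<tau> f s = det (mat (fst (fst f)) (fst (fst f)) (\<lambda>(a, b). chart_coord t \<tau> f ((t f)(a := s b))))"
proof -
  let ?i = "fst (fst f)"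
  have scale: "det (mat ?i ?i (\<lambda>(a, b). k * h a b)) = k ^ ?i * det (mat ?i ?i (\<lambda>(a, b). h a b))" for k :: complex and h
  proof -
    have "mat ?i ?i (\<lambda>(a, b). k * h a b) = k \<cdot>\<^sub>m mat ?i ?i (\<lambda>(a, b). h a b)" by (rule eq_matI) auto
    then show ?thesis by simp
  qed
  have "pform (t(f := s)) \<tau> * pform t \<tau> ^ ?i =
      pform t \<tau> * det (mat ?i ?i (\<lambda>(a, b). pform (t(f := (t f)(a := s b))) \<tau>))"
  proof (rule chart_relation'[OF \<tau>, where D = "1 + ?i"])
    show "pm_hom (1 + ?i) (\<lambda>\<tau>. pform (t(f := s)) \<tau> * pform t \<tau> ^ ?i)"
      by (intro pm_hom_mult pm_hom_pform pm_hom_pform_power)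
    show "pm_hom (1 + ?i) (\<lambda>\<tau>. pform t \<tau> * det (mat ?i ?i (\<lambda>(a, b). pform (t(f := (t f)(a := s b))) \<tau>)))"
      by (intro pm_hom_mult pm_hom_det pm_hom_pform)
    fix c assume p: "pform t (segre (graph_row n c)) \<noteq> 0"
    let ?q = "reduced_basis ?i (graph_row n c (fst f)) (t f)"
    have nz: "minor ?i (graph_row n c (fst f)) (t f) \<noteq> 0" by (rule cell_minor_nonzero[OF p f])
    note upd = cell_pform_upd[OF p f]
    have "mat ?i ?i (\<lambda>(a, b). pform (t(f := (t f)(a := s b))) (segre (graph_row n c))) =
        mat ?i ?i (\<lambda>(a, b). pform t (segre (graph_row n c)) * Poly_Mapping.lookup (?q a) (s b))"
      by (rule eq_matI) (auto simp: upd minor_reduced_basis[OF nz] lookup_reduced_basis)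
    then show "pform (t(f := s)) (segre (graph_row n c)) * pform t (segre (graph_row n c)) ^ ?i =
      pform t (segre (graph_row n c)) * det (mat ?i ?i (\<lambda>(a, b). pform (t(f := (t f)(a := s b))) (segre (graph_row n c))))"
      by (simp add: scale upd minor_def)
  qed
  moreover have "mat ?i ?i (\<lambda>(a, b). chart_coord t \<tau> f ((t f)(a := s b))) =
      mat ?i ?i (\<lambda>(a, b). (1 / pform t \<tau>) * pform (t(f := (t f)(a := s b))) \<tau>)"
    by (rule eq_matI) (auto simp: chart_coord_def)
  moreover have "pform t \<tau> \<noteq> 0" "pform t \<tau> ^ ?i \<noteq> 0" using \<tau> by (simp_all add: chart_lift_def)
  ultimately show ?thesis
    by (simp only: scale chart_coord_def[of t \<tau> f s] power_one_over) (simp add: divide_eq_eq mult.commute eq_divide_eq)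
qed

text \<open>\<open>D\<close> is to be the inclusion of \<open>V\<^bsub>i,j\<^esub>\<close> into \<open>V\<^bsub>i+1,j\<^esub>\<close> or the projection of \<open>V\<^bsub>i,j\<^esub>\<close> to
  \<open>V\<^bsub>i,j+1\<^esub>\<close>. On the cell it maps row \<open>a\<close> of the reduced basis of \<open>f\<close> into the span of the
  reduced basis of \<open>f'\<close>, where the coefficients are the coordinates at the pivots \<open>t f'\<close>.\<close>

lemma chart_coord_incidence:
  assumes \<tau>: "chart_lift t \<tau>" and f: "f \<in> S" "f' \<in> S" and a: "a < fst (fst f)"
    and D: "\<And>E v. E \<in> R_points n \<Longrightarrow> v \<in> E (fst f) \<Longrightarrow> D v \<in> E (fst f')"
      "\<And>v c. Poly_Mapping.lookup (D v) c = \<kappa> c * Poly_Mapping.lookup v c"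
  shows "\<kappa> x * chart_coord t \<tau> f ((t f)(a := x)) = (\<Sum>b<fst (fst f').
    \<kappa> (t f' b) * chart_coord t \<tau> f ((t f)(a := t f' b)) * chart_coord t \<tau> f' ((t f')(b := x)))"
proof -
  let ?i = "fst (fst f)" let ?i' = "fst (fst f')"
  have "\<kappa> x * (pform t \<tau> * pform (t(f := (t f)(a := x))) \<tau>) = (\<Sum>b<?i'.
      \<kappa> (t f' b) * (pform (t(f := (t f)(a := t f' b))) \<tau> * pform (t(f' := (t f')(b := x))) \<tau>))"
  proof (rule chart_relation'[OF \<tau>, where D = "1 + 1"])
    fix c assume p: "pform t (segre (graph_row n c)) \<noteq> 0"
    let ?u = "graph_row n c" let ?E = "point_of n ?u"
    let ?q = "reduced_basis ?i (?u (fst f)) (t f)" let ?q' = "reduced_basis ?i' (?u (fst f')) (t f')"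
    have nz: "minor ?i (?u (fst f)) (t f) \<noteq> 0" "minor ?i' (?u (fst f')) (t f') \<noteq> 0"
      by (rule cell_minor_nonzero[OF p f(1)], rule cell_minor_nonzero[OF p f(2)])
    have span: "fsv.span (?u (fst f) ` {..<?i}) = ?E (fst f)" "fsv.span (?u (fst f') ` {..<?i'}) = ?E (fst f')"
      using graph_row_basis[of n c] factor_root[OF f(1)] factor_root[OF f(2)] by (auto simp: basis_families_iff)
    have "?q a \<in> ?E (fst f)" using reduced_basis_in_span span(1) by blast
    then have "D (?q a) \<in> fsv.span (?u (fst f') ` {..<?i'})" using D(1)[OF graph_row_point] span(2) by simp
    note expand = arg_cong[OF reduced_basis_expand[OF nz(2) this], where f = "\<lambda>v. Poly_Mapping.lookup v x"]
    have "Poly_Mapping.lookup (D (?q a)) x = (\<Sum>b<?i'. Poly_Mapping.lookup (D (?q a)) (t f' b) * Poly_Mapping.lookup (?q' b) x)"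
      by (rule expand[unfolded lookup_lincomb])
    then have *: "\<kappa> x * Poly_Mapping.lookup (?q a) x =
        (\<Sum>b<?i'. \<kappa> (t f' b) * Poly_Mapping.lookup (?q a) (t f' b) * Poly_Mapping.lookup (?q' b) x)"
      by (simp add: D(2))
    have upd: "pform (t(f := (t f)(a := y))) (segre ?u) = pform t (segre ?u) * Poly_Mapping.lookup (?q a) y" for y
      using a by (simp add: cell_pform_upd[OF p f(1)] minor_reduced_basis[OF nz(1)] lookup_reduced_basis)
    have upd': "pform (t(f' := (t f')(b := y))) (segre ?u) = pform t (segre ?u) * Poly_Mapping.lookup (?q' b) y" if "b < ?i'" for b y
      using that by (simp add: cell_pform_upd[OF p f(2)] minor_reduced_basis[OF nz(2)] lookup_reduced_basis)
    have "\<kappa> x * (pform t (segre ?u) * (pform t (segre ?u) * Poly_Mapping.lookup (?q a) x)) =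
      pform t (segre ?u) * pform t (segre ?u) * (\<kappa> x * Poly_Mapping.lookup (?q a) x)" by simp
    also have "\<dots> = (\<Sum>b<?i'. \<kappa> (t f' b) * (pform t (segre ?u) * Poly_Mapping.lookup (?q a) (t f' b) *
        (pform t (segre ?u) * Poly_Mapping.lookup (?q' b) x)))"
      unfolding * sum_distrib_left by (rule sum.cong) (simp_all add: algebra_simps)
    also have "\<dots> = (\<Sum>b<?i'. \<kappa> (t f' b) *
        (pform (t(f := (t f)(a := t f' b))) (segre ?u) * pform (t(f' := (t f')(b := x))) (segre ?u)))"
      unfolding upd by (rule sum.cong[OF refl]) (subst upd', simp_all)
    finally show "\<kappa> x * (pform t (segre ?u) * pform (t(f := (t f)(a := x))) (segre ?u)) = (\<Sum>b<?i'. \<kappa> (t f' b) *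
        (pform (t(f := (t f)(a := t f' b))) (segre ?u) * pform (t(f' := (t f')(b := x))) (segre ?u)))"
      unfolding upd .
  qed (intro pm_hom_scale pm_hom_sum pm_hom_mult pm_hom_pform)+
  then have "\<kappa> x * (pform t \<tau> * pform (t(f := (t f)(a := x))) \<tau>) / (pform t \<tau> * pform t \<tau>) = (\<Sum>b<?i'.
      \<kappa> (t f' b) * (pform (t(f := (t f)(a := t f' b))) \<tau> * pform (t(f' := (t f')(b := x))) \<tau>) / (pform t \<tau> * pform t \<tau>))"
    unfolding sum_divide_distrib[symmetric] by simp
  then show ?thesis using \<tau> by (simp add: chart_coord_def chart_lift_def mult.assoc)
qed

lemma chart_coord_support:
  assumes \<tau>: "chart_lift t \<tau>" and f: "f \<in> S" and b: "b < fst (fst f)" "s b \<notin> support_indices n (fst f)"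
  shows "chart_coord t \<tau> f s = 0"
proof -
  have "pform (t(f := s)) \<tau> = 0"
  proof (rule chart_relation'[OF \<tau>, where D = 1 and h' = "\<lambda>_. 0"])
    fix c assume p: "pform t (segre (graph_row n c)) \<noteq> 0"
    have "minor (fst (fst f)) (graph_row n c (fst f)) s = 0"
    proof (rule minor_zero_column[OF b(1)])
      fix a assume "a < fst (fst f)"
      then have "Poly_Mapping.keys (graph_row n c (fst f) a) \<subseteq> support_indices n (fst f)"
        using supported_graph_row factor_root[OF f] unfolding supported_def by blast
      then show "Poly_Mapping.lookup (graph_row n c (fst f) a) (s b) = 0" using b(2) by (meson in_keys_iff subsetD)
    qed
    then show "pform (t(f := s)) (segre (graph_row n c)) = 0"
      by (simp add: cell_pform_upd[OF p f]
          minor_reduced_basis[OF cell_minor_nonzero[OF p f]])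
  qed (rule pm_hom_pform pm_hom_zero)+
  then show ?thesis by (simp add: chart_coord_def)
qed

section \<open>Bijectivity and charts\<close>

text \<open>The chart coordinates of a point of the closure serve as the entries of matrices \<open>q \<alpha>\<close>,
  read off at the factor \<open>(\<alpha>, 0)\<close>. The relations say that the row spaces of these matrices form
  a point of \<open>R\<^sub>n\<close> and that the given tensor has, up to a common factor, the same coordinates as
  the image of this point.\<close>

lemma Z_pluecker_map:
  assumes "L \<in> Z"
  obtains E where "E \<in> R_points n" "L = pluecker_map E"
proof -
  obtain \<tau> where \<tau>: "\<tau> \<in> cyclic_lift" "\<tau> \<notin> T" "L = line \<tau>" using assms Z_points points_P by blast
  have amb: "\<tau> \<in> ambient" using \<tau>(1) by (simp add: cyclic_lift_def)
  obtain t where t: "pform t \<tau> \<noteq> 0" using pforms_separate[OF amb] \<tau>(2) by blast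
  have ch: "chart_lift t \<tau>" using \<tau> t assms by (simp add: chart_lift_def)
  define r where "r = chart_coord t \<tau>"
  define q where "q \<alpha> a = (\<Sum>c\<in>support_indices n \<alpha>. cscale (r (\<alpha>, 0) ((t (\<alpha>, 0))(a := c))) (wvec c))" for \<alpha> a
  have r_outside: "r (\<alpha>, 0) ((t (\<alpha>, 0))(a := c)) = 0"
    if "\<alpha> \<in> pos_roots n" "a < fst \<alpha>" "c \<notin> support_indices n \<alpha>" for \<alpha> a c
    unfolding r_def by (rule chart_coord_support[OF ch first_factor[OF that(1)], of a]) (use that in auto)
  have q: "Poly_Mapping.lookup (q \<alpha> a) c = r (\<alpha>, 0) ((t (\<alpha>, 0))(a := c))"
    if "\<alpha> \<in> pos_roots n" "a < fst \<alpha>" for \<alpha> a c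
  proof -
    have fin: "finite (support_indices n \<alpha>)" by (simp add: support_indices_def)
    have "Poly_Mapping.lookup (q \<alpha> a) c =
        (\<Sum>x\<in>support_indices n \<alpha>. if c = x then r (\<alpha>, 0) ((t (\<alpha>, 0))(a := c)) else 0)"
      unfolding q_def lookup_lincomb by (rule sum.cong) (auto simp: lookup_wvec)
    then show ?thesis using r_outside[OF that] fin by (simp del: fun_upd_apply)
  qed
  have minor_q: "minor (fst \<alpha>) (q \<alpha>) s = r (\<alpha>, 0) s" if \<alpha>: "\<alpha> \<in> pos_roots n" for \<alpha> s
  proof -
    have "mat (fst \<alpha>) (fst \<alpha>) (\<lambda>(a, b). Poly_Mapping.lookup (q \<alpha> a) (s b)) =
       mat (fst \<alpha>) (fst \<alpha>) (\<lambda>(a, b). r (\<alpha>, 0) ((t (\<alpha>, 0))(a := s b)))"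
      by (rule eq_matI) (auto simp: q[OF \<alpha>])
    then show ?thesis using chart_coord_det[OF ch first_factor[OF \<alpha>], of s] by (simp add: minor_def r_def)
  qed
  have base: "r f (t f) = 1" for f unfolding r_def by (rule chart_coord_base[OF ch])
  have ind: "lin_indep (fst \<alpha>) (q \<alpha>)" if "\<alpha> \<in> pos_roots n" for \<alpha>
    by (rule nonzero_minor_imp_lin_indep[of _ _ "t (\<alpha>, 0)"]) (simp add: minor_q[OF that] base)
  have incidence: "D (q \<alpha> a) \<in> fsv.span (q \<alpha>' ` {..<fst \<alpha>'})"
    if pos: "\<alpha> \<in> pos_roots n" "\<alpha>' \<in> pos_roots n" "a < fst \<alpha>"
      and D: "\<And>E v. E \<in> R_points n \<Longrightarrow> v \<in> E \<alpha> \<Longrightarrow> D v \<in> E \<alpha>'"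
        "\<And>v c. Poly_Mapping.lookup (D v) c = \<kappa> c * Poly_Mapping.lookup v c" for \<alpha> \<alpha>' a D \<kappa>
  proof -
    have "Poly_Mapping.lookup (D (q \<alpha> a)) x = Poly_Mapping.lookup (\<Sum>b<fst \<alpha>'. cscale
        (\<kappa> (t (\<alpha>', 0) b) * r (\<alpha>, 0) ((t (\<alpha>, 0))(a := t (\<alpha>', 0) b))) (q \<alpha>' b)) x" for x
    proof -
      have "\<kappa> x * r (\<alpha>, 0) ((t (\<alpha>, 0))(a := x)) = (\<Sum>b<fst \<alpha>'. \<kappa> (t (\<alpha>', 0) b) *
         r (\<alpha>, 0) ((t (\<alpha>, 0))(a := t (\<alpha>', 0) b)) * r (\<alpha>', 0) ((t (\<alpha>', 0))(b := x)))"
        using chart_coord_incidence[OF ch first_factor[OF pos(1)] first_factor[OF pos(2)], of a D \<kappa> x] pos(3) D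
        by (simp add: r_def del: fun_upd_apply)
      also have "\<dots> = (\<Sum>b<fst \<alpha>'. \<kappa> (t (\<alpha>', 0) b) *
         r (\<alpha>, 0) ((t (\<alpha>, 0))(a := t (\<alpha>', 0) b)) * Poly_Mapping.lookup (q \<alpha>' b) x)"
        by (rule sum.cong) (simp_all add: q[OF pos(2)] del: fun_upd_apply)
      finally show ?thesis unfolding D(2) q[OF pos(1,3)] lookup_lincomb .
    qed
    then have "D (q \<alpha> a) = (\<Sum>b<fst \<alpha>'. cscale
        (\<kappa> (t (\<alpha>', 0) b) * r (\<alpha>, 0) ((t (\<alpha>, 0))(a := t (\<alpha>', 0) b))) (q \<alpha>' b))"
      by (rule poly_mapping_eqI)
    then show ?thesis by (simp only:) (intro fsv.span_sum fsv.span_scale fsv.span_base imageI)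
  qed
  define E where "E = point_of n q"
  have E: "E \<in> R_points n"
  proof (rule R_pointsI[where u = q])
    show "E \<in> extensional (pos_roots n)" by (simp add: E_def point_of_def)
    show "lin_indep (fst \<alpha>) (q \<alpha>)" if "\<alpha> \<in> pos_roots n" for \<alpha> by (rule ind[OF that])
    show "fsv.span (q \<alpha> ` {..<fst \<alpha>}) = E \<alpha>" if "\<alpha> \<in> pos_roots n" for \<alpha>
      unfolding E_def by (rule point_of_eq[OF that, symmetric])
    show "Poly_Mapping.keys (q \<alpha> a) \<subseteq> support_indices n \<alpha>" if "\<alpha> \<in> pos_roots n" "a < fst \<alpha>" for \<alpha> a
    proof
      fix c assume "c \<in> Poly_Mapping.keys (q \<alpha> a)"
      then have "r (\<alpha>, 0) ((t (\<alpha>, 0))(a := c)) \<noteq> 0" using q[OF that, of c] by (metis in_keys_iff)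
      then show "c \<in> support_indices n \<alpha>" using r_outside[OF that, of c] by blast
    qed
  next
    fix i j a assume ij: "(i, j) \<in> pos_roots n" "i < j" "a < i"
    then have pos: "(Suc i, j) \<in> pos_roots n" by (auto simp: pos_roots_def)
    show "q (i, j) a \<in> E (Suc i, j)"
      unfolding E_def point_of_eq[OF pos]
      by (rule incidence[OF ij(1) pos, where D = "\<lambda>v. v" and \<kappa> = "\<lambda>_. 1"])
        (use ij R_pointsD(5)[OF _ ij(1,2)] in auto)
  next
    fix i j a assume ij: "(i, j) \<in> pos_roots n" "j < n - 1" "a < i"
    then have pos: "(i, Suc j) \<in> pos_roots n" by (auto simp: pos_roots_def)
    show "proj_kill (Suc j) (q (i, j) a) \<in> E (i, Suc j)"
      unfolding E_def point_of_eq[OF pos]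
      by (rule incidence[OF ij(1) pos, where D = "proj_kill (Suc j)" and \<kappa> = "\<lambda>c. if c = Suc j then 0 else 1"])
        (use ij R_pointsD(6)[OF _ ij(1,2)] in \<open>auto simp: lookup_proj_kill\<close>)
  qed
  have qE: "q \<in> basis_families n E" unfolding E_def by (rule point_of_basis[OF ind])
  have sup: "supported q" by (rule basis_supported[OF E qE])
  \<comment> \<open>All factors with root \<open>\<alpha>\<close> are compared with the factor \<open>(\<alpha>, 0)\<close>, from which \<open>q \<alpha>\<close> was read
    off.\<close>
  let ?f0 = "\<lambda>f :: (nat \<times> nat) \<times> nat. (fst f, 0 :: nat)"
  let ?k = "pform t \<tau> * (\<Prod>f\<in>S. r f (t (?f0 f)))"
  have f0: "?f0 f \<in> S" if "f \<in> S" for f by (rule first_factor[OF factor_root[OF that]])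
  have split: "r f s = r f (t (?f0 f)) * r (?f0 f) s" if "f \<in> S" for f s
    using chart_coord_exchange[OF ch that f0[OF that], of s "t (?f0 f)"] base[of "?f0 f"] by (simp add: r_def)
  have nz: "r f (t (?f0 f)) \<noteq> 0" if "f \<in> S" for f
    using split[OF that, of "t f"] base[of f] by auto
  have k: "?k \<noteq> 0" using t nz finite_factors by simp
  have "pform s (\<tau> - cscale ?k (segre q)) = 0" for s
  proof -
    have "pform s \<tau> = pform t \<tau> * (\<Prod>f\<in>S. r f (s f))" unfolding r_def by (rule chart_pform[OF ch])
    also have "(\<Prod>f\<in>S. r f (s f)) = (\<Prod>f\<in>S. r f (t (?f0 f)) * minor (fst (fst f)) (q (fst f)) (s f))"
    proof (rule prod.cong[OF refl])
      fix f assume f: "f \<in> S"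
      show "r f (s f) = r f (t (?f0 f)) * minor (fst (fst f)) (q (fst f)) (s f)"
        unfolding minor_q[OF factor_root[OF f]] by (rule split[OF f])
    qed
    finally have "pform s \<tau> = ?k * pform s (segre q)" unfolding pform_segre[OF sup] by (simp only: prod.distrib mult.assoc)
    then show ?thesis by (simp only: linear_formD[OF pform_linear] right_minus_eq)
  qed
  moreover have "\<tau> - cscale ?k (segre q) \<in> ambient"
    by (intro fsv.subspace_diff[OF subspace_ambient] fsv.subspace_scale[OF subspace_ambient] segre_ambient amb)
  ultimately have "\<tau> - cscale ?k (segre q) \<in> T" by (intro pforms_separate)
  then have "line \<tau> = line (segre q)" by (rule line_cong[OF k])
  then have "L = pluecker_map E" unfolding \<tau>(3) pluecker_map_eq[OF E qE] .
  then show ?thesis by (rule that[OF E])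
qed

lemma pluecker_map_image: "pluecker_map ` R_points n = Z"
  using Z_pluecker_map pluecker_map_Z by blast

text \<open>In a chart, the entries of the reduced basis of \<open>V\<^sub>\<alpha>\<close> are recovered by varying the columns
  in the factor \<open>(\<alpha>, 0)\<close> only.\<close>

lemma inj_pluecker_map: "inj_on pluecker_map (R_points n)"
proof (rule inj_onI)
  fix E E' assume E: "E \<in> R_points n" and E': "E' \<in> R_points n" and eq: "pluecker_map E = pluecker_map E'"
  obtain u where u: "u \<in> basis_families n E" using R_point_basis[OF n E] by blast
  obtain u' where u': "u' \<in> basis_families n E'" using R_point_basis[OF n E'] by blast
  note sup = basis_supported[OF E u] and sup' = basis_supported[OF E' u']
  have "cls T (segre u') \<in> coords P (pluecker_map E)" unfolding eq by (rule segre_coords[OF E' u'])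
  then obtain k where "cls T (segre u') = cls T (cscale k (segre u))" "k \<noteq> 0"
    unfolding coords_pluecker_map[OF E u] by blast
  then have "segre u' - cscale k (segre u) \<in> T" using cls_eq_iff[OF T_subspace] by blast
  then have k: "pform s (segre u') = k * pform s (segre u)" for s
    using pform_T[of "segre u' - cscale k (segre u)" s] by (simp only: linear_formD[OF pform_linear] right_minus_eq)
  obtain t where t: "\<And>f. f \<in> S \<Longrightarrow> minor (fst (fst f)) (u' (fst f)) (t f) \<noteq> 0" by (rule basis_chart[OF u']) blast
  then have nz': "pform t (segre u') \<noteq> 0" using pform_segre_nonzero_iff[OF sup'] by blast
  then have nz: "pform t (segre u) \<noteq> 0" "k \<noteq> 0" unfolding k by auto
  have "E \<alpha> = E' \<alpha>" if \<alpha>: "\<alpha> \<in> pos_roots n" for \<alpha>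
  proof -
    let ?f = "(\<alpha>, 0 :: nat)"
    have f: "?f \<in> S" by (rule first_factor[OF \<alpha>])
    let ?q = "reduced_basis (fst \<alpha>) (u \<alpha>) (t ?f)" let ?q' = "reduced_basis (fst \<alpha>) (u' \<alpha>) (t ?f)"
    have m: "minor (fst \<alpha>) (u \<alpha>) (t ?f) \<noteq> 0" using nz(1) pform_segre_nonzero_iff[OF sup] f by force
    have m': "minor (fst \<alpha>) (u' \<alpha>) (t ?f) \<noteq> 0" using t[OF f] by simp
    have same: "minor (fst \<alpha>) ?q s = minor (fst \<alpha>) ?q' s" for s
    proof -
      have "k * pform t (segre u) * minor (fst \<alpha>) ?q' s = k * (pform t (segre u) * minor (fst \<alpha>) ?q s)"
        using pform_segre_upd[OF sup f, where t = t and s = s] pform_segre_upd[OF sup' f, where t = t and s = s] m m'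
          k[of t] k[of "t(?f := s)"] by (auto simp del: fun_upd_apply)
      then show ?thesis using nz by simp
    qed
    have "?q a = ?q' a" if "a < fst \<alpha>" for a
    proof (rule poly_mapping_eqI)
      fix c show "Poly_Mapping.lookup (?q a) c = Poly_Mapping.lookup (?q' a) c"
        using same[of "(t ?f)(a := c)"] that by (simp add: lookup_reduced_basis minor_reduced_basis[OF m] minor_reduced_basis[OF m'])
    qed
    then have "?q ` {..<fst \<alpha>} = ?q' ` {..<fst \<alpha>}" by (intro image_cong) auto
    then have "fsv.span (u \<alpha> ` {..<fst \<alpha>}) = fsv.span (u' \<alpha> ` {..<fst \<alpha>})"
      using span_reduced_basis[OF m] span_reduced_basis[OF m'] by simp
    then show ?thesis using u u' \<alpha> by (simp add: basis_families_iff)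
  qed
  then show "E = E'" by (rule extensionalityI[OF R_pointsD(1)[OF E] R_pointsD(1)[OF E']])
qed

subsection \<open>Coordinates of R in a chart\<close>

text \<open>A generator, that is, a minor of \<open>u \<alpha>\<close>, becomes the coordinate with the columns \<open>s\<close> in
  place of \<open>t (\<alpha>, 0)\<close> in the factor \<open>(\<alpha>, 0)\<close>. A sum is brought to one degree with powers of
  \<open>pform t\<close>.\<close>

lemma chart_form:
  assumes "homogeneous (gens R) d F"
  obtains D h where "pm_hom D h"
    "\<And>u. supported u \<Longrightarrow> h (segre u) * (\<Prod>\<alpha>\<in>pos_roots n. minor (fst \<alpha>) (u \<alpha>) (t (\<alpha>, 0)) ^ d \<alpha>) =
      F u * pform t (segre u) ^ D"
proof -
  let ?M = "\<lambda>u d. \<Prod>\<alpha>\<in>pos_roots n. minor (fst \<alpha>) (u \<alpha>) (t (\<alpha>, 0 :: nat)) ^ (d \<alpha> :: nat)"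
  have M_add: "?M u (\<lambda>\<alpha>. d \<alpha> + d' \<alpha>) = ?M u d * ?M u d'" for u d d' by (simp add: power_add prod.distrib)
  have "\<exists>D h. pm_hom D h \<and> (\<forall>u. supported u \<longrightarrow> h (segre u) * ?M u d = F u * pform t (segre u) ^ D)"
    using assms
  proof induction
    case (const c)
    show ?case by (intro exI[of _ 0] exI[of _ "\<lambda>_. c"]) (simp add: pm_hom_const)
  next
    case (gen g \<alpha>)
    then have \<alpha>: "\<alpha> \<in> pos_roots n" and "g \<in> range (pluecker_minor \<alpha>)" by (auto simp: R_variety_def split: if_splits)
    then obtain s where s: "g = pluecker_minor \<alpha> s" by blast
    have M: "?M u ((\<lambda>_. 0)(\<alpha> := 1)) = minor (fst \<alpha>) (u \<alpha>) (t (\<alpha>, 0))" for u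
    proof -
      have "?M u ((\<lambda>_. 0)(\<alpha> := 1)) = (\<Prod>\<beta>\<in>pos_roots n. if \<beta> = \<alpha> then minor (fst \<alpha>) (u \<alpha>) (t (\<alpha>, 0)) else 1)"
        by (rule prod.cong) auto
      then show ?thesis using \<alpha> by simp
    qed
    show ?case
      using pform_segre_exchange[OF _ first_factor[OF \<alpha>], where t = t and s = s] pm_hom_pform[of "t((\<alpha>, 0) := s)"]
      unfolding M s pluecker_minor_eq
      by (intro exI[of _ 1] exI[of _ "pform (t((\<alpha>, 0) := s))"]) (simp del: fun_upd_apply)
  next
    case (add d F1 F2)
    from add.IH(1) obtain D1 h1 where h1: "pm_hom D1 h1" "\<forall>u. supported u \<longrightarrow> h1 (segre u) * ?M u d = F1 u * pform t (segre u) ^ D1"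
      by (elim exE conjE)
    from add.IH(2) obtain D2 h2 where h2: "pm_hom D2 h2" "\<forall>u. supported u \<longrightarrow> h2 (segre u) * ?M u d = F2 u * pform t (segre u) ^ D2"
      by (elim exE conjE)
    note h = h1 h2
    let ?h = "\<lambda>\<tau>. h1 \<tau> * pform t \<tau> ^ D2 + h2 \<tau> * pform t \<tau> ^ D1"
    have "pm_hom (D1 + D2) (\<lambda>\<tau>. h2 \<tau> * pform t \<tau> ^ D1)"
      using pm_hom_mult[OF h(3) pm_hom_pform_power[of D1 t]] by (simp add: add.commute)
    then have "pm_hom (D1 + D2) ?h"
      by (intro pm_hom_add pm_hom_mult[OF h(1) pm_hom_pform_power])
    moreover have "?h (segre u) * ?M u d = (F1 u + F2 u) * pform t (segre u) ^ (D1 + D2)" if "supported u" for u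
    proof -
      have "?h (segre u) * ?M u d = (h1 (segre u) * ?M u d) * pform t (segre u) ^ D2 + (h2 (segre u) * ?M u d) * pform t (segre u) ^ D1"
        by (simp add: algebra_simps)
      also have "\<dots> = (F1 u * pform t (segre u) ^ D1) * pform t (segre u) ^ D2 + (F2 u * pform t (segre u) ^ D2) * pform t (segre u) ^ D1"
        using h(2,4) that by simp
      finally show ?thesis by (simp add: algebra_simps power_add)
    qed
    ultimately show ?case by (intro exI[of _ "D1 + D2"] exI[of _ ?h] conjI allI impI)
  next
    case (mult d1 F1 d2 F2)
    from mult.IH(1) obtain D1 h1 where h1: "pm_hom D1 h1" "\<forall>u. supported u \<longrightarrow> h1 (segre u) * ?M u d1 = F1 u * pform t (segre u) ^ D1"
      by (elim exE conjE)
    from mult.IH(2) obtain D2 h2 where h2: "pm_hom D2 h2" "\<forall>u. supported u \<longrightarrow> h2 (segre u) * ?M u d2 = F2 u * pform t (segre u) ^ D2"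
      by (elim exE conjE)
    note h = h1 h2
    have "(h1 (segre u) * h2 (segre u)) * ?M u (\<lambda>\<alpha>. d1 \<alpha> + d2 \<alpha>) = (F1 u * F2 u) * pform t (segre u) ^ (D1 + D2)" if "supported u" for u
    proof -
      have "(h1 (segre u) * h2 (segre u)) * ?M u (\<lambda>\<alpha>. d1 \<alpha> + d2 \<alpha>) = (h1 (segre u) * ?M u d1) * (h2 (segre u) * ?M u d2)"
        unfolding M_add by simp
      also have "\<dots> = (F1 u * pform t (segre u) ^ D1) * (F2 u * pform t (segre u) ^ D2)" using h(2,4) that by simp
      finally show ?thesis by (simp add: power_add)
    qed
    then show ?case using pm_hom_mult[OF h(1,3)]
      by (intro exI[of _ "D1 + D2"] exI[of _ "\<lambda>\<tau>. h1 \<tau> * h2 \<tau>"] conjI allI impI)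
  qed
  then obtain D h where h: "pm_hom D h" "\<forall>u. supported u \<longrightarrow> h (segre u) * ?M u d = F u * pform t (segre u) ^ D"
    by (elim exE conjE)
  show ?thesis by (rule that[OF h(1)]) (use h(2) in simp)
qed

lemma chart_monomial_nonzero:
  assumes "supported u" "pform t (segre u) \<noteq> 0"
  shows "(\<Prod>\<alpha>\<in>pos_roots n. minor (fst \<alpha>) (u \<alpha>) (t (\<alpha>, 0)) ^ d \<alpha>) \<noteq> 0"
proof -
  have "minor (fst \<alpha>) (u \<alpha>) (t (\<alpha>, 0)) \<noteq> 0" if "\<alpha> \<in> pos_roots n" for \<alpha>
    using assms pform_segre_nonzero_iff[OF assms(1)] first_factor[OF that] by force
  then show ?thesis by (simp add: prod_zero_iff)
qed

section \<open>The closed embedding\<close>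

lemma cross_nonzero_iff: "x * b = y * p ^ D \<Longrightarrow> b \<noteq> 0 \<Longrightarrow> p \<noteq> 0 \<Longrightarrow> x \<noteq> 0 \<longleftrightarrow> y \<noteq> 0" for x y b p :: complex
  by auto

abbreviation "Y \<equiv> subvariety P Z"

lemma points_Y: "points Y = Z" and coords_Y: "coords Y = coords P" and gens_Y: "gens Y = gens P"
  by (simp_all add: subvariety_def)

lemma coherent_Y: "coherent Y"
  by (rule coherent_P[OF Z_points])

lemma basic_open_Y_iff:
  assumes F: "homogeneous (gens P) d F" and E: "E \<in> R_points n" "u \<in> basis_families n E"
  shows "pluecker_map E \<in> basic_open Y F \<longleftrightarrow> F (cls T (segre u)) \<noteq> 0"
proof
  assume "pluecker_map E \<in> basic_open Y F"
  then obtain c where "c \<in> coords P (pluecker_map E)" "F c \<noteq> 0" by (auto simp: basic_open_def coords_Y)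
  then show "F (cls T (segre u)) \<noteq> 0"
    using coherentD(2)[OF coherent_P' F pluecker_map_points[OF E(1)]] segre_coords[OF E] by blast
next
  assume "F (cls T (segre u)) \<noteq> 0"
  then show "pluecker_map E \<in> basic_open Y F"
    unfolding basic_open_def points_Y coords_Y using pluecker_map_Z[OF E(1)] segre_coords[OF E] by blast
qed

lemma basic_open_R_iff:
  assumes "homogeneous (gens R) d F" "E \<in> R_points n" "u \<in> basis_families n E"
  shows "E \<in> basic_open R F \<longleftrightarrow> F u \<noteq> 0"
  unfolding basic_open_def points_R coords_R
  using homogeneous_basis_independent[OF assms(1) _ assms(3)] assms(2,3) by blast

lemma pluecker_map_preimage:
  assumes "homogeneous (gens P) d F"
  obtains d' F' where "homogeneous (gens R) d' F'"
    "{E \<in> R_points n. pluecker_map E \<in> basic_open Y F} = basic_open R F'"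
proof -
  obtain F' where F': "homogeneous (gens R) (\<lambda>\<alpha>. d () * mdeg \<alpha>) F'"
    "\<And>u. segre u \<in> cyclic_lift \<Longrightarrow> F' u = F (cls T (segre u))" using pullback[OF assms] by blast
  have iff: "pluecker_map E \<in> basic_open Y F \<longleftrightarrow> E \<in> basic_open R F'" if E: "E \<in> R_points n" for E
  proof -
    obtain u where u: "u \<in> basis_families n E" using R_point_basis[OF n E] by blast
    show ?thesis
      unfolding basic_open_Y_iff[OF assms E u] basic_open_R_iff[OF F'(1) E u] F'(2)[OF segre_cyclic_lift[OF E u]] ..
  qed
  have sub: "basic_open R F' \<subseteq> R_points n" by (auto simp: basic_open_def points_R)
  have "{E \<in> R_points n. pluecker_map E \<in> basic_open Y F} = basic_open R F'"
    using iff sub by blast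
  then show ?thesis by (rule that[OF F'(1)])
qed

lemma continuous_pluecker_map: "continuous_map (zariski R) (zariski Y) pluecker_map"
proof -
  have top: "topspace (zariski R) = R_points n" using topspace_zariski[OF coherent_R] by (simp add: points_R)
  show ?thesis unfolding zariski_eq[of Y]
  proof (rule continuous_on_generated_topo)
    fix U assume "U \<in> {basic_open Y F | F. \<exists>d. homogeneous (gens Y) d F}"
    then obtain d F where F: "U = basic_open Y F" "homogeneous (gens P) d F" unfolding gens_Y by blast
    obtain d' F' where F': "homogeneous (gens R) d' F'"
      "{E \<in> R_points n. pluecker_map E \<in> basic_open Y F} = basic_open R F'" using pluecker_map_preimage[OF F(2)] .
    have "pluecker_map -` U \<inter> topspace (zariski R) = basic_open R F'" unfolding F(1) top F'(2)[symmetric] by blast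
    then show "openin (zariski R) (pluecker_map -` U \<inter> topspace (zariski R))" using openin_basic_open[OF F'(1)] by simp
  next
    have "topspace (zariski Y) = Z" using topspace_zariski[OF coherent_Y] by (simp only: points_Y)
    then show "pluecker_map ` topspace (zariski R) \<subseteq> \<Union> {basic_open Y F | F. \<exists>d. homogeneous (gens Y) d F}"
      unfolding zariski_eq[of Y] topology_generated_by_topspace top using pluecker_map_image by simp
  qed
qed

lemma R_chart:
  assumes E: "E \<in> R_points n" "u \<in> basis_families n E"
  obtains t where "pform t (segre u) \<noteq> 0"
proof -
  obtain t where "\<And>f. f \<in> S \<Longrightarrow> minor (fst (fst f)) (u (fst f)) (t f) \<noteq> 0" by (rule basis_chart[OF E(2)]) blast
  then have "pform t (segre u) \<noteq> 0" using pform_segre_nonzero_iff[OF basis_supported[OF E]] by blast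
  then show ?thesis by (rule that)
qed

lemma open_pluecker_map: "open_map (zariski R) (zariski Y) pluecker_map"
  unfolding open_map_def
proof (intro allI impI)
  fix U assume U: "openin (zariski R) U"
  have "\<exists>W. openin (zariski Y) W \<and> y \<in> W \<and> W \<subseteq> pluecker_map ` U" if y: "y \<in> pluecker_map ` U" for y
  proof -
    obtain E where E: "E \<in> U" "y = pluecker_map E" using y by blast
    obtain d F where F: "homogeneous (gens R) d F" "E \<in> basic_open R F" "basic_open R F \<subseteq> U"
      using zariski_basis[OF coherent_R U E(1)] .
    have ER: "E \<in> R_points n" using F(2) by (simp add: basic_open_def points_R)
    obtain u where u: "u \<in> basis_families n E" using R_point_basis[OF n ER] by blast
    obtain t where t: "pform t (segre u) \<noteq> 0" using R_chart[OF ER u] .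
    obtain D h where h: "pm_hom D h"
      "\<And>u. supported u \<Longrightarrow> h (segre u) * (\<Prod>\<alpha>\<in>pos_roots n. minor (fst \<alpha>) (u \<alpha>) (t (\<alpha>, 0)) ^ d \<alpha>) = F u * pform t (segre u) ^ D"
      using chart_form[OF F(1), of t] by blast
    obtain H where H: "homogeneous (gens P) (\<lambda>_. 1 + D) H" "\<And>\<tau>. H (cls T \<tau>) = pform t \<tau> * h \<tau>"
      using pm_hom_mult[OF pm_hom_pform h(1), of t] unfolding pm_hom_def by blast
    have sup: "supported u" by (rule basis_supported[OF ER u])
    have "h (segre u) \<noteq> 0"
      using cross_nonzero_iff[OF h(2)[OF sup] chart_monomial_nonzero[OF sup t] t] basic_open_R_iff[OF F(1) ER u] F(2) by blast
    then have "H (cls T (segre u)) \<noteq> 0" using t H(2) by simp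
    then have "y \<in> basic_open Y H" unfolding E(2) using basic_open_Y_iff[OF H(1) ER u] by blast
    moreover have "basic_open Y H \<subseteq> pluecker_map ` U"
    proof
      fix L assume L: "L \<in> basic_open Y H"
      then have "L \<in> Z" by (simp add: basic_open_def points_Y)
      then obtain E' where E': "E' \<in> R_points n" "L = pluecker_map E'" using Z_pluecker_map by blast
      obtain u' where u': "u' \<in> basis_families n E'" using R_point_basis[OF n E'(1)] by blast
      have "H (cls T (segre u')) \<noteq> 0" using L basic_open_Y_iff[OF H(1) E'(1) u'] E'(2) by blast
      then have nz: "pform t (segre u') \<noteq> 0" "h (segre u') \<noteq> 0" using H(2) by auto
      have sup: "supported u'" by (rule basis_supported[OF E'(1) u'])
      have "F u' \<noteq> 0" using cross_nonzero_iff[OF h(2)[OF sup] chart_monomial_nonzero[OF sup nz(1)] nz(1)] nz(2) by blast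
      then have "E' \<in> basic_open R F" using basic_open_R_iff[OF F(1) E'(1) u'] by blast
      then show "L \<in> pluecker_map ` U" using F(3) E'(2) by blast
    qed
    moreover have "openin (zariski Y) (basic_open Y H)" by (rule openin_basic_open) (unfold gens_Y, rule H(1))
    ultimately show ?thesis by blast
  qed
  then show "openin (zariski Y) (pluecker_map ` U)" by (subst openin_subopen) blast
qed

lemma homeomorphic_pluecker_map: "homeomorphic_map (zariski R) (zariski Y) pluecker_map"
proof (rule bijective_open_imp_homeomorphic_map[OF continuous_pluecker_map open_pluecker_map])
  have top: "topspace (zariski R) = R_points n" using topspace_zariski[OF coherent_R] by (simp add: points_R)
  show "pluecker_map ` topspace (zariski R) = topspace (zariski Y)"
    unfolding top topspace_zariski[OF coherent_Y] points_Y by (rule pluecker_map_image)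
  show "inj_on pluecker_map (topspace (zariski R))" unfolding top by (rule inj_pluecker_map)
qed

lemma regular_pullback:
  assumes U: "openin (zariski Y) U" and reg: "regular_on Y U \<phi>"
  shows "regular_on R {E \<in> points R. pluecker_map E \<in> U} (\<phi> \<circ> pluecker_map)"
proof -
  have pre: "openin (zariski R) {E \<in> R_points n. pluecker_map E \<in> W}" if "openin (zariski Y) W" for W
    using openin_continuous_map_preimage[OF continuous_pluecker_map that] topspace_zariski[OF coherent_R] by (simp add: points_R)
  show ?thesis unfolding regular_on_def points_R
  proof (intro conjI ballI)
    show "openin (zariski R) {E \<in> R_points n. pluecker_map E \<in> U}" by (rule pre[OF U])
    fix E assume "E \<in> {E \<in> R_points n. pluecker_map E \<in> U}"
    then have E: "E \<in> R_points n" "pluecker_map E \<in> U" by auto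
    obtain U' d F G where *: "openin (zariski Y) U'" "pluecker_map E \<in> U'" "U' \<subseteq> U"
      "homogeneous (gens P) d F" "homogeneous (gens P) d G"
      "\<And>y c. y \<in> U' \<Longrightarrow> c \<in> coords P y \<Longrightarrow> G c \<noteq> 0 \<and> \<phi> y = F c / G c"
      using reg E(2) unfolding regular_on_def gens_Y coords_Y by meson
    obtain F' where F': "homogeneous (gens R) (\<lambda>\<alpha>. d () * mdeg \<alpha>) F'"
      "\<And>u. segre u \<in> cyclic_lift \<Longrightarrow> F' u = F (cls T (segre u))" using pullback[OF *(4)] by blast
    obtain G' where G': "homogeneous (gens R) (\<lambda>\<alpha>. d () * mdeg \<alpha>) G'"
      "\<And>u. segre u \<in> cyclic_lift \<Longrightarrow> G' u = G (cls T (segre u))" using pullback[OF *(5)] by blast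
    have "\<forall>E'\<in>{E \<in> R_points n. pluecker_map E \<in> U'}. \<forall>u\<in>coords R E'. G' u \<noteq> 0 \<and> (\<phi> \<circ> pluecker_map) E' = F' u / G' u"
    proof (intro ballI)
      fix E' u assume a: "E' \<in> {E \<in> R_points n. pluecker_map E \<in> U'}" "u \<in> coords R E'"
      then have E': "E' \<in> R_points n" "u \<in> basis_families n E'" "pluecker_map E' \<in> U'" by (auto simp: coords_R)
      show "G' u \<noteq> 0 \<and> (\<phi> \<circ> pluecker_map) E' = F' u / G' u"
        using *(6)[OF E'(3) segre_coords[OF E'(1,2)]]
        unfolding F'(2)[OF segre_cyclic_lift[OF E'(1,2)]] G'(2)[OF segre_cyclic_lift[OF E'(1,2)]] by simp
    qed
    moreover have "{E \<in> R_points n. pluecker_map E \<in> U'} \<subseteq> {E \<in> R_points n. pluecker_map E \<in> U}" using *(3) by blast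
    ultimately show "\<exists>U'' d F G. openin (zariski R) U'' \<and> E \<in> U'' \<and> U'' \<subseteq> {E \<in> R_points n. pluecker_map E \<in> U} \<and>
        homogeneous (gens R) d F \<and> homogeneous (gens R) d G \<and>
        (\<forall>y\<in>U''. \<forall>c\<in>coords R y. G c \<noteq> 0 \<and> (\<phi> \<circ> pluecker_map) y = F c / G c)"
      using pre[OF *(1)] E(1) *(2) F'(1) G'(1)
      by (intro exI[of _ "{E \<in> R_points n. pluecker_map E \<in> U'}"] exI[of _ "\<lambda>\<alpha>. d () * mdeg \<alpha>"] exI[of _ F'] exI[of _ G'] conjI) auto
  qed
qed

text \<open>A fraction \<open>F / G\<close> on \<open>R\<^sub>n\<close> is written in the coordinates of a chart by \<open>chart_form\<close>; the
  monomial factors cancel, and powers of \<open>pform t\<close> make the degrees of numerator and denominator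
  equal.\<close>

lemma regular_descend:
  assumes U: "openin (zariski Y) U"
    and reg: "regular_on R {E \<in> points R. pluecker_map E \<in> U} (\<phi> \<circ> pluecker_map)"
  shows "regular_on Y U \<phi>"
  unfolding regular_on_def gens_Y coords_Y
proof (intro conjI ballI U)
  fix y assume y: "y \<in> U"
  have "y \<in> Z" using openin_subset[OF U] y topspace_zariski[OF coherent_Y] unfolding points_Y by blast
  then obtain E where E: "E \<in> R_points n" "y = pluecker_map E" using Z_pluecker_map by blast
  obtain u where u: "u \<in> basis_families n E" using R_point_basis[OF n E(1)] by blast
  have "E \<in> {E \<in> R_points n. pluecker_map E \<in> U}" using E y by simp
  then obtain U' d F G where *: "openin (zariski R) U'" "E \<in> U'" "U' \<subseteq> {E \<in> R_points n. pluecker_map E \<in> U}"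
      "homogeneous (gens R) d F" "homogeneous (gens R) d G"
      "\<And>E u. E \<in> U' \<Longrightarrow> u \<in> basis_families n E \<Longrightarrow> G u \<noteq> 0 \<and> (\<phi> \<circ> pluecker_map) E = F u / G u"
    using reg unfolding regular_on_def points_R coords_R by meson
  obtain t where t: "pform t (segre u) \<noteq> 0" using R_chart[OF E(1) u] .
  let ?M = "\<lambda>u. \<Prod>\<alpha>\<in>pos_roots n. minor (fst \<alpha>) (u \<alpha>) (t (\<alpha>, 0 :: nat)) ^ d \<alpha>"
  obtain D1 h1 where h1: "pm_hom D1 h1" "\<And>u. supported u \<Longrightarrow> h1 (segre u) * ?M u = F u * pform t (segre u) ^ D1"
    using chart_form[OF *(4), of t] by blast
  obtain D2 h2 where h2: "pm_hom D2 h2" "\<And>u. supported u \<Longrightarrow> h2 (segre u) * ?M u = G u * pform t (segre u) ^ D2"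
    using chart_form[OF *(5), of t] by blast
  obtain N where N: "homogeneous (gens P) (\<lambda>_. D1 + D2) N" "\<And>\<tau>. N (cls T \<tau>) = h1 \<tau> * pform t \<tau> ^ D2"
    using pm_hom_mult[OF h1(1) pm_hom_pform_power[of D2 t]] unfolding pm_hom_def by blast
  obtain Q where Q: "homogeneous (gens P) (\<lambda>_. D2 + D1) Q" "\<And>\<tau>. Q (cls T \<tau>) = h2 \<tau> * pform t \<tau> ^ D1"
    using pm_hom_mult[OF h2(1) pm_hom_pform_power[of D1 t]] unfolding pm_hom_def by blast
  obtain H where H: "homogeneous (gens P) (\<lambda>_. 1) H" "\<And>\<tau>. H (cls T \<tau>) = pform t \<tau>"
    using pm_hom_pform[of t] unfolding pm_hom_def by blast
  let ?W = "pluecker_map ` U' \<inter> basic_open Y H"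
  have frac: "Q c \<noteq> 0 \<and> \<phi> L = N c / Q c" if L: "L \<in> ?W" and c: "c \<in> coords P L" for L c
  proof -
    obtain E' where E': "E' \<in> U'" "L = pluecker_map E'" using L by blast
    have R: "E' \<in> R_points n" using E'(1) *(3) by blast
    obtain u' where u': "u' \<in> basis_families n E'" using R_point_basis[OF n R] by blast
    have sup: "supported u'" by (rule basis_supported[OF R u'])
    have "pluecker_map E' \<in> basic_open Y H" using L unfolding E'(2) by blast
    then have "H (cls T (segre u')) \<noteq> 0" using basic_open_Y_iff[OF H(1) R u'] by blast
    then have nz: "pform t (segre u') \<noteq> 0" by (simp add: H(2))
    have G: "G u' \<noteq> 0" "\<phi> L = F u' / G u'" using *(6)[OF E'(1) u'] E'(2) by auto
    have M: "?M u' \<noteq> 0" by (rule chart_monomial_nonzero[OF sup nz])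
    have "h2 (segre u') \<noteq> 0" using cross_nonzero_iff[OF h2(2)[OF sup] M nz] G(1) by blast
    then have Qnz: "Q (cls T (segre u')) \<noteq> 0" using nz by (simp add: Q(2))
    have "F u' * Q (cls T (segre u')) * ?M u' = G u' * N (cls T (segre u')) * ?M u'"
    proof -
      have "F u' * Q (cls T (segre u')) * ?M u' = F u' * pform t (segre u') ^ D1 * (h2 (segre u') * ?M u')"
        by (simp only: Q(2) mult_ac)
      also have "\<dots> = (h1 (segre u') * ?M u') * (G u' * pform t (segre u') ^ D2)"
        by (simp only: h1(2)[OF sup] h2(2)[OF sup])
      finally show ?thesis by (simp only: N(2) mult_ac)
    qed
    then have "F u' * Q (cls T (segre u')) = N (cls T (segre u')) * G u'"
      using mult_right_cancel[OF M] by (simp only: mult.commute[of "N _"])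
    then have eq: "\<phi> L = N (cls T (segre u')) / Q (cls T (segre u'))"
      unfolding G(2) frac_eq_eq[OF G(1) Qnz] .
    obtain k where k: "k \<noteq> 0" "c = cls T (cscale k (segre u'))" using c unfolding E'(2) coords_pluecker_map[OF R u'] by blast
    have lift: "segre u' \<in> cyclic_lift" by (rule segre_cyclic_lift[OF R u'])
    have "N c = k ^ (D1 + D2) * N (cls T (segre u'))" "Q c = k ^ (D1 + D2) * Q (cls T (segre u'))"
      unfolding k(2) using homogeneous_scale_P[OF N(1) lift, of k] homogeneous_scale_P[OF Q(1) lift, of k]
      by (simp_all add: add.commute)
    then show ?thesis using k(1) Qnz eq by simp
  qed
  have "openin (zariski Y) (pluecker_map ` U')" using open_pluecker_map *(1) unfolding open_map_def by blast
  moreover have "openin (zariski Y) (basic_open Y H)" by (rule openin_basic_open) (unfold gens_Y, rule H(1))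
  ultimately have "openin (zariski Y) ?W" by (rule openin_Int)
  moreover have "y \<in> ?W" using basic_open_Y_iff[OF H(1) E(1) u] t H(2) *(2) E(2) by auto
  moreover have "?W \<subseteq> U" using *(3) by blast
  moreover have "homogeneous (gens P) (\<lambda>_. D1 + D2) Q" using Q(1) by (simp add: add.commute)
  ultimately show "\<exists>U' d F G. openin (zariski Y) U' \<and> y \<in> U' \<and> U' \<subseteq> U \<and> homogeneous (gens P) d F \<and>
      homogeneous (gens P) d G \<and> (\<forall>y\<in>U'. \<forall>c\<in>coords P y. G c \<noteq> 0 \<and> \<phi> y = F c / G c)"
    using N(1) frac by (intro exI[of _ ?W] exI[of _ "\<lambda>_. D1 + D2"] exI[of _ N] exI[of _ Q] conjI ballI) auto
qed

lemma closed_embedding_pluecker_map: "closed_embedding_onto R P Z pluecker_map"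
  unfolding closed_embedding_onto_def variety_iso_def
  by (intro conjI allI impI iffI closedin_closure_of homeomorphic_pluecker_map)
    (erule (1) regular_pullback, erule (1) regular_descend)

end

theorem proposition2p8:
  fixes n :: nat and m :: "nat \<Rightarrow> nat \<Rightarrow> nat"
  assumes "n \<ge> 2"
    and "\<forall>(i, j)\<in>pos_roots n. m i j > 0"
  shows "orbit n m (carrier (SLa n)) \<subseteq> points (PM n m) \<and>
    zariski (PM n m) closure_of orbit n m (carrier (SLa n)) =
      zariski (PM n m) closure_of orbit n m (Na n) \<and>
    (\<exists>\<Phi>. closed_embedding_onto (R_variety n) (PM n m)
      (zariski (PM n m) closure_of orbit n m (carrier (SLa n))) \<Phi>)"
proof -
  interpret collection n m by standard (rule assms)+
  show ?thesis
    unfolding orbit_SLa orbit_Na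
  proof (intro conjI exI)
    show "Orb \<subseteq> points P" by (rule Orb_points)
    show "closed_embedding_onto R P Z pluecker_map" by (rule closed_embedding_pluecker_map)
  qed (rule refl)
qed

end
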